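(* Let $N \in \mathbb{N}\setminus\{0,1\}$, $s \in (0,1)$ and $p \in (1,\infty)$. Every weakly differentiable function $u \colon \mathbb{R}^N_+ \to \mathbb{R}$ satisfying $$\int_{\mathbb{R}^N_+} \frac{|\mathrm{D}u(z)|^p}{z_N^{1-(1-s)p}}\,\mathrm{d}z < \infty$$ has a trace $v = \operatorname{tr}_{\partial\mathbb{R}^N_+} u$ satisfying $$\int_{\partial\mathbb{R}^N_+}\Bigl(\int_{\mathbb{R}^N_+} \frac{|v(x)-u(y)|^p}{|x-y|^{N+sp}}\,\mathrm{d}y\Bigr)\mathrm{d}x \le \frac{\pi^{\frac{N-1}{2}}\,\Gamma\bigl(\frac{sp+1}{2}\bigr)}{\Gamma\bigl(\frac{N+sp}{2}\bigr)}\Bigl(\frac{N}{s}\Bigr)^p \int_{\mathbb{R}^N_+} \frac{|\mathrm{D}u(z)|^p}{z_N^{1-(1-s)p}}\,\mathrm{d}z .$$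
   Context: $\mathbb{R}^N_+ = \mathbb{R}^{N-1}\times(0,\infty)$, with points written $z=(z',z_N)$. Its boundary $\partial\mathbb{R}^N_+ = \mathbb{R}^{N-1}\times\{0\}$ is identified with $\mathbb{R}^{N-1}$ and carries the $(N-1)$-dimensional Lebesgue measure; for $x\in\partial\mathbb{R}^N_+$ and $y \in \mathbb{R}^N_+$, $|x-y|$ is the Euclidean distance in $\mathbb{R}^N$. $\Gamma$ is the Euler Gamma function. $\mathrm{D}u$ is the weak derivative and $|\cdot|$ its Euclidean norm. The trace $\operatorname{tr}_{\partial\mathbb{R}^N_+}u$ is the usual Sobolev trace, i.e. the extension of the restriction $u\mapsto u|_{\partial\mathbb{R}^N_+}$ from functions that are $C^1$ up to the boundary; equivalently, it is the limit in $L^1_{\mathrm{loc}}(\mathbb{R}^{N-1})$ of $u(\cdot,t)$ as $t\to 0^+$ (for a suitable representative of $u$). *)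

theory Defs
  imports "HOL-Analysis.Analysis"
begin

text \<open>
  The space \<open>\<real>\<^sup>N\<close> is written as the product \<open>'a \<times> real\<close>, where \<open>'a\<close> plays the role of
  \<open>\<real>\<^bsup>N-1\<^esup>\<close>; the product norm is the Euclidean one. A point \<open>z = (z', z\<^sub>N)\<close> has
  \<open>z\<^sub>N = snd z\<close>.
\<close>

definition upper_half :: "('a::euclidean_space \<times> real) set" where
  "upper_half = {z. 0 < snd z}"

text \<open>
  Membership in \<open>L\<^sup>1\<^sub>l\<^sub>o\<^sub>c(U)\<close>. Measurability of \<open>f\<close> on an open set \<open>U\<close> is implied, since \<open>U\<close> is a
  countable union of compact sets.
\<close>

definition locally_integrable_on ::
    "('a::euclidean_space \<Rightarrow> 'b::{banach, second_countable_topology}) \<Rightarrow> 'a set \<Rightarrow> bool"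
    (infix \<open>locally'_integrable'_on\<close> 50) where
  "f locally_integrable_on U \<longleftrightarrow>
     (\<forall>K. compact K \<and> K \<subseteq> U \<longrightarrow> set_integrable lebesgue K f)"

definition partial_deriv :: "'a::euclidean_space \<Rightarrow> ('a \<Rightarrow> real) \<Rightarrow> 'a \<Rightarrow> real" where
  "partial_deriv i f = (\<lambda>x. frechet_derivative f (at x) i)"

text \<open>
  At successor stages continuity of \<open>f\<close> follows from differentiability, so that
  \<open>C_diff k f\<close> says that \<open>f\<close> is of class \<open>C\<^sup>k\<close> on the whole space.
\<close>

primrec C_diff :: "nat \<Rightarrow> ('a::euclidean_space \<Rightarrow> real) \<Rightarrow> bool" where
  "C_diff 0 f \<longleftrightarrow> continuous_on UNIV f"
| "C_diff (Suc k) f \<longleftrightarrow>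
     (\<forall>x. f differentiable (at x)) \<and> (\<forall>i\<in>Basis. C_diff k (partial_deriv i f))"

text \<open>The class \<open>C\<^sub>c\<^sup>\<infinity>(U)\<close>, each function being extended by zero outside \<open>U\<close>.\<close>

definition test_function_on :: "('a::euclidean_space \<Rightarrow> real) \<Rightarrow> 'a set \<Rightarrow> bool" where
  "test_function_on \<phi> U \<longleftrightarrow>
     (\<forall>k. C_diff k \<phi>) \<and> compact (closure {x. \<phi> x \<noteq> 0}) \<and> closure {x. \<phi> x \<noteq> 0} \<subseteq> U"

text \<open>
  \<open>g\<close> is (a representative of) the weak derivative \<open>Du\<close>, identified with the weak gradient.
  A function \<open>u\<close> is weakly differentiable on \<open>U\<close> iff such a \<open>g\<close> exists, and \<open>g\<close> is then
  unique almost everywhere on \<open>U\<close>.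
\<close>

definition has_weak_derivative_on ::
    "('a::euclidean_space \<Rightarrow> real) \<Rightarrow> ('a \<Rightarrow> 'a) \<Rightarrow> 'a set \<Rightarrow> bool" where
  "has_weak_derivative_on u g U \<longleftrightarrow>
     u locally_integrable_on U \<and> g locally_integrable_on U \<and>
     (\<forall>\<phi>. test_function_on \<phi> U \<longrightarrow>
        (\<forall>i\<in>Basis. (LINT x:U|lebesgue. u x * partial_deriv i \<phi> x)
                   = - (LINT x:U|lebesgue. (g x \<bullet> i) * \<phi> x)))"

text \<open>
  \<open>v\<close> is the trace of \<open>u\<close>: the limit in \<open>L\<^sup>1\<^sub>l\<^sub>o\<^sub>c(\<real>\<^bsup>N-1\<^esup>)\<close>, as \<open>t\<close> decreases to \<open>0\<close>, of the
  slices \<open>w(\<cdot>, t)\<close> of some representative \<open>w\<close> of \<open>u\<close>. Almost every slice of \<open>w\<close> is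
  determined almost everywhere by \<open>u\<close>, hence \<open>v\<close> is unique almost everywhere.
\<close>

definition has_trace ::
    "('a::euclidean_space \<times> real \<Rightarrow> real) \<Rightarrow> ('a \<Rightarrow> real) \<Rightarrow> bool" where
  "has_trace u v \<longleftrightarrow>
     v locally_integrable_on UNIV \<and>
     (\<exists>w. (AE z in lebesgue. z \<in> upper_half \<longrightarrow> w z = u z) \<and>
          (\<forall>t>0. (\<lambda>x. w (x, t)) locally_integrable_on UNIV) \<and>
          (\<forall>K. compact K \<longrightarrow>
             ((\<lambda>t. LINT x:K|lebesgue. \<bar>w (x, t) - v x\<bar>) \<longlongrightarrow> 0) (at_right 0)))"

end

theory Submission
  imports Defs
begin

text \<open>
  Write \<open>\<beta> = (1 - s) p - 1\<close>, so that the weight of the energy is \<open>z\<^sub>N powr \<beta>\<close>. For a function that is smooth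
  up to the boundary, a boundary point \<open>x\<close> and a point \<open>(x + \<tau> \<xi>, \<tau>)\<close> of the half-space are joined by the
  circular arc that meets the boundary orthogonally at \<open>x\<close>. Its length in the metric of density
  \<open>z\<^sub>N powr (s - 1)\<close> is \<open>\<tau> powr s\<close> times a number that depends on the slope \<open>\<xi>\<close> only, and Jensen's inequality
  with respect to this length bounds the \<open>p\<close>-th power of the difference of the two values by an integral
  along the arc (\<open>arc_estimate\<close>). Integration over \<open>x\<close> removes the horizontal displacement and integration
  over \<open>\<tau>\<close> the scale, so that each slope contributes the \<open>p\<close>-th power of its length times the energy; the
  constant is the integral over all slopes (\<open>mollified_estimate\<close>).

  The change of variables from slopes to directions turns this integral into a mean over the unit sphere, in
  which \<open>1 / (1 + \<bar>\<xi>\<bar>\<^sup>2)\<close> is the square \<open>Z\<close> of the height of a random direction, with moments given by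
  Gamma functions. The length is at most \<open>(1 + \<bar>\<xi>\<bar>\<^sup>2) powr (s / 2) / s\<close> times an explicit function of \<open>Z\<close>,
  the barrier (\<open>semicircle_length\<close>). It remains to see that the mean of the \<open>p\<close>-th power of the barrier is at
  most \<open>N powr p\<close> times the mean of \<open>Z powr (s p / 2)\<close> (\<open>barrier_power_mean\<close>). For \<open>N \<ge> 3\<close> the barrier may be
  replaced by \<open>2 - Z powr (s / 2)\<close>, and Jensen's inequality and elementary estimates of moments suffice. For
  \<open>N = 2\<close> the two coordinates of a direction have the same distribution, and the inequality for \<open>p = 1\<close> passes
  to larger \<open>p\<close> because the two functions to be compared cross only once.

  For a general \<open>u\<close> the estimate is applied to mollifications whose kernel is supported above the origin, so
  that they are defined and smooth up to the boundary. Their energies converge to that of \<open>u\<close>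
  (\<open>mollified_power_limit\<close>). By Young's inequality the gradient of \<open>u\<close> is integrable near compact parts of
  the boundary, hence on almost every vertical line \<open>u\<close> is the primitive of its vertical derivative, the
  mollifications converge at every height including \<open>0\<close>, and the limit at height \<open>0\<close> is the trace. Fatou's
  lemma transfers the estimate.
\<close>

section \<open>Gaussian integrals and sections of the kernel\<close>

lemma nn_integral_square_substitution:
  fixes f :: "real \<Rightarrow> ennreal"
  assumes [measurable]: "f \<in> borel_measurable borel"
  shows "(\<integral>\<^sup>+x. f (x\<^sup>2) * ennreal (2 * x) * indicator {0..} x \<partial>lborel)
       = (\<integral>\<^sup>+y. f y * indicator {0..} y \<partial>lborel)"
proof -
  have sup: "(\<integral>\<^sup>+x. F x * indicator {0..} x \<partial>lborel) = (SUP n. \<integral>\<^sup>+x. F x * indicator {0..c n} x \<partial>lborel)"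
    if [measurable]: "F \<in> borel_measurable borel" and c: "incseq c" "\<And>x. \<exists>n. x \<le> c n"
    for F :: "real \<Rightarrow> ennreal" and c :: "nat \<Rightarrow> real"
  proof -
    have "(\<integral>\<^sup>+x. F x * indicator {0..} x \<partial>lborel)
        = (\<integral>\<^sup>+x. (SUP n. F x * indicator {0..c n} x) \<partial>lborel)"
    proof (rule nn_integral_cong)
      fix x :: real
      obtain n where "x \<le> c n" using c(2) by blast
      then have "F x * indicator {0..} x \<le> F x * indicator {0..c n} x"
        by (auto split: split_indicator)
      then show "F x * indicator {0..} x = (SUP n. F x * indicator {0..c n} x)"
        by (intro antisym SUP_upper2[of n] SUP_least) (auto split: split_indicator)
    qed
    also have "\<dots> = (SUP n. \<integral>\<^sup>+x. F x * indicator {0..c n} x \<partial>lborel)"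
      using c(1) by (intro nn_integral_monotone_convergence_SUP)
        (auto simp: incseq_def le_fun_def split: split_indicator intro: order_trans)
    finally show ?thesis .
  qed
  have ub: "\<exists>n::nat. x \<le> real n" "\<exists>n::nat. x \<le> (real n)\<^sup>2" for x
  proof -
    obtain n :: nat where n: "max 1 x \<le> real n" using real_arch_simple by blast
    then show "\<exists>n::nat. x \<le> real n" by auto
    have "1 * real n \<le> real n * real n" using n by (intro mult_mono) auto
    moreover have "x \<le> 1 * real n" using n by simp
    ultimately have "x \<le> (real n)\<^sup>2" unfolding power2_eq_square by (rule order_trans[rotated])
    then show "\<exists>n::nat. x \<le> (real n)\<^sup>2" by blast
  qed
  have "(\<integral>\<^sup>+x. f x * indicator {0..(real n)\<^sup>2} x \<partial>lborel)
      = (\<integral>\<^sup>+x. f (x\<^sup>2) * ennreal (2 * x) * indicator {0..real n} x \<partial>lborel)" for n :: nat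
  proof (cases "n = 0")
    case True
    have "f x * indicator {0..0} x = 0" "f (x\<^sup>2) * ennreal (2 * x) * indicator {0..0} x = 0"
      if "x \<noteq> 0" for x :: real
      using that by (auto split: split_indicator)
    then show ?thesis using True AE_lborel_singleton[of "0::real"]
      by (intro nn_integral_cong_AE) (auto elim!: eventually_mono)
  next
    case False
    have "(\<integral>\<^sup>+x. f x * indicator {0\<^sup>2..(real n)\<^sup>2} x \<partial>lborel)
      = (\<integral>\<^sup>+x. f (x\<^sup>2) * ennreal (2 * x) * indicator {0..real n} x \<partial>lborel)"
      using False
      by (intro nn_integral_substitution_aux[where g = "\<lambda>x. x\<^sup>2" and g' = "\<lambda>x. 2 * x"])
         (auto intro!: derivative_eq_intros continuous_intros)
    then show ?thesis by simp
  qed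
  then show ?thesis
    by (subst (1 2) sup[of _ "real"] sup[of _ "\<lambda>n. (real n)\<^sup>2"])
       (auto simp: incseq_def ub intro: power_mono)
qed

lemma nn_integral_even:
  fixes f :: "real \<Rightarrow> ennreal"
  assumes [measurable]: "f \<in> borel_measurable borel" and even: "\<And>x. f (- x) = f x"
  shows "(\<integral>\<^sup>+x. f x \<partial>lborel) = 2 * (\<integral>\<^sup>+x. f x * indicator {0..} x \<partial>lborel)"
proof -
  have "(\<integral>\<^sup>+x. f x \<partial>lborel) = (\<integral>\<^sup>+x. f x * indicator {0..} x + f x * indicator {..<0} x \<partial>lborel)"
    by (intro nn_integral_cong) (auto split: split_indicator)
  also have "\<dots> = (\<integral>\<^sup>+x. f x * indicator {0..} x \<partial>lborel) + (\<integral>\<^sup>+x. f x * indicator {..<0} x \<partial>lborel)"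
    by (rule nn_integral_add) auto
  also have "(\<integral>\<^sup>+x. f x * indicator {..<0} x \<partial>lborel)
      = (\<integral>\<^sup>+x. f (- x) * indicator {..<0} (- x) \<partial>lborel)"
    by (subst nn_integral_real_affine[where c = "-1" and t = 0]) auto
  also have "\<dots> = (\<integral>\<^sup>+x. f x * indicator {0..} x \<partial>lborel)"
    using AE_lborel_singleton[of "0::real"] even
    by (intro nn_integral_cong_AE) (auto split: split_indicator elim!: eventually_mono)
  finally show ?thesis by (simp add: mult_2)
qed

lemma nn_integral_Gamma_scaled:
  assumes "0 < a" "0 < c"
  shows "(\<integral>\<^sup>+t. ennreal (t powr (a - 1) * exp (- c * t)) * indicator {0..} t \<partial>lborel)
       = ennreal (Gamma a * c powr (- a))"
proof -
  have "ennreal (Gamma a) = (\<integral>\<^sup>+t. ennreal (indicator {0..} t * t powr (a - 1) / exp t) \<partial>lborel)"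
    using assms by (simp add: Gamma_conv_nn_integral_real)
  also have "\<dots> = ennreal c * (\<integral>\<^sup>+t. ennreal (indicator {0..} (c * t) * (c * t) powr (a - 1) / exp (c * t)) \<partial>lborel)"
    using assms by (subst nn_integral_real_affine[where c = c and t = 0]) auto
  also have "\<dots> = ennreal c * (\<integral>\<^sup>+t. ennreal (c powr (a - 1)) *
      (ennreal (t powr (a - 1) * exp (- c * t)) * indicator {0..} t) \<partial>lborel)"
    using assms
    by (intro arg_cong2[where f = "(*)"] refl nn_integral_cong)
       (auto simp: powr_mult exp_minus field_simps ennreal_mult'[symmetric] zero_le_mult_iff split: split_indicator)
  also have "\<dots> = ennreal (c powr a) *
      (\<integral>\<^sup>+t. ennreal (t powr (a - 1) * exp (- c * t)) * indicator {0..} t \<partial>lborel)" (is "_ = _ * ?I")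
    using assms by (subst nn_integral_cmult)
      (auto simp: mult.assoc[symmetric] ennreal_mult'[symmetric] powr_diff)
  finally have *: "ennreal (Gamma a) = ennreal (c powr a) * ?I" .
  have "?I = ennreal (c powr (- a)) * (ennreal (c powr a) * ?I)"
    using assms by (simp add: mult.assoc[symmetric] ennreal_mult'[symmetric] powr_minus)
  also have "\<dots> = ennreal (Gamma a * c powr (- a))"
    using assms unfolding *[symmetric] by (simp add: ennreal_mult'[symmetric] mult.commute)
  finally show ?thesis .
qed

lemma nn_integral_Gaussian_moment:
  assumes "- 1 < q" "0 < t"
  shows "(\<integral>\<^sup>+x. ennreal (\<bar>x\<bar> powr q * exp (- t * x\<^sup>2)) \<partial>lborel)
       = ennreal (Gamma ((q + 1) / 2) * t powr (- ((q + 1) / 2)))"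
proof -
  let ?f = "\<lambda>y. ennreal (y powr ((q + 1) / 2 - 1) * exp (- t * y))"
  have "(\<integral>\<^sup>+x. ennreal (\<bar>x\<bar> powr q * exp (- t * x\<^sup>2)) \<partial>lborel)
      = 2 * (\<integral>\<^sup>+x. ennreal (\<bar>x\<bar> powr q * exp (- t * x\<^sup>2)) * indicator {0..} x \<partial>lborel)"
    by (rule nn_integral_even) auto
  also have "\<dots> = (\<integral>\<^sup>+x. 2 * (ennreal (\<bar>x\<bar> powr q * exp (- t * x\<^sup>2)) * indicator {0..} x) \<partial>lborel)"
    by (rule nn_integral_cmult[symmetric]) auto
  also have "\<dots> = (\<integral>\<^sup>+x. ?f (x\<^sup>2) * ennreal (2 * x) * indicator {0..} x \<partial>lborel)"
  proof (rule nn_integral_cong_AE)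
    have "2 * (ennreal (\<bar>x\<bar> powr q * exp (- t * x\<^sup>2)) * indicator {0..} x)
        = ?f (x\<^sup>2) * ennreal (2 * x) * indicator {0..} x" if "x \<noteq> 0" for x :: real
    proof (cases "0 < x")
      case True
      have "(x\<^sup>2) powr ((q + 1) / 2 - 1) * x = x powr q"
      proof -
        have "(x\<^sup>2) powr ((q + 1) / 2 - 1) = x powr (q - 1)"
          using True by (simp add: powr_powr flip: powr_numeral) (simp add: diff_divide_distrib add_divide_distrib algebra_simps)
        then show ?thesis using True by (simp add: powr_diff)
      qed
      then have "2 * (x powr q * exp (- t * x\<^sup>2)) = (x\<^sup>2) powr ((q + 1) / 2 - 1) * exp (- t * x\<^sup>2) * (2 * x)"
        by (simp add: algebra_simps)
      then have "ennreal (2 * (x powr q * exp (- t * x\<^sup>2)))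
        = ennreal ((x\<^sup>2) powr ((q + 1) / 2 - 1) * exp (- t * x\<^sup>2) * (2 * x))" by (rule arg_cong)
      then show ?thesis using True by (simp add: ennreal_mult' ennreal_mult'')
    qed (use that in \<open>auto split: split_indicator\<close>)
    then show "AE x in lborel. 2 * (ennreal (\<bar>x\<bar> powr q * exp (- t * x\<^sup>2)) * indicator {0..} x)
        = ?f (x\<^sup>2) * ennreal (2 * x) * indicator {0..} x"
      using AE_lborel_singleton[of "0::real"] by (auto elim!: eventually_mono)
  qed
  also have "\<dots> = (\<integral>\<^sup>+y. ?f y * indicator {0..} y \<partial>lborel)"
    by (rule nn_integral_square_substitution) auto
  also have "\<dots> = ennreal (Gamma ((q + 1) / 2) * t powr (- ((q + 1) / 2)))"
    using assms by (intro nn_integral_Gamma_scaled) auto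
  finally show ?thesis .
qed

lemma nn_integral_Gaussian:
  assumes "0 < t"
  shows "(\<integral>\<^sup>+(\<xi>::'a::euclidean_space). ennreal (exp (- t * (norm \<xi>)\<^sup>2)) \<partial>lborel)
       = ennreal (pi powr (DIM('a) / 2) * t powr (- (DIM('a) / 2)))"
proof -
  have one: "(\<integral>\<^sup>+x. ennreal (exp (- t * x\<^sup>2)) \<partial>lborel) = ennreal (sqrt pi * t powr (- (1 / 2)))"
  proof -
    have "(\<integral>\<^sup>+x. ennreal (exp (- t * x\<^sup>2)) \<partial>lborel) = (\<integral>\<^sup>+x. ennreal (\<bar>x\<bar> powr 0 * exp (- t * x\<^sup>2)) \<partial>lborel)"
      using AE_lborel_singleton[of "0::real"] by (intro nn_integral_cong_AE) (auto elim!: eventually_mono)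
    then show ?thesis using nn_integral_Gaussian_moment[of 0 t] assms by (simp add: Gamma_one_half_real)
  qed
  have "(\<integral>\<^sup>+(\<xi>::'a). ennreal (exp (- t * (norm \<xi>)\<^sup>2)) \<partial>lborel)
      = (\<integral>\<^sup>+(\<xi>::'a). (\<Prod>b\<in>Basis. ennreal (exp (- t * (\<xi> \<bullet> b)\<^sup>2))) \<partial>lborel)"
  proof (intro nn_integral_cong)
    fix \<xi> :: 'a
    have "(norm \<xi>)\<^sup>2 = (\<Sum>b\<in>Basis. (\<xi> \<bullet> b)\<^sup>2)"
      by (simp add: power2_norm_eq_inner) (subst euclidean_inner, simp add: power2_eq_square)
    then show "ennreal (exp (- t * (norm \<xi>)\<^sup>2)) = (\<Prod>b\<in>Basis. ennreal (exp (- t * (\<xi> \<bullet> b)\<^sup>2)))"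
      by (subst prod_ennreal) (auto simp: exp_sum[symmetric] sum_distrib_left sum_negf)
  qed
  also have "\<dots> = (\<Prod>b\<in>(Basis::'a set). (\<integral>\<^sup>+x. ennreal (exp (- t * x\<^sup>2)) \<partial>lborel))"
    by (rule nn_integral_lborel_prod) auto
  also have "\<dots> = ennreal ((sqrt pi * t powr (- (1 / 2))) ^ DIM('a))"
    unfolding one by (simp add: ennreal_power)
  also have "(sqrt pi * t powr (- (1 / 2))) ^ DIM('a) = pi powr (DIM('a) / 2) * t powr (- (DIM('a) / 2))"
    using assms by (simp add: power_mult_distrib powr_half_sqrt[symmetric] powr_powr flip: powr_realpow)
  finally show ?thesis .
qed

text \<open>Subordination: a negative power of \<open>1 + \<bar>\<xi>\<bar>\<^sup>2\<close> is a mixture of Gaussians, so that its integral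
  against \<open>w\<close> only requires the Gaussian integrals of \<open>w\<close>.\<close>

lemma nn_integral_subordination:
  fixes w :: "'a::euclidean_space \<Rightarrow> real"
  assumes [measurable]: "w \<in> borel_measurable borel" and w: "\<And>\<xi>. 0 \<le> w \<xi>"
    and gauss: "\<And>t. 0 < t \<Longrightarrow> (\<integral>\<^sup>+\<xi>. ennreal (w \<xi> * exp (- t * (norm \<xi>)\<^sup>2)) \<partial>lborel) = ennreal (C * t powr (- e))"
    and "0 \<le> C" "0 < a" "e < a"
  shows "(\<integral>\<^sup>+\<xi>. ennreal (w \<xi> * (1 + (norm \<xi>)\<^sup>2) powr (- a)) \<partial>lborel) = ennreal (C * Gamma (a - e) / Gamma a)"
proof -
  have G: "0 < Gamma a" using assms by (simp add: Gamma_real_pos)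
  have "ennreal (Gamma a) * (\<integral>\<^sup>+\<xi>. ennreal (w \<xi> * (1 + (norm \<xi>)\<^sup>2) powr (- a)) \<partial>lborel)
      = (\<integral>\<^sup>+\<xi>. ennreal (w \<xi>) * ennreal (Gamma a * (1 + (norm \<xi>)\<^sup>2) powr (- a)) \<partial>lborel)"
    using w G by (subst nn_integral_cmult[symmetric]) (auto intro!: nn_integral_cong simp: ennreal_mult'[symmetric] mult_ac)
  also have "\<dots> = (\<integral>\<^sup>+\<xi>. ennreal (w \<xi>) * (\<integral>\<^sup>+t. ennreal (t powr (a - 1) * exp (- (1 + (norm \<xi>)\<^sup>2) * t)) * indicator {0..} t \<partial>lborel) \<partial>lborel)"
    using assms by (intro nn_integral_cong arg_cong2[where f = "(*)"] refl nn_integral_Gamma_scaled[symmetric])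
      (auto simp: add_pos_nonneg)
  also have "\<dots> = (\<integral>\<^sup>+\<xi>. \<integral>\<^sup>+t. ennreal (w \<xi>) * (ennreal (t powr (a - 1) * exp (- (1 + (norm \<xi>)\<^sup>2) * t)) * indicator {0..} t) \<partial>lborel \<partial>lborel)"
    by (intro nn_integral_cong nn_integral_cmult[symmetric]) auto
  also have "\<dots> = (\<integral>\<^sup>+t. \<integral>\<^sup>+\<xi>. ennreal (w \<xi>) * (ennreal (t powr (a - 1) * exp (- (1 + (norm \<xi>)\<^sup>2) * t)) * indicator {0..} t) \<partial>lborel \<partial>lborel)"
    by (rule lborel_pair.Fubini') measurable
  also have "\<dots> = (\<integral>\<^sup>+t. ennreal C * (ennreal (t powr (a - e - 1) * exp (- 1 * t)) * indicator {0..} t) \<partial>lborel)"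
  proof (rule nn_integral_cong_AE)
    have "(\<integral>\<^sup>+\<xi>. ennreal (w \<xi>) * (ennreal (t powr (a - 1) * exp (- (1 + (norm \<xi>)\<^sup>2) * t)) * indicator {0..} t) \<partial>lborel)
        = ennreal C * (ennreal (t powr (a - e - 1) * exp (- 1 * t)) * indicator {0..} t)" if "t \<noteq> 0" for t :: real
    proof (cases "0 < t")
      case True
      have "(\<integral>\<^sup>+\<xi>. ennreal (w \<xi>) * (ennreal (t powr (a - 1) * exp (- (1 + (norm \<xi>)\<^sup>2) * t)) * indicator {0..} t) \<partial>lborel)
        = (\<integral>\<^sup>+\<xi>. ennreal (t powr (a - 1) * exp (- t)) * ennreal (w \<xi> * exp (- t * (norm \<xi>)\<^sup>2)) \<partial>lborel)"
        using True w by (intro nn_integral_cong) (simp add: ennreal_mult'[symmetric] exp_add[symmetric] algebra_simps mult_exp_exp)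
      also have "\<dots> = ennreal (t powr (a - 1) * exp (- t)) * ennreal (C * t powr (- e))"
        using True by (subst nn_integral_cmult) (auto simp only: gauss, measurable)
      also have "\<dots> = ennreal C * (ennreal (t powr (a - e - 1) * exp (- 1 * t)) * indicator {0..} t)"
        using True \<open>0 \<le> C\<close> by (simp add: ennreal_mult'[symmetric] powr_diff powr_minus powr_add field_simps)
      finally show ?thesis .
    qed (use that in \<open>auto split: split_indicator\<close>)
    then show "AE t in lborel. (\<integral>\<^sup>+\<xi>. ennreal (w \<xi>) * (ennreal (t powr (a - 1) * exp (- (1 + (norm \<xi>)\<^sup>2) * t)) * indicator {0..} t) \<partial>lborel)
        = ennreal C * (ennreal (t powr (a - e - 1) * exp (- 1 * t)) * indicator {0..} t)"
      using AE_lborel_singleton[of "0::real"] by (auto elim!: eventually_mono)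
  qed
  also have "\<dots> = ennreal C * ennreal (Gamma (a - e))"
    using assms nn_integral_Gamma_scaled[of "a - e" 1] by (subst nn_integral_cmult) auto
  finally have *: "ennreal (Gamma a) * (\<integral>\<^sup>+\<xi>. ennreal (w \<xi> * (1 + (norm \<xi>)\<^sup>2) powr (- a)) \<partial>lborel)     = ennreal C * ennreal (Gamma (a - e))" (is "_ * ?I = _") .
  have "?I = ennreal (1 / Gamma a) * (ennreal (Gamma a) * ?I)"
    using G by (simp add: mult.assoc[symmetric] ennreal_mult'[symmetric])
  also have "\<dots> = ennreal (C * Gamma (a - e) / Gamma a)"
    unfolding * using G assms by (simp add: ennreal_mult'[symmetric] Gamma_real_pos less_imp_le)
  finally show ?thesis .
qed

text \<open>The integral of the kernel over a horizontal hyperplane at unit distance from the pole: subordination with the Gaussian integral.\<close>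

lemma nn_integral_kernel_section:
  fixes k :: real
  assumes "- 1 < k"
  shows "(\<integral>\<^sup>+(\<xi>::'a::euclidean_space). ennreal ((1 + (norm \<xi>)\<^sup>2) powr (- ((real DIM('a) + 1 + k) / 2))) \<partial>lborel)
       = ennreal (pi powr (real DIM('a) / 2) * Gamma ((k + 1) / 2) / Gamma ((real DIM('a) + 1 + k) / 2))"
proof -
  have "(\<integral>\<^sup>+(\<xi>::'a). ennreal (1 * (1 + (norm \<xi>)\<^sup>2) powr (- ((real DIM('a) + 1 + k) / 2))) \<partial>lborel)
      = ennreal (pi powr (real DIM('a) / 2) * Gamma ((real DIM('a) + 1 + k) / 2 - real DIM('a) / 2) / Gamma ((real DIM('a) + 1 + k) / 2))"
    using assms nn_integral_Gaussian[where ?'a = 'a] by (intro nn_integral_subordination) auto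
  then show ?thesis by (simp add: diff_divide_distrib[symmetric] add.commute)
qed

text \<open>On the half-circle, exchanging the two coordinates preserves arc length.\<close>

lemma nn_integral_kernel_section_swapped:
  assumes "- 1 < q" and dim: "DIM('a::euclidean_space) = 1"
  shows "(\<integral>\<^sup>+(\<xi>::'a). ennreal (norm \<xi> powr q * (1 + (norm \<xi>)\<^sup>2) powr (- ((q + 2) / 2))) \<partial>lborel)
       = ennreal (pi powr (1 / 2) * Gamma ((q + 1) / 2) / Gamma ((q + 2) / 2))"
proof -
  obtain b :: 'a where b: "Basis = {b}" using dim card_1_singletonE by blast
  have nb: "norm \<xi> = \<bar>\<xi> \<bullet> b\<bar>" for \<xi> :: 'a
    by (subst norm_eq_sqrt_inner, subst euclidean_inner) (simp add: b real_sqrt_abs2)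
  have gauss: "(\<integral>\<^sup>+(\<xi>::'a). ennreal (norm \<xi> powr q * exp (- t * (norm \<xi>)\<^sup>2)) \<partial>lborel)
      = ennreal (Gamma ((q + 1) / 2) * t powr (- ((q + 1) / 2)))" if "0 < t" for t
    using nn_integral_lborel_prod[where ?'a = 'a and f = "\<lambda>_ x. ennreal (\<bar>x\<bar> powr q * exp (- t * x\<^sup>2))"]
      nn_integral_Gaussian_moment[OF assms(1) that]
    by (simp add: b nb)
  have "(\<integral>\<^sup>+(\<xi>::'a). ennreal (norm \<xi> powr q * (1 + (norm \<xi>)\<^sup>2) powr (- ((q + 2) / 2))) \<partial>lborel)
      = ennreal (Gamma ((q + 1) / 2) * Gamma ((q + 2) / 2 - (q + 1) / 2) / Gamma ((q + 2) / 2))"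
    using assms by (intro nn_integral_subordination gauss) (auto simp: Gamma_real_pos less_imp_le)
  then show ?thesis
    by (simp add: diff_divide_distrib[symmetric] powr_half_sqrt Gamma_one_half_real mult.commute)
qed

section \<open>A smooth mollifier above the boundary\<close>

text \<open>Class \<open>C\<^sup>k\<close> is closed under the operations from which the bump is built.\<close>

lemma partial_deriv_eq:
  assumes "(f has_derivative f') (at x)"
  shows "partial_deriv i f x = f' i"
  using frechet_derivative_at[OF assms] by (simp add: partial_deriv_def)

lemma C_diff_SucI:
  assumes "\<And>x. (f has_derivative f' x) (at x)" "\<And>i. i \<in> Basis \<Longrightarrow> C_diff k (\<lambda>x. f' x i)"
  shows "C_diff (Suc k) f"
proof -
  have "partial_deriv i f = (\<lambda>x. f' x i)" for i
    using partial_deriv_eq[OF assms(1)] by auto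
  then show ?thesis using assms by (auto intro: differentiableI)
qed

lemma C_diff_SucD:
  assumes "C_diff (Suc k) f"
  shows "(f has_derivative frechet_derivative f (at x)) (at x)"
    "i \<in> Basis \<Longrightarrow> C_diff k (\<lambda>x. frechet_derivative f (at x) i)"
proof -
  have "f differentiable (at x)" using assms by simp
  then show "(f has_derivative frechet_derivative f (at x)) (at x)" by (simp only: frechet_derivative_works)
  show "i \<in> Basis \<Longrightarrow> C_diff k (\<lambda>x. frechet_derivative f (at x) i)"
    using assms by (simp add: partial_deriv_def)
qed

lemma C_diff_pred: "C_diff (Suc k) f \<Longrightarrow> C_diff k f"
proof (induction k arbitrary: f)
  case 0
  then have "f differentiable (at x)" for x by simp
  then have "f differentiable_on UNIV" by (auto simp: differentiable_on_def)
  then show ?case by (simp add: differentiable_imp_continuous_on)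
next
  case (Suc k)
  have "(\<forall>x. f differentiable (at x)) \<and> (\<forall>i\<in>Basis. C_diff (Suc k) (partial_deriv i f))"
    using Suc.prems by (subst (asm) C_diff.simps(2)) simp
  then show ?case by (subst C_diff.simps(2)) (blast intro: Suc.IH)
qed

lemma C_diff_const: "C_diff k (\<lambda>x. c)"
proof (induction k arbitrary: c)
  case 0
  then show ?case by simp
next
  case (Suc k)
  show ?case by (rule C_diff_SucI[OF has_derivative_const]) (rule Suc.IH)
qed

lemma C_diff_add: "C_diff k f \<Longrightarrow> C_diff k g \<Longrightarrow> C_diff k (\<lambda>x. f x + g x)"
proof (induction k arbitrary: f g)
  case 0
  then show ?case by (simp add: continuous_on_add)
next
  case (Suc k)
  note f = C_diff_SucD[OF Suc.prems(1)] and g = C_diff_SucD[OF Suc.prems(2)]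
  show ?case
    by (rule C_diff_SucI[OF has_derivative_add[OF f(1) g(1)]]) (intro Suc.IH f(2) g(2))
qed

lemma C_diff_mult: "C_diff k f \<Longrightarrow> C_diff k g \<Longrightarrow> C_diff k (\<lambda>x. f x * g x)"
proof (induction k arbitrary: f g)
  case 0
  then show ?case by (simp add: continuous_on_mult)
next
  case (Suc k)
  note f = C_diff_SucD[OF Suc.prems(1)] and g = C_diff_SucD[OF Suc.prems(2)]
  show ?case
    by (rule C_diff_SucI[OF has_derivative_mult[OF f(1) g(1)]])
       (intro C_diff_add Suc.IH f(2) g(2) C_diff_pred[OF Suc.prems(1)] C_diff_pred[OF Suc.prems(2)])
qed

lemma C_diff_inner: "C_diff k (\<lambda>x. x \<bullet> (b::'a::euclidean_space))"
proof (cases k)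
  case (Suc j)
  have "((\<lambda>x. x \<bullet> b) has_derivative (\<lambda>h. h \<bullet> b)) (at x)" for x :: 'a
    by (intro has_derivative_inner_left has_derivative_ident)
  then have "C_diff (Suc j) (\<lambda>x. x \<bullet> b)"
    by (rule C_diff_SucI) (rule C_diff_const)
  then show ?thesis using Suc by simp
qed (auto intro: continuous_intros)

lemma C_diff_sum: "(\<And>i. i \<in> A \<Longrightarrow> C_diff k (f i)) \<Longrightarrow> C_diff k (\<lambda>x. \<Sum>i\<in>A. f i x)"
  by (induction A rule: infinite_finite_induct) (auto intro: C_diff_const C_diff_add)

lemma C_diff_compose:
  fixes q :: "'a::euclidean_space \<Rightarrow> real" and F :: "nat \<Rightarrow> real \<Rightarrow> real"
  assumes F: "\<And>n t. (F n has_real_derivative F (Suc n) t) (at t)" and q: "\<And>k. C_diff k q"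
  shows "C_diff k (\<lambda>x. F n (q x))"
proof (induction k arbitrary: n)
  case 0
  have "continuous_on UNIV (F n)"
    using F by (meson DERIV_continuous_on has_field_derivative_at_within)
  moreover have "continuous_on UNIV q" using q[of 0] by simp
  ultimately show ?case by (simp add: continuous_on_compose2[of UNIV])
next
  case (Suc k)
  have "C_diff (Suc k) q" by (rule q)
  note q' = C_diff_SucD[OF this]
  have "((\<lambda>x. F n (q x)) has_derivative (\<lambda>h. F (Suc n) (q x) * frechet_derivative q (at x) h)) (at x)" for x
    using has_derivative_compose[OF q'(1)[of x] F[of n "q x", unfolded has_field_derivative_def]] by simp
  then show ?case
    by (rule C_diff_SucI) (intro C_diff_mult Suc.IH q'(2))
qed

lemma C_diff_affine_arg:
  fixes f :: "'a::euclidean_space \<Rightarrow> real"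
  shows "C_diff k f \<Longrightarrow> C_diff k (\<lambda>x. f (c *\<^sub>R (x - a)))"
proof (induction k arbitrary: f)
  case 0
  then have "continuous_on UNIV f" by simp
  then have "continuous_on UNIV (\<lambda>x. f (c *\<^sub>R (x - a)))"
    by (rule continuous_on_compose2) (auto intro!: continuous_intros)
  then show ?case by simp
next
  case (Suc k)
  note f = C_diff_SucD[OF Suc.prems(1)]
  have "((\<lambda>x. f (c *\<^sub>R (x - a))) has_derivative (\<lambda>h. c * frechet_derivative f (at (c *\<^sub>R (x - a))) h)) (at x)" for x
  proof -
    have "((\<lambda>x. f (c *\<^sub>R (x - a))) has_derivative (\<lambda>h. frechet_derivative f (at (c *\<^sub>R (x - a))) (c *\<^sub>R h))) (at x)"
      by (rule has_derivative_compose[OF _ f(1)]) (auto intro!: derivative_eq_intros)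
    moreover have "frechet_derivative f (at (c *\<^sub>R (x - a))) (c *\<^sub>R h) = c * frechet_derivative f (at (c *\<^sub>R (x - a))) h" for h
      using linear_cmul[OF has_derivative_linear[OF f(1)]] by simp
    ultimately show ?thesis by simp
  qed
  then show ?case
    by (rule C_diff_SucI) (intro C_diff_mult C_diff_const Suc.IH f(2))
qed

text \<open>The flat function \<open>exp (- 1 / t)\<close> (zero for \<open>t \<le> 0\<close>) together with all its derivatives, which have the
  form \<open>P (1 / t) exp (- 1 / t)\<close> for polynomials \<open>P\<close>.\<close>

definition flat_exp :: "real poly \<Rightarrow> real \<Rightarrow> real" where
  "flat_exp P t = (if t \<le> 0 then 0 else poly P (1 / t) * exp (- (1 / t)))"

definition flat_step :: "real poly \<Rightarrow> real poly" where
  "flat_step P = [:0, 0, 1:] * (P - pderiv P)"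

lemma poly_exp_decay: "((\<lambda>y::real. poly P y * exp (- y)) \<longlongrightarrow> 0) at_top"
proof -
  have "((\<lambda>y. \<Sum>i\<le>degree P. coeff P i * (y ^ i / exp y)) \<longlongrightarrow> (\<Sum>i\<le>degree P. coeff P i * 0)) at_top"
    by (intro tendsto_intros tendsto_power_div_exp_0)
  moreover have "poly P y * exp (- y) = (\<Sum>i\<le>degree P. coeff P i * (y ^ i / exp y))" for y
    by (simp add: poly_altdef sum_distrib_right exp_minus divide_inverse mult.assoc)
  ultimately show ?thesis by simp
qed

lemma flat_exp_deriv: "(flat_exp P has_real_derivative flat_exp (flat_step P) t) (at t)"
proof -
  consider "t < 0" | "t = 0" | "0 < t" by linarith
  then show ?thesis
  proof cases
    case 1
    have "(flat_exp P has_real_derivative 0) (at t)"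
      by (rule has_field_derivative_transform_within_open[where S = "{..<0}" and f = "\<lambda>_. 0"])
         (use 1 in \<open>auto simp: flat_exp_def\<close>)
    then show ?thesis using 1 by (simp add: flat_exp_def)
  next
    case 3
    have "((\<lambda>t. poly P (1 / t) * exp (- (1 / t))) has_real_derivative
        poly (flat_step P) (1 / t) * exp (- (1 / t))) (at t)"
      using 3 by (auto intro!: derivative_eq_intros poly_DERIV[THEN DERIV_chain2]
          simp: flat_step_def field_simps power2_eq_square)
    then have "(flat_exp P has_real_derivative poly (flat_step P) (1 / t) * exp (- (1 / t))) (at t)"
      by (rule has_field_derivative_transform_within_open[where S = "{0<..}"])
         (use 3 in \<open>auto simp: flat_exp_def\<close>)
    then show ?thesis using 3 by (simp add: flat_exp_def)
  next
    case 2
    have right: "((\<lambda>h. flat_exp P h / h) \<longlongrightarrow> 0) (at_right 0)"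
    proof -
      have "((\<lambda>y. poly ([:0, 1:] * P) y * exp (- y)) \<longlongrightarrow> 0) at_top" by (rule poly_exp_decay)
      then have "((\<lambda>h. poly ([:0, 1:] * P) (inverse h) * exp (- inverse h)) \<longlongrightarrow> 0) (at_right 0)"
        by (rule filterlim_compose) (rule filterlim_inverse_at_top_right)
      then show ?thesis
        by (rule Lim_transform_eventually)
           (auto simp: eventually_at_right_less flat_exp_def field_simps intro!: eventually_at_rightI[of 0 1])
    qed
    have left: "((\<lambda>h. flat_exp P h / h) \<longlongrightarrow> 0) (at_left 0)"
      by (rule tendsto_eventually) (auto simp: flat_exp_def intro!: eventually_at_leftI[of "-1"])
    have "((\<lambda>h. flat_exp P h / h) \<longlongrightarrow> 0) (at 0)"
      using left right by (rule filterlim_split_at)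
    then show ?thesis using 2 by (simp add: DERIV_def flat_exp_def)
  qed
qed

text \<open>A mollifier kernel living at heights between \<open>1\<close> and \<open>3\<close>. Mollifying with it only uses values at larger
  heights, so that a function on the upper half-space has mollifications up to the boundary.\<close>

definition raw_bump :: "'a::euclidean_space \<times> real \<Rightarrow> real" where
  "raw_bump z = flat_exp 1 (1 - (norm (z - (0, 2)))\<^sup>2)"

lemma raw_bump_nonneg: "0 \<le> raw_bump z"
  by (simp add: raw_bump_def flat_exp_def)

lemma raw_bump_eq_0_iff: "raw_bump z = 0 \<longleftrightarrow> 1 \<le> norm (z - (0, 2))"
proof -
  have "1 - (norm (z - (0, 2)))\<^sup>2 \<le> 0 \<longleftrightarrow> 1 \<le> norm (z - (0, 2))"
    using abs_square_le_1[of "norm (z - (0, 2))"] power2_le_iff_abs_le[of 1 "norm (z - (0, 2))"]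
    by (auto simp: one_le_power power2_nonneg_ge_1_iff)
  then show ?thesis by (auto simp: raw_bump_def flat_exp_def)
qed

lemma raw_bump_le_1: "raw_bump z \<le> 1"
  by (simp add: raw_bump_def flat_exp_def)

lemma abs_raw_bump_le: "\<bar>raw_bump z\<bar> \<le> indicator (cball (0, 2) 1) z"
proof (cases "z \<in> cball (0, 2) 1")
  case True
  then show ?thesis using raw_bump_le_1[of z] raw_bump_nonneg[of z] by (simp del: mem_cball)
next
  case False
  then have "raw_bump z = 0"
    unfolding raw_bump_eq_0_iff mem_cball by (subst (asm) dist_commute) (simp only: dist_norm not_le less_imp_le)
  then show ?thesis by simp
qed

lemma C_diff_raw_bump: "C_diff k (raw_bump :: 'a::euclidean_space \<times> real \<Rightarrow> real)"
proof -
  let ?c = "(0, 2) :: 'a \<times> real"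
  have "C_diff k (\<lambda>z. 1 + (- 1) * (\<Sum>b\<in>Basis. ((z \<bullet> b) + (- (?c \<bullet> b))) * ((z \<bullet> b) + (- (?c \<bullet> b)))))" for k
    by (intro C_diff_add C_diff_mult C_diff_const C_diff_sum C_diff_inner)
  moreover have "(norm (z - ?c))\<^sup>2 = (\<Sum>b\<in>Basis. ((z \<bullet> b) + (- (?c \<bullet> b))) * ((z \<bullet> b) + (- (?c \<bullet> b))))" for z
    by (subst power2_norm_eq_inner, subst euclidean_inner) (simp add: inner_diff_left)
  ultimately have q: "C_diff k (\<lambda>z. 1 - (norm (z - ?c))\<^sup>2)" for k by simp
  have "C_diff k (\<lambda>z. flat_exp ((flat_step ^^ 0) 1) (1 - (norm (z - ?c))\<^sup>2))"
    by (rule C_diff_compose[where F = "\<lambda>n. flat_exp ((flat_step ^^ n) 1)"]) (auto intro: flat_exp_deriv q)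
  then show ?thesis by (simp add: raw_bump_def[abs_def])
qed

lemma continuous_raw_bump: "continuous_on A raw_bump"
  using C_diff_raw_bump[of 0] continuous_on_subset by auto

lemma borel_measurable_raw_bump[measurable]: "raw_bump \<in> borel_measurable borel"
  by (intro borel_measurable_continuous_onI continuous_raw_bump)

lemma integrable_raw_bump: "integrable lborel (raw_bump :: 'a::euclidean_space \<times> real \<Rightarrow> real)"
proof (rule Bochner_Integration.integrable_bound)
  show "integrable lborel (indicator (cball ((0::'a), 2::real) 1) :: _ \<Rightarrow> real)"
    using emeasure_bounded_finite[of "cball ((0::'a), 2::real) 1"] by (intro integrable_real_indicator) auto
  show "AE z in lborel. norm (raw_bump z) \<le> norm (indicator (cball ((0::'a), 2) 1) z :: real)"
    using abs_raw_bump_le by (intro AE_I2) simp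
qed auto

lemma integral_raw_bump_pos: "0 < (LINT y|lborel. raw_bump (y :: 'a::euclidean_space \<times> real))"
proof -
  have "(LINT y|lborel. raw_bump (y :: 'a \<times> real)) \<noteq> 0"
  proof
    assume "(LINT y|lborel. raw_bump (y :: 'a \<times> real)) = 0"
    then have "AE y in lborel. raw_bump (y :: 'a \<times> real) = 0"
      by (subst (asm) integral_nonneg_eq_0_iff_AE[OF integrable_raw_bump]) (simp_all add: raw_bump_nonneg)
    then have "AE y in lborel. y \<notin> ball ((0::'a), 2::real) 1"
      by (auto simp: raw_bump_eq_0_iff dist_norm norm_minus_commute elim!: eventually_mono)
    then have "emeasure lborel (ball ((0::'a), 2::real) 1) = 0"
      by (subst (asm) AE_iff_measurable[where N = "ball ((0::'a), 2::real) 1"]) auto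
    then show False using emeasure_lborel_ball_finite content_ball_pos[of 1 "((0::'a), 2::real)"]
      by (simp add: measure_def)
  qed
  moreover have "0 \<le> (LINT y|lborel. raw_bump (y :: 'a \<times> real))"
    by (rule Bochner_Integration.integral_nonneg) (rule raw_bump_nonneg)
  ultimately show ?thesis by linarith
qed

definition mollifier :: "real \<Rightarrow> 'a::euclidean_space \<times> real \<Rightarrow> real" where
  "mollifier \<epsilon> w = raw_bump ((1 / \<epsilon>) *\<^sub>R w) / (\<epsilon> ^ (DIM('a) + 1) * (LINT y|lborel. raw_bump (y :: 'a \<times> real)))"

lemma mollifier_nonneg: "0 < \<epsilon> \<Longrightarrow> 0 \<le> mollifier \<epsilon> w"
  using integral_raw_bump_pos[where ?'a = 'a] by (simp add: mollifier_def raw_bump_nonneg)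

lemma mollifier_support:
  assumes "0 < \<epsilon>" "mollifier \<epsilon> w \<noteq> 0"
  shows "norm (w - (0, 2 * \<epsilon>)) < \<epsilon>" "norm (fst w) < \<epsilon>" "\<epsilon> < snd w" "snd w < 3 * \<epsilon>"
proof -
  have "norm ((1 / \<epsilon>) *\<^sub>R w - (0, 2)) < 1"
    using assms(2) raw_bump_eq_0_iff[of "(1 / \<epsilon>) *\<^sub>R w"] by (auto simp: mollifier_def)
  moreover have "w - (0, 2 * \<epsilon>) = \<epsilon> *\<^sub>R ((1 / \<epsilon>) *\<^sub>R w - (0, 2))"
    using assms(1) by (simp add: prod_eq_iff algebra_simps)
  ultimately show *: "norm (w - (0, 2 * \<epsilon>)) < \<epsilon>"
    using assms(1) by simp
  have "norm (fst v) \<le> norm v" "\<bar>snd v\<bar> \<le> norm v" for v :: "'a \<times> real"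
    using norm_fst_le[of "fst v" "snd v"] norm_snd_le[of "snd v" "fst v"] by (simp_all only: prod.collapse real_norm_def)
  from this[of "w - (0, 2 * \<epsilon>)"] have f: "norm (fst w) \<le> norm (w - (0, 2 * \<epsilon>))" and g: "\<bar>snd w - 2 * \<epsilon>\<bar> \<le> norm (w - (0, 2 * \<epsilon>))"
    by (simp_all only: fst_diff snd_diff fst_conv snd_conv diff_zero)
  show "norm (fst w) < \<epsilon>" using * f by linarith
  show "\<epsilon> < snd w" "snd w < 3 * \<epsilon>" using * g by linarith+
qed

lemma C_diff_mollifier: "C_diff k (\<lambda>\<zeta>. mollifier \<epsilon> (\<zeta> - z))"
proof -
  have "mollifier \<epsilon> (\<zeta> - z) = raw_bump ((1 / \<epsilon>) *\<^sub>R (\<zeta> - z)) * inverse (\<epsilon> ^ (DIM('a) + 1) * (LINT y|lborel. raw_bump (y :: 'a \<times> real)))" for \<zeta>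
    by (simp only: mollifier_def divide_inverse)
  then show ?thesis
    by (simp only:) (rule C_diff_mult[OF C_diff_affine_arg[OF C_diff_raw_bump] C_diff_const])
qed

lemma continuous_mollifier: "continuous_on A (mollifier \<epsilon>)"
  using C_diff_mollifier[of 0 \<epsilon> 0] continuous_on_subset by auto

lemma borel_measurable_mollifier[measurable]: "mollifier \<epsilon> \<in> borel_measurable borel"
  by (intro borel_measurable_continuous_onI continuous_mollifier)

lemma mollifier_bounded:
  assumes "0 < \<epsilon>"
  shows "mollifier \<epsilon> (w :: 'a::euclidean_space \<times> real)
    \<le> 1 / (\<epsilon> ^ (DIM('a) + 1) * (LINT y|lborel. raw_bump (y :: 'a \<times> real)))"
  using assms integral_raw_bump_pos[where ?'a = 'a]
  unfolding mollifier_def by (intro divide_right_mono raw_bump_le_1 mult_nonneg_nonneg) simp_all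

lemma nn_integral_mollifier:
  assumes "0 < \<epsilon>"
  shows "(\<integral>\<^sup>+w. ennreal (mollifier \<epsilon> (w :: 'a::euclidean_space \<times> real)) \<partial>lborel) = 1"
proof -
  let ?N = "DIM('a) + 1" and ?I = "LINT y|lborel. raw_bump (y :: 'a \<times> real)"
  have I: "0 < ?I" by (rule integral_raw_bump_pos)
  have "(\<integral>\<^sup>+y. ennreal (raw_bump (y :: 'a \<times> real)) \<partial>lborel) = ennreal ?I"
    by (intro nn_integral_eq_integral integrable_raw_bump) (simp add: raw_bump_nonneg)
  have "(\<integral>\<^sup>+w. ennreal (mollifier \<epsilon> (w :: 'a \<times> real)) \<partial>lborel)
      = (\<integral>\<^sup>+w. ennreal (mollifier \<epsilon> w) \<partial>density (distr lborel borel (\<lambda>x :: 'a \<times> real. 0 + \<epsilon> *\<^sub>R x)) (\<lambda>_. \<bar>\<epsilon>\<bar> ^ DIM('a \<times> real)))"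
    using assms by (subst lborel_affine[of \<epsilon> 0]) auto
  also have "\<dots> = (\<integral>\<^sup>+y. ennreal (\<epsilon> ^ ?N) * ennreal (mollifier \<epsilon> (\<epsilon> *\<^sub>R y)) \<partial>(lborel :: ('a \<times> real) measure))"
    using assms by (subst nn_integral_density) (auto simp: nn_integral_distr)
  also have "\<dots> = (\<integral>\<^sup>+y. ennreal (1 / ?I) * ennreal (raw_bump y) \<partial>(lborel :: ('a \<times> real) measure))"
    using assms I raw_bump_nonneg
    by (intro nn_integral_cong) (simp add: mollifier_def ennreal_mult'[symmetric])
  also have "\<dots> = ennreal (1 / ?I) * ennreal ?I"
    by (subst nn_integral_cmult) (auto simp: \<open>_ = ennreal ?I\<close>)
  also have "\<dots> = 1"
    using I by (simp add: ennreal_mult'[symmetric])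
  finally show ?thesis .
qed

lemma mollifier_test_function:
  assumes "0 < \<epsilon>" "0 \<le> snd (z :: 'a::euclidean_space \<times> real)"
  shows "test_function_on (\<lambda>\<zeta>. mollifier \<epsilon> (\<zeta> - z)) upper_half"
proof -
  let ?S = "{\<zeta>. mollifier \<epsilon> (\<zeta> - z) \<noteq> 0}"
  have "?S \<subseteq> cball (z + (0, 2 * \<epsilon>)) \<epsilon>"
  proof
    fix \<zeta> assume "\<zeta> \<in> ?S"
    then have "norm (\<zeta> - z - (0, 2 * \<epsilon>)) < \<epsilon>" using mollifier_support(1)[OF assms(1)] by blast
    moreover have "norm (\<zeta> - z - (0, 2 * \<epsilon>)) = dist (z + (0, 2 * \<epsilon>)) \<zeta>"
      by (subst dist_commute) (simp only: dist_norm diff_diff_eq)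
    ultimately show "\<zeta> \<in> cball (z + (0, 2 * \<epsilon>)) \<epsilon>" by (simp only: mem_cball)
  qed
  then have cl: "closure ?S \<subseteq> cball (z + (0, 2 * \<epsilon>)) \<epsilon>" by (rule closure_minimal) simp
  moreover have "cball (z + (0, 2 * \<epsilon>)) \<epsilon> \<subseteq> upper_half"
  proof
    fix \<zeta> assume "\<zeta> \<in> cball (z + (0, 2 * \<epsilon>)) \<epsilon>"
    then have "dist (z + (0, 2 * \<epsilon>)) \<zeta> \<le> \<epsilon>" by (simp only: mem_cball)
    then have "dist (snd (z + (0, 2 * \<epsilon>))) (snd \<zeta>) \<le> \<epsilon>" by (rule order_trans[OF dist_snd_le])
    then have "0 < snd \<zeta>" using assms by (simp add: dist_real_def)
    then show "\<zeta> \<in> upper_half" by (simp only: upper_half_def mem_Collect_eq)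
  qed
  moreover have "compact (closure ?S)"
    using bounded_subset[OF bounded_cball cl] by (simp only: compact_eq_bounded_closed closed_closure simp_thms)
  ultimately show ?thesis
    unfolding test_function_on_def using C_diff_mollifier by blast
qed

section \<open>Weak gradients and mollification along curves\<close>

locale weak_gradient =
  fixes u :: "'a::euclidean_space \<times> real \<Rightarrow> real" and g :: "'a \<times> real \<Rightarrow> 'a \<times> real"
  assumes u_borel[measurable]: "u \<in> borel_measurable borel"
    and g_borel[measurable]: "g \<in> borel_measurable borel"
    and u_integrable: "\<And>K. compact K \<Longrightarrow> K \<subseteq> upper_half \<Longrightarrow> integrable lborel (\<lambda>z. indicator K z *\<^sub>R u z)"
    and g_integrable: "\<And>K. compact K \<Longrightarrow> K \<subseteq> upper_half \<Longrightarrow> integrable lborel (\<lambda>z. indicator K z *\<^sub>R g z)"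
    and weak: "\<And>\<phi> i. test_function_on \<phi> upper_half \<Longrightarrow> i \<in> Basis \<Longrightarrow>
      (LINT z|lborel. u z * partial_deriv i \<phi> z) = - (LINT z|lborel. (g z \<bullet> i) * \<phi> z)"

lemma open_upper_half: "open upper_half"
  unfolding upper_half_def by (intro open_Collect_less continuous_intros)

lemma upper_half_borel[measurable]: "upper_half \<in> sets borel"
  by (rule borel_open[OF open_upper_half])

lemma locally_integrable_measurable:
  fixes f :: "'a::euclidean_space \<times> real \<Rightarrow> 'b::euclidean_space"
  assumes "f locally_integrable_on upper_half"
  shows "(\<lambda>z. indicator upper_half z *\<^sub>R f z) \<in> borel_measurable lebesgue"
proof (rule borel_measurable_LIMSEQ_metric)
  let ?K = "\<lambda>n. cball 0 (real n) \<inter> {z::'a \<times> real. 1 / (real n + 1) \<le> snd z}"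
  show "(\<lambda>z. indicator (?K n) z *\<^sub>R f z) \<in> borel_measurable lebesgue" for n
  proof -
    have "compact (?K n)"
      by (intro compact_Int_closed compact_cball closed_Collect_le continuous_intros)
    moreover have "?K n \<subseteq> upper_half"
      by (auto simp: upper_half_def intro: less_le_trans[rotated])
    ultimately have "set_integrable lebesgue (?K n) f"
      using assms by (auto simp: locally_integrable_on_def)
    then show ?thesis by (simp add: set_integrable_def borel_measurable_integrable)
  qed
  show "(\<lambda>n. indicator (?K n) z *\<^sub>R f z) \<longlonglongrightarrow> indicator upper_half z *\<^sub>R f z" for z
  proof (cases "z \<in> upper_half")
    case True
    then have z: "0 < snd z" by (simp add: upper_half_def)
    obtain m :: nat where m: "norm z \<le> real m" using real_arch_simple by blast
    obtain k :: nat where k: "1 / snd z \<le> real k" using real_arch_simple by blast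
    have "indicator (?K n) z = (1 :: real)" if "n \<ge> max m k" for n
    proof -
      have "1 / snd z \<le> real n + 1" using k that by simp
      then have "1 / (real n + 1) \<le> snd z" using z by (simp add: field_simps)
      moreover have "norm z \<le> real n" using m that by simp
      ultimately have "z \<in> ?K n" by (simp add: dist_norm del: split_paired_All)
      then show ?thesis by simp
    qed
    then have "\<forall>\<^sub>F n in sequentially. indicator (?K n) z *\<^sub>R f z = indicator upper_half z *\<^sub>R f z"
      using True unfolding eventually_sequentially by (intro exI[of _ "max m k"]) simp
    then show ?thesis by (rule tendsto_eventually)
  next
    case False
    then have "z \<notin> ?K n" for n
      by (auto simp: upper_half_def intro: less_le_trans[rotated])
    then have "indicator (?K n) z = (0 :: real)" for n by (intro indicator_simps(2)) blast
    moreover have "indicator upper_half z = (0 :: real)" using False by (rule indicator_simps(2))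
    ultimately show ?thesis by (simp only: scaleR_zero_left tendsto_const)
  qed
qed

text \<open>Borel representatives make Fubini and joint measurability available. They are constructed coordinate by coordinate.\<close>

lemma locally_integrable_borel_representative:
  fixes f :: "'a::euclidean_space \<times> real \<Rightarrow> 'b::euclidean_space"
  assumes "f locally_integrable_on upper_half"
  obtains f0 where "f0 \<in> borel_measurable borel" "AE z in lborel. z \<in> upper_half \<longrightarrow> f0 z = f z"
    "\<And>K. compact K \<Longrightarrow> K \<subseteq> upper_half \<Longrightarrow> integrable lborel (\<lambda>z. indicator K z *\<^sub>R f0 z)"
proof -
  let ?f = "\<lambda>z. indicator upper_half z *\<^sub>R f z"
  have meas: "?f \<in> borel_measurable lebesgue" by (rule locally_integrable_measurable[OF assms])
  have "\<exists>h\<in>borel_measurable lborel. AE z in lborel. ?f z \<bullet> i = h z" for i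
    by (rule completion_ex_borel_measurable_real) (intro borel_measurable_inner meas borel_measurable_const)
  then obtain h where h: "\<And>i. h i \<in> borel_measurable lborel" "\<And>i. AE z in lborel. ?f z \<bullet> i = h i z"
    by metis
  define f0 where "f0 z = (\<Sum>i\<in>Basis. h i z *\<^sub>R i)" for z
  have [measurable]: "f0 \<in> borel_measurable borel"
    unfolding f0_def using h(1) by auto
  have "AE z in lborel. \<forall>i\<in>Basis. ?f z \<bullet> i = h i z"
    using h(2) by (intro AE_finite_allI) auto
  then have ae: "AE z in lborel. f0 z = ?f z"
  proof eventually_elim
    case (elim z)
    have "f0 z = (\<Sum>i\<in>Basis. (?f z \<bullet> i) *\<^sub>R i)"
      unfolding f0_def using elim by (intro sum.cong) simp_all
    then show ?case by (simp only: euclidean_representation)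
  qed
  show ?thesis
  proof
    show "f0 \<in> borel_measurable borel" by measurable
    show "AE z in lborel. z \<in> upper_half \<longrightarrow> f0 z = f z"
      using ae by eventually_elim simp
    fix K :: "('a \<times> real) set" assume K: "compact K" "K \<subseteq> upper_half"
    have [measurable]: "K \<in> sets borel" using K(1) by (simp add: compact_imp_closed)
    have *: "integrable lebesgue (\<lambda>z. indicator K z *\<^sub>R f z)"
      using assms K by (simp add: locally_integrable_on_def set_integrable_def)
    have "integrable lebesgue (\<lambda>z. indicator K z *\<^sub>R f0 z)"
    proof (rule integrable_cong_AE_imp[OF *])
      have "(\<lambda>z. indicator K z *\<^sub>R f0 z) \<in> borel_measurable lborel" by measurable
      then show "(\<lambda>z. indicator K z *\<^sub>R f0 z) \<in> borel_measurable lebesgue" by (rule measurable_completion)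
      have "AE z in lborel. indicator K z *\<^sub>R f z = indicator K z *\<^sub>R f0 z"
        using ae
      proof eventually_elim
        case (elim z)
        then show ?case using K(2) by (cases "z \<in> K") auto
      qed
      then show "AE z in lebesgue. indicator K z *\<^sub>R f z = indicator K z *\<^sub>R f0 z" by (rule AE_completion)
    qed
    then show "integrable lborel (\<lambda>z. indicator K z *\<^sub>R f0 z)"
      by (subst (asm) integrable_completion) auto
  qed
qed

lemma partial_deriv_outside_support:
  assumes "x \<notin> closure {x. \<phi> x \<noteq> 0}"
  shows "partial_deriv i \<phi> x = 0"
proof -
  have "(\<phi> has_derivative (\<lambda>_. 0)) (at x)"
    by (rule has_derivative_transform_within_open[where f = "\<lambda>_. 0" and s = "- closure {x. \<phi> x \<noteq> 0}"])
       (use assms closure_subset[of "{x. \<phi> x \<noteq> 0}"] in auto)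
  then show ?thesis by (rule partial_deriv_eq)
qed

lemma C_diff_1_continuous: "C_diff (Suc 0) \<phi> \<Longrightarrow> i \<in> Basis \<Longrightarrow> continuous_on UNIV (partial_deriv i \<phi>)"
  by simp

lemma weak_gradient_representative:
  fixes u :: "'a::euclidean_space \<times> real \<Rightarrow> real"
  assumes "has_weak_derivative_on u g upper_half"
  obtains u0 g0 where "weak_gradient u0 g0"
    "AE z in lborel. z \<in> upper_half \<longrightarrow> u0 z = u z" "AE z in lborel. z \<in> upper_half \<longrightarrow> g0 z = g z"
proof -
  have u: "u locally_integrable_on upper_half" and g: "g locally_integrable_on upper_half"
    and weak: "\<And>\<phi> i. test_function_on \<phi> upper_half \<Longrightarrow> i \<in> Basis \<Longrightarrow>
      (LINT x:upper_half|lebesgue. u x * partial_deriv i \<phi> x) = - (LINT x:upper_half|lebesgue. (g x \<bullet> i) * \<phi> x)"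
    using assms unfolding has_weak_derivative_on_def by blast+
  obtain u0 where u0[measurable]: "u0 \<in> borel_measurable borel" and u0': "AE z in lborel. z \<in> upper_half \<longrightarrow> u0 z = u z"
    and u0_int: "\<And>K. compact K \<Longrightarrow> K \<subseteq> upper_half \<Longrightarrow> integrable lborel (\<lambda>z. indicator K z *\<^sub>R u0 z)"
    using locally_integrable_borel_representative[OF u] by blast
  obtain g0 where g0[measurable]: "g0 \<in> borel_measurable borel" and g0': "AE z in lborel. z \<in> upper_half \<longrightarrow> g0 z = g z"
    and g0_int: "\<And>K. compact K \<Longrightarrow> K \<subseteq> upper_half \<Longrightarrow> integrable lborel (\<lambda>z. indicator K z *\<^sub>R g0 z)"
    using locally_integrable_borel_representative[OF g] by blast
  have transfer: "(LINT x:upper_half|lebesgue. f x * \<psi> x) = (LINT x|lborel. f0 x * \<psi> x)"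
    if [measurable]: "f0 \<in> borel_measurable borel" "\<psi> \<in> borel_measurable borel"
      and f: "(\<lambda>z. indicator upper_half z *\<^sub>R f z) \<in> borel_measurable lebesgue"
      and ae: "AE z in lborel. z \<in> upper_half \<longrightarrow> f0 z = f z"
      and 0: "\<And>z. z \<notin> upper_half \<Longrightarrow> \<psi> z = 0" for f f0 \<psi> :: "'a \<times> real \<Rightarrow> real"
  proof -
    have "(LINT x|lborel. f0 x * \<psi> x) = (LINT x|lebesgue. f0 x * \<psi> x)"
      by (rule integral_completion[symmetric]) simp
    also have "\<dots> = (LINT x|lebesgue. indicator upper_half x *\<^sub>R (f x * \<psi> x))"
    proof (rule integral_cong_AE)
      have "(\<lambda>x. f0 x * \<psi> x) \<in> borel_measurable lborel" by measurable
      then show "(\<lambda>x. f0 x * \<psi> x) \<in> borel_measurable lebesgue" by (rule measurable_completion)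
      have "\<psi> \<in> borel_measurable lborel" by measurable
      then have "\<psi> \<in> borel_measurable lebesgue" by (rule measurable_completion)
      then have "(\<lambda>x. (indicator upper_half x *\<^sub>R f x) * \<psi> x) \<in> borel_measurable lebesgue"
        by (intro borel_measurable_times f)
      then show "(\<lambda>x. indicator upper_half x *\<^sub>R (f x * \<psi> x)) \<in> borel_measurable lebesgue"
        by (simp add: mult.assoc)
      have "AE x in lborel. f0 x * \<psi> x = indicator upper_half x *\<^sub>R (f x * \<psi> x)"
        using ae by eventually_elim (use 0 in \<open>auto split: split_indicator\<close>)
      then show "AE x in lebesgue. f0 x * \<psi> x = indicator upper_half x *\<^sub>R (f x * \<psi> x)" by (rule AE_completion)
    qed
    finally show ?thesis by (simp add: set_lebesgue_integral_def)
  qed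
  have "weak_gradient u0 g0"
  proof (unfold_locales)
    fix \<phi> :: "'a \<times> real \<Rightarrow> real" and i assume \<phi>: "test_function_on \<phi> upper_half" and i: "i \<in> (Basis :: ('a \<times> real) set)"
    have sub: "closure {x. \<phi> x \<noteq> 0} \<subseteq> upper_half" and C: "C_diff k \<phi>" for k
      using \<phi> by (simp_all only: test_function_on_def)
    have c0: "continuous_on UNIV \<phi>" using C[of 0] by simp
    have c1: "continuous_on UNIV (partial_deriv i \<phi>)" using C[of "Suc 0"] i by (rule C_diff_1_continuous)
    have z0: "\<phi> z = 0" if "z \<notin> upper_half" for z
      using that sub closure_subset[of "{x. \<phi> x \<noteq> 0}"] by blast
    have z1: "partial_deriv i \<phi> z = 0" if "z \<notin> upper_half" for z
      using that sub by (intro partial_deriv_outside_support) blast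
    have gi: "(\<lambda>z. indicator upper_half z *\<^sub>R (g z \<bullet> i)) \<in> borel_measurable lebesgue"
    proof -
      have "(\<lambda>z. (indicator upper_half z *\<^sub>R g z) \<bullet> i) \<in> borel_measurable lebesgue"
        by (intro borel_measurable_inner locally_integrable_measurable[OF g] borel_measurable_const)
      then show ?thesis by simp
    qed
    have "(LINT z|lborel. u0 z * partial_deriv i \<phi> z) = (LINT x:upper_half|lebesgue. u x * partial_deriv i \<phi> x)"
      by (rule transfer[symmetric])
         (use borel_measurable_continuous_onI[OF c1] locally_integrable_measurable[OF u] u0' z1 in \<open>simp_all\<close>)
    also have "\<dots> = - (LINT x:upper_half|lebesgue. (g x \<bullet> i) * \<phi> x)" by (rule weak[OF \<phi> i])
    also have "(LINT x:upper_half|lebesgue. (g x \<bullet> i) * \<phi> x) = (LINT z|lborel. (g0 z \<bullet> i) * \<phi> z)"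
    proof (rule transfer)
      show "AE z in lborel. z \<in> upper_half \<longrightarrow> g0 z \<bullet> i = g z \<bullet> i" using g0' by eventually_elim simp
    qed (use borel_measurable_continuous_onI[OF c0] gi z0 in \<open>simp_all\<close>)
    finally show "(LINT z|lborel. u0 z * partial_deriv i \<phi> z) = - (LINT z|lborel. (g0 z \<bullet> i) * \<phi> z)" .
  qed (use u0 g0 u0_int g0_int in \<open>simp_all\<close>)
  then show ?thesis using u0' g0' that by blast
qed

lemma partial_deriv_translate:
  assumes "C_diff (Suc 0) \<phi>"
  shows "partial_deriv i (\<lambda>\<zeta>. \<phi> (\<zeta> - z)) \<zeta> = partial_deriv i \<phi> (\<zeta> - z)"
proof -
  have "((\<lambda>\<zeta>. \<phi> (\<zeta> - z)) has_derivative (\<lambda>h. frechet_derivative \<phi> (at (\<zeta> - z)) h)) (at \<zeta>)"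
  proof (rule has_derivative_compose[OF _ C_diff_SucD(1)[OF assms]])
    show "((\<lambda>\<zeta>. \<zeta> - z) has_derivative (\<lambda>h. h)) (at \<zeta>)"
      using has_derivative_diff[OF has_derivative_ident has_derivative_const[of z]] by simp
  qed
  then have "partial_deriv i (\<lambda>\<zeta>. \<phi> (\<zeta> - z)) \<zeta> = frechet_derivative \<phi> (at (\<zeta> - z)) i"
    by (rule partial_deriv_eq)
  then show ?thesis by (simp only: partial_deriv_def)
qed

lemma has_derivative_partial_derivs:
  assumes "C_diff (Suc 0) \<phi>"
  shows "(\<phi> has_derivative (\<lambda>h. \<Sum>i\<in>Basis. (h \<bullet> i) * partial_deriv i \<phi> w)) (at w)"
proof -
  note D = C_diff_SucD(1)[OF assms, of w]
  have "frechet_derivative \<phi> (at w) = (\<lambda>h. \<Sum>i\<in>Basis. (h \<bullet> i) * partial_deriv i \<phi> w)"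
  proof
    fix h
    have "frechet_derivative \<phi> (at w) h = frechet_derivative \<phi> (at w) (\<Sum>i\<in>Basis. (h \<bullet> i) *\<^sub>R i)"
      by (simp only: euclidean_representation)
    also have "\<dots> = (\<Sum>i\<in>Basis. (h \<bullet> i) *\<^sub>R frechet_derivative \<phi> (at w) i)"
      using has_derivative_linear[OF D] by (simp only: linear_sum linear_cmul)
    finally show "frechet_derivative \<phi> (at w) h = (\<Sum>i\<in>Basis. (h \<bullet> i) * partial_deriv i \<phi> w)"
      by (simp only: partial_deriv_def real_scaleR_def)
  qed
  with D show ?thesis by (simp only:)
qed

text \<open>Moving the kernel along a curve changes the mollification of \<open>u\<close> at the rate given by the mollified
  gradient: the fundamental theorem of calculus is applied to the kernel, which is smooth, and the
  definition of the weak derivative then moves the derivative from the kernel to \<open>u\<close>.\<close>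

definition (in weak_gradient) mollified :: "real \<Rightarrow> 'a \<times> real \<Rightarrow> real" where
  "mollified \<epsilon> z = (LINT \<zeta>|lborel. u \<zeta> * mollifier \<epsilon> (\<zeta> - z))"

lemma bounded_compact_support:
  fixes \<psi> :: "'a::euclidean_space \<Rightarrow> real"
  assumes "continuous_on UNIV \<psi>" "compact S" "\<And>w. w \<notin> S \<Longrightarrow> \<psi> w = 0"
  obtains C where "0 \<le> C" "\<And>w. \<bar>\<psi> w\<bar> \<le> C"
proof -
  have "compact (\<psi> ` S)"
    using assms by (intro compact_continuous_image) (auto intro: continuous_on_subset)
  then obtain C where "\<And>y. y \<in> \<psi> ` S \<Longrightarrow> norm y \<le> C"
    using compact_imp_bounded bounded_iff by metis
  then have C: "\<bar>\<psi> w\<bar> \<le> C" if "w \<in> S" for w using that by fastforce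
  have "\<bar>\<psi> w\<bar> \<le> max C 0" for w
    using assms(3)[of w] C[of w] by (cases "w \<in> S") (simp_all add: le_max_iff_disj)
  then show ?thesis using that[of "max C 0"] by simp
qed

lemma mollifier_eq_0_outside:
  assumes "0 < \<epsilon>" "w \<notin> cball (0, 2 * \<epsilon>) \<epsilon>"
  shows "mollifier \<epsilon> w = 0"
proof (rule ccontr)
  assume "mollifier \<epsilon> w \<noteq> 0"
  then have "dist w (0, 2 * \<epsilon>) < \<epsilon>" unfolding dist_norm by (rule mollifier_support(1)[OF assms(1)])
  then have "w \<in> cball (0, 2 * \<epsilon>) \<epsilon>" by (subst mem_cball, subst dist_commute) (rule less_imp_le)
  then show False using assms(2) by contradiction
qed

lemma partial_deriv_mollifier_eq_0_outside:
  assumes "0 < \<epsilon>" "w \<notin> cball (0, 2 * \<epsilon>) \<epsilon>"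
  shows "partial_deriv i (mollifier \<epsilon>) w = 0"
proof (rule partial_deriv_outside_support)
  have "closure {w. mollifier \<epsilon> w \<noteq> 0} \<subseteq> cball (0, 2 * \<epsilon>) \<epsilon>"
    using mollifier_eq_0_outside[OF assms(1)] by (intro closure_minimal) blast+
  then show "w \<notin> closure {w. mollifier \<epsilon> w \<noteq> 0}" using assms(2) by blast
qed

lemma C_diff_mollifier': "C_diff k (mollifier \<epsilon> :: 'a::euclidean_space \<times> real \<Rightarrow> real)"
  using C_diff_mollifier[of k \<epsilon> 0] by (simp only: diff_zero)

text \<open>A compact subset of the upper half-space that contains the supports of all translates of the kernel
  along a curve.\<close>

lemma swept_support:
  fixes \<Gamma> :: "real \<Rightarrow> 'a::euclidean_space \<times> real"
  assumes "0 < \<epsilon>" "continuous_on {a..b} \<Gamma>" "\<And>\<theta>. \<theta> \<in> {a..b} \<Longrightarrow> 0 \<le> snd (\<Gamma> \<theta>)"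
  obtains K where "compact K" "K \<subseteq> upper_half"
    "\<And>\<theta> \<zeta>. \<theta> \<in> {a..b} \<Longrightarrow> \<zeta> - \<Gamma> \<theta> \<in> cball (0, 2 * \<epsilon>) \<epsilon> \<Longrightarrow> \<zeta> \<in> K"
proof
  let ?K = "(\<lambda>(x, y). x + y) ` (\<Gamma> ` {a..b} \<times> cball (0, 2 * \<epsilon>) \<epsilon>)"
  show "compact ?K"
    by (intro compact_continuous_image compact_Times assms(2) compact_cball compact_Icc)
       (auto intro!: continuous_intros simp: split_beta)
  show "?K \<subseteq> upper_half"
  proof
    fix \<zeta> assume "\<zeta> \<in> ?K"
    then obtain \<theta> w where *: "\<theta> \<in> {a..b}" "w \<in> cball (0, 2 * \<epsilon>) \<epsilon>" "\<zeta> = \<Gamma> \<theta> + w"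
      by (elim imageE SigmaE) (simp only: prod.case)
    have "dist (0, 2 * \<epsilon>) w \<le> \<epsilon>" using *(2) by (simp only: mem_cball)
    then have "dist (snd (0::'a, 2 * \<epsilon>)) (snd w) \<le> \<epsilon>" by (rule order_trans[OF dist_snd_le])
    then have "0 < snd w" using assms(1) by (simp add: dist_real_def)
    then have "0 < snd \<zeta>" using assms(3)[OF *(1)] *(3) by simp
    then show "\<zeta> \<in> upper_half" by (simp only: upper_half_def mem_Collect_eq)
  qed
  fix \<theta> \<zeta> assume "\<theta> \<in> {a..b}" "\<zeta> - \<Gamma> \<theta> \<in> cball (0, 2 * \<epsilon>) \<epsilon>"
  then have "(\<Gamma> \<theta>, \<zeta> - \<Gamma> \<theta>) \<in> \<Gamma> ` {a..b} \<times> cball (0, 2 * \<epsilon>) \<epsilon>" by blast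
  then have "(\<lambda>(x, y). x + y) (\<Gamma> \<theta>, \<zeta> - \<Gamma> \<theta>) \<in> ?K" by (rule imageI)
  then show "\<zeta> \<in> ?K" by simp
qed

lemma (in weak_gradient) integrable_times_kernel:
  assumes "compact K" "K \<subseteq> upper_half" "\<psi> \<in> borel_measurable borel" "\<And>w. \<bar>\<psi> w\<bar> \<le> C" "\<And>w. w \<notin> K \<Longrightarrow> \<psi> w = 0"
  shows "integrable lborel (\<lambda>\<zeta>. u \<zeta> * \<psi> \<zeta>)" "integrable lborel (\<lambda>\<zeta>. (g \<zeta> \<bullet> e) * \<psi> \<zeta>)"
proof -
  note [measurable] = assms(3)
  have gen: "integrable lborel (\<lambda>\<zeta>. f \<zeta> * \<psi> \<zeta>)"
    if [measurable]: "f \<in> borel_measurable borel" and f: "integrable lborel (\<lambda>z. indicator K z *\<^sub>R f z)" for f :: "'a \<times> real \<Rightarrow> real"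
  proof (rule Bochner_Integration.integrable_bound[OF integrable_mult_right[OF f, of C]])
    show "AE \<zeta> in lborel. norm (f \<zeta> * \<psi> \<zeta>) \<le> norm (C * (indicator K \<zeta> *\<^sub>R f \<zeta>))"
    proof (rule AE_I2)
      fix \<zeta>
      have "\<bar>f \<zeta>\<bar> * \<bar>\<psi> \<zeta>\<bar> \<le> \<bar>f \<zeta>\<bar> * \<bar>C\<bar>" using assms(4)[of \<zeta>] by (intro mult_left_mono) auto
      then show "norm (f \<zeta> * \<psi> \<zeta>) \<le> norm (C * (indicator K \<zeta> *\<^sub>R f \<zeta>))"
        using assms(5)[of \<zeta>] by (cases "\<zeta> \<in> K") (simp_all add: abs_mult mult.commute)
    qed
  qed simp
  show "integrable lborel (\<lambda>\<zeta>. u \<zeta> * \<psi> \<zeta>)"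
    by (rule gen[OF u_borel u_integrable[OF assms(1,2)]])
  have "integrable lborel (\<lambda>z. (indicator K z *\<^sub>R g z) \<bullet> e)"
    by (intro integrable_inner_left g_integrable assms)
  then show "integrable lborel (\<lambda>\<zeta>. (g \<zeta> \<bullet> e) * \<psi> \<zeta>)"
    by (intro gen) simp_all
qed

lemma (in weak_gradient) mollified_curve:
  assumes "0 < \<epsilon>" "a \<le> b"
    and \<Gamma>: "\<And>\<theta>. \<theta> \<in> {a..b} \<Longrightarrow> (\<Gamma> has_vector_derivative \<Gamma>' \<theta>) (at \<theta> within {a..b})"
    and cont: "continuous_on {a..b} \<Gamma>'"
    and height: "\<And>\<theta>. \<theta> \<in> {a..b} \<Longrightarrow> 0 \<le> snd (\<Gamma> \<theta>)"
  shows "mollified \<epsilon> (\<Gamma> b) - mollified \<epsilon> (\<Gamma> a)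
    = (LINT \<theta>|lborel. indicator {a..b} \<theta> * (LINT \<zeta>|lborel. (g \<zeta> \<bullet> \<Gamma>' \<theta>) * mollifier \<epsilon> (\<zeta> - \<Gamma> \<theta>)))"
proof -
  let ?\<phi> = "mollifier \<epsilon> :: 'a \<times> real \<Rightarrow> real"
  let ?S = "cball (0, 2 * \<epsilon>) \<epsilon> :: ('a \<times> real) set"
  let ?\<psi> = "\<lambda>i. partial_deriv i ?\<phi>"
  have C: "C_diff (Suc 0) ?\<phi>" by (rule C_diff_mollifier')
  have cont\<Gamma>: "continuous_on {a..b} \<Gamma>"
    using \<Gamma> by (meson continuous_on_eq_continuous_within has_vector_derivative_continuous)
  obtain K where K: "compact K" "K \<subseteq> upper_half"
    "\<And>\<theta> \<zeta>. \<theta> \<in> {a..b} \<Longrightarrow> \<zeta> - \<Gamma> \<theta> \<in> ?S \<Longrightarrow> \<zeta> \<in> K"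
    using swept_support[OF assms(1) cont\<Gamma> height] by blast
  have c\<phi>: "continuous_on UNIV ?\<phi>" by (rule continuous_mollifier)
  have c\<psi>: "continuous_on UNIV (?\<psi> i)" if "i \<in> Basis" for i by (rule C_diff_1_continuous[OF C that])
  have [measurable]: "?\<psi> i \<in> borel_measurable borel" if "i \<in> Basis" for i
    by (rule borel_measurable_continuous_onI[OF c\<psi>[OF that]])
  obtain C0 where C0: "\<And>w. \<bar>?\<phi> w\<bar> \<le> C0"
    using bounded_compact_support[OF c\<phi> compact_cball] mollifier_eq_0_outside[OF assms(1)] by metis
  have "\<exists>C\<ge>0. \<forall>w. \<bar>?\<psi> i w\<bar> \<le> C" if "i \<in> Basis" for i
    using bounded_compact_support[OF c\<psi>[OF that] compact_cball] partial_deriv_mollifier_eq_0_outside[OF assms(1)] by metis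
  then obtain C1 where C1: "\<And>i. i \<in> Basis \<Longrightarrow> 0 \<le> C1 i" "\<And>i w. i \<in> Basis \<Longrightarrow> \<bar>?\<psi> i w\<bar> \<le> C1 i" by metis
  have "compact (\<Gamma>' ` {a..b})" by (intro compact_continuous_image cont compact_Icc)
  then obtain G where G: "\<And>\<theta>. \<theta> \<in> {a..b} \<Longrightarrow> norm (\<Gamma>' \<theta>) \<le> G"
    using compact_imp_bounded bounded_iff by (metis imageI)
  \<comment> \<open>Measurable extensions of the curve and of its velocity by zero.\<close>
  define \<gamma> where "\<gamma> \<theta> = indicator {a..b} \<theta> *\<^sub>R \<Gamma> \<theta>" for \<theta>
  define \<gamma>' where "\<gamma>' \<theta> = indicator {a..b} \<theta> *\<^sub>R \<Gamma>' \<theta>" for \<theta>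
  have [measurable]: "\<gamma> \<in> borel_measurable borel" "\<gamma>' \<in> borel_measurable borel"
    unfolding \<gamma>_def[abs_def] \<gamma>'_def[abs_def]
    using borel_measurable_continuous_on_indicator[OF _ cont\<Gamma>] borel_measurable_continuous_on_indicator[OF _ cont] by simp_all
  define P where "P \<theta> \<zeta> = (\<Sum>i\<in>Basis. (\<gamma>' \<theta> \<bullet> i) * ?\<psi> i (\<zeta> - \<gamma> \<theta>))" for \<theta> \<zeta>
  have ftc: "(LINT \<theta>|lborel. indicator {a..b} \<theta> * P \<theta> \<zeta>) = ?\<phi> (\<zeta> - \<Gamma> a) - ?\<phi> (\<zeta> - \<Gamma> b)" for \<zeta>
  proof -
    let ?D = "\<lambda>\<theta>. \<Sum>i\<in>Basis. (\<Gamma>' \<theta> \<bullet> i) * ?\<psi> i (\<zeta> - \<Gamma> \<theta>)"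
    have "(LINT \<theta>|lborel. indicator {a..b} \<theta> *\<^sub>R ?D \<theta>) = (- ?\<phi> (\<zeta> - \<Gamma> b)) - (- ?\<phi> (\<zeta> - \<Gamma> a))"
    proof (rule integral_FTC_atLeastAtMost[OF assms(2)])
      fix \<theta> assume \<theta>: "a \<le> \<theta>" "\<theta> \<le> b"
      have "((\<lambda>\<theta>. \<zeta> - \<Gamma> \<theta>) has_derivative (\<lambda>h. - (h *\<^sub>R \<Gamma>' \<theta>))) (at \<theta> within {a..b})"
        using has_derivative_diff[OF has_derivative_const[of \<zeta>] \<Gamma>[of \<theta>, unfolded has_vector_derivative_def]] \<theta> by simp
      then have "((\<lambda>\<theta>. ?\<phi> (\<zeta> - \<Gamma> \<theta>)) has_derivative (\<lambda>h. \<Sum>i\<in>Basis. (- (h *\<^sub>R \<Gamma>' \<theta>) \<bullet> i) * ?\<psi> i (\<zeta> - \<Gamma> \<theta>))) (at \<theta> within {a..b})"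
        by (rule has_derivative_compose) (rule has_derivative_partial_derivs[OF C])
      then have "((\<lambda>\<theta>. - ?\<phi> (\<zeta> - \<Gamma> \<theta>)) has_derivative (\<lambda>h. - (\<Sum>i\<in>Basis. (- (h *\<^sub>R \<Gamma>' \<theta>) \<bullet> i) * ?\<psi> i (\<zeta> - \<Gamma> \<theta>)))) (at \<theta> within {a..b})"
        by (rule has_derivative_minus)
      then show "((\<lambda>\<theta>. - ?\<phi> (\<zeta> - \<Gamma> \<theta>)) has_vector_derivative ?D \<theta>) (at \<theta> within {a..b})"
        by (simp add: has_vector_derivative_def sum_negf sum_distrib_left mult.assoc)
    next
      show "continuous_on {a..b} ?D"
        by (intro continuous_intros cont cont\<Gamma> continuous_on_compose2[OF c\<psi>]) auto
    qed
    moreover have "indicator {a..b} \<theta> * P \<theta> \<zeta> = indicator {a..b} \<theta> *\<^sub>R ?D \<theta>" for \<theta>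
      by (cases "\<theta> \<in> {a..b}") (simp_all add: P_def \<gamma>_def \<gamma>'_def)
    ultimately show ?thesis by (simp only: diff_minus_eq_add add.commute[of "- _"] add_uminus_conv_diff)
  qed
  have suppK: "?\<phi> (\<zeta> - \<Gamma> \<theta>) = 0" "?\<psi> i (\<zeta> - \<Gamma> \<theta>) = 0" if "\<theta> \<in> {a..b}" "\<zeta> \<notin> K" for \<theta> \<zeta> i
    using K(3)[OF that(1)] that(2) mollifier_eq_0_outside[OF assms(1)] partial_deriv_mollifier_eq_0_outside[OF assms(1)] by blast+
  have int\<phi>: "integrable lborel (\<lambda>\<zeta>. u \<zeta> * ?\<phi> (\<zeta> - \<Gamma> \<theta>))" "integrable lborel (\<lambda>\<zeta>. (g \<zeta> \<bullet> e) * ?\<phi> (\<zeta> - \<Gamma> \<theta>))" if "\<theta> \<in> {a..b}" for \<theta> e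
    by (intro integrable_times_kernel[OF K(1,2), where C = C0]; simp add: suppK[OF that] C0)+
  have int\<psi>: "integrable lborel (\<lambda>\<zeta>. u \<zeta> * ?\<psi> i (\<zeta> - \<Gamma> \<theta>))" if "\<theta> \<in> {a..b}" "i \<in> Basis" for \<theta> i
    using suppK[OF that(1)] C1(2)[OF that(2)] that(2) by (intro integrable_times_kernel[OF K(1,2), where C = "C1 i"]) simp_all
  have "mollified \<epsilon> (\<Gamma> b) - mollified \<epsilon> (\<Gamma> a) = (LINT \<zeta>|lborel. u \<zeta> * ?\<phi> (\<zeta> - \<Gamma> b) - u \<zeta> * ?\<phi> (\<zeta> - \<Gamma> a))"
    unfolding mollified_def using assms(2) by (intro Bochner_Integration.integral_diff[symmetric] int\<phi>) auto
  also have "\<dots> = (LINT \<zeta>|lborel. LINT \<theta>|lborel. - (u \<zeta> * (indicator {a..b} \<theta> * P \<theta> \<zeta>)))"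
    by (intro Bochner_Integration.integral_cong refl) (simp add: ftc right_diff_distrib)
  also have "\<dots> = (LINT \<theta>|lborel. LINT \<zeta>|lborel. - (u \<zeta> * (indicator {a..b} \<theta> * P \<theta> \<zeta>)))"
  proof (rule lborel_pair.Fubini_integral)
    let ?C = "\<Sum>i\<in>(Basis :: ('a \<times> real) set). G * C1 i"
    have P0: "P \<theta> \<zeta> = 0" if "\<zeta> \<notin> K" for \<theta> \<zeta>
      using suppK(2)[of \<theta> \<zeta>] that by (cases "\<theta> \<in> {a..b}") (simp_all add: P_def \<gamma>_def \<gamma>'_def)
    have PC: "\<bar>P \<theta> \<zeta>\<bar> \<le> ?C" if "\<theta> \<in> {a..b}" for \<theta> \<zeta>
      unfolding P_def
    proof (intro order_trans[OF sum_abs] sum_mono)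
      fix i :: "'a \<times> real" assume i: "i \<in> Basis"
      have "\<bar>\<gamma>' \<theta> \<bullet> i\<bar> \<le> G" using that Basis_le_norm[OF i, of "\<Gamma>' \<theta>"] G[OF that] by (simp add: \<gamma>'_def)
      then show "\<bar>(\<gamma>' \<theta> \<bullet> i) * ?\<psi> i (\<zeta> - \<gamma> \<theta>)\<bar> \<le> G * C1 i"
        unfolding abs_mult using C1[OF i] by (intro mult_mono) auto
    qed
    have [measurable]: "K \<in> sets borel" using K(1) by (simp add: compact_imp_closed)
    have uK: "integrable lborel (\<lambda>\<zeta>. indicator K \<zeta> *\<^sub>R u \<zeta>)" by (rule u_integrable[OF K(1,2)])
    have i1: "integrable lborel (\<lambda>\<theta>. indicator {a..b} \<theta> * ?C)"
      using assms(2) by (intro integrable_mult_left integrable_real_indicator) simp_all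
    have "integrable (lborel \<Otimes>\<^sub>M lborel) (\<lambda>(\<theta>, \<zeta>). (indicator {a..b} \<theta> * ?C) * (indicator K \<zeta> *\<^sub>R u \<zeta>))"
    proof (rule lborel_pair.Fubini_integrable)
      show "integrable lborel (\<lambda>\<theta>. LINT \<zeta>|lborel. norm (case (\<theta>, \<zeta>) of (\<theta>, \<zeta>) \<Rightarrow> (indicator {a..b} \<theta> * ?C) * (indicator K \<zeta> *\<^sub>R u \<zeta>)))"
        using integrable_mult_left[OF integrable_abs[OF i1], of "LINT \<zeta>|lborel. \<bar>indicator K \<zeta> *\<^sub>R u \<zeta>\<bar>"]
        by (simp add: abs_mult)
      show "AE \<theta> in lborel. integrable lborel (\<lambda>\<zeta>. case (\<theta>, \<zeta>) of (\<theta>, \<zeta>) \<Rightarrow> (indicator {a..b} \<theta> * ?C) * (indicator K \<zeta> *\<^sub>R u \<zeta>))"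
        using uK by (intro AE_I2) simp
    qed measurable
    then show "integrable (lborel \<Otimes>\<^sub>M lborel) (\<lambda>(\<theta>, \<zeta>). - (u \<zeta> * (indicator {a..b} \<theta> * P \<theta> \<zeta>)))"
    proof (rule Bochner_Integration.integrable_bound)
      show "(\<lambda>(\<theta>, \<zeta>). - (u \<zeta> * (indicator {a..b} \<theta> * P \<theta> \<zeta>))) \<in> borel_measurable (lborel \<Otimes>\<^sub>M lborel)"
        unfolding P_def by measurable
      show "AE x in lborel \<Otimes>\<^sub>M lborel. norm (case x of (\<theta>, \<zeta>) \<Rightarrow> - (u \<zeta> * (indicator {a..b} \<theta> * P \<theta> \<zeta>)))
        \<le> norm (case x of (\<theta>, \<zeta>) \<Rightarrow> (indicator {a..b} \<theta> * ?C) * (indicator K \<zeta> *\<^sub>R u \<zeta>))"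
      proof (rule AE_I2)
        fix x :: "real \<times> ('a \<times> real)"
        obtain \<theta> \<zeta> where x: "x = (\<theta>, \<zeta>)" by (cases x)
        show "norm (case x of (\<theta>, \<zeta>) \<Rightarrow> - (u \<zeta> * (indicator {a..b} \<theta> * P \<theta> \<zeta>)))
          \<le> norm (case x of (\<theta>, \<zeta>) \<Rightarrow> (indicator {a..b} \<theta> * ?C) * (indicator K \<zeta> *\<^sub>R u \<zeta>))"
        proof (cases "\<theta> \<in> {a..b} \<and> \<zeta> \<in> K")
          case True
          then have "\<bar>u \<zeta>\<bar> * \<bar>P \<theta> \<zeta>\<bar> \<le> \<bar>u \<zeta>\<bar> * \<bar>?C\<bar>" using PC[of \<theta> \<zeta>] by (intro mult_left_mono) auto
          then show ?thesis using True by (simp add: x abs_mult mult.commute del: split_paired_All)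
        qed (auto simp: x P0)
      qed
    qed
  qed
  also have "\<dots> = (LINT \<theta>|lborel. indicator {a..b} \<theta> * (LINT \<zeta>|lborel. (g \<zeta> \<bullet> \<Gamma>' \<theta>) * ?\<phi> (\<zeta> - \<Gamma> \<theta>)))"
  proof (intro Bochner_Integration.integral_cong refl)
    fix \<theta>
    show "(LINT \<zeta>|lborel. - (u \<zeta> * (indicator {a..b} \<theta> * P \<theta> \<zeta>)))
      = indicator {a..b} \<theta> * (LINT \<zeta>|lborel. (g \<zeta> \<bullet> \<Gamma>' \<theta>) * ?\<phi> (\<zeta> - \<Gamma> \<theta>))"
    proof (cases "\<theta> \<in> {a..b}")
      case \<theta>: True
      have test: "test_function_on (\<lambda>\<zeta>. ?\<phi> (\<zeta> - \<Gamma> \<theta>)) upper_half"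
        by (rule mollifier_test_function[OF assms(1) height[OF \<theta>]])
      have "(LINT \<zeta>|lborel. - (u \<zeta> * (indicator {a..b} \<theta> * P \<theta> \<zeta>)))
        = (LINT \<zeta>|lborel. (\<Sum>i\<in>Basis. - (\<Gamma>' \<theta> \<bullet> i) * (u \<zeta> * ?\<psi> i (\<zeta> - \<Gamma> \<theta>))))"
        using \<theta> by (intro Bochner_Integration.integral_cong refl)
          (simp add: P_def \<gamma>_def \<gamma>'_def sum_negf sum_distrib_left mult_ac)
      also have "\<dots> = (\<Sum>i\<in>Basis. - (\<Gamma>' \<theta> \<bullet> i) * (LINT \<zeta>|lborel. u \<zeta> * ?\<psi> i (\<zeta> - \<Gamma> \<theta>)))"
        by (subst Bochner_Integration.integral_sum) (auto intro!: sum.cong integrable_mult_right int\<psi> \<theta> simp del: mult_minus_left)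
      also have "\<dots> = (\<Sum>i\<in>Basis. (\<Gamma>' \<theta> \<bullet> i) * (LINT \<zeta>|lborel. (g \<zeta> \<bullet> i) * ?\<phi> (\<zeta> - \<Gamma> \<theta>)))"
      proof (intro sum.cong refl)
        fix i :: "'a \<times> real" assume i: "i \<in> Basis"
        show "- (\<Gamma>' \<theta> \<bullet> i) * (LINT \<zeta>|lborel. u \<zeta> * ?\<psi> i (\<zeta> - \<Gamma> \<theta>)) = (\<Gamma>' \<theta> \<bullet> i) * (LINT \<zeta>|lborel. (g \<zeta> \<bullet> i) * ?\<phi> (\<zeta> - \<Gamma> \<theta>))"
          using weak[OF test i] by (simp add: partial_deriv_translate[OF C])
      qed
      also have "\<dots> = (LINT \<zeta>|lborel. (\<Sum>i\<in>Basis. (\<Gamma>' \<theta> \<bullet> i) * ((g \<zeta> \<bullet> i) * ?\<phi> (\<zeta> - \<Gamma> \<theta>))))"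
        by (subst Bochner_Integration.integral_sum) (auto intro!: sum.cong integrable_mult_right int\<phi> \<theta>)
      also have "\<dots> = (LINT \<zeta>|lborel. (g \<zeta> \<bullet> \<Gamma>' \<theta>) * ?\<phi> (\<zeta> - \<Gamma> \<theta>))"
      proof (intro Bochner_Integration.integral_cong refl)
        fix \<zeta>
        have "g \<zeta> \<bullet> \<Gamma>' \<theta> = (\<Sum>i\<in>Basis. (g \<zeta> \<bullet> i) * (\<Gamma>' \<theta> \<bullet> i))" by (rule euclidean_inner)
        then show "(\<Sum>i\<in>Basis. (\<Gamma>' \<theta> \<bullet> i) * ((g \<zeta> \<bullet> i) * ?\<phi> (\<zeta> - \<Gamma> \<theta>))) = (g \<zeta> \<bullet> \<Gamma>' \<theta>) * ?\<phi> (\<zeta> - \<Gamma> \<theta>)"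
          by (simp only: sum_distrib_left sum_distrib_right mult_ac)
      qed
      finally show ?thesis using \<theta> by simp
    qed simp
  qed
  finally show ?thesis .
qed

section \<open>Semicircles orthogonal to the boundary\<close>

lemma powr_tangent:
  fixes p c h :: real
  assumes "1 \<le> p" "0 < c" "0 \<le> h"
  shows "p * c powr (p - 1) * h \<le> h powr p + (p - 1) * c powr p"
proof (cases "h = 0")
  case True
  moreover have "0 \<le> (p - 1) * c powr p" using assms by (intro mult_nonneg_nonneg) auto
  ultimately show ?thesis using assms by simp
next
  case False
  then have h: "0 < h" using assms by simp
  have convex: "convex_on {0<..} (\<lambda>x. x powr p)"
    using assms(1) by (rule powr_convex)
  have "(h powr p - c powr p) \<ge> (p * c powr (p - 1)) * (h - c)"
    by (rule convex_on_imp_above_tangent[OF convex])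
       (use h assms in \<open>auto simp: interior_open connected_Ioi intro!: derivative_eq_intros\<close>)
  moreover have "c powr (p - 1) * c = c powr p" using assms by (simp add: powr_diff)
  hence "p * c powr (p - 1) * c = p * c powr p" by (simp add: mult.assoc)
  ultimately show ?thesis by (simp add: right_diff_distrib left_diff_distrib)
qed

lemma integral_norm_le_nn_integral:
  fixes f :: "'a \<Rightarrow> 'b::{banach, second_countable_topology}"
  shows "ennreal (norm (integral\<^sup>L M f)) \<le> (\<integral>\<^sup>+x. ennreal (norm (f x)) \<partial>M)"
  by (cases "integrable M f") (simp_all add: integral_norm_bound_ennreal not_integrable_integral_eq)

text \<open>Jensen's inequality for the power function and a weight of total mass at most \<open>L\<close>: integrate the tangent
  inequality at \<open>A / L\<close>.\<close>

lemma powr_le_nn_integral_powr: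
  assumes [measurable]: "W \<in> borel_measurable M" "h \<in> borel_measurable M"
    and W: "\<And>x. 0 \<le> W x" and h: "\<And>x. 0 \<le> h x" and "1 \<le> (p :: real)" "0 < L" "0 \<le> A"
    and mass: "(\<integral>\<^sup>+x. ennreal (W x) \<partial>M) \<le> ennreal L"
    and A: "ennreal A \<le> (\<integral>\<^sup>+x. ennreal (W x * h x) \<partial>M)"
  shows "ennreal (A powr p) \<le> ennreal (L powr (p - 1)) * (\<integral>\<^sup>+x. ennreal (W x * h x powr p) \<partial>M)" (is "_ \<le> _ * ?X")
proof (cases "A = 0")
  case False
  define c where "c = A / L"
  have c: "0 < c" using assms False by (simp add: c_def)
  have "ennreal (p * c powr (p - 1) * A) \<le> ennreal (p * c powr (p - 1)) * (\<integral>\<^sup>+x. ennreal (W x * h x) \<partial>M)"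
    using A assms(5) by (subst ennreal_mult') (auto intro!: mult_left_mono)
  also have "\<dots> = (\<integral>\<^sup>+x. ennreal (p * c powr (p - 1)) * ennreal (W x * h x) \<partial>M)"
    by (rule nn_integral_cmult[symmetric]) measurable
  also have "\<dots> \<le> (\<integral>\<^sup>+x. ennreal (W x * h x powr p) + ennreal ((p - 1) * c powr p) * ennreal (W x) \<partial>M)"
  proof (rule nn_integral_mono)
    fix x
    have "W x * (p * c powr (p - 1) * h x) \<le> W x * (h x powr p + (p - 1) * c powr p)"
      by (rule mult_left_mono[OF powr_tangent[OF \<open>1 \<le> p\<close> c h] W])
    then have "(p * c powr (p - 1)) * (W x * h x) \<le> W x * h x powr p + ((p - 1) * c powr p) * W x"
      by (simp add: algebra_simps)
    then show "ennreal (p * c powr (p - 1)) * ennreal (W x * h x) \<le> ennreal (W x * h x powr p) + ennreal ((p - 1) * c powr p) * ennreal (W x)"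
      using W h assms(5) by (simp add: ennreal_mult'[symmetric] ennreal_plus[symmetric] del: ennreal_plus)
  qed
  also have "\<dots> = ?X + ennreal ((p - 1) * c powr p) * (\<integral>\<^sup>+x. ennreal (W x) \<partial>M)"
    by (subst nn_integral_add) (auto simp: nn_integral_cmult)
  also have "\<dots> \<le> ?X + ennreal ((p - 1) * c powr p) * ennreal L"
    by (intro add_left_mono mult_left_mono mass) simp
  also have "\<dots> = ?X + ennreal ((p - 1) * c powr p * L)"
    using assms by (simp add: ennreal_mult'[symmetric])
  finally have *: "ennreal (p * c powr (p - 1) * A) \<le> ?X + ennreal ((p - 1) * c powr p * L)" .
  have "c powr (p - 1) * A = c powr p * L"
    using c assms by (simp add: powr_diff c_def field_simps)
  then have "p * c powr (p - 1) * A = c powr p * L + (p - 1) * c powr p * L"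
    by (simp add: algebra_simps)
  then have "ennreal (c powr p * L) + ennreal ((p - 1) * c powr p * L) \<le> ?X + ennreal ((p - 1) * c powr p * L)"
    using * assms by (simp add: ennreal_plus[symmetric] del: ennreal_plus)
  then have "ennreal (c powr p * L) \<le> ?X" by simp
  then have "ennreal (L powr (p - 1)) * ennreal (c powr p * L) \<le> ennreal (L powr (p - 1)) * ?X"
    by (rule mult_left_mono) simp
  moreover have "L powr (p - 1) * (c powr p * L) = A powr p"
    using assms by (simp add: c_def powr_divide powr_diff)
  ultimately show ?thesis using assms by (simp add: ennreal_mult'[symmetric])
qed simp

text \<open>An upper solution for the length of a semicircle: an explicit function that dominates it, is elementary enough to be integrated, and loses little in the mean.\<close>

definition barrier :: "real \<Rightarrow> real \<Rightarrow> real" where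
  "barrier s z = 2 - 2 * s\<^sup>2 / 9 - z powr (s / 2) + (2 * s\<^sup>2 / 9) * z powr (s / 2 + 1)"

text \<open>The differential inequality behind \<open>semicircle_length\<close>. The difference of the two sides vanishes at \<open>1\<close> and is nonincreasing.\<close>

lemma barrier_supersolution:
  assumes "0 < s" "s < 1" "0 < z" "z \<le> 1"
  shows "z powr (s / 2) + (2 * s * (s + 2) / 9) * (1 - z) * z powr (s / 2) \<le> barrier s z"
proof -
  define a where "a = 2 * s * (s + 2) / 9"
  define b where "b = 2 * s\<^sup>2 / 9"
  define H where "H z = 2 - b - (2 + a) * z powr (s / 2) + (a + b) * z powr (s / 2 + 1)" for z
  have "H 1 \<le> H z"
  proof (rule DERIV_nonpos_imp_nonincreasing[OF assms(4)])
    fix y assume y: "z \<le> y" "y \<le> 1"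
    then have y0: "0 < y" using assms by simp
    have "(H has_real_derivative (- (2 + a) * (s / 2 * y powr (s / 2 - 1)) + (a + b) * ((s / 2 + 1) * y powr (s / 2)))) (at y)"
      unfolding H_def[abs_def] using y0
      by (auto intro!: derivative_eq_intros simp: add_divide_distrib) (simp add: algebra_simps)
    moreover have "- (2 + a) * (s / 2 * y powr (s / 2 - 1)) + (a + b) * ((s / 2 + 1) * y powr (s / 2)) \<le> 0"
    proof -
      have "y powr (s / 2) = y powr (s / 2 - 1) * y" using y0 by (simp add: powr_diff)
      then have eq: "- (2 + a) * (s / 2 * y powr (s / 2 - 1)) + (a + b) * ((s / 2 + 1) * y powr (s / 2))
          = y powr (s / 2 - 1) * ((a + b) * (s / 2 + 1) * y - (2 + a) * (s / 2))"
        by (simp add: field_simps)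
      have bs: "b * (s + 2) = a * s" by (simp add: a_def b_def power2_eq_square)
      have ab: "0 \<le> a" "0 \<le> b" using assms by (simp_all add: a_def b_def)
      have "(s + 2) * (s + 2) \<le> 3 * 3" using assms by (intro mult_mono) auto
      then have "s * ((s + 2) * (s + 2)) \<le> s * 9" using assms by (intro mult_left_mono) auto
      then have "a * (s + 2) \<le> 2 * s" unfolding a_def by (simp add: algebra_simps)
      then have le: "(a + b) * (s / 2 + 1) \<le> (2 + a) * (s / 2)" using bs by (simp add: field_simps)
      have "(a + b) * (s / 2 + 1) * y \<le> (a + b) * (s / 2 + 1)"
        using mult_left_mono[OF y(2), of "(a + b) * (s / 2 + 1)"] ab assms by simp
      then have "(a + b) * (s / 2 + 1) * y - (2 + a) * (s / 2) \<le> 0" using le by linarith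
      then show ?thesis unfolding eq by (intro mult_nonneg_nonpos) auto
    qed
    ultimately show "\<exists>y'. (H has_real_derivative y') (at y) \<and> y' \<le> 0" by blast
  qed
  moreover have "H 1 = 0" by (simp add: H_def)
  moreover have "z powr (s / 2 + 1) = z powr (s / 2) * z" using assms by (simp add: powr_add)
  ultimately have "0 \<le> 2 - b - (2 + a) * z powr (s / 2) + (a + b) * (z powr (s / 2) * z)"
    by (simp add: H_def)
  moreover have "barrier s z = 2 - b - z powr (s / 2) + b * (z powr (s / 2) * z)"
    using \<open>z powr (s / 2 + 1) = _\<close> by (simp add: barrier_def b_def)
  ultimately show ?thesis
    unfolding a_def[symmetric] by (simp add: algebra_simps)
qed

lemma barrier_pos:
  assumes "0 < s" "s < 1" "0 < z" "z \<le> 1"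
  shows "0 < barrier s z"
proof -
  have "0 < z powr (s / 2)" using assms by simp
  moreover have "0 \<le> (2 * s * (s + 2) / 9) * (1 - z) * z powr (s / 2)" using assms by simp
  ultimately show ?thesis using barrier_supersolution[OF assms] by linarith
qed

lemma barrier_deriv:
  assumes "0 < z"
  shows "(barrier s has_real_derivative
    - (s / 2 * z powr (s / 2 - 1)) + (2 * s\<^sup>2 / 9) * ((s / 2 + 1) * z powr (s / 2))) (at z)"
  unfolding barrier_def[abs_def] using assms
  by (auto intro!: derivative_eq_intros simp: add_divide_distrib)

text \<open>The function \<open>\<theta> powr s * barrier s (1 - S * \<theta>\<^sup>2)\<close> vanishes at \<open>0\<close>, equals the right-hand side at \<open>1\<close>, and its derivative dominates the integrand.\<close>

lemma semicircle_length:
  assumes s: "0 < s" "s < 1" and S: "0 \<le> S" "S < 1"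
  shows "(\<integral>\<^sup>+\<theta>. ennreal (indicator {0<..<1} \<theta> * (s * \<theta> powr (s - 1) * (1 - S * \<theta>\<^sup>2) powr (s / 2 - 1))) \<partial>lborel)
    \<le> ennreal (barrier s (1 - S))"
proof -
  define b where "b = 2 * s\<^sup>2 / 9"
  define Z where "Z \<theta> = 1 - S * \<theta>\<^sup>2" for \<theta> :: real
  define F where "F \<theta> = \<theta> powr s * barrier s (Z \<theta>)" for \<theta>
  define k where "k \<theta> = s * \<theta> powr (s - 1) * barrier s (Z \<theta>)
      + \<theta> powr s * ((- (s / 2 * Z \<theta> powr (s / 2 - 1)) + b * ((s / 2 + 1) * Z \<theta> powr (s / 2))) * (- 2 * S * \<theta>))" for \<theta>
  have Z: "0 < Z \<theta>" "Z \<theta> \<le> 1" if "0 \<le> \<theta>" "\<theta> \<le> 1" for \<theta>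
  proof -
    have "\<theta>\<^sup>2 \<le> 1" using that by (simp add: power_le_one)
    then have "S * \<theta>\<^sup>2 \<le> S * 1" using S by (intro mult_left_mono) auto
    then show "0 < Z \<theta>" using S by (simp add: Z_def)
    show "Z \<theta> \<le> 1" using S by (simp add: Z_def)
  qed
  have deriv: "(F has_real_derivative k \<theta>) (at \<theta>)" if "0 < \<theta>" "\<theta> < 1" for \<theta>
  proof -
    have "(Z has_real_derivative - 2 * S * \<theta>) (at \<theta>)"
      unfolding Z_def[abs_def] by (auto intro!: derivative_eq_intros)
    then have "((\<lambda>\<theta>. barrier s (Z \<theta>)) has_real_derivative
        (- (s / 2 * Z \<theta> powr (s / 2 - 1)) + b * ((s / 2 + 1) * Z \<theta> powr (s / 2))) * (- 2 * S * \<theta>)) (at \<theta>)"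
      unfolding b_def using Z[of \<theta>] that by (intro DERIV_chain2[OF barrier_deriv]) auto
    moreover have "((\<lambda>\<theta>. \<theta> powr s) has_real_derivative s * \<theta> powr (s - 1)) (at \<theta>)"
      using that by (auto intro!: derivative_eq_intros)
    ultimately have "(F has_real_derivative s * \<theta> powr (s - 1) * barrier s (Z \<theta>)
      + (- (s / 2 * Z \<theta> powr (s / 2 - 1)) + b * ((s / 2 + 1) * Z \<theta> powr (s / 2))) * (- 2 * S * \<theta>) * \<theta> powr s) (at \<theta>)"
      unfolding F_def[abs_def] by (rule DERIV_mult[rotated])
    then show ?thesis unfolding k_def by (simp only: mult.commute[of _ "\<theta> powr s"])
  qed
  have le: "s * \<theta> powr (s - 1) * Z \<theta> powr (s / 2 - 1) \<le> k \<theta>" if "0 < \<theta>" "\<theta> < 1" for \<theta>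
  proof -
    have z: "0 < Z \<theta>" "Z \<theta> \<le> 1" using Z[of \<theta>] that by auto
    define y where "y = Z \<theta> powr (s / 2 - 1)"
    have y: "Z \<theta> powr (s / 2) = y * Z \<theta>" using z by (simp add: y_def powr_diff)
    have t: "\<theta> powr s = \<theta> powr (s - 1) * \<theta>" using that by (simp add: powr_diff)
    have one: "S * \<theta> * \<theta> = 1 - Z \<theta>" by (simp add: Z_def power2_eq_square)
    have "k \<theta> = \<theta> powr (s - 1) * (s * barrier s (Z \<theta>) + (s * y - b * (s + 2) * (y * Z \<theta>)) * (S * \<theta> * \<theta>))"
      unfolding k_def y t y_def[symmetric] by (simp add: algebra_simps)
    then have "k \<theta> = \<theta> powr (s - 1) * (s * barrier s (Z \<theta>) + (s * y - b * (s + 2) * (y * Z \<theta>)) * (1 - Z \<theta>))"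
      by (simp only: one)
    moreover have "s * y \<le> s * barrier s (Z \<theta>) + (s * y - b * (s + 2) * (y * Z \<theta>)) * (1 - Z \<theta>)"
    proof -
      have "s * (y * Z \<theta> + (2 * s * (s + 2) / 9) * (1 - Z \<theta>) * (y * Z \<theta>)) \<le> s * barrier s (Z \<theta>)"
        using barrier_supersolution[OF s z] s unfolding y by (intro mult_left_mono) auto
      then show ?thesis by (simp add: b_def algebra_simps power2_eq_square)
    qed
    ultimately have "\<theta> powr (s - 1) * (s * y) \<le> k \<theta>"
      by (simp add: mult_left_mono)
    then show ?thesis by (simp add: y_def mult_ac)
  qed
  have contF: "continuous_on {0..1} F"
    unfolding F_def[abs_def]
  proof (rule continuous_on_mult)
    show "continuous_on {0..1} (\<lambda>\<theta>. \<theta> powr s)"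
      by (rule continuous_on_powr') (use s in \<open>auto intro: continuous_on_id continuous_on_const\<close>)
    have "continuous_on {0<..} (barrier s)"
      by (rule DERIV_continuous_on[OF DERIV_subset[OF barrier_deriv]]) auto
    moreover have "continuous_on {0..1} Z" unfolding Z_def[abs_def] by (intro continuous_intros)
    ultimately show "continuous_on {0..1} (\<lambda>\<theta>. barrier s (Z \<theta>))"
      by (rule continuous_on_compose2) (use Z in auto)
  qed
  have "(k has_integral (F 1 - F 0)) {0..1}"
    by (rule fundamental_theorem_of_calculus_interior)
       (use contF deriv in \<open>auto simp: has_real_derivative_iff_has_vector_derivative[symmetric]\<close>)
  then have "(k has_integral (F 1 - F 0)) {0<..<1}"
    using has_integral_open_interval[of k "F 1 - F 0" 0 1] by (simp add: box_real cbox_interval)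
  moreover have "0 \<le> k \<theta>" if "\<theta> \<in> {0<..<1}" for \<theta>
    using le[of \<theta>] that s by (auto intro: order_trans[rotated])
  ultimately have "(\<integral>\<^sup>+\<theta>. ennreal (indicator {0<..<1} \<theta> * k \<theta>) \<partial>lborel) = ennreal (F 1 - F 0)"
    by (intro nn_integral_has_integral_lebesgue)
  moreover have "(\<integral>\<^sup>+\<theta>. ennreal (indicator {0<..<1} \<theta> * (s * \<theta> powr (s - 1) * (1 - S * \<theta>\<^sup>2) powr (s / 2 - 1))) \<partial>lborel)
      \<le> (\<integral>\<^sup>+\<theta>. ennreal (indicator {0<..<1} \<theta> * k \<theta>) \<partial>lborel)"
    using le by (intro nn_integral_mono ennreal_leI) (auto simp: Z_def split: split_indicator)
  moreover have "F 1 - F 0 = barrier s (1 - S)" using s by (simp add: F_def Z_def)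
  ultimately show ?thesis by simp
qed

text \<open>The semicircle through the origin and \<open>(\<xi>, 1)\<close> that meets the boundary orthogonally, and the
  bound for its length in the metric of density \<open>z\<^sub>N powr (s - 1)\<close>.\<close>

definition arc_q :: "'a::euclidean_space \<Rightarrow> real \<Rightarrow> real" where
  "arc_q \<xi> \<theta> = 1 + (norm \<xi>)\<^sup>2 - (norm \<xi>)\<^sup>2 * \<theta>\<^sup>2"

definition arc :: "'a::euclidean_space \<Rightarrow> real \<Rightarrow> 'a \<times> real" where
  "arc \<xi> \<theta> = (\<theta>\<^sup>2 *\<^sub>R \<xi>, \<theta> * sqrt (arc_q \<xi> \<theta>))"

definition arc_velocity :: "'a::euclidean_space \<Rightarrow> real \<Rightarrow> 'a \<times> real" where
  "arc_velocity \<xi> \<theta> = ((2 * \<theta>) *\<^sub>R \<xi>, sqrt (arc_q \<xi> \<theta>) - (norm \<xi>)\<^sup>2 * \<theta>\<^sup>2 / sqrt (arc_q \<xi> \<theta>))"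

definition arc_bound :: "real \<Rightarrow> 'a::euclidean_space \<Rightarrow> real" where
  "arc_bound s \<xi> = (1 + (norm \<xi>)\<^sup>2) powr (s / 2) * barrier s (1 / (1 + (norm \<xi>)\<^sup>2)) / s"

lemma arc_q_ge_1: "0 \<le> \<theta> \<Longrightarrow> \<theta> \<le> 1 \<Longrightarrow> 1 \<le> arc_q \<xi> \<theta>"
  using mult_left_mono[of "\<theta>\<^sup>2" 1 "(norm \<xi>)\<^sup>2"] power_le_one[of \<theta> 2] by (simp add: arc_q_def)

lemma arc_q_measurable[measurable]: "(\<lambda>x. arc_q (f x) (h x)) \<in> borel_measurable M"
  if [measurable]: "f \<in> borel_measurable M" "h \<in> borel_measurable M"
  unfolding arc_q_def by measurable

lemma norm_arc_velocity:
  assumes "0 \<le> \<theta>" "\<theta> \<le> 1"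
  shows "norm (arc_velocity \<xi> \<theta>) = (1 + (norm \<xi>)\<^sup>2) / sqrt (arc_q \<xi> \<theta>)"
proof -
  let ?a = "(norm \<xi>)\<^sup>2" and ?q = "arc_q \<xi> \<theta>"
  have q: "1 \<le> ?q" by (rule arc_q_ge_1[OF assms])
  define c where "c = ?a * \<theta>\<^sup>2"
  define r where "r = sqrt ?q"
  have r: "0 < r" "r * r = ?q" using q by (simp_all add: r_def)
  have "(norm (arc_velocity \<xi> \<theta>))\<^sup>2 = (norm ((2 * \<theta>) *\<^sub>R \<xi>))\<^sup>2 + (r - c / r)\<^sup>2"
    unfolding arc_velocity_def norm_Pair c_def r_def by (simp only: real_norm_def power2_abs real_sqrt_pow2 sum_power2_ge_zero)
  also have "(norm ((2 * \<theta>) *\<^sub>R \<xi>))\<^sup>2 = 4 * c" by (simp add: power_mult_distrib c_def)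
  also have "4 * c + (r - c / r)\<^sup>2 = ((r * r + c) / r)\<^sup>2"
    using r(1) by (simp add: power2_eq_square field_simps)
  also have "r * r + c = 1 + ?a" by (simp add: r(2) c_def arc_q_def)
  finally have "(norm (arc_velocity \<xi> \<theta>))\<^sup>2 = ((1 + ?a) / r)\<^sup>2" .
  then have "norm (arc_velocity \<xi> \<theta>) = (1 + ?a) / r"
    by (rule power2_eq_imp_eq) (use r in simp_all)
  then show ?thesis by (simp only: r_def)
qed

lemma arc_has_velocity:
  assumes "0 \<le> \<theta>" "\<theta> \<le> 1"
  shows "(arc \<xi> has_vector_derivative arc_velocity \<xi> \<theta>) (at \<theta> within T)"
proof -
  let ?a = "(norm \<xi>)\<^sup>2" and ?q = "arc_q \<xi>"
  have q: "1 \<le> ?q \<theta>" by (rule arc_q_ge_1[OF assms])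
  have q_deriv: "((\<lambda>\<theta>. 1 + a - a * \<theta>\<^sup>2) has_real_derivative - (a * (2 * \<theta>))) (at \<theta> within T)" for a :: real
    by (rule DERIV_cong) (rule derivative_intros | simp)+
  have D: "(?q has_real_derivative - (?a * (2 * \<theta>))) (at \<theta> within T)"
    unfolding arc_q_def[abs_def] by (rule q_deriv)
  have r: "((\<lambda>\<theta>. sqrt (?q \<theta>)) has_real_derivative (inverse (sqrt (?q \<theta>)) / 2) * (- (?a * (2 * \<theta>)))) (at \<theta> within T)"
    by (rule DERIV_chain2[where f = sqrt and g = ?q and x = \<theta> and s = T, OF DERIV_real_sqrt D]) (use q in linarith)
  have prod: "((\<lambda>\<theta>. \<theta> * sqrt (?q \<theta>)) has_real_derivative
      1 * sqrt (?q \<theta>) + (inverse (sqrt (?q \<theta>)) / 2) * (- (?a * (2 * \<theta>))) * \<theta>) (at \<theta> within T)"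
    by (rule DERIV_mult[OF DERIV_ident r])
  have alg: "1 * w + (i / 2) * (- (a * (2 * t))) * t = w - a * t\<^sup>2 * i" for w i a t :: real
    by (simp add: power2_eq_square)
  have "((\<lambda>\<theta>. \<theta> * sqrt (?q \<theta>)) has_real_derivative sqrt (?q \<theta>) - ?a * \<theta>\<^sup>2 / sqrt (?q \<theta>)) (at \<theta> within T)"
    using prod unfolding alg divide_inverse[of "(norm \<xi>)\<^sup>2 * \<theta>\<^sup>2"] .
  then have 2: "((\<lambda>\<theta>. \<theta> * sqrt (?q \<theta>)) has_vector_derivative sqrt (?q \<theta>) - ?a * \<theta>\<^sup>2 / sqrt (?q \<theta>)) (at \<theta> within T)"
    by (rule has_real_derivative_iff_has_vector_derivative[THEN iffD1])
  have sq: "((\<lambda>\<theta>. \<theta>\<^sup>2) has_real_derivative 2 * \<theta>) (at \<theta> within T)"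
    by (rule DERIV_cong) (rule derivative_intros | simp)+
  have 1: "((\<lambda>\<theta>. \<theta>\<^sup>2 *\<^sub>R \<xi>) has_vector_derivative (2 * \<theta>) *\<^sub>R \<xi>) (at \<theta> within T)"
    unfolding has_vector_derivative_def
    by (rule has_derivative_eq_rhs[OF has_derivative_scaleR_left[OF sq[unfolded has_field_derivative_def]]])
       (rule ext, simp)
  show ?thesis
    unfolding arc_def[abs_def] arc_velocity_def by (rule has_vector_derivative_Pair[OF 1 2])
qed

lemma continuous_arc_velocity: "continuous_on {0..1} (arc_velocity \<xi>)"
  unfolding arc_velocity_def[abs_def] arc_q_def
proof (intro continuous_intros)
  show "\<forall>x\<in>{0..1}. sqrt (1 + (norm \<xi>)\<^sup>2 - (norm \<xi>)\<^sup>2 * x\<^sup>2) \<noteq> 0"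
    using arc_q_ge_1[of _ \<xi>] by (force simp: arc_q_def)
qed

lemma arc_bound_pos: "0 < s \<Longrightarrow> s < 1 \<Longrightarrow> 0 < arc_bound s \<xi>"
proof -
  assume s: "0 < s" "s < 1"
  have A: "0 < 1 + (norm \<xi>)\<^sup>2" "1 / (1 + (norm \<xi>)\<^sup>2) \<le> 1" by (simp_all add: add_pos_nonneg)
  have "0 < barrier s (1 / (1 + (norm \<xi>)\<^sup>2))" using A by (intro barrier_pos s) auto
  moreover have "0 < (1 + (norm \<xi>)\<^sup>2) powr (s / 2)" using A by simp
  ultimately show ?thesis unfolding arc_bound_def using s by (intro divide_pos_pos mult_pos_pos)
qed

text \<open>The substitution \<open>S = \<bar>\<xi>\<bar>\<^sup>2 / (1 + \<bar>\<xi>\<bar>\<^sup>2)\<close> reduces the length of the arc to the integral bounded by the barrier.\<close>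

lemma arc_mass:
  assumes "0 < s" "s < 1"
  shows "(\<integral>\<^sup>+\<theta>. ennreal (indicator {0<..<1} \<theta> * ((1 + (norm \<xi>)\<^sup>2) * \<theta> powr (s - 1) * arc_q \<xi> \<theta> powr (s / 2 - 1))) \<partial>lborel)
    \<le> ennreal (arc_bound s \<xi>)"
proof -
  let ?A = "1 + (norm \<xi>)\<^sup>2"
  define S where "S = (norm \<xi>)\<^sup>2 / ?A"
  have A: "0 < ?A" by (simp add: add_pos_nonneg)
  have S: "0 \<le> S" "S < 1" "1 - S = 1 / ?A" using A by (simp_all add: S_def field_simps)
  have q: "arc_q \<xi> \<theta> = ?A * (1 - S * \<theta>\<^sup>2)" for \<theta> using A by (simp add: arc_q_def S_def field_simps)
  have "(\<integral>\<^sup>+\<theta>. ennreal (indicator {0<..<1} \<theta> * (?A * \<theta> powr (s - 1) * arc_q \<xi> \<theta> powr (s / 2 - 1))) \<partial>lborel)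
    = (\<integral>\<^sup>+\<theta>. ennreal (?A powr (s / 2) / s) * ennreal (indicator {0<..<1} \<theta> * (s * \<theta> powr (s - 1) * (1 - S * \<theta>\<^sup>2) powr (s / 2 - 1))) \<partial>lborel)"
  proof (rule nn_integral_cong)
    fix \<theta> :: real
    show "ennreal (indicator {0<..<1} \<theta> * (?A * \<theta> powr (s - 1) * arc_q \<xi> \<theta> powr (s / 2 - 1)))
      = ennreal (?A powr (s / 2) / s) * ennreal (indicator {0<..<1} \<theta> * (s * \<theta> powr (s - 1) * (1 - S * \<theta>\<^sup>2) powr (s / 2 - 1)))"
    proof (cases "\<theta> \<in> {0<..<1}")
      case True
      then have "\<theta>\<^sup>2 \<le> 1" by (simp add: power_le_one)
      then have "S * \<theta>\<^sup>2 \<le> S * 1" using S by (intro mult_left_mono) auto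
      then have "0 < 1 - S * \<theta>\<^sup>2" using S by simp
      then have "?A * arc_q \<xi> \<theta> powr (s / 2 - 1) = ?A powr (s / 2) * (1 - S * \<theta>\<^sup>2) powr (s / 2 - 1)"
        using A by (simp only: q powr_mult) (simp add: powr_diff)
      then have "?A * \<theta> powr (s - 1) * arc_q \<xi> \<theta> powr (s / 2 - 1)
        = ?A powr (s / 2) / s * (s * \<theta> powr (s - 1) * (1 - S * \<theta>\<^sup>2) powr (s / 2 - 1))"
        using assms by (simp add: mult_ac)
      then show ?thesis using True assms by (simp only: indicator_simps mult_1) (simp add: ennreal_mult'[symmetric])
    qed simp
  qed
  also have "\<dots> = ennreal (?A powr (s / 2) / s) * (\<integral>\<^sup>+\<theta>. ennreal (indicator {0<..<1} \<theta> * (s * \<theta> powr (s - 1) * (1 - S * \<theta>\<^sup>2) powr (s / 2 - 1))) \<partial>lborel)"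
    by (rule nn_integral_cmult) measurable
  also have "\<dots> \<le> ennreal (?A powr (s / 2) / s) * ennreal (barrier s (1 - S))"
    by (intro mult_left_mono semicircle_length assms S) simp
  also have "\<dots> = ennreal (arc_bound s \<xi>)"
    using assms by (simp add: ennreal_mult'[symmetric] arc_bound_def S(3))
  finally show ?thesis .
qed

definition (in weak_gradient) mollified_power :: "real \<Rightarrow> real \<Rightarrow> 'a \<times> real \<Rightarrow> ennreal" where
  "mollified_power p \<epsilon> z = (\<integral>\<^sup>+\<zeta>. ennreal (mollifier \<epsilon> (\<zeta> - z) * norm (g \<zeta>) powr p) \<partial>lborel)"

lemma (in weak_gradient) mollified_measurable[measurable]: "mollified \<epsilon> \<in> borel_measurable borel"
  unfolding mollified_def[abs_def] by measurable

lemma (in weak_gradient) mollified_power_measurable[measurable]: "mollified_power p \<epsilon> \<in> borel_measurable borel"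
  unfolding mollified_power_def[abs_def] by measurable

text \<open>Write the difference of the values as the integral of the mollified gradient along the dilated arc. Jensen with respect to the length in the weighted metric puts the power inside, and Jensen with respect to the mollifier replaces the power of the mean gradient by the mean of the power.\<close>

lemma (in weak_gradient) arc_estimate:
  assumes s: "0 < s" "s < 1" and p: "1 \<le> p" and "0 < \<epsilon>" "0 < \<tau>"
  shows "ennreal (\<bar>mollified \<epsilon> (x + \<tau> *\<^sub>R \<xi>, \<tau>) - mollified \<epsilon> (x, 0)\<bar> powr p)
    \<le> ennreal (arc_bound s \<xi> powr (p - 1)) *
      (\<integral>\<^sup>+\<theta>. ennreal (indicator {0<..<1} \<theta> * ((1 + (norm \<xi>)\<^sup>2) * \<theta> powr (s - 1) * arc_q \<xi> \<theta> powr (s / 2 - 1)))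
        * (ennreal ((\<tau> * (\<theta> * sqrt (arc_q \<xi> \<theta>)) powr (1 - s)) powr p) * mollified_power p \<epsilon> ((x, 0) + \<tau> *\<^sub>R arc \<xi> \<theta>)) \<partial>lborel)"
proof -
  let ?A = "1 + (norm \<xi>)\<^sup>2"
  define w where "w \<theta> = indicator {0<..<1} \<theta> * (?A * \<theta> powr (s - 1) * arc_q \<xi> \<theta> powr (s / 2 - 1))" for \<theta>
  define H where "H \<theta> = \<tau> * (\<theta> * sqrt (arc_q \<xi> \<theta>)) powr (1 - s)" for \<theta>
  define \<Gamma> where "\<Gamma> \<theta> = (x, 0) + \<tau> *\<^sub>R arc \<xi> \<theta>" for \<theta>
  have [measurable]: "arc \<xi> \<in> borel_measurable borel" unfolding arc_def[abs_def] by measurable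
  have [measurable]: "w \<in> borel_measurable borel" "H \<in> borel_measurable borel" "\<Gamma> \<in> borel_measurable borel"
    unfolding w_def[abs_def] H_def[abs_def] \<Gamma>_def[abs_def] by measurable
  have w0: "0 \<le> w \<theta>" for \<theta> by (simp add: w_def)
  have H0: "0 \<le> H \<theta>" for \<theta> using assms by (simp add: H_def)
  define W where "W = (\<lambda>(\<theta>, \<zeta>). w \<theta> * mollifier \<epsilon> (\<zeta> - \<Gamma> \<theta>))"
  define h where "h = (\<lambda>(\<theta>, \<zeta>). H \<theta> * norm (g \<zeta>))"
  have [measurable]: "W \<in> borel_measurable (lborel \<Otimes>\<^sub>M lborel)" "h \<in> borel_measurable (lborel \<Otimes>\<^sub>M lborel)"
    unfolding W_def h_def by measurable
  have ends: "\<Gamma> 1 = (x + \<tau> *\<^sub>R \<xi>, \<tau>)" "\<Gamma> 0 = (x, 0)"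
    by (simp_all add: \<Gamma>_def arc_def arc_q_def)
  have step: "ennreal \<bar>mollified \<epsilon> (\<Gamma> 1) - mollified \<epsilon> (\<Gamma> 0)\<bar> \<le> (\<integral>\<^sup>+x. ennreal (W x * h x) \<partial>(lborel \<Otimes>\<^sub>M lborel))"
  proof -
    let ?I = "\<lambda>\<theta>. LINT \<zeta>|lborel. (g \<zeta> \<bullet> (\<tau> *\<^sub>R arc_velocity \<xi> \<theta>)) * mollifier \<epsilon> (\<zeta> - \<Gamma> \<theta>)"
    have "mollified \<epsilon> (\<Gamma> 1) - mollified \<epsilon> (\<Gamma> 0) = (LINT \<theta>|lborel. indicator {0..1} \<theta> * ?I \<theta>)"
    proof (rule mollified_curve)
      fix \<theta> :: real assume \<theta>: "\<theta> \<in> {0..1}"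
      have "(arc \<xi> has_vector_derivative arc_velocity \<xi> \<theta>) (at \<theta> within {0..1})"
        using \<theta> by (intro arc_has_velocity) auto
      then show "(\<Gamma> has_vector_derivative \<tau> *\<^sub>R arc_velocity \<xi> \<theta>) (at \<theta> within {0..1})"
        unfolding \<Gamma>_def[abs_def] by (auto intro!: derivative_eq_intros)
      show "0 \<le> snd (\<Gamma> \<theta>)" using \<theta> assms arc_q_ge_1[of \<theta> \<xi>] by (simp add: \<Gamma>_def arc_def)
    qed (use assms continuous_arc_velocity in \<open>auto intro!: continuous_intros\<close>)
    then have "ennreal \<bar>mollified \<epsilon> (\<Gamma> 1) - mollified \<epsilon> (\<Gamma> 0)\<bar> = ennreal (norm (LINT \<theta>|lborel. indicator {0..1} \<theta> * ?I \<theta>))" by simp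
    also have "\<dots> \<le> (\<integral>\<^sup>+\<theta>. ennreal (norm (indicator {0..1} \<theta> * ?I \<theta>)) \<partial>lborel)"
      by (rule integral_norm_le_nn_integral)
    also have "\<dots> \<le> (\<integral>\<^sup>+\<theta>. (\<integral>\<^sup>+\<zeta>. ennreal (W (\<theta>, \<zeta>) * h (\<theta>, \<zeta>)) \<partial>lborel) \<partial>lborel)"
    proof (rule nn_integral_mono_AE)
      have ae: "AE \<theta> in lborel. \<theta> \<noteq> (0::real) \<and> \<theta> \<noteq> 1"
        using AE_lborel_singleton[of "0::real"] AE_lborel_singleton[of "1::real"] by eventually_elim simp
      then show "AE \<theta> in lborel. ennreal (norm (indicator {0..1} \<theta> * ?I \<theta>)) \<le> (\<integral>\<^sup>+\<zeta>. ennreal (W (\<theta>, \<zeta>) * h (\<theta>, \<zeta>)) \<partial>lborel)"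
      proof eventually_elim
        case (elim \<theta>)
        show ?case
        proof (cases "\<theta> \<in> {0..1}")
          case True
          then have \<theta>: "0 < \<theta>" "\<theta> < 1" using elim by auto
          have q: "1 \<le> arc_q \<xi> \<theta>" using \<theta> by (intro arc_q_ge_1) auto
          have wH: "w \<theta> * H \<theta> = \<tau> * norm (arc_velocity \<xi> \<theta>)"
          proof -
            have "\<theta> powr (s - 1) * \<theta> powr (1 - s) = 1" using \<theta> by (simp add: powr_add[symmetric])
            moreover have "arc_q \<xi> \<theta> powr (s / 2 - 1) * sqrt (arc_q \<xi> \<theta>) powr (1 - s) = 1 / sqrt (arc_q \<xi> \<theta>)"
            proof -
              have "arc_q \<xi> \<theta> powr (s / 2 - 1) * sqrt (arc_q \<xi> \<theta>) powr (1 - s) = arc_q \<xi> \<theta> powr (- (1 / 2))"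
                using q by (simp add: powr_half_sqrt[symmetric] powr_powr powr_add[symmetric] field_simps)
              then show ?thesis using q by (simp add: powr_minus_divide powr_half_sqrt)
            qed
            moreover have "w \<theta> * H \<theta> = \<tau> * (?A * ((\<theta> powr (s - 1) * \<theta> powr (1 - s)) * (arc_q \<xi> \<theta> powr (s / 2 - 1) * sqrt (arc_q \<xi> \<theta>) powr (1 - s))))"
              using \<theta> by (simp add: w_def H_def powr_mult mult_ac)
            ultimately show ?thesis
              using \<theta> by (simp add: norm_arc_velocity)
          qed
          have "norm (indicator {0..1} \<theta> * ?I \<theta>) = norm (?I \<theta>)" using True by simp
          also have "ennreal \<dots> \<le> (\<integral>\<^sup>+\<zeta>. ennreal (norm ((g \<zeta> \<bullet> (\<tau> *\<^sub>R arc_velocity \<xi> \<theta>)) * mollifier \<epsilon> (\<zeta> - \<Gamma> \<theta>))) \<partial>lborel)"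
            by (rule integral_norm_le_nn_integral)
          also have "\<dots> \<le> (\<integral>\<^sup>+\<zeta>. ennreal (W (\<theta>, \<zeta>) * h (\<theta>, \<zeta>)) \<partial>lborel)"
          proof (intro nn_integral_mono ennreal_leI)
            fix \<zeta>
            have "norm (g \<zeta> \<bullet> (\<tau> *\<^sub>R arc_velocity \<xi> \<theta>)) \<le> norm (g \<zeta>) * norm (\<tau> *\<^sub>R arc_velocity \<xi> \<theta>)"
              unfolding real_norm_def by (rule Cauchy_Schwarz_ineq2)
            also have "\<dots> = w \<theta> * H \<theta> * norm (g \<zeta>)" using assms by (simp add: wH)
            finally have "norm (g \<zeta> \<bullet> (\<tau> *\<^sub>R arc_velocity \<xi> \<theta>)) * mollifier \<epsilon> (\<zeta> - \<Gamma> \<theta>) \<le> w \<theta> * H \<theta> * norm (g \<zeta>) * mollifier \<epsilon> (\<zeta> - \<Gamma> \<theta>)"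
              by (rule mult_right_mono) (rule mollifier_nonneg[OF assms(4)])
            then show "norm ((g \<zeta> \<bullet> (\<tau> *\<^sub>R arc_velocity \<xi> \<theta>)) * mollifier \<epsilon> (\<zeta> - \<Gamma> \<theta>)) \<le> W (\<theta>, \<zeta>) * h (\<theta>, \<zeta>)"
              using mollifier_nonneg[OF assms(4), of "\<zeta> - \<Gamma> \<theta>"] by (simp add: W_def h_def abs_mult mult_ac)
          qed
          finally show ?thesis .
        qed simp
      qed
    qed
    also have "\<dots> = (\<integral>\<^sup>+x. ennreal (W x * h x) \<partial>(lborel \<Otimes>\<^sub>M lborel))"
      by (rule lborel.nn_integral_fst) measurable
    finally show ?thesis .
  qed
  have moll1: "(\<integral>\<^sup>+\<zeta>. ennreal (mollifier \<epsilon> (\<zeta> - z)) \<partial>lborel) = 1" for z :: "'a \<times> real"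
  proof -
    have "(\<integral>\<^sup>+\<zeta>. ennreal (mollifier \<epsilon> (\<zeta> - z)) \<partial>lborel)
        = (\<integral>\<^sup>+\<zeta>. ennreal (mollifier \<epsilon> (\<zeta> - z)) \<partial>distr lborel borel ((+) z))"
      by (simp only: lborel_distr_plus)
    also have "\<dots> = 1"
      by (subst nn_integral_distr) (auto simp: nn_integral_mollifier[OF assms(4)])
    finally show ?thesis .
  qed
  have "ennreal (\<bar>mollified \<epsilon> (\<Gamma> 1) - mollified \<epsilon> (\<Gamma> 0)\<bar> powr p)
    \<le> ennreal (arc_bound s \<xi> powr (p - 1)) * (\<integral>\<^sup>+x. ennreal (W x * h x powr p) \<partial>(lborel \<Otimes>\<^sub>M lborel))"
  proof (rule powr_le_nn_integral_powr)
    show "0 \<le> W x" for x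
      unfolding W_def split_beta by (intro mult_nonneg_nonneg w0 mollifier_nonneg[OF assms(4)])
    show "0 \<le> h x" for x
      unfolding h_def split_beta by (intro mult_nonneg_nonneg H0 norm_ge_zero)
    have "(\<integral>\<^sup>+x. ennreal (W x) \<partial>(lborel \<Otimes>\<^sub>M lborel)) = (\<integral>\<^sup>+\<theta>. \<integral>\<^sup>+\<zeta>. ennreal (W (\<theta>, \<zeta>)) \<partial>lborel \<partial>lborel)"
      by (rule lborel.nn_integral_fst[symmetric]) measurable
    also have "\<dots> = (\<integral>\<^sup>+\<theta>. ennreal (w \<theta>) \<partial>lborel)"
      using w0 mollifier_nonneg[OF assms(4)]
      by (intro nn_integral_cong) (simp add: W_def ennreal_mult' nn_integral_cmult moll1)
    also have "\<dots> \<le> ennreal (arc_bound s \<xi>)" unfolding w_def by (rule arc_mass[OF s])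
    finally show "(\<integral>\<^sup>+x. ennreal (W x) \<partial>(lborel \<Otimes>\<^sub>M lborel)) \<le> ennreal (arc_bound s \<xi>)" .
  qed (use p arc_bound_pos[OF s] step in auto)
  also have "(\<integral>\<^sup>+x. ennreal (W x * h x powr p) \<partial>(lborel \<Otimes>\<^sub>M lborel)) = (\<integral>\<^sup>+\<theta>. \<integral>\<^sup>+\<zeta>. ennreal (W (\<theta>, \<zeta>) * h (\<theta>, \<zeta>) powr p) \<partial>lborel \<partial>lborel)"
    by (rule lborel.nn_integral_fst[symmetric]) measurable
  also have "\<dots> = (\<integral>\<^sup>+\<theta>. ennreal (w \<theta>) * (ennreal (H \<theta> powr p) * mollified_power p \<epsilon> (\<Gamma> \<theta>)) \<partial>lborel)"
  proof (rule nn_integral_cong)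
    fix \<theta>
    have "(\<integral>\<^sup>+\<zeta>. ennreal (W (\<theta>, \<zeta>) * h (\<theta>, \<zeta>) powr p) \<partial>lborel)
      = (\<integral>\<^sup>+\<zeta>. ennreal (w \<theta> * H \<theta> powr p) * ennreal (mollifier \<epsilon> (\<zeta> - \<Gamma> \<theta>) * norm (g \<zeta>) powr p) \<partial>lborel)"
      using w0 H0 mollifier_nonneg[OF assms(4)]
      by (intro nn_integral_cong) (simp add: W_def h_def powr_mult ennreal_mult'[symmetric] mult_ac)
    also have "\<dots> = ennreal (w \<theta> * H \<theta> powr p) * mollified_power p \<epsilon> (\<Gamma> \<theta>)"
      unfolding mollified_power_def by (rule nn_integral_cmult) measurable
    finally show "(\<integral>\<^sup>+\<zeta>. ennreal (W (\<theta>, \<zeta>) * h (\<theta>, \<zeta>) powr p) \<partial>lborel)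
      = ennreal (w \<theta>) * (ennreal (H \<theta> powr p) * mollified_power p \<epsilon> (\<Gamma> \<theta>))"
      using w0 by (simp add: ennreal_mult' mult.assoc)
  qed
  finally show ?thesis unfolding ends by (simp only: w_def H_def \<Gamma>_def)
qed

section \<open>The estimate for mollified functions\<close>

lemma fst_snd_borel[measurable]:
  "fst \<in> borel_measurable (borel :: ('a::euclidean_space \<times> real) measure)"
  "snd \<in> borel_measurable (borel :: ('a::euclidean_space \<times> real) measure)"
  by (intro borel_measurable_continuous_onI continuous_on_fst continuous_on_snd continuous_on_id)+

lemma nn_integral_lborel_affine:
  fixes G :: "'a::euclidean_space \<Rightarrow> ennreal"
  assumes [measurable]: "G \<in> borel_measurable borel" and "0 < \<tau>"
  shows "(\<integral>\<^sup>+h. G h \<partial>lborel) = (\<integral>\<^sup>+\<xi>. ennreal (\<tau> ^ DIM('a)) * G (x + \<tau> *\<^sub>R \<xi>) \<partial>lborel)"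
proof -
  have "(\<integral>\<^sup>+h. G h \<partial>lborel) = (\<integral>\<^sup>+h. G h \<partial>density (distr lborel borel (\<lambda>\<xi>. x + \<tau> *\<^sub>R \<xi>)) (\<lambda>_. \<bar>\<tau>\<bar> ^ DIM('a)))"
    using assms(2) by (subst lborel_affine[of \<tau> x]) auto
  also have "\<dots> = (\<integral>\<^sup>+\<xi>. ennreal (\<tau> ^ DIM('a)) * G (x + \<tau> *\<^sub>R \<xi>) \<partial>lborel)"
    using assms(2) by (subst nn_integral_density) (auto simp: nn_integral_distr)
  finally show ?thesis .
qed

lemma nn_integral_lborel_translate:
  fixes G :: "'a::euclidean_space \<Rightarrow> ennreal"
  assumes [measurable]: "G \<in> borel_measurable borel"
  shows "(\<integral>\<^sup>+x. G (x + c) \<partial>lborel) = (\<integral>\<^sup>+x. G x \<partial>lborel)"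
  using nn_integral_lborel_affine[OF assms, of 1 c] by (simp add: add.commute)

lemma nn_integral_lborel_Pair:
  fixes G :: "'a::euclidean_space \<times> real \<Rightarrow> ennreal"
  assumes [measurable]: "G \<in> borel_measurable borel"
  shows "(\<integral>\<^sup>+z. G z \<partial>lborel) = (\<integral>\<^sup>+t. \<integral>\<^sup>+x. G (x, t) \<partial>lborel \<partial>lborel)"
proof -
  have "(\<integral>\<^sup>+z. G z \<partial>lborel) = (\<integral>\<^sup>+z. G z \<partial>(lborel \<Otimes>\<^sub>M lborel))" by (simp only: lborel_prod)
  also have "\<dots> = (\<integral>\<^sup>+t. \<integral>\<^sup>+x. G (x, t) \<partial>lborel \<partial>lborel)"
    by (rule lborel_pair.nn_integral_snd[symmetric]) (simp add: lborel_prod)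
  finally show ?thesis .
qed

definition kernel_quotient :: "('a::euclidean_space \<times> real \<Rightarrow> real) \<Rightarrow> real \<Rightarrow> real \<Rightarrow> 'a \<Rightarrow> 'a \<times> real \<Rightarrow> real" where
  "kernel_quotient f p k x y = \<bar>f (x, 0) - f y\<bar> powr p / norm ((x, 0) - y) powr (real DIM('a) + 1 + k)"

text \<open>Points of the half-space are written as \<open>(x + \<tau> \<xi>, \<tau>)\<close>; the slope \<open>\<xi>\<close> is scale-invariant.\<close>

lemma nn_integral_slopes:
  fixes f :: "'a::euclidean_space \<times> real \<Rightarrow> real"
  assumes [measurable]: "f \<in> borel_measurable borel"
  shows "(\<integral>\<^sup>+y\<in>upper_half. ennreal (kernel_quotient f p k x y) \<partial>lborel)
    = (\<integral>\<^sup>+\<tau>. \<integral>\<^sup>+\<xi>. ennreal (indicator {0<..} \<tau> * (\<tau> powr (- 1 - k) * (1 + (norm \<xi>)\<^sup>2) powr (- ((real DIM('a) + 1 + k) / 2))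
        * \<bar>f (x + \<tau> *\<^sub>R \<xi>, \<tau>) - f (x, 0)\<bar> powr p)) \<partial>lborel \<partial>lborel)"
proof -
  let ?N = "real DIM('a) + 1 + k"
  have [measurable]: "kernel_quotient f p k x \<in> borel_measurable borel"
    unfolding kernel_quotient_def[abs_def] by measurable
  have "(\<integral>\<^sup>+y\<in>upper_half. ennreal (kernel_quotient f p k x y) \<partial>lborel)
    = (\<integral>\<^sup>+\<tau>. \<integral>\<^sup>+h. ennreal (kernel_quotient f p k x (h, \<tau>)) * indicator upper_half (h, \<tau>) \<partial>lborel \<partial>lborel)"
    by (rule nn_integral_lborel_Pair) measurable
  also have "\<dots> = (\<integral>\<^sup>+\<tau>. \<integral>\<^sup>+\<xi>. ennreal (indicator {0<..} \<tau> * (\<tau> powr (- 1 - k) * (1 + (norm \<xi>)\<^sup>2) powr (- (?N / 2))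
        * \<bar>f (x + \<tau> *\<^sub>R \<xi>, \<tau>) - f (x, 0)\<bar> powr p)) \<partial>lborel \<partial>lborel)"
  proof (rule nn_integral_cong)
    fix \<tau> :: real
    show "(\<integral>\<^sup>+h. ennreal (kernel_quotient f p k x (h, \<tau>)) * indicator upper_half (h, \<tau>) \<partial>lborel)
      = (\<integral>\<^sup>+\<xi>. ennreal (indicator {0<..} \<tau> * (\<tau> powr (- 1 - k) * (1 + (norm \<xi>)\<^sup>2) powr (- (?N / 2))
        * \<bar>f (x + \<tau> *\<^sub>R \<xi>, \<tau>) - f (x, 0)\<bar> powr p)) \<partial>lborel)"
    proof (cases "0 < \<tau>")
      case True
      have "(\<integral>\<^sup>+h. ennreal (kernel_quotient f p k x (h, \<tau>)) * indicator upper_half (h, \<tau>) \<partial>lborel)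
        = (\<integral>\<^sup>+\<xi>. ennreal (\<tau> ^ DIM('a)) * (ennreal (kernel_quotient f p k x (x + \<tau> *\<^sub>R \<xi>, \<tau>)) * indicator upper_half (x + \<tau> *\<^sub>R \<xi>, \<tau>)) \<partial>lborel)"
        using True by (intro nn_integral_lborel_affine) measurable
      also have "\<dots> = (\<integral>\<^sup>+\<xi>. ennreal (indicator {0<..} \<tau> * (\<tau> powr (- 1 - k) * (1 + (norm \<xi>)\<^sup>2) powr (- (?N / 2))
        * \<bar>f (x + \<tau> *\<^sub>R \<xi>, \<tau>) - f (x, 0)\<bar> powr p)) \<partial>lborel)"
      proof (rule nn_integral_cong)
        fix \<xi> :: 'a
        let ?A = "1 + (norm \<xi>)\<^sup>2"
        have A: "0 < ?A" by (simp add: add_pos_nonneg)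
        have "norm ((x, 0) - (x + \<tau> *\<^sub>R \<xi>, \<tau>)) = sqrt ((\<tau> * norm \<xi>)\<^sup>2 + \<tau>\<^sup>2)"
          using True by (simp add: norm_Pair)
        also have "(\<tau> * norm \<xi>)\<^sup>2 + \<tau>\<^sup>2 = \<tau>\<^sup>2 * ?A" by (simp add: power_mult_distrib distrib_left add.commute)
        also have "sqrt (\<tau>\<^sup>2 * ?A) = \<tau> * ?A powr (1 / 2)"
          using True A by (simp add: real_sqrt_mult powr_half_sqrt)
        finally have "norm ((x, 0) - (x + \<tau> *\<^sub>R \<xi>, \<tau>)) powr ?N = \<tau> powr ?N * ?A powr (?N / 2)"
          using True A by (simp add: powr_mult powr_powr)
        moreover have "\<tau> ^ DIM('a) / \<tau> powr ?N = \<tau> powr (- 1 - k)"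
          using True by (simp add: powr_realpow[symmetric] powr_diff[symmetric])
        ultimately have "\<tau> ^ DIM('a) * kernel_quotient f p k x (x + \<tau> *\<^sub>R \<xi>, \<tau>)
          = \<tau> powr (- 1 - k) * ?A powr (- (?N / 2)) * \<bar>f (x + \<tau> *\<^sub>R \<xi>, \<tau>) - f (x, 0)\<bar> powr p"
          using A True by (simp add: kernel_quotient_def abs_minus_commute powr_minus_divide field_simps)
        moreover have "(x + \<tau> *\<^sub>R \<xi>, \<tau>) \<in> upper_half" using True by (simp add: upper_half_def)
        ultimately show "ennreal (\<tau> ^ DIM('a)) * (ennreal (kernel_quotient f p k x (x + \<tau> *\<^sub>R \<xi>, \<tau>)) * indicator upper_half (x + \<tau> *\<^sub>R \<xi>, \<tau>))
          = ennreal (indicator {0<..} \<tau> * (\<tau> powr (- 1 - k) * ?A powr (- (?N / 2)) * \<bar>f (x + \<tau> *\<^sub>R \<xi>, \<tau>) - f (x, 0)\<bar> powr p))"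
          using True by (simp add: ennreal_mult'[symmetric])
      qed
      finally show ?thesis .
    qed (simp add: upper_half_def)
  qed
  finally show ?thesis .
qed

text \<open>Integrating over the horizontal variable removes the horizontal part of the path, and the measure
  \<open>\<tau> powr \<beta>\<close> turns the scale \<open>\<tau>\<close> of the path into the height of the moving point.\<close>

lemma nn_integral_dilated_path:
  fixes Q :: "'a::euclidean_space \<times> real \<Rightarrow> ennreal"
  assumes [measurable]: "Q \<in> borel_measurable borel" and h: "0 < h" and \<beta>: "\<beta> = (1 - s) * p - 1"
  shows "(\<integral>\<^sup>+\<tau>. ennreal (indicator {0<..} \<tau> * (\<tau> powr (- 1 - s * p) * (\<tau> * h powr (1 - s)) powr p)) * (\<integral>\<^sup>+x. Q (x + \<tau> *\<^sub>R c, \<tau> * h) \<partial>lborel) \<partial>lborel)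
    = (\<integral>\<^sup>+z\<in>upper_half. Q z * ennreal (snd z powr \<beta>) \<partial>lborel)"
proof -
  define F where "F t = (\<integral>\<^sup>+x. Q (x, t) \<partial>lborel)" for t
  have [measurable]: "F \<in> borel_measurable borel" unfolding F_def[abs_def] by measurable
  have F: "(\<integral>\<^sup>+x. Q (x + y, t) \<partial>lborel) = F t" for t y
    unfolding F_def by (rule nn_integral_lborel_translate) measurable
  have "(\<integral>\<^sup>+z\<in>upper_half. Q z * ennreal (snd z powr \<beta>) \<partial>lborel)
    = (\<integral>\<^sup>+t. \<integral>\<^sup>+x. Q (x, t) * ennreal (snd (x, t) powr \<beta>) * indicator upper_half (x, t) \<partial>lborel \<partial>lborel)"
    by (rule nn_integral_lborel_Pair) measurable
  also have "\<dots> = (\<integral>\<^sup>+t. \<integral>\<^sup>+x. Q (x, t) * ennreal (indicator {0<..} t * t powr \<beta>) \<partial>lborel \<partial>lborel)"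
    by (intro nn_integral_cong) (simp add: upper_half_def split: split_indicator)
  also have "\<dots> = (\<integral>\<^sup>+t. F t * ennreal (indicator {0<..} t * t powr \<beta>) \<partial>lborel)"
    unfolding F_def by (intro nn_integral_cong nn_integral_multc) measurable
  also have "\<dots> = ennreal h * (\<integral>\<^sup>+\<tau>. F (h * \<tau>) * ennreal (indicator {0<..} (h * \<tau>) * (h * \<tau>) powr \<beta>) \<partial>lborel)"
    using h by (subst nn_integral_real_affine[where c = h and t = 0]) auto
  also have "\<dots> = (\<integral>\<^sup>+\<tau>. ennreal h * (F (h * \<tau>) * ennreal (indicator {0<..} (h * \<tau>) * (h * \<tau>) powr \<beta>)) \<partial>lborel)"
    by (rule nn_integral_cmult[symmetric]) measurable
  also have "\<dots> = (\<integral>\<^sup>+\<tau>. ennreal (indicator {0<..} \<tau> * (\<tau> powr (- 1 - s * p) * (\<tau> * h powr (1 - s)) powr p)) * (\<integral>\<^sup>+x. Q (x + \<tau> *\<^sub>R c, \<tau> * h) \<partial>lborel) \<partial>lborel)"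
  proof (rule nn_integral_cong)
    fix \<tau> :: real
    show "ennreal h * (F (h * \<tau>) * ennreal (indicator {0<..} (h * \<tau>) * (h * \<tau>) powr \<beta>))
      = ennreal (indicator {0<..} \<tau> * (\<tau> powr (- 1 - s * p) * (\<tau> * h powr (1 - s)) powr p)) * (\<integral>\<^sup>+x. Q (x + \<tau> *\<^sub>R c, \<tau> * h) \<partial>lborel)"
    proof (cases "0 < \<tau>")
      case True
      have "h * (h * \<tau>) powr \<beta> = \<tau> powr (- 1 - s * p) * (\<tau> * h powr (1 - s)) powr p"
      proof -
        have "h * (h * \<tau>) powr \<beta> = h powr (\<beta> + 1) * \<tau> powr \<beta>" using h True by (simp add: powr_mult powr_add)
        also have "\<dots> = \<tau> powr (- 1 - s * p + p) * h powr ((1 - s) * p)" by (simp add: \<beta> algebra_simps)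
        also have "\<dots> = \<tau> powr (- 1 - s * p) * (\<tau> * h powr (1 - s)) powr p"
          using h True by (simp add: powr_mult powr_powr powr_add)
        finally show ?thesis .
      qed
      then have eq: "ennreal h * ennreal ((h * \<tau>) powr \<beta>) = ennreal (\<tau> powr (- 1 - s * p) * (\<tau> * h powr (1 - s)) powr p)"
        using h by (simp add: ennreal_mult'[symmetric])
      have "ennreal h * (F (h * \<tau>) * ennreal (indicator {0<..} (h * \<tau>) * (h * \<tau>) powr \<beta>))
        = (ennreal h * ennreal ((h * \<tau>) powr \<beta>)) * F (h * \<tau>)"
        using True h by (simp add: mult_ac)
      also have "\<dots> = ennreal (indicator {0<..} \<tau> * (\<tau> powr (- 1 - s * p) * (\<tau> * h powr (1 - s)) powr p)) * (\<integral>\<^sup>+x. Q (x + \<tau> *\<^sub>R c, \<tau> * h) \<partial>lborel)"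
        unfolding eq F using True by (simp add: mult.commute)
      finally show ?thesis .
    next
      case False
      then have "\<not> 0 < h * \<tau>" using h by (simp add: zero_less_mult_iff)
      then show ?thesis using False by simp
    qed
  qed
  finally show ?thesis by simp
qed

text \<open>For each slope the integrals over \<open>x\<close> and \<open>\<tau>\<close> of the right-hand side of \<open>arc_estimate\<close> decouple: at every point of the arc they give the same energy. The integral along the arc then contributes one further factor of the length.\<close>

theorem (in weak_gradient) mollified_estimate:
  assumes s: "0 < s" "s < 1" and p: "1 \<le> p" and "0 < \<epsilon>" and \<beta>: "\<beta> = (1 - s) * p - 1"
  shows "(\<integral>\<^sup>+x. (\<integral>\<^sup>+y\<in>upper_half. ennreal (kernel_quotient (mollified \<epsilon>) p (s * p) x y) \<partial>lborel) \<partial>lborel)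
    \<le> (\<integral>\<^sup>+(\<xi>::'a). ennreal (arc_bound s \<xi> powr p * (1 + (norm \<xi>)\<^sup>2) powr (- ((real DIM('a) + 1 + s * p) / 2))) \<partial>lborel)
      * (\<integral>\<^sup>+z\<in>upper_half. mollified_power p \<epsilon> z * ennreal (snd z powr \<beta>) \<partial>lborel)"
proof -
  let ?k = "\<lambda>\<xi>::'a. (1 + (norm \<xi>)\<^sup>2) powr (- ((real DIM('a) + 1 + s * p) / 2))"
  define R where "R = (\<integral>\<^sup>+z\<in>upper_half. mollified_power p \<epsilon> z * ennreal (snd z powr \<beta>) \<partial>lborel)"
  define D where "D x \<xi> \<tau> = \<bar>mollified \<epsilon> (x + \<tau> *\<^sub>R \<xi>, \<tau>) - mollified \<epsilon> (x, 0)\<bar> powr p" for x \<xi> \<tau>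
  define T where "T \<tau> = indicator {0<..} \<tau> * \<tau> powr (- 1 - s * p)" for \<tau> :: real
  have T0: "0 \<le> T \<tau>" for \<tau> by (simp add: T_def)
  have [measurable]: "T \<in> borel_measurable borel" unfolding T_def[abs_def] by measurable
  have [measurable]: "(\<lambda>y. D (f y) (h y) (k y)) \<in> borel_measurable M"
    if [measurable]: "f \<in> borel_measurable M" "h \<in> borel_measurable M" "k \<in> borel_measurable M" for f h k and M :: "'c measure"
    unfolding D_def by measurable
  have [measurable]: "arc_bound s \<in> borel_measurable borel" unfolding arc_bound_def[abs_def] barrier_def by measurable
  have slope: "(\<integral>\<^sup>+\<tau>. \<integral>\<^sup>+x. ennreal (T \<tau>) * ennreal (D x \<xi> \<tau>) \<partial>lborel \<partial>lborel) \<le> ennreal (arc_bound s \<xi> powr p) * R" for \<xi>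
  proof -
    define w where "w \<theta> = indicator {0<..<1} \<theta> * ((1 + (norm \<xi>)\<^sup>2) * \<theta> powr (s - 1) * arc_q \<xi> \<theta> powr (s / 2 - 1))" for \<theta>
    define h where "h \<theta> = \<theta> * sqrt (arc_q \<xi> \<theta>)" for \<theta>
    define Q where "Q \<theta> x \<tau> = mollified_power p \<epsilon> ((x, 0) + \<tau> *\<^sub>R arc \<xi> \<theta>)" for \<theta> x \<tau>
    have [measurable]: "w \<in> borel_measurable borel" "h \<in> borel_measurable borel" unfolding w_def[abs_def] h_def[abs_def] by measurable
    have [measurable]: "(\<lambda>y. Q (f y) (g y) (k y)) \<in> borel_measurable M"
      if [measurable]: "f \<in> borel_measurable M" "g \<in> borel_measurable M" "k \<in> borel_measurable M" for f g k and M :: "'c measure"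
      unfolding Q_def arc_def by measurable
    let ?B = "ennreal (arc_bound s \<xi> powr (p - 1))"
    have "(\<integral>\<^sup>+\<tau>. \<integral>\<^sup>+x. ennreal (T \<tau>) * ennreal (D x \<xi> \<tau>) \<partial>lborel \<partial>lborel)
      \<le> (\<integral>\<^sup>+\<tau>. \<integral>\<^sup>+x. ?B * (\<integral>\<^sup>+\<theta>. ennreal (w \<theta>) * (ennreal (T \<tau> * (\<tau> * h \<theta> powr (1 - s)) powr p) * Q \<theta> x \<tau>) \<partial>lborel) \<partial>lborel \<partial>lborel)"
    proof (intro nn_integral_mono)
      fix \<tau> x
      show "ennreal (T \<tau>) * ennreal (D x \<xi> \<tau>)
        \<le> ?B * (\<integral>\<^sup>+\<theta>. ennreal (w \<theta>) * (ennreal (T \<tau> * (\<tau> * h \<theta> powr (1 - s)) powr p) * Q \<theta> x \<tau>) \<partial>lborel)"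
      proof (cases "0 < \<tau>")
        case True
        have "ennreal (T \<tau>) * ennreal (D x \<xi> \<tau>) \<le> ennreal (T \<tau>) * (?B * (\<integral>\<^sup>+\<theta>. ennreal (w \<theta>) * (ennreal ((\<tau> * h \<theta> powr (1 - s)) powr p) * Q \<theta> x \<tau>) \<partial>lborel))"
          unfolding D_def w_def h_def Q_def
          by (intro mult_left_mono arc_estimate[OF s p assms(4) True]) simp
        also have "\<dots> = ?B * (ennreal (T \<tau>) * (\<integral>\<^sup>+\<theta>. ennreal (w \<theta>) * (ennreal ((\<tau> * h \<theta> powr (1 - s)) powr p) * Q \<theta> x \<tau>) \<partial>lborel))"
          by (rule mult.left_commute)
        also have "ennreal (T \<tau>) * (\<integral>\<^sup>+\<theta>. ennreal (w \<theta>) * (ennreal ((\<tau> * h \<theta> powr (1 - s)) powr p) * Q \<theta> x \<tau>) \<partial>lborel)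
          = (\<integral>\<^sup>+\<theta>. ennreal (T \<tau>) * (ennreal (w \<theta>) * (ennreal ((\<tau> * h \<theta> powr (1 - s)) powr p) * Q \<theta> x \<tau>)) \<partial>lborel)"
          by (rule nn_integral_cmult[symmetric]) measurable
        also have "\<dots> = (\<integral>\<^sup>+\<theta>. ennreal (w \<theta>) * (ennreal (T \<tau> * (\<tau> * h \<theta> powr (1 - s)) powr p) * Q \<theta> x \<tau>) \<partial>lborel)"
          using T0 by (intro nn_integral_cong) (simp add: ennreal_mult mult_ac)
        finally show ?thesis .
      qed (simp add: T_def)
    qed
    also have "\<dots> = (\<integral>\<^sup>+\<tau>. ?B * (\<integral>\<^sup>+x. \<integral>\<^sup>+\<theta>. ennreal (w \<theta>) * (ennreal (T \<tau> * (\<tau> * h \<theta> powr (1 - s)) powr p) * Q \<theta> x \<tau>) \<partial>lborel \<partial>lborel) \<partial>lborel)"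
      by (intro nn_integral_cong nn_integral_cmult) measurable
    also have "\<dots> = ?B * (\<integral>\<^sup>+\<tau>. \<integral>\<^sup>+x. \<integral>\<^sup>+\<theta>. ennreal (w \<theta>) * (ennreal (T \<tau> * (\<tau> * h \<theta> powr (1 - s)) powr p) * Q \<theta> x \<tau>) \<partial>lborel \<partial>lborel \<partial>lborel)"
      by (rule nn_integral_cmult) measurable
    also have "(\<integral>\<^sup>+\<tau>. \<integral>\<^sup>+x. \<integral>\<^sup>+\<theta>. ennreal (w \<theta>) * (ennreal (T \<tau> * (\<tau> * h \<theta> powr (1 - s)) powr p) * Q \<theta> x \<tau>) \<partial>lborel \<partial>lborel \<partial>lborel)
      = (\<integral>\<^sup>+\<tau>. \<integral>\<^sup>+\<theta>. \<integral>\<^sup>+x. ennreal (w \<theta>) * (ennreal (T \<tau> * (\<tau> * h \<theta> powr (1 - s)) powr p) * Q \<theta> x \<tau>) \<partial>lborel \<partial>lborel \<partial>lborel)"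
      by (intro nn_integral_cong lborel_pair.Fubini') measurable
    also have "\<dots> = (\<integral>\<^sup>+\<theta>. \<integral>\<^sup>+\<tau>. \<integral>\<^sup>+x. ennreal (w \<theta>) * (ennreal (T \<tau> * (\<tau> * h \<theta> powr (1 - s)) powr p) * Q \<theta> x \<tau>) \<partial>lborel \<partial>lborel \<partial>lborel)"
      by (rule lborel_pair.Fubini') measurable
    also have "\<dots> = (\<integral>\<^sup>+\<theta>. ennreal (w \<theta>) * R \<partial>lborel)"
    proof (rule nn_integral_cong)
      fix \<theta>
      show "(\<integral>\<^sup>+\<tau>. \<integral>\<^sup>+x. ennreal (w \<theta>) * (ennreal (T \<tau> * (\<tau> * h \<theta> powr (1 - s)) powr p) * Q \<theta> x \<tau>) \<partial>lborel \<partial>lborel) = ennreal (w \<theta>) * R"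
      proof (cases "\<theta> \<in> {0<..<1}")
        case True
        then have "0 < h \<theta>" using arc_q_ge_1[of \<theta> \<xi>] by (auto simp: h_def intro!: mult_pos_pos)
        have "(\<integral>\<^sup>+\<tau>. \<integral>\<^sup>+x. ennreal (w \<theta>) * (ennreal (T \<tau> * (\<tau> * h \<theta> powr (1 - s)) powr p) * Q \<theta> x \<tau>) \<partial>lborel \<partial>lborel)
          = (\<integral>\<^sup>+\<tau>. ennreal (w \<theta>) * (ennreal (T \<tau> * (\<tau> * h \<theta> powr (1 - s)) powr p) * (\<integral>\<^sup>+x. Q \<theta> x \<tau> \<partial>lborel)) \<partial>lborel)"
          by (intro nn_integral_cong) (simp add: nn_integral_cmult)
        also have "\<dots> = ennreal (w \<theta>) * (\<integral>\<^sup>+\<tau>. ennreal (T \<tau> * (\<tau> * h \<theta> powr (1 - s)) powr p) * (\<integral>\<^sup>+x. Q \<theta> x \<tau> \<partial>lborel) \<partial>lborel)"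
          by (rule nn_integral_cmult) measurable
        also have "(\<integral>\<^sup>+\<tau>. ennreal (T \<tau> * (\<tau> * h \<theta> powr (1 - s)) powr p) * (\<integral>\<^sup>+x. Q \<theta> x \<tau> \<partial>lborel) \<partial>lborel)
          = (\<integral>\<^sup>+\<tau>. ennreal (indicator {0<..} \<tau> * (\<tau> powr (- 1 - s * p) * (\<tau> * h \<theta> powr (1 - s)) powr p)) * (\<integral>\<^sup>+x. mollified_power p \<epsilon> (x + \<tau> *\<^sub>R (\<theta>\<^sup>2 *\<^sub>R \<xi>), \<tau> * h \<theta>) \<partial>lborel) \<partial>lborel)"
          by (intro nn_integral_cong) (simp add: T_def Q_def arc_def h_def mult.assoc)
        also have "\<dots> = R"
          unfolding R_def by (rule nn_integral_dilated_path[OF _ \<open>0 < h \<theta>\<close> \<beta>]) measurable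
        finally show ?thesis .
      next
        case False
        then have "w \<theta> = 0" by (simp add: w_def)
        then show ?thesis by simp
      qed
    qed
    also have "\<dots> = (\<integral>\<^sup>+\<theta>. ennreal (w \<theta>) \<partial>lborel) * R" by (rule nn_integral_multc) measurable
    also have "?B * \<dots> \<le> ?B * (ennreal (arc_bound s \<xi>) * R)"
      unfolding w_def by (intro mult_left_mono mult_right_mono arc_mass[OF s]) auto
    also have "\<dots> = ennreal (arc_bound s \<xi> powr p) * R"
      using arc_bound_pos[OF s, of \<xi>] by (simp add: mult.assoc[symmetric] ennreal_mult'[symmetric] powr_diff)
    finally show ?thesis .
  qed
  have "(\<integral>\<^sup>+x. (\<integral>\<^sup>+y\<in>upper_half. ennreal (kernel_quotient (mollified \<epsilon>) p (s * p) x y) \<partial>lborel) \<partial>lborel)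
    = (\<integral>\<^sup>+x. \<integral>\<^sup>+\<tau>. \<integral>\<^sup>+\<xi>. ennreal (?k \<xi>) * (ennreal (T \<tau>) * ennreal (D x \<xi> \<tau>)) \<partial>lborel \<partial>lborel \<partial>lborel)"
    using T0 by (subst nn_integral_slopes) (auto intro!: nn_integral_cong simp: ennreal_mult'[symmetric] D_def T_def mult_ac)
  also have "\<dots> = (\<integral>\<^sup>+x. \<integral>\<^sup>+\<xi>. \<integral>\<^sup>+\<tau>. ennreal (?k \<xi>) * (ennreal (T \<tau>) * ennreal (D x \<xi> \<tau>)) \<partial>lborel \<partial>lborel \<partial>lborel)"
    by (intro nn_integral_cong lborel_pair.Fubini') measurable
  also have "\<dots> = (\<integral>\<^sup>+\<xi>. \<integral>\<^sup>+x. \<integral>\<^sup>+\<tau>. ennreal (?k \<xi>) * (ennreal (T \<tau>) * ennreal (D x \<xi> \<tau>)) \<partial>lborel \<partial>lborel \<partial>lborel)"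
    by (rule lborel_pair.Fubini') measurable
  also have "\<dots> = (\<integral>\<^sup>+\<xi>. \<integral>\<^sup>+\<tau>. \<integral>\<^sup>+x. ennreal (?k \<xi>) * (ennreal (T \<tau>) * ennreal (D x \<xi> \<tau>)) \<partial>lborel \<partial>lborel \<partial>lborel)"
    by (intro nn_integral_cong lborel_pair.Fubini') measurable
  also have "\<dots> = (\<integral>\<^sup>+\<xi>. ennreal (?k \<xi>) * (\<integral>\<^sup>+\<tau>. \<integral>\<^sup>+x. ennreal (T \<tau>) * ennreal (D x \<xi> \<tau>) \<partial>lborel \<partial>lborel) \<partial>lborel)"
    by (intro nn_integral_cong) (simp add: nn_integral_cmult)
  also have "\<dots> \<le> (\<integral>\<^sup>+\<xi>. ennreal (?k \<xi>) * (ennreal (arc_bound s \<xi> powr p) * R) \<partial>lborel)"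
    by (intro nn_integral_mono mult_left_mono slope) simp
  also have "\<dots> = (\<integral>\<^sup>+\<xi>. ennreal (arc_bound s \<xi> powr p * ?k \<xi>) * R \<partial>lborel)"
    by (intro nn_integral_cong) (simp add: ennreal_mult mult_ac)
  also have "\<dots> = (\<integral>\<^sup>+\<xi>. ennreal (arc_bound s \<xi> powr p * ?k \<xi>) \<partial>lborel) * R"
    by (rule nn_integral_multc) measurable
  finally show ?thesis unfolding R_def .
qed

section \<open>The inequality for powers of the barrier\<close>

text \<open>The mean of \<open>\<bar>\<omega>\<^sub>N\<bar> powr k\<close> over the unit sphere of dimension \<open>N - 1\<close>.\<close>

definition height_moment :: "nat \<Rightarrow> real \<Rightarrow> real" where
  "height_moment N k = Gamma ((k + 1) / 2) * Gamma (real N / 2) / (Gamma ((real N + k) / 2) * sqrt pi)"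

lemma Gamma_step: "0 < x \<Longrightarrow> Gamma (x + 1) = x * Gamma (x :: real)"
  by (rule Gamma_plus1) (auto elim!: nonpos_Ints_cases)

lemma height_moment_add_2:
  assumes "0 \<le> k" "0 < N"
  shows "height_moment N (k + 2) = (k + 1) / (real N + k) * height_moment N k"
proof -
  have e: "(k + 2 + 1) / 2 = (k + 1) / 2 + 1" "(real N + (k + 2)) / 2 = (real N + k) / 2 + 1" by simp_all
  have g: "Gamma ((k + 2 + 1) / 2) = (k + 1) / 2 * Gamma ((k + 1) / 2)"
    "Gamma ((real N + (k + 2)) / 2) = (real N + k) / 2 * Gamma ((real N + k) / 2)"
    unfolding e using assms by (intro Gamma_step; simp)+
  show ?thesis unfolding height_moment_def g using assms by simp
qed

lemma height_moment_0: "0 < N \<Longrightarrow> height_moment N 0 = 1"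
  using Gamma_real_pos[of "real N / 2"] by (simp add: height_moment_def Gamma_one_half_real less_imp_neq[symmetric])

lemma height_moment_2: "0 < N \<Longrightarrow> height_moment N 2 = 1 / real N"
  using height_moment_add_2[of 0 N] by (simp add: height_moment_0)

lemma Gamma_three_halves_real: "Gamma (3 / 2 :: real) = sqrt pi / 2"
  using Gamma_step[of "1 / 2"] by (simp add: Gamma_one_half_real)

lemma height_moment_1_2: "height_moment 2 1 = 2 / pi"
  by (simp add: height_moment_def Gamma_three_halves_real)

lemma height_moment_dim3: 
  assumes "0 \<le> k" shows "height_moment 3 k = 1 / (k + 1)"
proof -
  have e: "(real 3 + k) / 2 = (k + 1) / 2 + 1" by simp
  have g: "Gamma ((real 3 + k) / 2) = (k + 1) / 2 * Gamma ((k + 1) / 2)"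
    unfolding e using assms by (intro Gamma_step) simp
  have "0 < Gamma ((k + 1) / 2)" using assms by (intro Gamma_real_pos) simp
  then show ?thesis unfolding height_moment_def g using assms
    by (simp add: Gamma_three_halves_real less_imp_neq[symmetric])
qed

lemma height_moment_1_lower:
  assumes "3 \<le> N"
  shows "2 / (real N + 1) \<le> height_moment N 1"
  using assms
proof (induction N rule: less_induct)
  case (less N)
  consider "N = 3" | "N = 4" | "5 \<le> N" using less.prems by linarith
  then show ?case
  proof cases
    case 1
    then show ?thesis by (simp add: height_moment_dim3)
  next
    case 2
    have e: "(real 4 + 1) / 2 = (3 / 2 + 1 :: real)" "real 4 / 2 = (1 + 1 :: real)" by simp_all
    have v: "height_moment 4 1 = 4 / (3 * pi)"
    proof -
      have "Gamma (3 / 2 + 1 :: real) = 3 / 4 * sqrt pi" "Gamma (1 + 1 :: real) = 1"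
        using Gamma_step[of "3 / 2"] Gamma_step[of 1] by (simp_all add: Gamma_three_halves_real)
      then show ?thesis unfolding height_moment_def e by (simp only:) simp
    qed
    have "2 / 5 \<le> 4 / (3 * pi)" using pi_approx by (simp add: field_simps)
    then show ?thesis unfolding 2 v by simp
  next
    case 3
    define M where "M = N - 2"
    have M: "N = M + 2" "3 \<le> M" "M < N" using 3 by (simp_all add: M_def)
    have e: "real (M + 2) / 2 = real M / 2 + 1" "(real (M + 2) + 1) / 2 = (real M + 1) / 2 + 1" by simp_all
    have g: "Gamma (real (M + 2) / 2) = real M / 2 * Gamma (real M / 2)"
      "Gamma ((real (M + 2) + 1) / 2) = (real M + 1) / 2 * Gamma ((real M + 1) / 2)"
      unfolding e using M by (intro Gamma_step; simp)+
    have "height_moment N 1 = real M / (real M + 1) * height_moment M 1"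
      unfolding height_moment_def M(1) g by simp
    moreover have "real M / (real M + 1) * (2 / (real M + 1)) \<le> real M / (real M + 1) * height_moment M 1"
      by (intro mult_left_mono less.IH M) simp
    moreover have "2 / (real N + 1) \<le> real M / (real M + 1) * (2 / (real M + 1))"
      using M by (simp add: divide_simps) (simp add: algebra_simps)
    ultimately show ?thesis by linarith
  qed
qed

text \<open>The variable \<open>Z\<close> has the distribution of \<open>\<omega>\<^sub>N\<^sup>2\<close> for a uniform point \<open>\<omega>\<close> of the sphere. On the circle the two coordinates have the same distribution, which is the last assumption.\<close>

locale height_law = finite_measure M for M :: "'b measure" +
  fixes Z :: "'b \<Rightarrow> real" and N :: nat
  assumes total: "measure M (space M) = 1"
    and Z_measurable[measurable]: "Z \<in> borel_measurable M"
    and Z_pos: "0 < Z x" and Z_le_1: "Z x \<le> 1"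
    and N: "2 \<le> N"
    and moment: "0 \<le> k \<Longrightarrow> (LINT x|M. Z x powr (k / 2)) = height_moment N k"
    and swapped_moment: "N = 2 \<Longrightarrow> 0 < k \<Longrightarrow> (LINT x|M. (1 - Z x) powr (k / 2)) = height_moment N k"
begin

lemma integrable_bounded:
  fixes f :: "real \<Rightarrow> real"
  assumes "f \<in> borel_measurable borel" "\<And>z. 0 < z \<Longrightarrow> z \<le> 1 \<Longrightarrow> \<bar>f z\<bar> \<le> B"
  shows "integrable M (\<lambda>x. f (Z x))"
proof (rule integrable_const_bound[where B = B])
  show "(\<lambda>x. f (Z x)) \<in> borel_measurable M" using measurable_compose[OF Z_measurable assms(1)] .
qed (use assms(2) Z_pos Z_le_1 in auto)

lemma integrable_power: "0 \<le> k \<Longrightarrow> integrable M (\<lambda>x. Z x powr k)"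
  using integrable_bounded[of "\<lambda>z. z powr k" 1] by (simp add: powr_le1)

lemma mean_antimono:
  assumes "0 \<le> j" "j \<le> k"
  shows "height_moment N k \<le> height_moment N j"
proof -
  have "(LINT x|M. Z x powr (k / 2)) \<le> (LINT x|M. Z x powr (j / 2))"
    using assms Z_pos Z_le_1 by (intro integral_mono integrable_power) (auto intro!: powr_mono' intro: less_imp_le)
  then show ?thesis using assms by (simp add: moment)
qed

lemma height_moment_pos:
  assumes "0 \<le> k" shows "0 < height_moment N k"
  using assms N unfolding height_moment_def
  by (intro divide_pos_pos mult_pos_pos Gamma_real_pos) auto

text \<open>Jensen's inequality in the form needed here.\<close>

lemma moment_power_le:
  assumes "0 \<le> k" "1 \<le> r"
  shows "height_moment N k powr r \<le> height_moment N (k * r)"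
proof -
  define c where "c = height_moment N k"
  have c: "0 < c" unfolding c_def by (rule height_moment_pos[OF assms(1)])
  have "(LINT x|M. r * c powr (r - 1) * Z x powr (k / 2)) \<le> (LINT x|M. (Z x powr (k / 2)) powr r + (r - 1) * c powr r)"
  proof (rule integral_mono)
    show "integrable M (\<lambda>x. r * c powr (r - 1) * Z x powr (k / 2))"
      using assms by (intro integrable_mult_right integrable_power) auto
    have "integrable M (\<lambda>x. Z x powr (k * r / 2))" using assms by (intro integrable_power) auto
    then have "integrable M (\<lambda>x. (Z x powr (k / 2)) powr r)" by (simp add: powr_powr)
    then show "integrable M (\<lambda>x. (Z x powr (k / 2)) powr r + (r - 1) * c powr r)" by simp
    show "r * c powr (r - 1) * Z x powr (k / 2) \<le> (Z x powr (k / 2)) powr r + (r - 1) * c powr r" for x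
      using assms c by (intro powr_tangent) auto
  qed
  also have "(LINT x|M. (Z x powr (k / 2)) powr r + (r - 1) * c powr r) = height_moment N (k * r) + (r - 1) * c powr r"
    using assms integrable_power[of "k * r / 2"] moment[of "k * r"]
    by (subst Bochner_Integration.integral_add) (simp_all add: powr_powr total)
  finally have "r * c powr (r - 1) * c \<le> height_moment N (k * r) + (r - 1) * c powr r"
    using assms by (simp add: moment c_def)
  moreover have "c powr (r - 1) * c = c powr r" using c by (simp add: powr_diff)
  then have "r * c powr (r - 1) * c = r * c powr r" by (simp add: mult.assoc)
  ultimately have "c powr r \<le> height_moment N (k * r)" by (simp add: left_diff_distrib)
  then show ?thesis by (simp only: c_def)
qed

lemma barrier_le: "0 < s \<Longrightarrow> s < 1 \<Longrightarrow> 0 < z \<Longrightarrow> z \<le> 1 \<Longrightarrow> barrier s z \<le> 2 - z powr (s / 2)"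
  using mult_left_mono[OF powr_le1[of "s / 2 + 1" z], of "2 * s\<^sup>2 / 9"] by (simp add: barrier_def)

lemma two_minus_measurable: "(\<lambda>z :: real. (2 - z powr r) powr q) \<in> borel_measurable borel"
  by measurable

lemma two_minus_bounded:
  fixes z r q :: real
  assumes "0 < z" "z \<le> 1" "0 \<le> r" "0 \<le> q"
  shows "\<bar>(2 - z powr r) powr q\<bar> \<le> 2 powr q" "1 \<le> 2 - z powr r" "2 - z powr r \<le> 2"
proof -
  show *: "1 \<le> 2 - z powr r" "2 - z powr r \<le> 2" using powr_le1[of r z] assms by auto
  show "\<bar>(2 - z powr r) powr q\<bar> \<le> 2 powr q" using * assms by (auto intro: powr_mono2)
qed

lemma integrable_two_minus: "0 \<le> r \<Longrightarrow> 0 \<le> q \<Longrightarrow> integrable M (\<lambda>x. (2 - Z x powr r) powr q)"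
  by (rule integrable_bounded[where B = "2 powr q", OF two_minus_measurable two_minus_bounded(1)])

text \<open>In the variable \<open>y = Z powr (s / 2)\<close> the difference \<open>(N y) powr q - (2 - y) powr q\<close> is convex and vanishes at \<open>2 / (N + 1)\<close>, which does not exceed the mean of \<open>y\<close>. Integrate the tangent inequality at this zero.\<close>

lemma two_minus_small_exponent:
  assumes "3 \<le> N" "0 < s" "s < 1" "1 \<le> q" "q \<le> 2"
  shows "(LINT x|M. (2 - Z x powr (s / 2)) powr q) \<le> real N powr q * height_moment N (s * q)"
proof -
  define f where "f y = (real N * y) powr q - (2 - y) powr q" for y
  define f1 where "f1 y = q * real N * (real N * y) powr (q - 1) + q * (2 - y) powr (q - 1)" for y
  define f2 where "f2 y = q * (q - 1) * ((real N)\<^sup>2 * (real N * y) powr (q - 2) - (2 - y) powr (q - 2))" for y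
  define y0 where "y0 = 2 / (real N + 1)"
  have n: "3 \<le> real N" using assms by simp
  have y0: "0 < y0" "y0 < 1" "real N * y0 = 2 - y0" using n by (simp_all add: y0_def field_simps)
  have d1: "(f has_real_derivative f1 y) (at y)" if "y \<in> {0<..1}" for y
    unfolding f_def[abs_def] f1_def using that n
    by (auto intro!: derivative_eq_intros simp: algebra_simps)
  have d2: "(f1 has_real_derivative f2 y) (at y)" if "y \<in> {0<..1}" for y
    unfolding f1_def[abs_def] f2_def using that n
    by (auto intro!: derivative_eq_intros simp: algebra_simps power2_eq_square)
  have conv: "convex_on {0<..1} f"
  proof (rule f''_ge0_imp_convex[OF _ d1 d2])
    fix y :: real assume y: "y \<in> {0<..1}"
    have "(2 - y) powr (q - 2) \<le> 1 powr (q - 2)" using y assms by (intro powr_mono2') auto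
    also have "\<dots> \<le> (real N)\<^sup>2 * (real N) powr (q - 2)"
    proof -
      have "(real N)\<^sup>2 * (real N) powr (q - 2) = real N powr q" using n by (simp add: powr_diff)
      then show ?thesis using n assms by (simp add: ge_one_powr_ge_zero)
    qed
    also have "\<dots> \<le> (real N)\<^sup>2 * (real N * y) powr (q - 2)"
      using y assms n by (intro mult_left_mono powr_mono2') auto
    finally show "0 \<le> f2 y" unfolding f2_def using assms by (intro mult_nonneg_nonneg) auto
  qed simp
  have f1: "0 \<le> f1 y0" unfolding f1_def using assms y0 by simp
  have tangent: "f1 y0 * (y - y0) \<le> f y" if "0 < y" "y \<le> 1" for y
  proof -
    have "f y - f y0 \<ge> f1 y0 * (y - y0)"
      by (rule convex_on_imp_above_tangent[OF conv])
         (use that y0 in \<open>auto intro!: has_field_derivative_at_within d1 interiorI[of "{0<..<1}"]\<close>)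
    moreover have "f y0 = 0" by (simp add: f_def y0)
    ultimately show ?thesis by simp
  qed
  define Y where "Y x = Z x powr (s / 2)" for x
  have Y: "0 < Y x" "Y x \<le> 1" for x using Z_pos[of x] Z_le_1[of x] assms by (auto simp: Y_def intro: powr_le1)
  have iY: "integrable M Y" unfolding Y_def[abs_def] using assms by (intro integrable_power) auto
  have "integrable M (\<lambda>x. real N powr q * Z x powr (s * q / 2))"
    using assms by (intro integrable_mult_right integrable_power) auto
  moreover have NY: "(real N * Y x) powr q = real N powr q * Z x powr (s * q / 2)" for x
    unfolding Y_def by (simp add: powr_mult powr_powr)
  ultimately have i1: "integrable M (\<lambda>x. (real N * Y x) powr q)" by simp
  have i2: "integrable M (\<lambda>x. (2 - Y x) powr q)" unfolding Y_def using assms by (intro integrable_two_minus) auto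
  have "y0 \<le> height_moment N 1" unfolding y0_def by (rule height_moment_1_lower[OF assms(1)])
  also have "\<dots> \<le> height_moment N s" using assms by (intro mean_antimono) auto
  also have "\<dots> = (LINT x|M. Y x)" using assms by (simp add: moment Y_def)
  finally have "0 \<le> f1 y0 * ((LINT x|M. Y x) - y0)" using f1 by simp
  also have "\<dots> = (LINT x|M. f1 y0 * (Y x - y0))" using iY by (simp add: total)
  also have "\<dots> \<le> (LINT x|M. (real N * Y x) powr q - (2 - Y x) powr q)"
    using tangent[OF Y] iY i1 i2 by (intro integral_mono) (auto simp: f_def)
  also have "\<dots> = (LINT x|M. (real N * Y x) powr q) - (LINT x|M. (2 - Y x) powr q)"
    by (rule Bochner_Integration.integral_diff[OF i1 i2])
  also have "(LINT x|M. (real N * Y x) powr q) = real N powr q * height_moment N (s * q)"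
    using assms by (simp add: NY moment)
  finally show ?thesis by (simp add: Y_def)
qed

lemma two_minus_square:
  assumes "3 \<le> N" "0 < s" "s < 1"
  shows "(LINT x|M. (2 - Z x powr (s / 2))\<^sup>2) \<le> (real N)\<^sup>2 * height_moment N (2 * s)"
proof -
  have "(2 - Z x powr (s / 2)) powr 2 = (2 - Z x powr (s / 2))\<^sup>2" for x
    using two_minus_bounded(2)[OF Z_pos Z_le_1, of "s / 2" 1 x] assms by (simp add: powr_numeral)
  then show ?thesis using two_minus_small_exponent[of s 2] assms by (simp add: mult.commute)
qed

text \<open>All but two of the \<open>p\<close> factors are bounded by \<open>2\<close>, which reduces the claim to the square. For \<open>N \<ge> 4\<close> this loss is affordable.\<close>

lemma two_minus_large_dimension:
  assumes "4 \<le> N" "0 < s" "s < 1" "2 \<le> p"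
  shows "(LINT x|M. (2 - Z x powr (s / 2)) powr p) \<le> real N powr p * height_moment N (s * p)"
proof -
  define q where "q = height_moment N (2 * s)"
  have q: "0 < q" unfolding q_def using assms by (intro height_moment_pos) simp
  have n: "4 \<le> real N" using assms by simp
  have "1 / real N = height_moment N 2" using N by (simp add: height_moment_2)
  also have "\<dots> \<le> q" unfolding q_def using assms by (intro mean_antimono) auto
  finally have "1 \<le> real N * q" using n by (simp add: field_simps)
  then have nq: "4 \<le> (real N)\<^sup>2 * q" using mult_mono[of 4 "real N" 1 "real N * q"] n by (simp add: power2_eq_square mult.assoc)
  have "(LINT x|M. (2 - Z x powr (s / 2)) powr p) \<le> (LINT x|M. 2 powr (p - 2) * (2 - Z x powr (s / 2))\<^sup>2)"
  proof (rule integral_mono)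
    show "integrable M (\<lambda>x. (2 - Z x powr (s / 2)) powr p)" using assms by (intro integrable_two_minus) auto
    show "integrable M (\<lambda>x. 2 powr (p - 2) * (2 - Z x powr (s / 2))\<^sup>2)"
    proof (rule integrable_bounded[where f = "\<lambda>z. 2 powr (p - 2) * (2 - z powr (s / 2))\<^sup>2" and B = "2 powr (p - 2) * 2\<^sup>2"])
      fix z :: real assume z: "0 < z" "z \<le> 1"
      have "(2 - z powr (s / 2))\<^sup>2 \<le> 2\<^sup>2"
        using two_minus_bounded(2,3)[OF z, of "s / 2" 1] assms by (intro power_mono) auto
      then show "\<bar>2 powr (p - 2) * (2 - z powr (s / 2))\<^sup>2\<bar> \<le> 2 powr (p - 2) * 2\<^sup>2" by (simp add: abs_mult)
    qed measurable
    fix x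
    define X where "X = 2 - Z x powr (s / 2)"
    have X: "1 \<le> X" "X \<le> 2" unfolding X_def using two_minus_bounded(2,3)[OF Z_pos Z_le_1, of "s / 2" 1 x] assms by auto
    have "X powr p = X powr (p - 2) * X\<^sup>2" using X by (simp add: powr_diff)
    also have "\<dots> \<le> 2 powr (p - 2) * X\<^sup>2" using X assms by (intro mult_right_mono powr_mono2) auto
    finally show "(2 - Z x powr (s / 2)) powr p \<le> 2 powr (p - 2) * (2 - Z x powr (s / 2))\<^sup>2" by (simp only: X_def)
  qed
  also have "\<dots> \<le> 2 powr (p - 2) * ((real N)\<^sup>2 * q)"
    using two_minus_square[of s] assms by (simp add: q_def)
  also have "2 powr (p - 2) = 4 powr (p / 2 - 1)"
  proof -
    have "4 powr (p / 2 - 1) = (2 powr 2) powr (p / 2 - 1)" by (simp add: powr_numeral)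
    also have "\<dots> = 2 powr (p - 2)" by (simp only: powr_powr) (simp add: algebra_simps)
    finally show ?thesis by simp
  qed
  also have "4 powr (p / 2 - 1) * ((real N)\<^sup>2 * q) \<le> ((real N)\<^sup>2 * q) powr (p / 2 - 1) * ((real N)\<^sup>2 * q)"
    using nq assms by (intro mult_right_mono powr_mono2) auto
  also have "\<dots> = ((real N)\<^sup>2 * q) powr (p / 2)" using nq by (simp add: powr_diff)
  also have "\<dots> = real N powr p * q powr (p / 2)"
    using n q by (simp add: powr_mult powr_powr flip: powr_numeral)
  also have "\<dots> \<le> real N powr p * height_moment N (2 * s * (p / 2))"
    unfolding q_def using assms by (intro mult_left_mono moment_power_le) auto
  finally show ?thesis by simp
qed

text \<open>In dimension three \<open>sqrt Z\<close> is uniformly distributed. Exponents between \<open>2\<close> and \<open>4\<close> are reached by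
  interpolation, larger ones by the crude bound \<open>2\<close> for the length.\<close>

lemma two_minus_dim3:
  assumes "N = 3" "0 < s" "s < 1" "2 \<le> p"
  shows "(LINT x|M. (2 - Z x powr (s / 2)) powr p) \<le> real N powr p * height_moment N (s * p)"
proof (cases "4 \<le> p")
  case True
  have "(LINT x|M. (2 - Z x powr (s / 2)) powr p) \<le> (LINT x|M. 2 powr p)"
  proof (rule integral_mono)
    fix x show "(2 - Z x powr (s / 2)) powr p \<le> 2 powr p"
      using two_minus_bounded(1)[OF Z_pos Z_le_1, of "s / 2" p x] assms by auto
  qed (use assms in \<open>auto intro: integrable_two_minus\<close>)
  also have "\<dots> = (16 :: real) powr (p / 4)"
  proof -
    have "(16 :: real) powr (p / 4) = (2 powr 4) powr (p / 4)" by (simp add: powr_numeral)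
    also have "\<dots> = 2 powr p" by (simp only: powr_powr) simp
    finally show ?thesis by (simp add: total)
  qed
  also have "\<dots> \<le> (3 ^ 4 * height_moment N (4 * s)) powr (p / 4)"
  proof (rule powr_mono2)
    show "16 \<le> 3 ^ 4 * height_moment N (4 * s)"
      using assms by (simp add: height_moment_dim3 divide_simps)
  qed (use assms in auto)
  also have "\<dots> = 3 powr p * height_moment N (4 * s) powr (p / 4)"
    using height_moment_pos[of "4 * s"] assms by (simp add: powr_mult powr_powr flip: powr_numeral)
  also have "\<dots> \<le> 3 powr p * height_moment N (4 * s * (p / 4))"
    using assms True by (intro mult_left_mono moment_power_le) auto
  finally show ?thesis using assms by simp
next
  case False
  define t where "t = p / 2 - 1"
  have t: "0 \<le> t" "t \<le> 1" "p / 2 = 1 + t" using assms False by (simp_all add: t_def)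
  define K where "K = 9 / (2 * s + 1)"
  have K: "0 < K" using assms by (simp add: K_def)
  define X where "X x = (2 - Z x powr (s / 2))\<^sup>2" for x
  have X: "1 \<le> X x" for x
    unfolding X_def using two_minus_bounded(2)[OF Z_pos Z_le_1, of "s / 2" 1 x] assms by (simp add: one_le_power)
  have Zp: "(Z x powr (s / 2)) ^ j = Z x powr (real j * s / 2)" for x and j :: nat
    using Z_pos[of x] by (simp add: powr_realpow[symmetric] powr_powr mult_ac)
  have m: "(LINT x|M. (Z x powr (s / 2)) ^ j) = 1 / (real j * s + 1)" for j
    using moment[of "real j * s"] assms by (simp add: Zp height_moment_dim3)
  have ip: "integrable M (\<lambda>x. (Z x powr (s / 2)) ^ j)" for j
    unfolding Zp using assms by (intro integrable_power) auto
  have sq: "X x = 4 - 4 * (Z x powr (s / 2)) ^ 1 + (Z x powr (s / 2)) ^ 2" for x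
    by (simp add: X_def power2_eq_square algebra_simps)
  have quart: "(X x)\<^sup>2 = 16 - 32 * (Z x powr (s / 2)) ^ 1 + 24 * (Z x powr (s / 2)) ^ 2
      - 8 * (Z x powr (s / 2)) ^ 3 + (Z x powr (s / 2)) ^ 4" for x
    by (simp add: X_def power2_eq_square power3_eq_cube power4_eq_xxxx algebra_simps)
  have iX: "integrable M X" "integrable M (\<lambda>x. (X x)\<^sup>2)"
    unfolding sq[abs_def] quart[unfolded sq, abs_def]
    using ip by (auto simp only: intro!: Bochner_Integration.integrable_add Bochner_Integration.integrable_diff integrable_mult_right integrable_const) 
  have EX: "(LINT x|M. X x) \<le> K"
    using two_minus_square[of s] assms by (simp add: X_def K_def height_moment_dim3)
  have "(LINT x|M. (X x)\<^sup>2) = 16 - 32 / (s + 1) + 24 / (2 * s + 1) - 8 / (3 * s + 1) + 1 / (4 * s + 1)"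
    unfolding quart using ip[of 1] ip[of 2] ip[of 3] ip[of 4] m[of 1] m[of 2] m[of 3] m[of 4]
    by (simp add: total)
  also have "\<dots> \<le> K\<^sup>2"
  proof -
    have pos: "0 < s + 1" "0 < 2 * s + 1" "0 < 3 * s + 1" "0 < 4 * s + 1" using assms by auto
    define A B C D where "A = s + 1" and "B = 2 * s + 1" and "C = 3 * s + 1" and "D = 4 * s + 1"
    have ne: "0 < A" "0 < B" "0 < C" "0 < D" using pos by (simp_all add: A_def B_def C_def D_def)
    have "81 / B\<^sup>2 - (16 - 32 / A + 24 / B - 8 / C + 1 / D)
      = (81 * (A * C * D) - 16 * (A * B * B * C * D) + 32 * (B * B * C * D) - 24 * (A * B * C * D)
         + 8 * (A * B * B * D) - A * B * B * C) / (A * B * B * C * D)"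
      using ne by (simp add: field_simps power2_eq_square)
    also have "81 * (A * C * D) - 16 * (A * B * B * C * D) + 32 * (B * B * C * D) - 24 * (A * B * C * D)
         + 8 * (A * B * B * D) - A * B * B * C
      = 80 + 1428 * s ^ 2 - 908 * s ^ 4 + 544 * s ^ 3 + 632 * s - 768 * s ^ 5"
      unfolding A_def B_def C_def D_def by algebra
    also have "0 \<le> (80 + 1428 * s ^ 2 - 908 * s ^ 4 + 544 * s ^ 3 + 632 * s - 768 * s ^ 5) / (A * B * B * C * D)"
    proof -
      have "s ^ 4 \<le> s ^ 2" "s ^ 5 \<le> s ^ 3" "s ^ 5 \<le> s ^ 1"
        using assms by (intro power_decreasing; simp)+
      moreover have "0 \<le> s ^ 2" "0 \<le> s ^ 3" using assms by simp_all
      ultimately have "0 \<le> 80 + 1428 * s ^ 2 - 908 * s ^ 4 + 544 * s ^ 3 + 632 * s - 768 * s ^ 5"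
        using assms unfolding power_one_right by linarith
      then show ?thesis using ne by simp
    qed
    finally have "16 - 32 / A + 24 / B - 8 / C + 1 / D \<le> 81 / B\<^sup>2" by simp
    then show ?thesis by (simp add: K_def A_def B_def C_def D_def power_divide)
  qed
  finally have EX2: "(LINT x|M. (X x)\<^sup>2) \<le> K\<^sup>2" .
  have pt: "X x powr (1 + t) \<le> (1 - t) * K powr t * X x + t * K powr t / K * (X x)\<^sup>2" for x
  proof -
    have "(X x / K) powr t * 1 powr (1 - t) \<le> t * (X x / K) + (1 - t) * 1"
      using t K X[of x] by (intro Youngs_inequality_0) auto
    then have "X x powr t \<le> K powr t * (t * (X x / K) + (1 - t))"
      using K X[of x] by (simp add: powr_divide field_simps)
    then have "X x * X x powr t \<le> X x * (K powr t * (t * (X x / K) + (1 - t)))"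
      using X[of x] by (intro mult_left_mono) auto
    moreover have "X x powr (1 + t) = X x * X x powr t" using X[of x] by (simp add: powr_add)
    ultimately show ?thesis by (simp add: algebra_simps power2_eq_square)
  qed
  have Xp: "(2 - Z x powr (s / 2)) powr p = X x powr (1 + t)" for x
  proof -
    have "X x powr (p / 2) = (2 - Z x powr (s / 2)) powr p"
      unfolding X_def using two_minus_bounded(2)[OF Z_pos Z_le_1, of "s / 2" 1 x] assms
      by (simp add: powr_powr flip: powr_numeral)
    then show ?thesis by (simp only: t)
  qed
  have "(LINT x|M. (2 - Z x powr (s / 2)) powr p)
    \<le> (LINT x|M. (1 - t) * K powr t * X x + t * K powr t / K * (X x)\<^sup>2)"
  proof (rule integral_mono)
    show "integrable M (\<lambda>x. (2 - Z x powr (s / 2)) powr p)" using assms by (intro integrable_two_minus) auto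
    show "integrable M (\<lambda>x. (1 - t) * K powr t * X x + t * K powr t / K * (X x)\<^sup>2)"
      by (intro Bochner_Integration.integrable_add integrable_mult_right iX)
  qed (simp only: Xp pt)
  also have "\<dots> = (1 - t) * K powr t * (LINT x|M. X x) + t * K powr t / K * (LINT x|M. (X x)\<^sup>2)"
    using iX by simp
  also have "\<dots> \<le> (1 - t) * K powr t * K + t * K powr t / K * K\<^sup>2"
    using t K EX EX2 by (intro add_mono mult_left_mono) auto
  also have "\<dots> = K powr (p / 2)"
    using K by (simp only: t powr_add) (simp add: power2_eq_square algebra_simps)
  also have "\<dots> = 3 powr p * height_moment N (2 * s) powr (p / 2)"
  proof -
    have "K = 3\<^sup>2 * height_moment N (2 * s)" using assms by (simp add: K_def height_moment_dim3)
    then show ?thesis using height_moment_pos[of "2 * s"] assms by (simp add: powr_mult powr_powr flip: powr_numeral)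
  qed
  also have "\<dots> \<le> 3 powr p * height_moment N (2 * s * (p / 2))"
    using assms by (intro mult_left_mono moment_power_le) auto
  finally show ?thesis using assms by simp
qed

text \<open>The moments of orders \<open>1\<close> and \<open>2\<close> are explicit, and Young's inequality interpolates the first between the orders \<open>s\<close> and \<open>2\<close>.\<close>

lemma first_moment_lower_dim2:
  assumes "N = 2" "0 < s" "s < 1"
  shows "2 / pi * (1 + (1 - s) * (1 - pi / 4)) \<le> height_moment N s"
proof -
  define c where "c = pi / 4"
  have c: "0 < c" "c < 1" using pi_less_4 by (simp_all add: c_def)
  define r where "r = 1 / (2 - s)"
  have r: "0 < r" "r < 1" using assms by (simp_all add: r_def)
  have rs: "s * r + 2 * (1 - r) = 1" using assms by (simp add: r_def divide_simps)
  have pt: "Z x powr (1 / 2) / c \<le> r * c powr (- s) * Z x powr (s / 2) + (1 - r) / c\<^sup>2 * Z x powr (2 / 2)" for x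
  proof -
    define y where "y = Z x powr (1 / 2)"
    have y: "0 < y" using Z_pos[of x] by (simp add: y_def)
    have "((y / c) powr s) powr r * ((y / c) powr 2) powr (1 - r) \<le> r * (y / c) powr s + (1 - r) * (y / c) powr 2"
      using r c y by (intro Youngs_inequality_0) auto
    also have "((y / c) powr s) powr r * ((y / c) powr 2) powr (1 - r) = (y / c) powr (s * r + 2 * (1 - r))"
      by (simp add: powr_powr powr_add)
    also have "\<dots> = y / c" unfolding rs using y c by simp
    finally have "y / c \<le> r * (y / c) powr s + (1 - r) * (y / c) powr 2" .
    moreover have "(y / c) powr s = c powr (- s) * Z x powr (s / 2)"
      using c Z_pos[of x] by (simp add: y_def powr_divide powr_powr powr_minus_divide)
    moreover have "(y / c) powr 2 = Z x powr (2 / 2) / c\<^sup>2"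
      using c Z_pos[of x] by (simp add: y_def powr_divide powr_powr powr_numeral)
    ultimately show ?thesis by (simp add: y_def)
  qed
  have "(LINT x|M. Z x powr (1 / 2) / c) \<le> (LINT x|M. r * c powr (- s) * Z x powr (s / 2) + (1 - r) / c\<^sup>2 * Z x powr (2 / 2))"
    using assms pt by (intro integral_mono Bochner_Integration.integrable_add integrable_divide integrable_mult_right integrable_power) auto
  also have "\<dots> = r * c powr (- s) * height_moment N s + (1 - r) / c\<^sup>2 * height_moment N 2"
    using assms moment[of s] moment[of 2] integrable_power[of "s / 2"] integrable_power[of "2 / 2"]
    by (subst Bochner_Integration.integral_add) (auto simp del: powr_one)
  finally have "height_moment N 1 / c \<le> r * c powr (- s) * height_moment N s + (1 - r) / c\<^sup>2 * height_moment N 2"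
    using moment[of 1] by simp
  moreover have h: "height_moment N 1 = 1 / (2 * c)" "height_moment N 2 = 1 / 2"
    using assms by (simp_all add: height_moment_1_2 height_moment_2 c_def)
  ultimately have "1 / (2 * c\<^sup>2) \<le> r * c powr (- s) * height_moment N s + (1 - r) / (2 * c\<^sup>2)"
    by (simp add: power2_eq_square)
  then have "r * (1 / (2 * c\<^sup>2)) \<le> r * (c powr (- s) * height_moment N s)"
    by (simp add: diff_divide_distrib algebra_simps)
  then have "1 / (2 * c\<^sup>2) \<le> c powr (- s) * height_moment N s" by (rule mult_left_le_imp_le[OF _ r(1)])
  then have "c powr s * (1 / (2 * c\<^sup>2)) \<le> c powr s * (c powr (- s) * height_moment N s)" by (rule mult_left_mono) simp
  also have "\<dots> = height_moment N s" using c by (simp add: powr_minus)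
  also have "c powr s * (1 / (2 * c\<^sup>2)) = 1 / (2 * c) * (1 / c) powr (1 - s)"
    using c by (simp add: powr_divide powr_diff power2_eq_square)
  finally have le: "1 / (2 * c) * (1 / c) powr (1 - s) \<le> height_moment N s" .
  have "1 + (1 - s) * (1 - c) \<le> (1 / c) powr (1 - s)"
  proof -
    have "ln c \<le> c - 1" using c by (intro ln_le_minus_one)
    then have "(1 - s) * (1 - c) \<le> (1 - s) * ln (1 / c)" using assms c by (intro mult_left_mono) (auto simp: ln_div)
    also have "1 + (1 - s) * ln (1 / c) \<le> exp ((1 - s) * ln (1 / c))" by (rule exp_ge_add_one_self)
    also have "\<dots> = (1 / c) powr (1 - s)" using c by (simp add: powr_def)
    finally show ?thesis by simp
  qed
  then have "1 / (2 * c) * (1 + (1 - s) * (1 - c)) \<le> 1 / (2 * c) * (1 / c) powr (1 - s)"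
    using c by (intro mult_left_mono) auto
  then show ?thesis using le by (simp add: c_def)
qed

text \<open>The recursion for the moments expresses the mean of the barrier by the single moment of order \<open>s\<close>. The remaining inequality says that this moment is not too small.\<close>

lemma barrier_mean_dim2:
  assumes "N = 2" "0 < s" "s < 1"
  shows "(LINT x|M. barrier s (Z x) / 2) \<le> height_moment N s"
proof -
  define b where "b = 2 * s\<^sup>2 / 9"
  define A where "A = height_moment N s"
  have A0: "0 < A" unfolding A_def using assms by (intro height_moment_pos) simp
  have "(LINT x|M. barrier s (Z x) / 2) = (LINT x|M. (2 - b) / 2 - Z x powr (s / 2) / 2 + b / 2 * Z x powr ((s + 2) / 2))"
    by (intro Bochner_Integration.integral_cong refl) (simp add: barrier_def b_def diff_divide_distrib add_divide_distrib)
  also have "\<dots> = (2 - b) / 2 - A / 2 + b / 2 * height_moment N (s + 2)"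
    using assms moment[of s] moment[of "s + 2"] integrable_power[of "s / 2"] integrable_power[of "(s + 2) / 2"]
    by (simp add: A_def total)
  also have "height_moment N (s + 2) = (s + 1) / (s + 2) * A"
    using assms by (subst height_moment_add_2) (simp_all add: A_def add.commute)
  finally have eq: "(LINT x|M. barrier s (Z x) / 2) = (2 - b) / 2 - A / 2 + b / 2 * ((s + 1) / (s + 2) * A)" .
  have b: "0 \<le> b" by (simp add: b_def)
  have "(s + 1) / (s + 2) * A \<le> 2 / 3 * A" using assms A0 by (intro mult_right_mono) (simp_all add: divide_simps)
  then have "b / 2 * ((s + 1) / (s + 2) * A) \<le> b / 2 * (2 / 3 * A)" using b by (intro mult_left_mono) auto
  moreover have "2 - b \<le> A * (3 - 2 * b / 3)"
  proof -
    have "6366 / 10000 * (1 + (1 - s) * (2145 / 10000)) \<le> 2 / pi * (1 + (1 - s) * (1 - pi / 4))"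
      using assms pi_approx by (intro mult_mono add_mono) (auto simp: field_simps)
    also have "\<dots> \<le> A" unfolding A_def by (rule first_moment_lower_dim2[OF assms])
    finally have A: "6366 / 10000 * (1 + (1 - s) * (2145 / 10000)) \<le> A" .
    have s2: "s ^ 2 \<le> 1" "2 * s - 1 \<le> s ^ 2"
      using assms sum_squares_ge_zero[of "s - 1" 0] mult_mono[of s 1 s 1] by (auto simp: power2_eq_square algebra_simps)
    moreover have "0 \<le> s ^ 3" using assms by simp
    ultimately have s2: "s ^ 2 \<le> 1" "2 * s - 1 \<le> s ^ 2" "0 \<le> s ^ 3" by simp_all
    have b1: "b \<le> 1" using s2 by (simp add: b_def)
    have "2 - b \<le> 6366 / 10000 * (1 + (1 - s) * (2145 / 10000)) * (3 - 2 * b / 3)"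
    proof -
      have "2 - b \<le> 6366 / 10000 * (36435 / 10000 - 6435 / 10000 * s - 4858 / 27000 * s ^ 2 + 858 / 27000 * s ^ 3)"
      proof -
        have "2 - 2 * q / 9 \<le> 6366 / 10000 * (36435 / 10000 - 6435 / 10000 * s - 4858 / 27000 * q + 858 / 27000 * c)"
          if "2 * s - 1 \<le> q" "0 \<le> c" for q c :: real
          using that assms by (simp add: field_simps)
        then show ?thesis using s2 unfolding b_def by blast
      qed
      also have "\<dots> = 6366 / 10000 * (1 + (1 - s) * (2145 / 10000)) * (3 - 2 * b / 3)"
        unfolding b_def by (simp add: field_simps power2_eq_square power3_eq_cube)
      finally show ?thesis by simp
    qed
    also have "\<dots> \<le> A * (3 - 2 * b / 3)" using A b1 by (intro mult_right_mono) auto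
    finally show ?thesis .
  qed
  moreover have "b / 2 * (2 / 3 * A) = A * b / 3" "A * (3 - 2 * b / 3) = 3 * A - 2 * (A * b / 3)"
    by (simp_all add: algebra_simps)
  moreover have "(2 - b) / 2 - A / 2 + W \<le> A" if "W \<le> X" "2 - b \<le> 3 * A - 2 * X" for W X
    using that by (simp add: field_simps)
  ultimately show ?thesis unfolding eq A_def[symmetric] by metis
qed

text \<open>The next three lemmas concern \<open>N = 2\<close>. The functions \<open>(1 - z) powr (s / 2)\<close> and \<open>barrier s z / 2\<close> cross at
  most once, so that the comparison of their means carries over to all powers.\<close>

lemma barrier_decreasing:
  assumes "0 < s" "s < 1" "0 < z" "z \<le> z'" "z' \<le> 1"
  shows "barrier s z' \<le> barrier s z"
proof (rule DERIV_nonpos_imp_nonincreasing[OF assms(4)])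
  fix y assume y: "z \<le> y" "y \<le> z'"
  then have y0: "0 < y" "y \<le> 1" using assms by auto
  have "s * (s + 2) \<le> 1 * 3" using assms by (intro mult_mono) auto
  then have "2 * s * (s + 2) / 9 \<le> 1" by (simp add: algebra_simps)
  then have "2 * s * (s + 2) / 9 * y \<le> 1 * 1" using y0 assms by (intro mult_mono) auto
  then have "(s / 2 * y powr (s / 2 - 1)) * (2 * s * (s + 2) / 9 * y) \<le> (s / 2 * y powr (s / 2 - 1)) * 1"
    using assms by (intro mult_left_mono) auto
  moreover have "y powr (s / 2) = y powr (s / 2 - 1) * y" using y0 by (simp add: powr_diff)
  ultimately have "- (s / 2 * y powr (s / 2 - 1)) + (2 * s\<^sup>2 / 9) * ((s / 2 + 1) * y powr (s / 2)) \<le> 0"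
    by (simp add: algebra_simps power2_eq_square add_divide_distrib)
  then show "\<exists>d. (barrier s has_real_derivative d) (at y) \<and> d \<le> 0"
    using barrier_deriv[OF y0(1)] by blast
qed

text \<open>On the interval from \<open>0\<close> to \<open>z1\<close> the left-hand side lies below its chord and the right-hand side above its chord, and the chords are ordered at both ends.\<close>

lemma crossing_monotone:
  assumes s: "0 < s" "s < 1" and z: "0 < z" "z \<le> z1" "z1 \<le> 1"
    and le: "barrier s z1 / 2 \<le> (1 - z1) powr (s / 2)"
  shows "barrier s z / 2 \<le> (1 - z) powr (s / 2)"
proof -
  define t where "t = s / 2"
  define b where "b = 2 * s\<^sup>2 / 9"
  define l where "l = z / z1"
  have b: "0 \<le> b" by (simp add: b_def)
  have t: "0 < t" "t < 1" using s by (simp_all add: t_def)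
  have z1: "z1 < 1"
  proof (rule ccontr)
    assume "\<not> z1 < 1"
    then have "z1 = 1" using z by simp
    then show False using le barrier_pos[of s 1] s by simp
  qed
  have l: "0 < l" "l \<le> 1" "z = l * z1" using z by (simp_all add: l_def)
  have m: "0 < 1 - z" using z z1 by simp
  have tan: "x powr t \<le> (1 - z) powr t + t * (1 - z) powr t / (1 - z) * (x - (1 - z))" if "0 < x" for x
  proof -
    have "(x / (1 - z)) powr t * 1 powr (1 - t) \<le> t * (x / (1 - z)) + (1 - t) * 1"
      using t m that by (intro Youngs_inequality_0) auto
    then have "x powr t \<le> (1 - z) powr t * (t * (x / (1 - z)) + (1 - t))"
      using that m by (simp add: powr_divide divide_le_eq mult.commute)
    also have "\<dots> = (1 - z) powr t + t * (1 - z) powr t / (1 - z) * (x - (1 - z))"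
      using m by (simp add: field_simps)
    finally show ?thesis .
  qed
  define d where "d = t * (1 - z) powr t / (1 - z)"
  have "l * (1 - z1) powr t + (1 - l) * 1 powr t
    \<le> l * ((1 - z) powr t + d * ((1 - z1) - (1 - z))) + (1 - l) * ((1 - z) powr t + d * (1 - (1 - z)))"
    unfolding d_def using l z1 by (intro add_mono mult_left_mono tan) auto
  also have "\<dots> = (1 - z) powr t" using l(3) by (simp add: algebra_simps)
  finally have U: "l * (1 - z1) powr t + (1 - l) \<le> (1 - z) powr t" by simp
  have V1: "l * z1 powr t \<le> z powr t"
    using l t powr_mono'[of t 1 l] by (simp add: powr_mult mult_right_mono)
  have V2: "z powr (t + 1) \<le> l * z1 powr (t + 1)"
    using l t powr_mono'[of 1 "t + 1" l] by (simp add: powr_mult mult_right_mono)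
  have "barrier s z = 2 - b - z powr t + b * z powr (t + 1)" by (simp add: barrier_def b_def t_def)
  also have "\<dots> \<le> 2 - b - l * z1 powr t + b * (l * z1 powr (t + 1))"
    using V1 mult_left_mono[OF V2 b] by linarith
  also have "\<dots> = l * barrier s z1 + (1 - l) * (2 - b)"
    by (simp add: barrier_def b_def[symmetric] t_def[symmetric]) (simp add: algebra_simps)
  also have "\<dots> \<le> l * (2 * (1 - z1) powr t) + (1 - l) * 2"
    using l le b by (intro add_mono mult_left_mono) (auto simp: t_def)
  also have "\<dots> \<le> 2 * (1 - z) powr t" using U by simp
  finally show ?thesis by (simp add: t_def)
qed

text \<open>The constant \<open>c\<close> lies below the values of \<open>barrier s z / 2\<close> where \<open>(1 - z) powr (s / 2)\<close> is at least as large, and above them elsewhere. So in the tangent inequality for \<open>y powr p\<close> at \<open>barrier s z / 2\<close> the slope may be replaced by the slope at \<open>c\<close>, which is constant and can be integrated.\<close>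

lemma single_crossing:
  assumes s: "0 < s" "s < 1" and p: "1 \<le> p"
  obtains c where "0 < c" "\<And>z. 0 < z \<Longrightarrow> z \<le> 1 \<Longrightarrow>
    p * c powr (p - 1) * ((1 - z) powr (s / 2) - barrier s z / 2)
      \<le> ((1 - z) powr (s / 2)) powr p - (barrier s z / 2) powr p"
proof -
  define U where "U z = (1 - z) powr (s / 2)" for z
  define V where "V z = barrier s z / 2" for z
  have V0: "0 < V z" if "0 < z" "z \<le> 1" for z using barrier_pos[OF s that] by (simp add: V_def)
  have anti: "V z' \<le> V z" if "0 < z" "z \<le> z'" "z' \<le> 1" for z z'
    using barrier_decreasing[OF s that] by (simp add: V_def)
  have mono: "V z \<le> U z" if "0 < z" "z \<le> z1" "z1 \<le> 1" "V z1 \<le> U z1" for z z1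
    using crossing_monotone[OF s that(1-3)] that(4) by (simp add: U_def V_def)
  have "\<exists>c>0. \<forall>z. 0 < z \<and> z \<le> 1 \<longrightarrow> (V z \<le> U z \<longrightarrow> c \<le> V z) \<and> (U z < V z \<longrightarrow> V z \<le> c)"
  proof (cases "\<exists>z. 0 < z \<and> z \<le> 1 \<and> V z \<le> U z")
    case False
    have "V z \<le> 1" if "0 < z" "z \<le> 1" for z
      using barrier_le[OF s that] powr_ge_zero[of z "s / 2"] unfolding V_def by linarith
    then show ?thesis using False by (intro exI[of _ 1]) auto
  next
    case True
    define S where "S = {z. 0 < z \<and> z \<le> 1 \<and> V z \<le> U z}"
    have S: "S \<noteq> {}" "bdd_above S" using True by (auto simp: S_def)
    define w where "w = Sup S"
    obtain z0 where z0: "z0 \<in> S" using S by blast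
    have w: "0 < w" "w \<le> 1"
      using cSup_upper[OF z0 S(2)] z0 S(1) by (auto simp: w_def S_def intro!: cSup_least intro: less_le_trans)
    show ?thesis
    proof (intro exI[of _ "V w"] conjI allI impI)
      show "0 < V w" by (rule V0[OF w])
      fix z :: real assume z: "0 < z \<and> z \<le> 1"
      show "V w \<le> V z" if "V z \<le> U z"
      proof -
        have "z \<in> S" using z that by (simp add: S_def)
        then have "z \<le> w" unfolding w_def by (rule cSup_upper[OF _ S(2)])
        then show ?thesis using z w by (intro anti) auto
      qed
      show "V z \<le> V w" if "U z < V z"
      proof (rule anti[OF w(1)])
        show "w \<le> z" unfolding w_def
        proof (rule cSup_least[OF S(1)])
          fix z1 assume "z1 \<in> S"
          then show "z1 \<le> z" using mono[of z z1] z that by (force simp: S_def)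
        qed
      qed (use z in simp)
    qed
  qed
  then obtain c where c: "0 < c" "\<And>z. 0 < z \<Longrightarrow> z \<le> 1 \<Longrightarrow> V z \<le> U z \<Longrightarrow> c \<le> V z"
    "\<And>z. 0 < z \<Longrightarrow> z \<le> 1 \<Longrightarrow> U z < V z \<Longrightarrow> V z \<le> c" by metis
  show ?thesis
  proof (rule that[OF c(1)])
    fix z :: real assume z: "0 < z" "z \<le> 1"
    have "p * V z powr (p - 1) * U z \<le> U z powr p + (p - 1) * V z powr p"
      using p V0[OF z] by (intro powr_tangent) (auto simp: U_def)
    moreover have "V z powr (p - 1) * V z = V z powr p" using V0[OF z] by (simp add: powr_diff)
    then have "p * V z powr (p - 1) * V z = p * V z powr p" by (simp add: mult.assoc)
    ultimately have 1: "p * V z powr (p - 1) * (U z - V z) \<le> U z powr p - V z powr p"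
      unfolding right_diff_distrib left_diff_distrib mult_1 by linarith
    have "p * c powr (p - 1) * (U z - V z) \<le> p * V z powr (p - 1) * (U z - V z)"
    proof (cases "V z \<le> U z")
      case True
      then show ?thesis using c z p by (intro mult_right_mono mult_left_mono powr_mono2) auto
    next
      case False
      then have "V z powr (p - 1) \<le> c powr (p - 1)" using c z p V0[OF z] by (intro powr_mono2) auto
      then have "p * V z powr (p - 1) \<le> p * c powr (p - 1)" using p by (intro mult_left_mono) auto
      then show ?thesis using False by (intro mult_right_mono_neg) auto
    qed
    with 1 show "p * c powr (p - 1) * ((1 - z) powr (s / 2) - barrier s z / 2)
      \<le> ((1 - z) powr (s / 2)) powr p - (barrier s z / 2) powr p"
      by (simp add: U_def V_def)
  qed
qed

lemma barrier_bounded: "0 < s \<Longrightarrow> s < 1 \<Longrightarrow> 0 < z \<Longrightarrow> z \<le> 1 \<Longrightarrow> \<bar>barrier s z\<bar> \<le> 2"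
  using barrier_le[of s z] barrier_pos[of s z] by (smt (verit) powr_ge_zero)

lemma barrier_measurable: "barrier s \<in> borel_measurable borel"
  unfolding barrier_def[abs_def] by measurable

lemma integrable_barrier_powr:
  assumes "0 < s" "s < 1" "1 \<le> p"
  shows "integrable M (\<lambda>x. barrier s (Z x) powr p)"
proof (rule integrable_bounded[where f = "\<lambda>z. barrier s z powr p" and B = "2 powr p"])
  note [measurable] = barrier_measurable
  show "(\<lambda>z. barrier s z powr p) \<in> borel_measurable borel" by measurable
  fix z :: real assume "0 < z" "z \<le> 1"
  then show "\<bar>barrier s z powr p\<bar> \<le> 2 powr p"
    using barrier_bounded[of s z] barrier_pos[of s z] assms by (auto intro: powr_mono2)
qed

lemma barrier_power_dim2:
  assumes "N = 2" "0 < s" "s < 1" "1 \<le> p"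
  shows "(LINT x|M. barrier s (Z x) powr p) \<le> real N powr p * height_moment N (s * p)"
proof -
  note s = assms(2,3)
  obtain c where c: "0 < c" "\<And>z. 0 < z \<Longrightarrow> z \<le> 1 \<Longrightarrow>
    p * c powr (p - 1) * ((1 - z) powr (s / 2) - barrier s z / 2)
      \<le> ((1 - z) powr (s / 2)) powr p - (barrier s z / 2) powr p"
    using single_crossing[OF s assms(4)] by metis
  have swap: "integrable M (\<lambda>x. (1 - Z x) powr k)" if "0 \<le> k" for k
    by (rule integrable_bounded[where f = "\<lambda>z. (1 - z) powr k" and B = 1]) (use that in \<open>auto intro!: powr_le1\<close>)
  have pp: "((1 - Z x) powr (s / 2)) powr p = (1 - Z x) powr (s * p / 2)" for x by (simp add: powr_powr)
  have half: "(barrier s (Z x) / 2) powr p = barrier s (Z x) powr p / 2 powr p" for x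
    using barrier_pos[OF s Z_pos Z_le_1, of x] by (simp add: powr_divide)
  have iB: "integrable M (\<lambda>x. barrier s (Z x) / 2)"
    by (rule integrable_bounded[where f = "\<lambda>z. barrier s z / 2" and B = 1])
       (use barrier_bounded[OF s] barrier_measurable in auto)
  have "0 \<le> (LINT x|M. p * c powr (p - 1) * ((1 - Z x) powr (s / 2) - barrier s (Z x) / 2))"
    using barrier_mean_dim2[OF assms(1-3)] swapped_moment[OF assms(1), of s] swap[of "s / 2"] iB assms by simp
  also have "\<dots> \<le> (LINT x|M. (1 - Z x) powr (s * p / 2) - barrier s (Z x) powr p / 2 powr p)"
  proof (rule integral_mono)
    show "p * c powr (p - 1) * ((1 - Z x) powr (s / 2) - barrier s (Z x) / 2) \<le> (1 - Z x) powr (s * p / 2) - barrier s (Z x) powr p / 2 powr p" for x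
      using c(2)[OF Z_pos Z_le_1, of x] by (simp only: pp half)
  qed (use assms swap[of "s / 2"] swap[of "s * p / 2"] iB integrable_barrier_powr[OF s assms(4)] in auto)
  also have "\<dots> = height_moment N (s * p) - (LINT x|M. barrier s (Z x) powr p) / 2 powr p"
    using assms swap[of "s * p / 2"] integrable_barrier_powr[OF s assms(4)] swapped_moment[OF assms(1), of "s * p"]
    by (subst Bochner_Integration.integral_diff) auto
  finally show ?thesis using assms by (simp add: field_simps)
qed

theorem barrier_power_mean:
  assumes s: "0 < s" "s < 1" and p: "1 \<le> p"
  shows "(LINT x|M. barrier s (Z x) powr p) \<le> real N powr p * height_moment N (s * p)"
proof (cases "N = 2")
  case True
  then show ?thesis using assms by (intro barrier_power_dim2)
next
  case False
  then have N3: "3 \<le> N" using N by simp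
  have "(LINT x|M. barrier s (Z x) powr p) \<le> (LINT x|M. (2 - Z x powr (s / 2)) powr p)"
    using assms barrier_le[OF s Z_pos Z_le_1] barrier_pos[OF s Z_pos Z_le_1]
    by (intro integral_mono integrable_barrier_powr integrable_two_minus) (auto intro!: powr_mono2 intro: less_imp_le)
  also have "\<dots> \<le> real N powr p * height_moment N (s * p)"
  proof (cases "p \<le> 2")
    case True
    then show ?thesis using N3 assms by (intro two_minus_small_exponent)
  next
    case False
    then show ?thesis
      using N3 assms two_minus_dim3[of s p] two_minus_large_dimension[of s p] by (cases "N = 3") auto
  qed
  finally show ?thesis .
qed

end

section \<open>The integral over the slopes\<close>

text \<open>The square of the height of the direction \<open>(\<xi>, 1) / \<bar>(\<xi>, 1)\<bar>\<close>.\<close>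

definition slope_height :: "'a::euclidean_space \<Rightarrow> real" where
  "slope_height \<xi> = 1 / (1 + (norm \<xi>)\<^sup>2)"

text \<open>The integral of the kernel over a section, as computed by \<open>nn_integral_kernel_section\<close>.\<close>

definition section_integral :: "nat \<Rightarrow> real \<Rightarrow> real" where
  "section_integral d k = pi powr (d / 2) * Gamma ((k + 1) / 2) / Gamma ((real d + 1 + k) / 2)"

text \<open>The image of the uniform distribution on the upper half-sphere under the central projection to slopes.\<close>

definition slope_measure :: "'a::euclidean_space measure" where
  "slope_measure = density lborel
     (\<lambda>\<xi>. ennreal ((1 + (norm \<xi>)\<^sup>2) powr (- ((real DIM('a) + 1) / 2)) / section_integral DIM('a) 0))"

lemma section_integral_pos: "0 \<le> k \<Longrightarrow> 0 < section_integral d k"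
  unfolding section_integral_def by (intro divide_pos_pos mult_pos_pos Gamma_real_pos) auto

lemma section_integral_moment:
  "height_moment (d + 1) k * section_integral d 0 = section_integral d k"
proof -
  have "0 < Gamma ((real d + 1) / 2)" by (intro Gamma_real_pos) auto
  then show ?thesis
    by (simp add: height_moment_def section_integral_def Gamma_one_half_real add_ac less_imp_neq[symmetric])
qed

lemma slope_height_bounds: "0 < slope_height \<xi>" "slope_height \<xi> \<le> 1"
  by (simp_all add: slope_height_def add_pos_nonneg)

lemma slope_height_powr: "slope_height \<xi> powr r = (1 + (norm \<xi>)\<^sup>2) powr (- r)"
  by (simp add: slope_height_def powr_minus_divide powr_divide)

lemma slope_height_measurable[measurable]: "slope_height \<in> borel_measurable borel"
  unfolding slope_height_def[abs_def] by measurable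

lemma nn_integral_slope_measure:
  fixes f :: "'a::euclidean_space \<Rightarrow> real"
  assumes [measurable]: "f \<in> borel_measurable borel" and "\<And>\<xi>. 0 \<le> f \<xi>"
  shows "(\<integral>\<^sup>+\<xi>. ennreal (f \<xi>) \<partial>slope_measure)
    = ennreal (1 / section_integral DIM('a) 0) * (\<integral>\<^sup>+\<xi>. ennreal (f \<xi> * (1 + (norm \<xi>)\<^sup>2) powr (- ((real DIM('a) + 1) / 2))) \<partial>lborel)"
proof -
  have "(\<integral>\<^sup>+\<xi>. ennreal (f \<xi>) \<partial>slope_measure)
    = (\<integral>\<^sup>+\<xi>. ennreal ((1 + (norm \<xi>)\<^sup>2) powr (- ((real DIM('a) + 1) / 2)) / section_integral DIM('a) 0) * ennreal (f \<xi>) \<partial>lborel)"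
    unfolding slope_measure_def by (rule nn_integral_density) measurable
  also have "\<dots> = (\<integral>\<^sup>+\<xi>. ennreal (1 / section_integral DIM('a) 0) * ennreal (f \<xi> * (1 + (norm \<xi>)\<^sup>2) powr (- ((real DIM('a) + 1) / 2))) \<partial>lborel)"
    using assms section_integral_pos[of 0 "DIM('a)"]
    by (intro nn_integral_cong) (simp add: ennreal_mult'[symmetric] mult_ac)
  also have "\<dots> = ennreal (1 / section_integral DIM('a) 0) * (\<integral>\<^sup>+\<xi>. ennreal (f \<xi> * (1 + (norm \<xi>)\<^sup>2) powr (- ((real DIM('a) + 1) / 2))) \<partial>lborel)"
    by (rule nn_integral_cmult) measurable
  finally show ?thesis .
qed

lemma slope_moment:
  assumes "0 \<le> k"
  shows "(\<integral>\<^sup>+(\<xi>::'a::euclidean_space). ennreal (slope_height \<xi> powr (k / 2)) \<partial>slope_measure) = ennreal (height_moment (DIM('a) + 1) k)"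
proof -
  have pt: "slope_height \<xi> powr (k / 2) * (1 + (norm \<xi>)\<^sup>2) powr (- ((real DIM('a) + 1) / 2))
    = (1 + (norm \<xi>)\<^sup>2) powr (- ((real DIM('a) + 1 + k) / 2))" for \<xi> :: 'a
  proof -
    have "- (k / 2) + - ((real DIM('a) + 1) / 2) = - ((real DIM('a) + 1 + k) / 2)" by (simp add: field_simps)
    then show ?thesis by (simp only: slope_height_powr powr_add[symmetric])
  qed
  have "(\<integral>\<^sup>+(\<xi>::'a). ennreal (slope_height \<xi> powr (k / 2)) \<partial>slope_measure)
    = ennreal (1 / section_integral DIM('a) 0) * ennreal (section_integral DIM('a) k)"
  proof -
    have "(\<integral>\<^sup>+(\<xi>::'a). ennreal ((1 + (norm \<xi>)\<^sup>2) powr (- ((real DIM('a) + 1 + k) / 2))) \<partial>lborel) = ennreal (section_integral DIM('a) k)"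
      using assms nn_integral_kernel_section[of k, where ?'a = 'a] unfolding section_integral_def by simp
    then show ?thesis
      using nn_integral_slope_measure[of "\<lambda>\<xi>::'a. slope_height \<xi> powr (k / 2)"] unfolding pt by simp
  qed
  also have "\<dots> = ennreal (height_moment (DIM('a) + 1) k)"
  proof -
    have "section_integral DIM('a) k = height_moment (DIM('a) + 1) k * section_integral DIM('a) 0"
      by (rule section_integral_moment[symmetric])
    then have "1 / section_integral DIM('a) 0 * section_integral DIM('a) k = height_moment (DIM('a) + 1) k"
      using section_integral_pos[of 0 "DIM('a)"] by simp
    moreover have "ennreal (1 / section_integral DIM('a) 0) * ennreal (section_integral DIM('a) k)
      = ennreal (1 / section_integral DIM('a) 0 * section_integral DIM('a) k)"
      using section_integral_pos[of 0 "DIM('a)"] by (intro ennreal_mult'[symmetric]) simp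
    ultimately show ?thesis by simp
  qed
  finally show ?thesis .
qed

lemma slope_swapped_moment:
  assumes "0 < k" and dim: "DIM('a::euclidean_space) = 1"
  shows "(\<integral>\<^sup>+(\<xi>::'a). ennreal ((1 - slope_height \<xi>) powr (k / 2)) \<partial>slope_measure) = ennreal (height_moment 2 k)"
proof -
  have pt: "(1 - slope_height \<xi>) powr (k / 2) * (1 + (norm \<xi>)\<^sup>2) powr (- ((real DIM('a) + 1) / 2))
    = norm \<xi> powr k * (1 + (norm \<xi>)\<^sup>2) powr (- ((k + 2) / 2))" for \<xi> :: 'a
  proof -
    have A: "0 < 1 + (norm \<xi>)\<^sup>2" by (simp add: add_pos_nonneg)
    have "1 - slope_height \<xi> = (norm \<xi>)\<^sup>2 / (1 + (norm \<xi>)\<^sup>2)" using A by (simp add: slope_height_def field_simps)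
    then have "(1 - slope_height \<xi>) powr (k / 2) = ((norm \<xi>)\<^sup>2) powr (k / 2) * (1 + (norm \<xi>)\<^sup>2) powr (- (k / 2))"
      using A by (simp add: powr_divide powr_minus_divide)
    moreover have "((norm \<xi>)\<^sup>2) powr (k / 2) = norm \<xi> powr k"
    proof (cases "\<xi> = 0")
      case False
      then have "(norm \<xi>)\<^sup>2 = norm \<xi> powr 2" by simp
      then show ?thesis by (simp only: powr_powr) simp
    qed (use assms in simp)
    moreover have "(1 + (norm \<xi>)\<^sup>2) powr (- (k / 2)) * (1 + (norm \<xi>)\<^sup>2) powr (- ((real DIM('a) + 1) / 2)) = (1 + (norm \<xi>)\<^sup>2) powr (- ((k + 2) / 2))"
    proof -
      have "- (k / 2) + - ((real DIM('a) + 1) / 2) = - ((k + 2) / 2)" using dim by (simp add: field_simps)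
      then show ?thesis by (simp only: powr_add[symmetric])
    qed
    ultimately show ?thesis by (simp add: mult.assoc)
  qed
  have "(\<integral>\<^sup>+(\<xi>::'a). ennreal ((1 - slope_height \<xi>) powr (k / 2)) \<partial>slope_measure)
    = ennreal (1 / section_integral DIM('a) 0) * ennreal (section_integral DIM('a) k)"
  proof -
    have "(\<integral>\<^sup>+(\<xi>::'a). ennreal (norm \<xi> powr k * (1 + (norm \<xi>)\<^sup>2) powr (- ((k + 2) / 2))) \<partial>lborel) = ennreal (section_integral DIM('a) k)"
      using nn_integral_kernel_section_swapped[of k, where ?'a = 'a] assms
      by (simp add: section_integral_def add.commute)
    then show ?thesis
      using nn_integral_slope_measure[of "\<lambda>\<xi>::'a. (1 - slope_height \<xi>) powr (k / 2)"] unfolding pt by simp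
  qed
  also have "\<dots> = ennreal (1 / section_integral 1 0) * ennreal (section_integral 1 k)"
    by (simp only: dim)
  also have "\<dots> = ennreal (section_integral 1 k / section_integral 1 0)"
    using section_integral_pos[of 0 1] section_integral_pos[of k 1] assms
    by (simp add: ennreal_mult'[symmetric])
  also have "section_integral 1 k / section_integral 1 0 = height_moment 2 k"
  proof -
    have "section_integral 1 k = height_moment 2 k * section_integral 1 0"
      using section_integral_moment[of 1 k] by (simp only: one_add_one)
    then show ?thesis using section_integral_pos[of 0 1] by simp
  qed
  finally show ?thesis .
qed

lemma height_law_slopes: "height_law (slope_measure :: 'a::euclidean_space measure) slope_height (DIM('a) + 1)"
proof -
  let ?M = "slope_measure :: 'a measure"
  have [measurable_cong, simp]: "sets ?M = sets borel" by (simp add: slope_measure_def)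
  have pos: "0 < height_moment (DIM('a) + 1) k" if "0 \<le> k" for k
    using that unfolding height_moment_def by (intro divide_pos_pos mult_pos_pos Gamma_real_pos) auto
  have "emeasure ?M (space ?M) = (\<integral>\<^sup>+\<xi>. ennreal (slope_height \<xi> powr (0 / 2)) \<partial>?M)"
  proof -
    have "slope_height \<xi> powr (0 / 2) = 1" for \<xi> :: 'a
      using slope_height_bounds(1)[of \<xi>] by simp
    then show ?thesis by simp
  qed
  also have "\<dots> = 1" using slope_moment[of 0, where ?'a = 'a] by (simp add: height_moment_0)
  finally have total: "emeasure ?M (space ?M) = 1" .
  interpret finite_measure ?M by (rule finite_measureI) (simp add: total)
  show ?thesis
  proof (unfold_locales)
    show "measure ?M (space ?M) = 1" by (simp add: measure_def total)
    show "slope_height \<in> borel_measurable ?M" by measurable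
    show "2 \<le> DIM('a) + 1" using DIM_positive[where 'a = 'a] by simp
    show "(LINT \<xi>|?M. slope_height \<xi> powr (k / 2)) = height_moment (DIM('a) + 1) k" if "0 \<le> k" for k
      using that pos[OF that] by (subst integral_eq_nn_integral) (auto simp: slope_moment)
    show "(LINT \<xi>|?M. (1 - slope_height \<xi>) powr (k / 2)) = height_moment (DIM('a) + 1) k" if "DIM('a) + 1 = 2" "0 < k" for k
      using that pos[of k] by (subst integral_eq_nn_integral) (auto simp: slope_swapped_moment numeral_2_eq_2[symmetric])
  qed (rule slope_height_bounds)+
qed

text \<open>The factors \<open>1 + \<bar>\<xi>\<bar>\<^sup>2\<close> in the length and in the kernel combine to the density of the slope measure, so that the integral is a mean of a power of the barrier.\<close>

theorem arc_bound_integral: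
  assumes "0 < s" "s < 1" "1 \<le> p"
  shows "(\<integral>\<^sup>+(\<xi>::'a::euclidean_space). ennreal (arc_bound s \<xi> powr p * (1 + (norm \<xi>)\<^sup>2) powr (- ((real DIM('a) + 1 + s * p) / 2))) \<partial>lborel)
    \<le> ennreal (section_integral DIM('a) (s * p) * ((real DIM('a) + 1) / s) powr p)"
proof -
  let ?N = "DIM('a) + 1" and ?I = "section_integral DIM('a)"
  interpret height_law "slope_measure :: 'a measure" slope_height ?N by (rule height_law_slopes)
  note [measurable] = barrier_measurable
  have I: "0 < ?I 0" by (simp add: section_integral_pos)
  have bp: "0 < barrier s (slope_height \<xi>)" for \<xi> :: 'a by (intro barrier_pos assms slope_height_bounds)
  have pt: "arc_bound s \<xi> powr p * (1 + (norm \<xi>)\<^sup>2) powr (- ((real DIM('a) + 1 + s * p) / 2))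
    = 1 / s powr p * (barrier s (slope_height \<xi>) powr p * (1 + (norm \<xi>)\<^sup>2) powr (- ((real DIM('a) + 1) / 2)))" for \<xi> :: 'a
  proof -
    let ?A = "1 + (norm \<xi>)\<^sup>2"
    have A: "0 < ?A" by (simp add: add_pos_nonneg)
    have "arc_bound s \<xi> powr p = ?A powr (s * p / 2) * barrier s (slope_height \<xi>) powr p / s powr p"
      using bp[of \<xi>] assms A by (simp add: arc_bound_def slope_height_def powr_divide powr_mult powr_powr)
    moreover have "?A powr (s * p / 2) * ?A powr (- ((real DIM('a) + 1 + s * p) / 2)) = ?A powr (- ((real DIM('a) + 1) / 2))"
    proof -
      have "s * p / 2 + - ((real DIM('a) + 1 + s * p) / 2) = - ((real DIM('a) + 1) / 2)" by (simp add: field_simps)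
      then show ?thesis by (simp only: powr_add[symmetric])
    qed
    ultimately show ?thesis by (simp add: mult_ac)
  qed
  have "(\<integral>\<^sup>+(\<xi>::'a). ennreal (barrier s (slope_height \<xi>) powr p) \<partial>slope_measure) = ennreal (LINT \<xi>|slope_measure. barrier s (slope_height (\<xi>::'a)) powr p)"
    by (intro nn_integral_eq_integral integrable_barrier_powr assms) simp
  also have "\<dots> \<le> ennreal (real ?N powr p * height_moment ?N (s * p))"
    by (intro ennreal_leI barrier_power_mean assms)
  also have "(\<integral>\<^sup>+(\<xi>::'a). ennreal (barrier s (slope_height \<xi>) powr p) \<partial>slope_measure)
    = ennreal (1 / ?I 0) * (\<integral>\<^sup>+(\<xi>::'a). ennreal (barrier s (slope_height \<xi>) powr p * (1 + (norm \<xi>)\<^sup>2) powr (- ((real DIM('a) + 1) / 2))) \<partial>lborel)"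
    by (rule nn_integral_slope_measure) auto
  finally have le: "ennreal (1 / ?I 0) * (\<integral>\<^sup>+(\<xi>::'a). ennreal (barrier s (slope_height \<xi>) powr p * (1 + (norm \<xi>)\<^sup>2) powr (- ((real DIM('a) + 1) / 2))) \<partial>lborel)
    \<le> ennreal (real ?N powr p * height_moment ?N (s * p))" (is "_ * ?J \<le> _") .
  have "(\<integral>\<^sup>+(\<xi>::'a). ennreal (arc_bound s \<xi> powr p * (1 + (norm \<xi>)\<^sup>2) powr (- ((real DIM('a) + 1 + s * p) / 2))) \<partial>lborel)
    = ennreal (1 / s powr p) * ?J"
    unfolding pt using assms by (subst nn_integral_cmult[symmetric]) (auto simp: ennreal_mult'[symmetric] intro!: nn_integral_cong)
  also have "\<dots> = ennreal (?I 0 / s powr p) * (ennreal (1 / ?I 0) * ?J)"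
    using I assms by (simp add: mult.assoc[symmetric] ennreal_mult'[symmetric])
  also have "\<dots> \<le> ennreal (?I 0 / s powr p) * ennreal (real ?N powr p * height_moment ?N (s * p))"
    by (intro mult_left_mono le) simp
  also have "\<dots> = ennreal (?I 0 / s powr p * (real ?N powr p * height_moment ?N (s * p)))"
    using I assms by (simp add: ennreal_mult'[symmetric])
  also have "?I 0 / s powr p * (real ?N powr p * height_moment ?N (s * p)) = ?I (s * p) * ((real DIM('a) + 1) / s) powr p"
  proof -
    have "?I (s * p) = height_moment ?N (s * p) * ?I 0" by (rule section_integral_moment[symmetric])
    then show ?thesis using assms by (simp add: powr_divide add.commute)
  qed
  finally show ?thesis .
qed

section \<open>Mollified energies\<close>

lemma nn_integral_lborel_reflect:
  fixes G :: "'a::euclidean_space \<Rightarrow> ennreal"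
  assumes [measurable]: "G \<in> borel_measurable borel"
  shows "(\<integral>\<^sup>+x. G (c - x) \<partial>lborel) = (\<integral>\<^sup>+x. G x \<partial>lborel)"
proof -
  have "(\<integral>\<^sup>+x. G x \<partial>lborel) = (\<integral>\<^sup>+x. G x \<partial>density (distr lborel borel (\<lambda>x. c + (-1) *\<^sub>R x)) (\<lambda>_. ennreal (\<bar>-1\<bar> ^ DIM('a))))"
    by (subst lborel_affine[of "-1" c]) auto
  also have "\<dots> = (\<integral>\<^sup>+x. G (c - x) \<partial>lborel)"
    by (subst nn_integral_density) (auto simp: nn_integral_distr)
  finally show ?thesis by simp
qed

lemma nn_integral_mollifier_reflect:
  assumes "0 < \<epsilon>"
  shows "(\<integral>\<^sup>+z. ennreal (mollifier \<epsilon> (\<zeta> - z)) \<partial>lborel) = 1"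
  using nn_integral_lborel_reflect[of "\<lambda>w. ennreal (mollifier \<epsilon> w)" \<zeta>] nn_integral_mollifier[OF assms] by simp

text \<open>The mollified boundary weight; it sees the weight only at heights in \<open>(t - 3 \<epsilon>, t - \<epsilon>)\<close>.\<close>

definition mollified_weight :: "real \<Rightarrow> real \<Rightarrow> 'a::euclidean_space \<times> real \<Rightarrow> ennreal" where
  "mollified_weight \<beta> \<epsilon> \<zeta> = (\<integral>\<^sup>+z. ennreal (indicator upper_half z * (mollifier \<epsilon> (\<zeta> - z) * snd z powr \<beta>)) \<partial>lborel)"

lemma mollified_weight_measurable[measurable]: "mollified_weight \<beta> \<epsilon> \<in> borel_measurable borel"
  unfolding mollified_weight_def[abs_def] by measurable

lemma mollifier_shift_support:
  assumes "0 < \<epsilon>" "mollifier \<epsilon> (\<zeta> - z) \<noteq> 0"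
  shows "snd \<zeta> - 3 * \<epsilon> < snd z" "snd z < snd \<zeta> - \<epsilon>" "norm (fst \<zeta> - fst z) < \<epsilon>"
  using mollifier_support(2-4)[OF assms] by (auto simp: algebra_simps)

lemma mollified_weight_below:
  assumes "0 < \<epsilon>" "snd \<zeta> \<le> \<epsilon>"
  shows "mollified_weight \<beta> \<epsilon> \<zeta> = 0"
proof -
  have "indicator upper_half z * (mollifier \<epsilon> (\<zeta> - z) * snd z powr \<beta>) = 0" for z :: "'a \<times> real"
    using mollifier_shift_support(2)[OF assms(1), of \<zeta> z] assms(2)
    by (cases "mollifier \<epsilon> (\<zeta> - z) = 0") (auto simp: upper_half_def indicator_def)
  then show ?thesis unfolding mollified_weight_def by (simp only: ennreal_0 nn_integral_0_iff_AE) simp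
qed

lemma powr_between:
  fixes a y b \<beta> :: real
  assumes "0 < a" "a \<le> y" "y \<le> b"
  shows "min (a powr \<beta>) (b powr \<beta>) \<le> y powr \<beta>" "y powr \<beta> \<le> max (a powr \<beta>) (b powr \<beta>)"
  using assms powr_mono2[of \<beta> a y] powr_mono2[of \<beta> y b] powr_mono2'[of \<beta> a y] powr_mono2'[of \<beta> y b]
  by (cases "0 \<le> \<beta>"; auto simp: min_le_iff_disj le_max_iff_disj)+

lemma mollified_weight_between:
  assumes "0 < \<epsilon>" "3 * \<epsilon> < snd \<zeta>"
  defines "a \<equiv> snd \<zeta> - 3 * \<epsilon>" and "b \<equiv> snd \<zeta> - \<epsilon>"
  shows "ennreal (min (a powr \<beta>) (b powr \<beta>)) \<le> mollified_weight \<beta> \<epsilon> \<zeta>"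
    "mollified_weight \<beta> \<epsilon> \<zeta> \<le> ennreal (max (a powr \<beta>) (b powr \<beta>))"
proof -
  have ab: "0 < a" "a \<le> b" using assms by simp_all
  have const: "(\<integral>\<^sup>+z. ennreal C * ennreal (mollifier \<epsilon> (\<zeta> - z)) \<partial>lborel) = ennreal C" for C
    by (subst nn_integral_cmult) (simp_all add: nn_integral_mollifier_reflect[OF assms(1)])
  have pt: "min (a powr \<beta>) (b powr \<beta>) * mollifier \<epsilon> (\<zeta> - z) \<le> indicator upper_half z * (mollifier \<epsilon> (\<zeta> - z) * snd z powr \<beta>)
      \<and> indicator upper_half z * (mollifier \<epsilon> (\<zeta> - z) * snd z powr \<beta>) \<le> max (a powr \<beta>) (b powr \<beta>) * mollifier \<epsilon> (\<zeta> - z)" for z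
  proof (cases "mollifier \<epsilon> (\<zeta> - z) = 0")
    case False
    then have z: "a \<le> snd z" "snd z \<le> b" "0 < snd z"
      using mollifier_shift_support(1,2)[OF assms(1) False] ab by (simp_all add: a_def b_def)
    have "min (a powr \<beta>) (b powr \<beta>) * mollifier \<epsilon> (\<zeta> - z) \<le> snd z powr \<beta> * mollifier \<epsilon> (\<zeta> - z)"
      "snd z powr \<beta> * mollifier \<epsilon> (\<zeta> - z) \<le> max (a powr \<beta>) (b powr \<beta>) * mollifier \<epsilon> (\<zeta> - z)"
      using powr_between[OF ab(1) z(1,2)] by (auto intro!: mult_right_mono mollifier_nonneg[OF assms(1)])
    then show ?thesis using z(3) by (simp add: upper_half_def mult.commute)
  qed simp
  have nn: "0 \<le> min (a powr \<beta>) (b powr \<beta>)" "0 \<le> max (a powr \<beta>) (b powr \<beta>)" by (simp_all add: le_max_iff_disj)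
  have "(\<integral>\<^sup>+z. ennreal (min (a powr \<beta>) (b powr \<beta>)) * ennreal (mollifier \<epsilon> (\<zeta> - z)) \<partial>lborel) \<le> mollified_weight \<beta> \<epsilon> \<zeta>"
    unfolding mollified_weight_def
    using pt nn by (intro nn_integral_mono) (simp only: ennreal_mult'[symmetric] ennreal_leI)
  then show "ennreal (min (a powr \<beta>) (b powr \<beta>)) \<le> mollified_weight \<beta> \<epsilon> \<zeta>" by (simp only: const)
  have "mollified_weight \<beta> \<epsilon> \<zeta> \<le> (\<integral>\<^sup>+z. ennreal (max (a powr \<beta>) (b powr \<beta>)) * ennreal (mollifier \<epsilon> (\<zeta> - z)) \<partial>lborel)"
    unfolding mollified_weight_def
    using pt nn by (intro nn_integral_mono) (simp only: ennreal_mult'[symmetric] ennreal_leI)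
  then show "mollified_weight \<beta> \<epsilon> \<zeta> \<le> ennreal (max (a powr \<beta>) (b powr \<beta>))" by (simp only: const)
qed

lemma mollified_weight_tendsto:
  assumes "\<And>n. 0 < \<epsilon> n" "\<epsilon> \<longlonglongrightarrow> 0" "0 < snd \<zeta>"
  shows "(\<lambda>n. mollified_weight \<beta> (\<epsilon> n) \<zeta>) \<longlonglongrightarrow> ennreal (snd \<zeta> powr \<beta>)"
proof (rule tendsto_sandwich)
  let ?t = "snd \<zeta>"
  have "(\<lambda>n. 3 * \<epsilon> n) \<longlonglongrightarrow> 3 * 0" by (intro tendsto_intros assms)
  then have ev: "\<forall>\<^sub>F n in sequentially. 3 * \<epsilon> n < ?t" using assms(3) by (intro order_tendstoD) auto
  show "\<forall>\<^sub>F n in sequentially. ennreal (min ((?t - 3 * \<epsilon> n) powr \<beta>) ((?t - \<epsilon> n) powr \<beta>)) \<le> mollified_weight \<beta> (\<epsilon> n) \<zeta>"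
    using ev by eventually_elim (rule mollified_weight_between(1)[OF assms(1)])
  show "\<forall>\<^sub>F n in sequentially. mollified_weight \<beta> (\<epsilon> n) \<zeta> \<le> ennreal (max ((?t - 3 * \<epsilon> n) powr \<beta>) ((?t - \<epsilon> n) powr \<beta>))"
    using ev by eventually_elim (rule mollified_weight_between(2)[OF assms(1)])
  have a: "(\<lambda>n. (?t - 3 * \<epsilon> n) powr \<beta>) \<longlonglongrightarrow> (?t - 3 * 0) powr \<beta>" "(\<lambda>n. (?t - \<epsilon> n) powr \<beta>) \<longlonglongrightarrow> (?t - 0) powr \<beta>"
    using assms(3) by (intro tendsto_intros assms; simp)+
  show "(\<lambda>n. ennreal (min ((?t - 3 * \<epsilon> n) powr \<beta>) ((?t - \<epsilon> n) powr \<beta>))) \<longlonglongrightarrow> ennreal (?t powr \<beta>)"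
    using tendsto_min[OF a] by (intro tendsto_ennrealI) simp
  show "(\<lambda>n. ennreal (max ((?t - 3 * \<epsilon> n) powr \<beta>) ((?t - \<epsilon> n) powr \<beta>))) \<longlonglongrightarrow> ennreal (?t powr \<beta>)"
    using tendsto_max[OF a] by (intro tendsto_ennrealI) simp
qed

text \<open>The mollified weight is dominated by a multiple of the weight itself. Only negative \<open>\<beta>\<close> and heights
  comparable to \<open>\<epsilon>\<close> need care: there the kernel may reach the boundary, where the weight is singular
  but integrable.\<close>

lemma mollified_weight_dominated:
  assumes "- 1 < \<beta>"
  obtains B where "0 \<le> B" "\<And>\<epsilon> \<zeta>. 0 < \<epsilon> \<Longrightarrow> 0 < snd (\<zeta> :: 'a::euclidean_space \<times> real) \<Longrightarrow>
    mollified_weight \<beta> \<epsilon> \<zeta> \<le> ennreal (B * snd \<zeta> powr \<beta>)"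
proof -
  define I where "I = (LINT y|lborel. raw_bump (y :: 'a \<times> real))"
  have I: "0 < I" unfolding I_def by (rule integral_raw_bump_pos)
  define v where "v = measure lborel (ball (0 :: 'a) 1)"
  have v: "0 \<le> v" by (simp add: v_def)
  define B1 where "B1 = 6 * v / (I * (\<beta> + 1))"
  define B where "B = max 1 (max (2 powr (- \<beta>)) B1)"
  have B: "1 \<le> B" "2 powr (- \<beta>) \<le> B" "B1 \<le> B" by (simp_all add: B_def)
  have main: "mollified_weight \<beta> \<epsilon> \<zeta> \<le> ennreal (B * snd \<zeta> powr \<beta>)" if e: "0 < \<epsilon>" and t: "0 < snd \<zeta>" for \<epsilon> and \<zeta> :: "'a \<times> real"
  proof -
    let ?t = "snd \<zeta>"
    consider "?t \<le> \<epsilon>" | "6 * \<epsilon> \<le> ?t" | "\<epsilon> < ?t" "?t < 6 * \<epsilon>" "0 \<le> \<beta>" | "\<epsilon> < ?t" "?t < 6 * \<epsilon>" "\<beta> < 0" by linarith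
    then show ?thesis
    proof cases
      case 1
      then show ?thesis by (simp add: mollified_weight_below[OF e])
    next
      case 2
      have le: "x powr \<beta> \<le> B * ?t powr \<beta>" if x: "?t / 2 \<le> x" "x \<le> ?t" for x
      proof (cases "0 \<le> \<beta>")
        case True
        then have "x powr \<beta> \<le> ?t powr \<beta>" using x t by (intro powr_mono2) auto
        also have "\<dots> \<le> B * ?t powr \<beta>" using B(1) by (simp add: mult_right_mono[of 1 B, simplified])
        finally show ?thesis .
      next
        case False
        then have "x powr \<beta> \<le> (?t / 2) powr \<beta>" using x t by (intro powr_mono2') auto
        also have "\<dots> = 2 powr (- \<beta>) * ?t powr \<beta>" using t by (simp add: powr_divide powr_minus_divide)
        also have "\<dots> \<le> B * ?t powr \<beta>" using B(2) by (intro mult_right_mono) auto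
        finally show ?thesis .
      qed
      have "mollified_weight \<beta> \<epsilon> \<zeta> \<le> ennreal (max ((?t - 3 * \<epsilon>) powr \<beta>) ((?t - \<epsilon>) powr \<beta>))"
        using 2 e by (intro mollified_weight_between(2)) auto
      also have "\<dots> \<le> ennreal (B * ?t powr \<beta>)"
        using 2 e le[of "?t - 3 * \<epsilon>"] le[of "?t - \<epsilon>"] by (intro ennreal_leI) auto
      finally show ?thesis .
    next
      case 3
      have "mollified_weight \<beta> \<epsilon> \<zeta> \<le> (\<integral>\<^sup>+z. ennreal (?t powr \<beta>) * ennreal (mollifier \<epsilon> (\<zeta> - z)) \<partial>lborel)"
        unfolding mollified_weight_def
      proof (intro nn_integral_mono)
        fix z :: "'a \<times> real"
        have "indicator upper_half z * (mollifier \<epsilon> (\<zeta> - z) * snd z powr \<beta>) \<le> ?t powr \<beta> * mollifier \<epsilon> (\<zeta> - z)"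
        proof (cases "mollifier \<epsilon> (\<zeta> - z) = 0 \<or> z \<notin> upper_half")
          case True
          then show ?thesis using mollifier_nonneg[OF e, of "\<zeta> - z"] by auto
        next
          case False
          then have "0 < snd z" "snd z \<le> ?t" using mollifier_shift_support(2)[OF e, of \<zeta> z] e by (auto simp: upper_half_def)
          then have "snd z powr \<beta> \<le> ?t powr \<beta>" using 3 by (intro powr_mono2) auto
          then show ?thesis using False mollifier_nonneg[OF e, of "\<zeta> - z"] by (simp add: mult.commute mult_right_mono)
        qed
        then show "ennreal (indicator upper_half z * (mollifier \<epsilon> (\<zeta> - z) * snd z powr \<beta>)) \<le> ennreal (?t powr \<beta>) * ennreal (mollifier \<epsilon> (\<zeta> - z))"
          by (simp add: ennreal_mult'[symmetric] ennreal_leI)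
      qed
      also have "\<dots> = ennreal (?t powr \<beta>)"
        by (subst nn_integral_cmult) (simp_all add: nn_integral_mollifier_reflect[OF e])
      also have "\<dots> \<le> ennreal (B * ?t powr \<beta>)" using B(1) by (intro ennreal_leI) (simp add: mult_right_mono[of 1 B, simplified])
      finally show ?thesis .
    next
      case 4
      define c where "c = 1 / (\<epsilon> ^ (DIM('a) + 1) * I)"
      have c: "0 \<le> c" using e I by (simp add: c_def)
      have [measurable]: "(\<lambda>z :: 'a \<times> real. indicator (ball (fst \<zeta>) \<epsilon>) (fst z) :: real) \<in> borel_measurable borel"
        by (rule measurable_compose[OF fst_snd_borel(1)]) (intro borel_measurable_indicator borel_open open_ball)
      have [measurable]: "(\<lambda>z :: 'a \<times> real. indicator {0..?t} (snd z) :: real) \<in> borel_measurable borel"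
        by (rule measurable_compose[OF fst_snd_borel(2)]) (intro borel_measurable_indicator borel_closed closed_atLeastAtMost)
      have "mollified_weight \<beta> \<epsilon> \<zeta> \<le> (\<integral>\<^sup>+z. ennreal c * (ennreal (indicator (ball (fst \<zeta>) \<epsilon>) (fst z)) * ennreal (indicator {0..?t} (snd z) * snd z powr \<beta>)) \<partial>lborel)"
        unfolding mollified_weight_def
      proof (intro nn_integral_mono)
        fix z :: "'a \<times> real"
        have "indicator upper_half z * (mollifier \<epsilon> (\<zeta> - z) * snd z powr \<beta>) \<le> c * (indicator (ball (fst \<zeta>) \<epsilon>) (fst z) * (indicator {0..?t} (snd z) * snd z powr \<beta>))"
        proof (cases "mollifier \<epsilon> (\<zeta> - z) = 0 \<or> z \<notin> upper_half")
          case True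
          then have "indicator upper_half z * (mollifier \<epsilon> (\<zeta> - z) * snd z powr \<beta>) = 0" by auto
          then show ?thesis using c by (simp only: zero_le_mult_iff indicator_pos_le powr_ge_zero simp_thms)
        next
          case False
          then have "mollifier \<epsilon> (\<zeta> - z) \<noteq> 0" by simp
          from mollifier_shift_support[OF e this]
          have "snd z \<in> {0..?t}" "fst z \<in> ball (fst \<zeta>) \<epsilon>"
            using False e by (auto simp: upper_half_def dist_norm)
          moreover have "mollifier \<epsilon> (\<zeta> - z) \<le> c" unfolding c_def I_def by (rule mollifier_bounded[OF e])
          ultimately show ?thesis using False by (simp add: mult_right_mono)
        qed
        then show "ennreal (indicator upper_half z * (mollifier \<epsilon> (\<zeta> - z) * snd z powr \<beta>))
          \<le> ennreal c * (ennreal (indicator (ball (fst \<zeta>) \<epsilon>) (fst z)) * ennreal (indicator {0..?t} (snd z) * snd z powr \<beta>))"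
          using c by (simp add: ennreal_mult'[symmetric] ennreal_leI)
      qed
      also have "\<dots> = ennreal c * (\<integral>\<^sup>+z. (ennreal (indicator (ball (fst \<zeta>) \<epsilon>) (fst z)) * ennreal (indicator {0..?t} (snd z) * snd z powr \<beta>)) \<partial>lborel)"
        by (rule nn_integral_cmult) measurable
      also have "(\<integral>\<^sup>+z. (ennreal (indicator (ball (fst \<zeta>) \<epsilon>) (fst z)) * ennreal (indicator {0..?t} (snd z) * snd z powr \<beta>)) \<partial>lborel)
        = (\<integral>\<^sup>+y. \<integral>\<^sup>+x. ennreal (indicator (ball (fst \<zeta>) \<epsilon>) (fst (x, y))) * ennreal (indicator {0..?t} (snd (x, y)) * snd (x, y) powr \<beta>) \<partial>lborel \<partial>lborel)"
        by (rule nn_integral_lborel_Pair) measurable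
      also have "\<dots> = (\<integral>\<^sup>+y. ennreal (v * \<epsilon> ^ DIM('a)) * ennreal (indicator {0..?t} y * y powr \<beta>) \<partial>lborel)"
      proof (rule nn_integral_cong)
        fix y :: real
        have "emeasure lborel (ball (fst \<zeta>) \<epsilon>) = ennreal (v * \<epsilon> ^ DIM('a))"
        proof -
          have "emeasure lborel (ball (fst \<zeta>) \<epsilon>) = ennreal (measure lborel (ball (fst \<zeta>) \<epsilon>))"
            using emeasure_lborel_ball_finite[of "fst \<zeta>" \<epsilon>] by (intro emeasure_eq_ennreal_measure) simp
          also have "measure lborel (ball (fst \<zeta>) \<epsilon>) = v * \<epsilon> ^ DIM('a)"
            using e by (simp add: v_def content_ball)
          finally show ?thesis .
        qed
        moreover have S: "ball (fst \<zeta>) \<epsilon> \<in> sets lborel" by simp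
        ultimately show "(\<integral>\<^sup>+x. ennreal (indicator (ball (fst \<zeta>) \<epsilon>) (fst (x, y))) * ennreal (indicator {0..?t} (snd (x, y)) * snd (x, y) powr \<beta>) \<partial>lborel)
          = ennreal (v * \<epsilon> ^ DIM('a)) * ennreal (indicator {0..?t} y * y powr \<beta>)"
          unfolding fst_conv snd_conv ennreal_indicator
          by (subst nn_integral_multc) (simp_all only: borel_measurable_indicator nn_integral_indicator)
      qed
      also have "\<dots> = ennreal (v * \<epsilon> ^ DIM('a)) * (\<integral>\<^sup>+y. ennreal (indicator {0..?t} y * y powr \<beta>) \<partial>lborel)"
        by (rule nn_integral_cmult) measurable
      also have "(\<integral>\<^sup>+y. ennreal (indicator {0..?t} y * y powr \<beta>) \<partial>lborel) = ennreal (?t powr (\<beta> + 1) / (\<beta> + 1))"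
        by (rule nn_integral_has_integral_lebesgue[OF _ has_integral_powr_from_0]) (use assms t in auto)
      also have "ennreal c * (ennreal (v * \<epsilon> ^ DIM('a)) * ennreal (?t powr (\<beta> + 1) / (\<beta> + 1)))
        = ennreal (v / (I * (\<beta> + 1)) * (?t / \<epsilon>) * ?t powr \<beta>)"
        using e I v t c assms by (simp add: ennreal_mult'[symmetric] c_def powr_add field_simps)
      also have "\<dots> \<le> ennreal (B * ?t powr \<beta>)"
      proof (intro ennreal_leI mult_right_mono)
        have "?t / \<epsilon> \<le> 6" using 4 e by (simp add: divide_le_eq)
        then have "v / (I * (\<beta> + 1)) * (?t / \<epsilon>) \<le> v / (I * (\<beta> + 1)) * 6"
          using v I assms by (intro mult_left_mono) auto
        also have "\<dots> = B1" by (simp add: B1_def)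
        finally show "v / (I * (\<beta> + 1)) * (?t / \<epsilon>) \<le> B" using B(3) by linarith
      qed simp
      finally show ?thesis .
    qed
  qed
  show ?thesis by (rule that[of B]) (use B main in auto)
qed

text \<open>By Fubini the mollifier can be moved from the gradient to the weight, and the mollified weights converge with a bound by a multiple of the weight.\<close>

theorem (in weak_gradient) mollified_power_limit:
  assumes \<epsilon>: "\<And>n. 0 < \<epsilon> n" "\<epsilon> \<longlonglongrightarrow> 0" and \<beta>: "- 1 < \<beta>"
    and fin: "(\<integral>\<^sup>+z\<in>upper_half. ennreal (norm (g z) powr p * snd z powr \<beta>) \<partial>lborel) < \<infinity>"
  shows "(\<lambda>n. \<integral>\<^sup>+z\<in>upper_half. mollified_power p (\<epsilon> n) z * ennreal (snd z powr \<beta>) \<partial>lborel)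
    \<longlonglongrightarrow> (\<integral>\<^sup>+z\<in>upper_half. ennreal (norm (g z) powr p * snd z powr \<beta>) \<partial>lborel)"
proof -
  have swap: "(\<integral>\<^sup>+z\<in>upper_half. mollified_power p e z * ennreal (snd z powr \<beta>) \<partial>lborel)
    = (\<integral>\<^sup>+\<zeta>. ennreal (norm (g \<zeta>) powr p) * (mollified_weight \<beta> e \<zeta> * indicator upper_half \<zeta>) \<partial>lborel)" if e: "0 < e" for e
  proof -
    have "(\<integral>\<^sup>+z\<in>upper_half. mollified_power p e z * ennreal (snd z powr \<beta>) \<partial>lborel)
      = (\<integral>\<^sup>+z. \<integral>\<^sup>+\<zeta>. ennreal (norm (g \<zeta>) powr p) * ennreal (indicator upper_half z * (mollifier e (\<zeta> - z) * snd z powr \<beta>)) \<partial>lborel \<partial>lborel)"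
    proof (rule nn_integral_cong)
      fix z :: "'a \<times> real"
      have "mollified_power p e z * ennreal (snd z powr \<beta>) * indicator upper_half z
        = (\<integral>\<^sup>+\<zeta>. ennreal (mollifier e (\<zeta> - z) * norm (g \<zeta>) powr p) * (ennreal (snd z powr \<beta>) * indicator upper_half z) \<partial>lborel)"
        unfolding mollified_power_def mult.assoc[of "nn_integral _ _"] by (rule nn_integral_multc[symmetric]) measurable
      also have "\<dots> = (\<integral>\<^sup>+\<zeta>. ennreal (norm (g \<zeta>) powr p) * ennreal (indicator upper_half z * (mollifier e (\<zeta> - z) * snd z powr \<beta>)) \<partial>lborel)"
        using mollifier_nonneg[OF e]
        by (intro nn_integral_cong) (auto simp: ennreal_mult'[symmetric] mult_ac split: split_indicator)
      finally show "mollified_power p e z * ennreal (snd z powr \<beta>) * indicator upper_half z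
        = (\<integral>\<^sup>+\<zeta>. ennreal (norm (g \<zeta>) powr p) * ennreal (indicator upper_half z * (mollifier e (\<zeta> - z) * snd z powr \<beta>)) \<partial>lborel)" .
    qed
    also have "\<dots> = (\<integral>\<^sup>+\<zeta>. \<integral>\<^sup>+z. ennreal (norm (g \<zeta>) powr p) * ennreal (indicator upper_half z * (mollifier e (\<zeta> - z) * snd z powr \<beta>)) \<partial>lborel \<partial>lborel)"
      by (rule lborel_pair.Fubini') measurable
    also have "\<dots> = (\<integral>\<^sup>+\<zeta>. ennreal (norm (g \<zeta>) powr p) * mollified_weight \<beta> e \<zeta> \<partial>lborel)"
      unfolding mollified_weight_def by (intro nn_integral_cong nn_integral_cmult) measurable
    also have "\<dots> = (\<integral>\<^sup>+\<zeta>. ennreal (norm (g \<zeta>) powr p) * (mollified_weight \<beta> e \<zeta> * indicator upper_half \<zeta>) \<partial>lborel)"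
    proof (rule nn_integral_cong)
      fix \<zeta> :: "'a \<times> real"
      have "mollified_weight \<beta> e \<zeta> = 0" if "\<zeta> \<notin> upper_half"
        using that e by (intro mollified_weight_below) (auto simp: upper_half_def)
      then show "ennreal (norm (g \<zeta>) powr p) * mollified_weight \<beta> e \<zeta> = ennreal (norm (g \<zeta>) powr p) * (mollified_weight \<beta> e \<zeta> * indicator upper_half \<zeta>)"
        by (cases "\<zeta> \<in> upper_half") auto
    qed
    finally show ?thesis .
  qed
  obtain B where B: "0 \<le> B" "\<And>\<epsilon> \<zeta>. 0 < \<epsilon> \<Longrightarrow> 0 < snd (\<zeta> :: 'a \<times> real) \<Longrightarrow> mollified_weight \<beta> \<epsilon> \<zeta> \<le> ennreal (B * snd \<zeta> powr \<beta>)"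
    using mollified_weight_dominated[OF \<beta>] by metis
  have rhs: "(\<integral>\<^sup>+z\<in>upper_half. ennreal (norm (g z) powr p * snd z powr \<beta>) \<partial>lborel)
    = (\<integral>\<^sup>+\<zeta>. ennreal (norm (g \<zeta>) powr p) * (ennreal (snd \<zeta> powr \<beta>) * indicator upper_half \<zeta>) \<partial>lborel)"
    by (intro nn_integral_cong) (simp add: ennreal_mult'[symmetric] mult.assoc[symmetric])
  show ?thesis
    unfolding swap[OF \<epsilon>(1)] rhs
  proof (rule nn_integral_dominated_convergence[where w = "\<lambda>\<zeta>. ennreal B * (ennreal (norm (g \<zeta>) powr p * snd \<zeta> powr \<beta>) * indicator upper_half \<zeta>)"])
    show "AE \<zeta> in lborel. ennreal (norm (g \<zeta>) powr p) * (mollified_weight \<beta> (\<epsilon> n) \<zeta> * indicator upper_half \<zeta>)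
      \<le> ennreal B * (ennreal (norm (g \<zeta>) powr p * snd \<zeta> powr \<beta>) * indicator upper_half \<zeta>)" for n
    proof (rule AE_I2)
      fix \<zeta> :: "'a \<times> real"
      show "ennreal (norm (g \<zeta>) powr p) * (mollified_weight \<beta> (\<epsilon> n) \<zeta> * indicator upper_half \<zeta>)
        \<le> ennreal B * (ennreal (norm (g \<zeta>) powr p * snd \<zeta> powr \<beta>) * indicator upper_half \<zeta>)"
      proof (cases "\<zeta> \<in> upper_half")
        case True
        then have "mollified_weight \<beta> (\<epsilon> n) \<zeta> \<le> ennreal (B * snd \<zeta> powr \<beta>)"
          by (intro B(2) \<epsilon>(1)) (simp add: upper_half_def)
        then have "ennreal (norm (g \<zeta>) powr p) * mollified_weight \<beta> (\<epsilon> n) \<zeta> \<le> ennreal (norm (g \<zeta>) powr p) * ennreal (B * snd \<zeta> powr \<beta>)"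
          by (rule mult_left_mono) simp
        also have "\<dots> = ennreal B * ennreal (norm (g \<zeta>) powr p * snd \<zeta> powr \<beta>)"
          using B(1) by (simp add: ennreal_mult'[symmetric] mult.left_commute)
        finally show ?thesis using True by simp
      qed simp
    qed
    have "(\<integral>\<^sup>+\<zeta>. ennreal B * (ennreal (norm (g \<zeta>) powr p * snd \<zeta> powr \<beta>) * indicator upper_half \<zeta>) \<partial>lborel)
      = ennreal B * (\<integral>\<^sup>+z\<in>upper_half. ennreal (norm (g z) powr p * snd z powr \<beta>) \<partial>lborel)"
      by (rule nn_integral_cmult) measurable
    also have "\<dots> < \<infinity>" using fin by (simp add: ennreal_mult_less_top)
    finally show "(\<integral>\<^sup>+\<zeta>. ennreal B * (ennreal (norm (g \<zeta>) powr p * snd \<zeta> powr \<beta>) * indicator upper_half \<zeta>) \<partial>lborel) < \<infinity>" .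
    show "AE \<zeta> in lborel. (\<lambda>n. ennreal (norm (g \<zeta>) powr p) * (mollified_weight \<beta> (\<epsilon> n) \<zeta> * indicator upper_half \<zeta>))
      \<longlonglongrightarrow> ennreal (norm (g \<zeta>) powr p) * (ennreal (snd \<zeta> powr \<beta>) * indicator upper_half \<zeta>)"
    proof (rule AE_I2)
      fix \<zeta> :: "'a \<times> real"
      show "(\<lambda>n. ennreal (norm (g \<zeta>) powr p) * (mollified_weight \<beta> (\<epsilon> n) \<zeta> * indicator upper_half \<zeta>))
        \<longlonglongrightarrow> ennreal (norm (g \<zeta>) powr p) * (ennreal (snd \<zeta> powr \<beta>) * indicator upper_half \<zeta>)"
      proof (cases "\<zeta> \<in> upper_half")
        case True
        then have "(\<lambda>n. mollified_weight \<beta> (\<epsilon> n) \<zeta>) \<longlonglongrightarrow> ennreal (snd \<zeta> powr \<beta>)"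
          by (intro mollified_weight_tendsto \<epsilon>) (simp add: upper_half_def)
        then have "(\<lambda>n. ennreal (norm (g \<zeta>) powr p) * mollified_weight \<beta> (\<epsilon> n) \<zeta>) \<longlonglongrightarrow> ennreal (norm (g \<zeta>) powr p) * ennreal (snd \<zeta> powr \<beta>)"
          by (rule ennreal_tendsto_cmult[rotated]) simp
        then show ?thesis using True by simp
      qed simp
    qed
  qed measurable
qed

section \<open>Mollification in \<open>L\<^sup>1\<close>\<close>

text \<open>Continuity of translations in \<open>L\<^sup>1\<close>. For an indicator function the difference of a translate is supported,
  for small shifts, in the thin set between a compact subset and an open superset.\<close>

lemma finite_measure_compact_open:
  fixes A :: "'a::euclidean_space set"
  assumes A: "A \<in> sets borel" "emeasure lborel A < \<infinity>" and e: "0 < (e :: real)"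
  obtains K U where "compact K" "open U" "K \<subseteq> A" "A \<subseteq> U" "emeasure lborel (U - K) \<le> ennreal e"
proof -
  have leb: "A \<in> sets lebesgue" using A by simp
  have e3: "0 < e / 3" using e by simp
  have conv: "emeasure lebesgue S = emeasure lborel S" if "S \<in> sets borel" for S :: "'a set"
    using that by simp
  obtain U where U: "open U" "A \<subseteq> U" "emeasure lebesgue (U - A) < ennreal (e / 3)"
    using sets_lebesgue_outer_open[OF leb e3] by metis
  obtain C where C: "closed C" "C \<subseteq> A" "emeasure lebesgue (A - C) < ennreal (e / 3)"
    using sets_lebesgue_inner_closed[OF leb e3] by metis
  have "(\<lambda>n. emeasure lborel (A - cball 0 (real n))) \<longlonglongrightarrow> emeasure lborel (\<Inter>n. A - cball 0 (real n))"
  proof (rule Lim_emeasure_decseq)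
    show "range (\<lambda>n. A - cball 0 (real n)) \<subseteq> sets lborel" using A by auto
    show "decseq (\<lambda>n. A - cball 0 (real n))" by (auto simp: decseq_def)
    have "emeasure lborel (A - cball 0 (real n)) \<le> emeasure lborel A" for n
      using A by (intro emeasure_mono) auto
    then show "emeasure lborel (A - cball 0 (real n)) \<noteq> \<infinity>" for n
      using le_less_trans[OF _ A(2)] by (simp add: less_top[symmetric])
  qed
  moreover have "(\<Inter>n. A - cball 0 (real n)) = {}"
  proof -
    have "\<exists>n. x \<in> cball 0 (real n)" for x :: 'a
      using real_arch_simple[of "norm x"] by simp
    then show ?thesis by blast
  qed
  ultimately have "(\<lambda>n. emeasure lborel (A - cball 0 (real n))) \<longlonglongrightarrow> 0" by (simp only: emeasure_empty)
  then have "\<forall>\<^sub>F n in sequentially. emeasure lborel (A - cball 0 (real n)) < ennreal (e / 3)"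
    using e by (intro order_tendstoD) auto
  then obtain n where n: "emeasure lborel (A - cball 0 (real n)) < ennreal (e / 3)"
    unfolding eventually_sequentially by blast
  let ?K = "C \<inter> cball 0 (real n)"
  have sets: "U - A \<in> sets lborel" "A - C \<in> sets lborel" "A - cball 0 (real n) \<in> sets lborel"
    using A U C by auto
  have "emeasure lborel (U - ?K) \<le> emeasure lborel ((U - A) \<union> ((A - C) \<union> (A - cball 0 (real n))))"
    using sets by (intro emeasure_mono) auto
  also have "\<dots> \<le> emeasure lborel (U - A) + (emeasure lborel (A - C) + emeasure lborel (A - cball 0 (real n)))"
    using sets by (intro order_trans[OF emeasure_subadditive] add_left_mono emeasure_subadditive) auto
  also have "\<dots> \<le> ennreal (e / 3) + (ennreal (e / 3) + ennreal (e / 3))"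
  proof (intro add_mono)
    show "emeasure lborel (U - A) \<le> ennreal (e / 3)" using U(3) conv[of "U - A"] sets by simp
    show "emeasure lborel (A - C) \<le> ennreal (e / 3)" using C(3) conv[of "A - C"] sets by simp
    show "emeasure lborel (A - cball 0 (real n)) \<le> ennreal (e / 3)" using n by simp
  qed
  also have "\<dots> = ennreal e" using e by (simp flip: ennreal_plus)
  finally have "emeasure lborel (U - ?K) \<le> ennreal e" .
  moreover have "compact ?K" using C(1) compact_Int_closed[OF compact_cball, of C 0 "real n"] by (simp add: Int_commute)
  ultimately show ?thesis using that[of ?K U] U(1,2) C(2) by auto
qed

lemma L1_translation_continuous:
  fixes G :: "'a::euclidean_space \<Rightarrow> real"
  assumes "integrable lborel G" "0 < (e :: real)"
  shows "\<exists>d>0. \<forall>h. norm h < d \<longrightarrow> (\<integral>\<^sup>+z. ennreal \<bar>G (z + h) - G z\<bar> \<partial>lborel) \<le> ennreal e"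
  using assms
proof (induction G arbitrary: e rule: integrable_induct)
  case (base A c)
  have A[measurable]: "A \<in> sets borel" using base by simp
  obtain K U where KU: "compact K" "open U" "K \<subseteq> A" "A \<subseteq> U" "emeasure lborel (U - K) \<le> ennreal (e / (2 * (\<bar>c\<bar> + 1)))"
  proof -
    have "0 < e / (2 * (\<bar>c\<bar> + 1))" using base(3) by simp
    from finite_measure_compact_open[OF A base(2) this] show ?thesis using that by blast
  qed
  have [measurable]: "K \<in> sets borel" "U \<in> sets borel" using KU by (simp_all add: compact_imp_closed)
  have "\<exists>d>0. \<forall>x\<in>K. \<forall>y\<in>-U. d \<le> dist x y"
    using KU by (intro separate_compact_closed) auto
  then obtain d where d: "0 < d" "\<And>x y. x \<in> K \<Longrightarrow> y \<notin> U \<Longrightarrow> d \<le> dist x y" by auto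
  show ?case
  proof (intro exI[of _ d] conjI allI impI d(1))
    fix h :: 'a assume h: "norm h < d"
    have near: "x + h \<in> U" "x - h \<in> U" if "x \<in> K" for x
      using d(2)[OF that, of "x + h"] d(2)[OF that, of "x - h"] h by (auto simp: dist_norm)
    have pt: "\<bar>indicator A (z + h) *\<^sub>R c - indicator A z *\<^sub>R c\<bar> \<le> (\<bar>c\<bar> + 1) * (indicator (U - K) (z + h) + indicator (U - K) z)" for z
    proof -
      have "z \<in> A \<Longrightarrow> z + h \<notin> A \<Longrightarrow> z \<in> U - K \<or> z + h \<in> U - K" using near(1)[of z] KU by blast
      moreover have "z \<notin> A \<Longrightarrow> z + h \<in> A \<Longrightarrow> z \<in> U - K \<or> z + h \<in> U - K" using near(2)[of "z + h"] KU by auto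
      ultimately show ?thesis by (auto simp: indicator_def)
    qed
    have "(\<integral>\<^sup>+z. ennreal \<bar>indicator A (z + h) *\<^sub>R c - indicator A z *\<^sub>R c\<bar> \<partial>lborel)
      \<le> (\<integral>\<^sup>+z. ennreal (\<bar>c\<bar> + 1) * (indicator (U - K) (z + h) + indicator (U - K) z) \<partial>lborel)"
    proof (rule nn_integral_mono)
      fix z
      have "ennreal \<bar>indicator A (z + h) *\<^sub>R c - indicator A z *\<^sub>R c\<bar> \<le> ennreal ((\<bar>c\<bar> + 1) * (indicator (U - K) (z + h) + indicator (U - K) z))"
        by (rule ennreal_leI[OF pt])
      also have "\<dots> = ennreal (\<bar>c\<bar> + 1) * (indicator (U - K) (z + h) + indicator (U - K) z)"
        by (simp add: ennreal_mult' ennreal_plus ennreal_indicator)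
      finally show "ennreal \<bar>indicator A (z + h) *\<^sub>R c - indicator A z *\<^sub>R c\<bar> \<le> ennreal (\<bar>c\<bar> + 1) * (indicator (U - K) (z + h) + indicator (U - K) z)" .
    qed
    also have "\<dots> = ennreal (\<bar>c\<bar> + 1) * (\<integral>\<^sup>+z. indicator (U - K) (z + h) + indicator (U - K) z \<partial>lborel)"
      by (rule nn_integral_cmult) measurable
    also have "(\<integral>\<^sup>+z. indicator (U - K) (z + h) + indicator (U - K) z \<partial>lborel)
      = (\<integral>\<^sup>+z. indicator (U - K) (z + h) \<partial>lborel) + (\<integral>\<^sup>+z. indicator (U - K) z \<partial>lborel)"
      by (rule nn_integral_add) measurable
    also have "(\<integral>\<^sup>+z. indicator (U - K) (z + h) \<partial>lborel) = (\<integral>\<^sup>+z. indicator (U - K) z \<partial>lborel)"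
      by (rule nn_integral_lborel_translate) measurable
    also have "(\<integral>\<^sup>+z. indicator (U - K) z \<partial>lborel) = emeasure lborel (U - K)" by (rule nn_integral_indicator) measurable
    also have "ennreal (\<bar>c\<bar> + 1) * (emeasure lborel (U - K) + emeasure lborel (U - K))
      \<le> ennreal (\<bar>c\<bar> + 1) * (ennreal (e / (2 * (\<bar>c\<bar> + 1))) + ennreal (e / (2 * (\<bar>c\<bar> + 1))))"
      by (intro mult_left_mono add_mono KU) simp
    also have "\<dots> = ennreal e"
    proof -
      have c1: "0 < \<bar>c\<bar> + 1" by simp
      have "k * (e / (2 * k) + e / (2 * k)) = e" if "0 < k" for k using that by (simp add: field_simps)
      then have "(\<bar>c\<bar> + 1) * (e / (2 * (\<bar>c\<bar> + 1)) + e / (2 * (\<bar>c\<bar> + 1))) = e" using c1 by blast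
      then show ?thesis using base(3) c1 by (simp add: ennreal_plus[symmetric] ennreal_mult'[symmetric] del: ennreal_plus)
    qed
    finally show "(\<integral>\<^sup>+z. ennreal \<bar>indicator A (z + h) *\<^sub>R c - indicator A z *\<^sub>R c\<bar> \<partial>lborel) \<le> ennreal e" .
  qed
next
  case (add f g)
  have [measurable]: "f \<in> borel_measurable borel" "g \<in> borel_measurable borel" using add.hyps by auto
  have e2: "0 < e / 2" using add.prems by simp
  obtain d1 where d1: "0 < d1" "\<And>h. norm h < d1 \<Longrightarrow> (\<integral>\<^sup>+z. ennreal \<bar>f (z + h) - f z\<bar> \<partial>lborel) \<le> ennreal (e / 2)"
    using add.IH(1)[OF e2] by blast
  obtain d2 where d2: "0 < d2" "\<And>h. norm h < d2 \<Longrightarrow> (\<integral>\<^sup>+z. ennreal \<bar>g (z + h) - g z\<bar> \<partial>lborel) \<le> ennreal (e / 2)"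
    using add.IH(2)[OF e2] by blast
  show ?case
  proof (intro exI[of _ "min d1 d2"] conjI allI impI)
    fix h :: 'a assume h: "norm h < min d1 d2"
    have "(\<integral>\<^sup>+z. ennreal \<bar>(f (z + h) + g (z + h)) - (f z + g z)\<bar> \<partial>lborel)
      \<le> (\<integral>\<^sup>+z. ennreal \<bar>f (z + h) - f z\<bar> + ennreal \<bar>g (z + h) - g z\<bar> \<partial>lborel)"
      by (intro nn_integral_mono) (simp add: ennreal_plus[symmetric] ennreal_leI del: ennreal_plus)
    also have "\<dots> = (\<integral>\<^sup>+z. ennreal \<bar>f (z + h) - f z\<bar> \<partial>lborel) + (\<integral>\<^sup>+z. ennreal \<bar>g (z + h) - g z\<bar> \<partial>lborel)"
      by (rule nn_integral_add) measurable
    also have "\<dots> \<le> ennreal (e / 2) + ennreal (e / 2)" using h by (intro add_mono d1 d2) auto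
    also have "\<dots> = ennreal e" using add.prems by (simp flip: ennreal_plus)
    finally show "(\<integral>\<^sup>+z. ennreal \<bar>(f (z + h) + g (z + h)) - (f z + g z)\<bar> \<partial>lborel) \<le> ennreal e" .
  qed (use d1 d2 in auto)
next
  case (lim f s)
  have [measurable]: "f \<in> borel_measurable borel" "\<And>i. s i \<in> borel_measurable borel" using lim.hyps by auto
  have e3: "0 < e / 3" using lim.prems by simp
  have "(\<lambda>i. \<integral>\<^sup>+z. ennreal (norm (f z - s i z)) \<partial>lborel) \<longlonglongrightarrow> 0"
  proof (rule nn_integral_dominated_convergence_norm[where w = "\<lambda>z. 2 * norm (f z)"])
    show "(\<integral>\<^sup>+z. ennreal (2 * norm (f z)) \<partial>lborel) < \<infinity>"
    proof -
      have "integrable lborel (\<lambda>z. 2 * norm (f z))" using lim.hyps by simp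
      then show ?thesis unfolding integrable_iff_bounded by simp
    qed
  qed (use lim.hyps in auto)
  then have "\<forall>\<^sub>F i in sequentially. (\<integral>\<^sup>+z. ennreal (norm (f z - s i z)) \<partial>lborel) < ennreal (e / 3)"
    using lim.prems by (intro order_tendstoD) auto
  then obtain i where i: "(\<integral>\<^sup>+z. ennreal \<bar>s i z - f z\<bar> \<partial>lborel) < ennreal (e / 3)"
    unfolding eventually_sequentially real_norm_def abs_minus_commute[of "f _"] by blast
  obtain d where d: "0 < d" "\<And>h. norm h < d \<Longrightarrow> (\<integral>\<^sup>+z. ennreal \<bar>s i (z + h) - s i z\<bar> \<partial>lborel) \<le> ennreal (e / 3)"
    using lim.IH[OF e3] by blast
  show ?case
  proof (intro exI[of _ d] conjI allI impI d(1))
    fix h :: 'a assume h: "norm h < d"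
    have "(\<integral>\<^sup>+z. ennreal \<bar>f (z + h) - f z\<bar> \<partial>lborel)
      \<le> (\<integral>\<^sup>+z. ennreal \<bar>s i (z + h) - f (z + h)\<bar> + (ennreal \<bar>s i (z + h) - s i z\<bar> + ennreal \<bar>s i z - f z\<bar>) \<partial>lborel)"
      by (intro nn_integral_mono) (simp add: ennreal_plus[symmetric] ennreal_leI del: ennreal_plus)
    also have "\<dots> = (\<integral>\<^sup>+z. ennreal \<bar>s i (z + h) - f (z + h)\<bar> \<partial>lborel) + ((\<integral>\<^sup>+z. ennreal \<bar>s i (z + h) - s i z\<bar> \<partial>lborel) + (\<integral>\<^sup>+z. ennreal \<bar>s i z - f z\<bar> \<partial>lborel))"
      by (simp add: nn_integral_add)
    also have "(\<integral>\<^sup>+z. ennreal \<bar>s i (z + h) - f (z + h)\<bar> \<partial>lborel) = (\<integral>\<^sup>+z. ennreal \<bar>s i z - f z\<bar> \<partial>lborel)"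
      by (rule nn_integral_lborel_translate) measurable
    also have "(\<integral>\<^sup>+z. ennreal \<bar>s i z - f z\<bar> \<partial>lborel) + ((\<integral>\<^sup>+z. ennreal \<bar>s i (z + h) - s i z\<bar> \<partial>lborel) + (\<integral>\<^sup>+z. ennreal \<bar>s i z - f z\<bar> \<partial>lborel))
      \<le> ennreal (e / 3) + (ennreal (e / 3) + ennreal (e / 3))"
      using i h by (intro add_mono d) auto
    also have "\<dots> = ennreal e" using lim.prems by (simp flip: ennreal_plus)
    finally show "(\<integral>\<^sup>+z. ennreal \<bar>f (z + h) - f z\<bar> \<partial>lborel) \<le> ennreal e" .
  qed
qed

definition mollify :: "real \<Rightarrow> ('a::euclidean_space \<times> real \<Rightarrow> real) \<Rightarrow> 'a \<times> real \<Rightarrow> real" where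
  "mollify \<epsilon> f z = (LINT \<zeta>|lborel. f \<zeta> * mollifier \<epsilon> (\<zeta> - z))"

lemma mollify_measurable[measurable]:
  assumes [measurable]: "f \<in> borel_measurable borel"
  shows "mollify \<epsilon> f \<in> borel_measurable borel"
  unfolding mollify_def[abs_def] by measurable

lemma (in weak_gradient) mollified_eq_mollify: "mollified \<epsilon> = mollify \<epsilon> u"
  by (simp add: mollified_def mollify_def fun_eq_iff)

lemma integral_mollifier:
  fixes z :: "'a::euclidean_space \<times> real"
  assumes "0 < \<epsilon>"
  shows "integrable lborel (\<lambda>\<zeta>. mollifier \<epsilon> (\<zeta> - z))" "(LINT \<zeta>|lborel. mollifier \<epsilon> (\<zeta> - z)) = 1"
proof -
  have 1: "(\<integral>\<^sup>+\<zeta>. ennreal (mollifier \<epsilon> (\<zeta> - z)) \<partial>lborel) = 1"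
  proof -
    have "(\<integral>\<^sup>+\<zeta>. ennreal (mollifier \<epsilon> (\<zeta> + - z)) \<partial>lborel) = (\<integral>\<^sup>+(\<zeta> :: 'a \<times> real). ennreal (mollifier \<epsilon> \<zeta>) \<partial>lborel)"
      by (rule nn_integral_lborel_translate[where G = "\<lambda>w :: 'a \<times> real. ennreal (mollifier \<epsilon> w)"]) measurable
    then show ?thesis unfolding nn_integral_mollifier[OF assms] add_uminus_conv_diff .
  qed
  show "integrable lborel (\<lambda>\<zeta>. mollifier \<epsilon> (\<zeta> - z))"
  proof (rule integrableI_nonneg)
    show "(\<lambda>\<zeta>. mollifier \<epsilon> (\<zeta> - z)) \<in> borel_measurable lborel" by measurable
    show "AE \<zeta> in lborel. 0 \<le> mollifier \<epsilon> (\<zeta> - z)" by (rule AE_I2, rule mollifier_nonneg[OF assms])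
    show "(\<integral>\<^sup>+\<zeta>. ennreal (mollifier \<epsilon> (\<zeta> - z)) \<partial>lborel) < \<infinity>" unfolding 1 by simp
  qed
  show "(LINT \<zeta>|lborel. mollifier \<epsilon> (\<zeta> - z)) = 1"
  proof -
    have "(LINT \<zeta>|lborel. mollifier \<epsilon> (\<zeta> - z)) = enn2real (\<integral>\<^sup>+\<zeta>. ennreal (mollifier \<epsilon> (\<zeta> - z)) \<partial>lborel)"
    proof (rule integral_eq_nn_integral)
      show "(\<lambda>\<zeta>. mollifier \<epsilon> (\<zeta> - z)) \<in> borel_measurable lborel" by measurable
      show "AE \<zeta> in lborel. 0 \<le> mollifier \<epsilon> (\<zeta> - z)" by (rule AE_I2, rule mollifier_nonneg[OF assms])
    qed
    then show ?thesis unfolding 1 by simp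
  qed
qed

lemma integrable_mult_mollifier:
  assumes "integrable lborel G" "0 < \<epsilon>"
  shows "integrable lborel (\<lambda>\<zeta>. G \<zeta> * mollifier \<epsilon> (\<zeta> - z))"
proof -
  let ?C = "1 / (\<epsilon> ^ (DIM('a) + 1) * (LINT y|lborel. raw_bump (y :: 'a \<times> real)))"
  have [measurable]: "G \<in> borel_measurable borel" using assms(1) by auto
  show ?thesis
  proof (rule Bochner_Integration.integrable_bound[OF integrable_mult_right[OF assms(1), of ?C]])
    show "AE \<zeta> in lborel. norm (G \<zeta> * mollifier \<epsilon> (\<zeta> - z)) \<le> norm (?C * G \<zeta>)"
    proof (rule AE_I2)
      fix \<zeta>
      have "mollifier \<epsilon> (\<zeta> - z) \<le> ?C" "0 \<le> mollifier \<epsilon> (\<zeta> - z)" by (rule mollifier_bounded[OF assms(2)] mollifier_nonneg[OF assms(2)])+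
      then have "\<bar>mollifier \<epsilon> (\<zeta> - z)\<bar> \<le> \<bar>?C\<bar>" by linarith
      then have "\<bar>G \<zeta>\<bar> * \<bar>mollifier \<epsilon> (\<zeta> - z)\<bar> \<le> \<bar>G \<zeta>\<bar> * \<bar>?C\<bar>" by (rule mult_left_mono) simp
      then show "norm (G \<zeta> * mollifier \<epsilon> (\<zeta> - z)) \<le> norm (?C * G \<zeta>)"
        unfolding real_norm_def abs_mult by (simp only: mult.commute)
    qed
  qed measurable
qed

text \<open>A mollification is a mean of translates.\<close>

lemma mollify_L1:
  fixes G :: "'a::euclidean_space \<times> real \<Rightarrow> real"
  assumes G: "integrable lborel G" and "0 < (e :: real)"
  shows "\<exists>d>0. \<forall>\<epsilon>. 0 < \<epsilon> \<and> \<epsilon> < d \<longrightarrow> (\<integral>\<^sup>+z. ennreal \<bar>mollify \<epsilon> G z - G z\<bar> \<partial>lborel) \<le> ennreal e"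
proof -
  have [measurable]: "G \<in> borel_measurable borel" using G by auto
  obtain d where d: "0 < d" "\<And>h. norm h < d \<Longrightarrow> (\<integral>\<^sup>+z. ennreal \<bar>G (z + h) - G z\<bar> \<partial>lborel) \<le> ennreal e"
    using L1_translation_continuous[OF assms] by auto
  show ?thesis
  proof (intro exI[of _ "d / 3"] conjI allI impI)
    fix \<epsilon> assume e: "0 < \<epsilon> \<and> \<epsilon> < d / 3"
    then have \<epsilon>: "0 < \<epsilon>" by simp
    have "(\<integral>\<^sup>+z. ennreal \<bar>mollify \<epsilon> G z - G z\<bar> \<partial>lborel) \<le> (\<integral>\<^sup>+z. \<integral>\<^sup>+y. ennreal (mollifier \<epsilon> y) * ennreal \<bar>G (z + y) - G z\<bar> \<partial>lborel \<partial>lborel)"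
    proof (rule nn_integral_mono)
      fix z
      have "mollify \<epsilon> G z - G z = (LINT \<zeta>|lborel. G \<zeta> * mollifier \<epsilon> (\<zeta> - z)) - (LINT \<zeta>|lborel. G z * mollifier \<epsilon> (\<zeta> - z))"
        by (simp add: mollify_def integral_mollifier[OF \<epsilon>])
      also have "\<dots> = (LINT \<zeta>|lborel. G \<zeta> * mollifier \<epsilon> (\<zeta> - z) - G z * mollifier \<epsilon> (\<zeta> - z))"
        by (intro Bochner_Integration.integral_diff[symmetric] integrable_mult_mollifier G \<epsilon> integrable_mult_right integral_mollifier)
      finally have "ennreal \<bar>mollify \<epsilon> G z - G z\<bar> = ennreal (norm (LINT \<zeta>|lborel. G \<zeta> * mollifier \<epsilon> (\<zeta> - z) - G z * mollifier \<epsilon> (\<zeta> - z)))" by simp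
      also have "\<dots> \<le> (\<integral>\<^sup>+\<zeta>. ennreal (norm (G \<zeta> * mollifier \<epsilon> (\<zeta> - z) - G z * mollifier \<epsilon> (\<zeta> - z))) \<partial>lborel)"
        by (rule integral_norm_le_nn_integral)
      also have "\<dots> = (\<integral>\<^sup>+\<zeta>. ennreal (mollifier \<epsilon> (\<zeta> + - z)) * ennreal \<bar>G (z + (\<zeta> + - z)) - G z\<bar> \<partial>lborel)"
      proof (rule nn_integral_cong)
        fix \<zeta>
        have m: "0 \<le> mollifier \<epsilon> (\<zeta> - z)" by (rule mollifier_nonneg[OF \<epsilon>])
        then have "norm (G \<zeta> * mollifier \<epsilon> (\<zeta> - z) - G z * mollifier \<epsilon> (\<zeta> - z)) = mollifier \<epsilon> (\<zeta> - z) * \<bar>G \<zeta> - G z\<bar>"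
          by (simp add: left_diff_distrib[symmetric] abs_mult)
        then show "ennreal (norm (G \<zeta> * mollifier \<epsilon> (\<zeta> - z) - G z * mollifier \<epsilon> (\<zeta> - z)))
          = ennreal (mollifier \<epsilon> (\<zeta> + - z)) * ennreal \<bar>G (z + (\<zeta> + - z)) - G z\<bar>"
          using m by (simp add: ennreal_mult'[symmetric])
      qed
      also have "\<dots> = (\<integral>\<^sup>+y. ennreal (mollifier \<epsilon> y) * ennreal \<bar>G (z + y) - G z\<bar> \<partial>lborel)"
        by (rule nn_integral_lborel_translate[where G = "\<lambda>y. ennreal (mollifier \<epsilon> y) * ennreal \<bar>G (z + y) - G z\<bar>"]) measurable
      finally show "ennreal \<bar>mollify \<epsilon> G z - G z\<bar> \<le> (\<integral>\<^sup>+y. ennreal (mollifier \<epsilon> y) * ennreal \<bar>G (z + y) - G z\<bar> \<partial>lborel)" .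
    qed
    also have "\<dots> = (\<integral>\<^sup>+y. \<integral>\<^sup>+z. ennreal (mollifier \<epsilon> y) * ennreal \<bar>G (z + y) - G z\<bar> \<partial>lborel \<partial>lborel)"
      by (rule lborel_pair.Fubini') measurable
    also have "\<dots> = (\<integral>\<^sup>+y. ennreal (mollifier \<epsilon> y) * (\<integral>\<^sup>+z. ennreal \<bar>G (z + y) - G z\<bar> \<partial>lborel) \<partial>lborel)"
      by (intro nn_integral_cong nn_integral_cmult) measurable
    also have "\<dots> \<le> (\<integral>\<^sup>+y. ennreal (mollifier \<epsilon> y) * ennreal e \<partial>(lborel :: ('a \<times> real) measure))"
    proof (rule nn_integral_mono)
      fix y :: "'a \<times> real"
      show "ennreal (mollifier \<epsilon> y) * (\<integral>\<^sup>+z. ennreal \<bar>G (z + y) - G z\<bar> \<partial>lborel) \<le> ennreal (mollifier \<epsilon> y) * ennreal e"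
      proof (cases "mollifier \<epsilon> y = 0")
        case False
        have "norm y \<le> norm ((0, 2 * \<epsilon>) :: 'a \<times> real) + norm (y - (0, 2 * \<epsilon>))" by (rule norm_triangle_sub)
        moreover have "norm (y - (0, 2 * \<epsilon>)) < \<epsilon>" by (rule mollifier_support(1)[OF \<epsilon> False])
        moreover have "norm ((0, 2 * \<epsilon>) :: 'a \<times> real) = 2 * \<epsilon>" using \<epsilon> by (simp add: norm_Pair real_sqrt_mult)
        ultimately have "norm y < d" using e by linarith
        then show ?thesis by (intro mult_left_mono d) auto
      qed simp
    qed
    also have "\<dots> = ennreal e" by (subst nn_integral_multc) (auto simp: nn_integral_mollifier[OF \<epsilon>])
    finally show "(\<integral>\<^sup>+z. ennreal \<bar>mollify \<epsilon> G z - G z\<bar> \<partial>lborel) \<le> ennreal e" .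
  qed (use d in simp)
qed

lemma mollify_local_L1:
  fixes f :: "'a::euclidean_space \<times> real \<Rightarrow> real"
  assumes [measurable]: "f \<in> borel_measurable borel" "A' \<in> sets borel" "A \<in> sets borel"
    and int: "integrable lborel (\<lambda>z. indicator A' z * f z)" and sub: "A \<subseteq> A'"
    and near: "\<And>\<epsilon> z \<zeta>. 0 < \<epsilon> \<Longrightarrow> \<epsilon> < 1 \<Longrightarrow> z \<in> A \<Longrightarrow> mollifier \<epsilon> (\<zeta> - z) \<noteq> 0 \<Longrightarrow> \<zeta> \<in> A'"
    and e: "0 < (e :: real)"
  shows "\<exists>d>0. \<forall>\<epsilon>. 0 < \<epsilon> \<and> \<epsilon> < d \<longrightarrow> (\<integral>\<^sup>+z\<in>A. ennreal \<bar>mollify \<epsilon> f z - f z\<bar> \<partial>lborel) \<le> ennreal e"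
proof -
  let ?G = "\<lambda>z. indicator A' z * f z"
  obtain d where d: "0 < d" "\<And>\<epsilon>. 0 < \<epsilon> \<and> \<epsilon> < d \<Longrightarrow> (\<integral>\<^sup>+z. ennreal \<bar>mollify \<epsilon> ?G z - ?G z\<bar> \<partial>lborel) \<le> ennreal e"
    using mollify_L1[OF int e] by metis
  show ?thesis
  proof (intro exI[of _ "min d 1"] conjI allI impI)
    fix \<epsilon> :: real assume \<epsilon>: "0 < \<epsilon> \<and> \<epsilon> < min d 1"
    have "(\<integral>\<^sup>+z\<in>A. ennreal \<bar>mollify \<epsilon> f z - f z\<bar> \<partial>lborel) \<le> (\<integral>\<^sup>+z. ennreal \<bar>mollify \<epsilon> ?G z - ?G z\<bar> \<partial>lborel)"
    proof (rule nn_integral_mono)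
      fix z
      show "ennreal \<bar>mollify \<epsilon> f z - f z\<bar> * indicator A z \<le> ennreal \<bar>mollify \<epsilon> ?G z - ?G z\<bar>"
      proof (cases "z \<in> A")
        case True
        have "f \<zeta> * mollifier \<epsilon> (\<zeta> - z) = ?G \<zeta> * mollifier \<epsilon> (\<zeta> - z)" for \<zeta>
          using near[of \<epsilon> z \<zeta>] True \<epsilon> by (cases "mollifier \<epsilon> (\<zeta> - z) = 0") auto
        then have "mollify \<epsilon> f z = mollify \<epsilon> ?G z"
          unfolding mollify_def by (intro Bochner_Integration.integral_cong refl)
        then show ?thesis using True sub by auto
      qed simp
    qed
    also have "\<dots> \<le> ennreal e" using \<epsilon> by (intro d) auto
    finally show "(\<integral>\<^sup>+z\<in>A. ennreal \<bar>mollify \<epsilon> f z - f z\<bar> \<partial>lborel) \<le> ennreal e" .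
  qed (use d in auto)
qed

section \<open>Vertical lines and the boundary value\<close>

definition strip :: "real \<Rightarrow> real \<Rightarrow> real \<Rightarrow> ('a::euclidean_space \<times> real) set" where
  "strip R a b = cball 0 R \<times> {a..b}"

lemma compact_strip: "compact (strip R a b)"
  unfolding strip_def by (intro compact_Times compact_cball compact_Icc)

lemma cball_borel[measurable]: "cball a r \<in> sets borel"
  by (rule borel_closed[OF closed_cball])

lemma strip_borel[measurable]: "strip R a b \<in> sets borel"
  by (rule borel_closed[OF compact_imp_closed[OF compact_strip]])

lemma in_strip: "(x, t) \<in> strip R a b \<longleftrightarrow> norm x \<le> R \<and> a \<le> t \<and> t \<le> b"
  by (simp add: strip_def)

lemma strip_mono: "R \<le> R' \<Longrightarrow> a' \<le> a \<Longrightarrow> b \<le> b' \<Longrightarrow> strip R a b \<subseteq> strip R' a' b'"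
  unfolding strip_def by (intro Sigma_mono) auto

lemma strip_near:
  assumes "0 < \<epsilon>" "\<epsilon> < 1" "z \<in> strip R a b" "mollifier \<epsilon> (\<zeta> - z) \<noteq> 0"
  shows "\<zeta> \<in> strip (R + 1) a (b + 3)"
proof -
  obtain x t y s where eq: "z = (x, t)" "\<zeta> = (y, s)" by (cases z, cases \<zeta>)
  note m = mollifier_support[OF assms(1,4)]
  have "norm (y - x) < \<epsilon>" "\<epsilon> < s - t" "s - t < 3 * \<epsilon>" using m(2-4) by (simp_all add: eq)
  moreover have "norm y \<le> norm x + norm (y - x)" by (rule norm_triangle_sub)
  ultimately show ?thesis using assms(1-3) unfolding eq in_strip by auto
qed

lemma power_weight_strip:
  assumes "- 1 < \<gamma>" "0 \<le> T"
  shows "(\<integral>\<^sup>+z\<in>(strip R 0 T :: ('a::euclidean_space \<times> real) set). ennreal (snd z powr \<gamma>) \<partial>lborel) < \<infinity>"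
proof -
  have "(\<integral>\<^sup>+z\<in>(strip R 0 T :: ('a \<times> real) set). ennreal (snd z powr \<gamma>) \<partial>lborel)
    = (\<integral>\<^sup>+t. \<integral>\<^sup>+(x :: 'a). ennreal (snd (x, t) powr \<gamma>) * indicator (strip R 0 T) (x, t) \<partial>lborel \<partial>lborel)"
    by (rule nn_integral_lborel_Pair) measurable
  also have "\<dots> = (\<integral>\<^sup>+t. \<integral>\<^sup>+(x :: 'a). ennreal (indicator {0..T} t * t powr \<gamma>) * indicator (cball 0 R) x \<partial>lborel \<partial>lborel)"
    by (intro nn_integral_cong) (simp add: strip_def indicator_def)
  also have "\<dots> = (\<integral>\<^sup>+t. ennreal (indicator {0..T} t * t powr \<gamma>) * emeasure lborel (cball (0 :: 'a) R) \<partial>lborel)"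
    by (intro nn_integral_cong nn_integral_cmult_indicator) simp
  also have "\<dots> = (\<integral>\<^sup>+t. ennreal (indicator {0..T} t * t powr \<gamma>) \<partial>lborel) * emeasure lborel (cball (0 :: 'a) R)"
    by (rule nn_integral_multc) measurable
  also have "(\<integral>\<^sup>+t. ennreal (indicator {0..T} t * t powr \<gamma>) \<partial>lborel) = ennreal (T powr (\<gamma> + 1) / (\<gamma> + 1))"
    by (rule nn_integral_has_integral_lebesgue[OF _ has_integral_powr_from_0]) (use assms in auto)
  also have "ennreal (T powr (\<gamma> + 1) / (\<gamma> + 1)) * emeasure lborel (cball (0 :: 'a) R) < \<infinity>"
    using emeasure_bounded_finite[OF bounded_cball, of "0 :: 'a" R] by (simp add: ennreal_mult_less_top)
  finally show ?thesis .
qed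

text \<open>By Young's inequality \<open>f \<le> f powr p * t powr \<beta> + t powr \<gamma>\<close> at height \<open>t\<close>, where \<open>\<gamma> = - \<beta> / (p - 1) > - 1\<close>. So the weighted energy controls the gradient in \<open>L\<^sup>1\<close> up to the boundary.\<close>

lemma weighted_energy_L1:
  fixes f :: "'a::euclidean_space \<times> real \<Rightarrow> real"
  assumes [measurable]: "f \<in> borel_measurable borel" and f0: "\<And>z. 0 \<le> f z"
    and p: "1 < p" "\<beta> < p - 1" and T: "0 \<le> T"
    and fin: "(\<integral>\<^sup>+z\<in>upper_half. ennreal (f z powr p * snd z powr \<beta>) \<partial>lborel) < \<infinity>"
  shows "(\<integral>\<^sup>+z\<in>strip R 0 T. ennreal (f z) \<partial>lborel) < \<infinity>"
proof -
  define q where "q = p / (p - 1)"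
  have q: "1 < q" "1 / p + 1 / q = 1" using p by (simp_all add: q_def field_simps)
  define \<gamma> where "\<gamma> = - \<beta> / (p - 1)"
  have \<gamma>: "- 1 < \<gamma>" using p by (simp add: \<gamma>_def field_simps)
  have pt: "f z \<le> f z powr p * snd z powr \<beta> + snd z powr \<gamma>" if z: "0 < snd z" for z
  proof -
    have "(f z * snd z powr (\<beta> / p)) * snd z powr (- \<beta> / p)
        \<le> (f z * snd z powr (\<beta> / p)) powr p / p + (snd z powr (- \<beta> / p)) powr q / q"
      using p q f0[of z] by (intro Youngs_inequality) auto
    also have "(f z * snd z powr (\<beta> / p)) * snd z powr (- \<beta> / p) = f z"
    proof -
      have "snd z powr (\<beta> / p) * snd z powr (- \<beta> / p) = 1" using z by (simp add: powr_add[symmetric])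
      then show ?thesis by (simp add: mult.assoc)
    qed
    also have "(f z * snd z powr (\<beta> / p)) powr p = f z powr p * snd z powr \<beta>"
      using p f0[of z] by (simp add: powr_mult powr_powr)
    also have "(snd z powr (- \<beta> / p)) powr q = snd z powr \<gamma>"
      using p by (simp add: powr_powr q_def \<gamma>_def)
    also have "f z powr p * snd z powr \<beta> / p + snd z powr \<gamma> / q \<le> f z powr p * snd z powr \<beta> + snd z powr \<gamma>"
    proof -
      have "X / r \<le> X" if "0 \<le> X" "1 < r" for X r :: real
        using that mult_left_mono[of 1 r X] by (simp add: divide_le_eq)
      then show ?thesis using p q by (intro add_mono) simp_all
    qed
    finally show ?thesis .
  qed
  let ?F = "\<lambda>z. ennreal (f z powr p * snd z powr \<beta>) * indicator upper_half z + ennreal (snd z powr \<gamma>) * indicator (strip R 0 T) z"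
  have "(\<integral>\<^sup>+z\<in>strip R 0 T. ennreal (f z) \<partial>lborel) = (\<integral>\<^sup>+t. \<integral>\<^sup>+x. ennreal (f (x, t)) * indicator (strip R 0 T) (x, t) \<partial>lborel \<partial>lborel)"
    by (rule nn_integral_lborel_Pair) measurable
  also have "\<dots> \<le> (\<integral>\<^sup>+t. \<integral>\<^sup>+x. ?F (x, t) \<partial>lborel \<partial>lborel)"
  proof (rule nn_integral_mono_AE)
    have "AE t in lborel. t \<noteq> (0::real)" by (rule AE_lborel_singleton)
    then show "AE t in lborel. (\<integral>\<^sup>+x. ennreal (f (x, t)) * indicator (strip R 0 T) (x, t) \<partial>lborel) \<le> (\<integral>\<^sup>+x. ?F (x, t) \<partial>lborel)"
    proof eventually_elim
      case (elim t)
      show ?case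
      proof (rule nn_integral_mono)
        fix x
        show "ennreal (f (x, t)) * indicator (strip R 0 T) (x, t) \<le> ?F (x, t)"
        proof (cases "(x, t) \<in> strip R 0 T")
          case True
          then have t: "0 < t" using elim by (simp add: in_strip)
          then have "ennreal (f (x, t)) \<le> ennreal (f (x, t) powr p * t powr \<beta>) + ennreal (t powr \<gamma>)"
            using pt[of "(x, t)"] by (simp add: ennreal_plus[symmetric] ennreal_leI del: ennreal_plus)
          then show ?thesis using True t by (simp add: upper_half_def)
        qed simp
      qed
    qed
  qed
  also have "\<dots> = (\<integral>\<^sup>+z. ?F z \<partial>lborel)" by (rule nn_integral_lborel_Pair[symmetric]) measurable
  also have "\<dots> = (\<integral>\<^sup>+z\<in>upper_half. ennreal (f z powr p * snd z powr \<beta>) \<partial>lborel) + (\<integral>\<^sup>+z\<in>(strip R 0 T :: ('a \<times> real) set). ennreal (snd z powr \<gamma>) \<partial>lborel)"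
    by (rule nn_integral_add) measurable
  also have "\<dots> < \<infinity>" using fin power_weight_strip[OF \<gamma> T, where ?'a = 'a, of R] by simp
  finally show ?thesis .
qed

lemma AE_tendsto_0_of_summable_L1:
  fixes f :: "nat \<Rightarrow> 'b \<Rightarrow> ennreal"
  assumes [measurable]: "\<And>n. f n \<in> borel_measurable M" and le: "\<And>n. (\<integral>\<^sup>+x. f n x \<partial>M) \<le> ennreal ((1 / 2) ^ n)"
  shows "AE x in M. (\<lambda>n. f n x) \<longlonglongrightarrow> 0"
proof -
  have "(\<integral>\<^sup>+x. (\<Sum>n. f n x) \<partial>M) = (\<Sum>n. \<integral>\<^sup>+x. f n x \<partial>M)" by (rule nn_integral_suminf) measurable
  also have "\<dots> \<le> (\<Sum>n. ennreal ((1 / 2) ^ n))" by (intro suminf_le le) auto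
  also have "\<dots> = ennreal (\<Sum>n. (1 / 2) ^ n)" by (rule suminf_ennreal2) (auto intro: summable_geometric)
  finally have "(\<integral>\<^sup>+x. (\<Sum>n. f n x) \<partial>M) \<noteq> \<infinity>" by (auto simp: top_unique)
  then have "AE x in M. (\<Sum>n. f n x) \<noteq> \<infinity>" by (intro nn_integral_noteq_infinite) auto
  then show ?thesis
  proof eventually_elim
    case (elim x)
    have fin: "f n x \<noteq> \<infinity>" for n
    proof
      assume "f n x = \<infinity>"
      moreover have "f n x \<le> (\<Sum>n. f n x)"
        using sum_le_suminf[of "\<lambda>n. f n x" "{n}"] by simp
      ultimately show False using elim by (simp add: top_unique)
    qed
    define r where "r n = enn2real (f n x)" for n
    have fr: "f n x = ennreal (r n)" "0 \<le> r n" for n using fin[of n] by (simp_all add: r_def less_top)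
    have "summable r" using elim by (intro summable_suminf_not_top) (simp_all add: fr)
    then have "r \<longlonglongrightarrow> 0" by (rule summable_LIMSEQ_zero)
    then have "(\<lambda>n. ennreal (r n)) \<longlonglongrightarrow> ennreal 0" by (rule tendsto_ennrealI)
    then show ?case by (simp add: fr)
  qed
qed

lemma AE_lborel_fst:
  assumes "AE x in lborel. P (x :: 'a::euclidean_space)"
  shows "AE z in (lborel :: ('a \<times> real) measure). P (fst z)"
proof -
  obtain N where N: "N \<in> null_sets lborel" "{x \<in> space lborel. \<not> P x} \<subseteq> N"
    using assms unfolding eventually_ae_filter by blast
  have "emeasure (lborel \<Otimes>\<^sub>M lborel) (N \<times> (UNIV :: real set)) = emeasure lborel N * emeasure lborel (UNIV :: real set)"
    using N(1) by (intro lborel.emeasure_pair_measure_Times) auto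
  also have "\<dots> = 0" using N(1) by (simp add: null_setsD1)
  finally have "emeasure lborel (N \<times> (UNIV :: real set)) = 0" by (simp only: lborel_prod)
  moreover have "N \<times> (UNIV :: real set) \<in> sets (lborel \<Otimes>\<^sub>M lborel)" using N(1) by (intro pair_measureI) auto
  then have "N \<times> (UNIV :: real set) \<in> sets (lborel :: ('a \<times> real) measure)" by (simp only: lborel_prod)
  ultimately have "N \<times> (UNIV :: real set) \<in> null_sets lborel" by (rule null_setsI)
  then show ?thesis by (rule AE_I') (use N(2) in auto)
qed

lemma tendsto_of_ennreal_abs:
  fixes f :: "'b \<Rightarrow> real"
  assumes "((\<lambda>n. ennreal \<bar>f n - l\<bar>) \<longlongrightarrow> 0) F"
  shows "(f \<longlongrightarrow> l) F"
proof -
  have "((\<lambda>n. enn2real (ennreal \<bar>f n - l\<bar>)) \<longlongrightarrow> 0) F" by (rule tendsto_enn2real) (use assms in simp_all)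
  then have "((\<lambda>n. \<bar>f n - l\<bar>) \<longlongrightarrow> 0) F" by simp
  then show ?thesis by (rule LIM_zero_cancel[OF tendsto_rabs_zero_cancel])
qed

text \<open>Integrability of the gradient up to the boundary makes limits at the boundary exist along vertical lines.\<close>

locale trace_setting = weak_gradient u g for u :: "'a::euclidean_space \<times> real \<Rightarrow> real" and g +
  assumes gradient_L1: "\<And>R T. 0 \<le> T \<Longrightarrow> (\<integral>\<^sup>+z\<in>strip R 0 T. ennreal (norm (g z)) \<partial>lborel) < \<infinity>"
begin

definition gN :: "'a \<times> real \<Rightarrow> real" where
  "gN z = g z \<bullet> (0, 1)"

definition rise :: "('a \<times> real \<Rightarrow> real) \<Rightarrow> 'a \<Rightarrow> real \<Rightarrow> real" where
  "rise f x t = (LINT \<sigma>|lborel. indicator {0..t} \<sigma> * f (x, \<sigma>))"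

text \<open>On a vertical line, subtracting from \<open>u\<close> the increment since height \<open>0\<close> leaves a constant, the boundary value. Averaging over \<open>[1, 2]\<close> avoids point values of \<open>u\<close>.\<close>

definition boundary_value :: "'a \<Rightarrow> real" where
  "boundary_value x = (LINT \<tau>|lborel. indicator {1..2} \<tau> * (u (x, \<tau>) - rise gN x \<tau>))"

lemma gN_measurable[measurable]: "gN \<in> borel_measurable borel"
  unfolding gN_def[abs_def] by measurable

lemma gN_le: "\<bar>gN z\<bar> \<le> norm (g z)"
proof -
  have "\<bar>g z \<bullet> (0, 1)\<bar> \<le> norm (g z) * norm ((0, 1) :: 'a \<times> real)" by (rule Cauchy_Schwarz_ineq2)
  then show ?thesis by (simp add: gN_def norm_Pair)
qed

lemma rise_measurable[measurable]:
  assumes [measurable]: "f \<in> borel_measurable borel" "h \<in> borel_measurable M" "k \<in> borel_measurable M"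
  shows "(\<lambda>y. rise f (h y) (k y)) \<in> borel_measurable M"
  unfolding rise_def indicator_def atLeastAtMost_iff by measurable

lemma boundary_value_measurable[measurable]: "boundary_value \<in> borel_measurable borel"
  unfolding boundary_value_def[abs_def] by measurable

lemma gN_L1:
  assumes "0 \<le> T"
  shows "(\<integral>\<^sup>+z\<in>strip R 0 T. ennreal \<bar>gN z\<bar> \<partial>lborel) < \<infinity>"
proof -
  have "(\<integral>\<^sup>+z\<in>strip R 0 T. ennreal \<bar>gN z\<bar> \<partial>lborel) \<le> (\<integral>\<^sup>+z\<in>strip R 0 T. ennreal (norm (g z)) \<partial>lborel)"
    by (intro nn_integral_mono mult_right_mono ennreal_leI gN_le) simp
  then show ?thesis using gradient_L1[OF assms] by (rule le_less_trans)
qed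

lemma strip_upper_half: "0 < a \<Longrightarrow> strip R a b \<subseteq> upper_half"
  by (auto simp: strip_def upper_half_def)

lemma u_L1:
  assumes "0 < a"
  shows "integrable lborel (\<lambda>z. indicator (strip R a b) z * u z)" "(\<integral>\<^sup>+z\<in>strip R a b. ennreal \<bar>u z\<bar> \<partial>lborel) < \<infinity>"
proof -
  show i: "integrable lborel (\<lambda>z. indicator (strip R a b) z * u z)"
    using u_integrable[OF compact_strip strip_upper_half[OF assms]] by (simp only: real_scaleR_def)
  have "(\<integral>\<^sup>+z\<in>strip R a b. ennreal \<bar>u z\<bar> \<partial>lborel) = (\<integral>\<^sup>+z. ennreal (norm (indicator (strip R a b) z * u z)) \<partial>lborel)"
    by (intro nn_integral_cong) (simp add: abs_mult indicator_def)
  then show "(\<integral>\<^sup>+z\<in>strip R a b. ennreal \<bar>u z\<bar> \<partial>lborel) < \<infinity>"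
    using i unfolding integrable_iff_bounded by simp
qed

lemma integrable_gN_strip:
  assumes "0 \<le> T"
  shows "integrable lborel (\<lambda>z. indicator (strip R 0 T) z * gN z)"
proof (rule integrableI_bounded)
  show "(\<lambda>z. indicator (strip R 0 T) z * gN z) \<in> borel_measurable lborel" by measurable
  have "(\<integral>\<^sup>+z. ennreal (norm (indicator (strip R 0 T) z * gN z)) \<partial>lborel) = (\<integral>\<^sup>+z\<in>strip R 0 T. ennreal \<bar>gN z\<bar> \<partial>lborel)"
    by (intro nn_integral_cong) (simp add: abs_mult indicator_def)
  then show "(\<integral>\<^sup>+z. ennreal (norm (indicator (strip R 0 T) z * gN z)) \<partial>lborel) < \<infinity>" using gN_L1[OF assms, of R] by simp
qed

text \<open>Errors that are summable in \<open>n\<close> give almost everywhere convergence without passing to subsequences.\<close>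

lemma mollification_parameters:
  obtains \<epsilon> :: "nat \<Rightarrow> real" where "\<And>n. 0 < \<epsilon> n" "\<epsilon> \<longlonglongrightarrow> 0"
    "\<And>n. (\<integral>\<^sup>+z\<in>strip (real n + 1) (1 / (real n + 1)) (real n + 2). ennreal \<bar>mollify (\<epsilon> n) u z - u z\<bar> \<partial>lborel) \<le> ennreal ((1 / 2) ^ n)"
    "\<And>n. (\<integral>\<^sup>+z\<in>strip (real n + 1) 0 (real n + 2). ennreal \<bar>mollify (\<epsilon> n) gN z - gN z\<bar> \<partial>lborel) \<le> ennreal ((1 / 2) ^ n)"
proof -
  have "\<forall>n. \<exists>e. 0 < e \<and> e < 1 / (real n + 1)
    \<and> (\<integral>\<^sup>+z\<in>strip (real n + 1) (1 / (real n + 1)) (real n + 2). ennreal \<bar>mollify e u z - u z\<bar> \<partial>lborel) \<le> ennreal ((1 / 2) ^ n)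
    \<and> (\<integral>\<^sup>+z\<in>strip (real n + 1) 0 (real n + 2). ennreal \<bar>mollify e gN z - gN z\<bar> \<partial>lborel) \<le> ennreal ((1 / 2) ^ n)"
  proof
    fix n :: nat
    let ?A = "strip (real n + 1) (1 / (real n + 1)) (real n + 2) :: ('a \<times> real) set"
    let ?B = "strip (real n + 1) 0 (real n + 2) :: ('a \<times> real) set"
    have "\<exists>d>0. \<forall>e. 0 < e \<and> e < d \<longrightarrow> (\<integral>\<^sup>+z\<in>?A. ennreal \<bar>mollify e u z - u z\<bar> \<partial>lborel) \<le> ennreal ((1 / 2) ^ n)"
    proof (rule mollify_local_L1[where A' = "strip (real n + 1 + 1) (1 / (real n + 1)) (real n + 2 + 3)"])
      show "integrable lborel (\<lambda>z. indicator (strip (real n + 1 + 1) (1 / (real n + 1)) (real n + 2 + 3)) z * u z)"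
        by (rule u_L1(1)) simp
      show "?A \<subseteq> strip (real n + 1 + 1) (1 / (real n + 1)) (real n + 2 + 3)" by (rule strip_mono) auto
      show "\<zeta> \<in> strip (real n + 1 + 1) (1 / (real n + 1)) (real n + 2 + 3)"
        if "0 < e" "e < 1" "z \<in> ?A" "mollifier e (\<zeta> - z) \<noteq> 0" for e z \<zeta> using strip_near[OF that] .
    qed simp_all
    then obtain d1 where d1: "0 < d1 \<and> (\<forall>e. 0 < e \<and> e < d1 \<longrightarrow> (\<integral>\<^sup>+z\<in>?A. ennreal \<bar>mollify e u z - u z\<bar> \<partial>lborel) \<le> ennreal ((1 / 2) ^ n))" ..
    have "\<exists>d>0. \<forall>e. 0 < e \<and> e < d \<longrightarrow> (\<integral>\<^sup>+z\<in>?B. ennreal \<bar>mollify e gN z - gN z\<bar> \<partial>lborel) \<le> ennreal ((1 / 2) ^ n)"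
    proof (rule mollify_local_L1[where A' = "strip (real n + 1 + 1) 0 (real n + 2 + 3)"])
      show "integrable lborel (\<lambda>z. indicator (strip (real n + 1 + 1) 0 (real n + 2 + 3)) z * gN z)"
        by (rule integrable_gN_strip) simp
      show "?B \<subseteq> strip (real n + 1 + 1) 0 (real n + 2 + 3)" by (rule strip_mono) auto
      show "\<zeta> \<in> strip (real n + 1 + 1) 0 (real n + 2 + 3)"
        if "0 < e" "e < 1" "z \<in> ?B" "mollifier e (\<zeta> - z) \<noteq> 0" for e z \<zeta> using strip_near[OF that] .
    qed simp_all
    then obtain d2 where d2: "0 < d2 \<and> (\<forall>e. 0 < e \<and> e < d2 \<longrightarrow> (\<integral>\<^sup>+z\<in>?B. ennreal \<bar>mollify e gN z - gN z\<bar> \<partial>lborel) \<le> ennreal ((1 / 2) ^ n))" ..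
    obtain e where e: "0 < e" "e < min (min d1 d2) (1 / (real n + 1))"
      using dense[of 0 "min (min d1 d2) (1 / (real n + 1))"] conjunct1[OF d1] conjunct1[OF d2] by auto
    have e': "0 < e \<and> e < d1" "0 < e \<and> e < d2" "e < 1 / (real n + 1)" using e by simp_all
    show "\<exists>e. 0 < e \<and> e < 1 / (real n + 1)
      \<and> (\<integral>\<^sup>+z\<in>strip (real n + 1) (1 / (real n + 1)) (real n + 2). ennreal \<bar>mollify e u z - u z\<bar> \<partial>lborel) \<le> ennreal ((1 / 2) ^ n)
      \<and> (\<integral>\<^sup>+z\<in>strip (real n + 1) 0 (real n + 2). ennreal \<bar>mollify e gN z - gN z\<bar> \<partial>lborel) \<le> ennreal ((1 / 2) ^ n)"
      by (rule exI[of _ e], intro conjI e(1) e'(3) mp[OF spec[OF conjunct2[OF d1]] e'(1)] mp[OF spec[OF conjunct2[OF d2]] e'(2)])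
  qed
  from choice[OF this] obtain \<epsilon> where ex: "\<forall>n. 0 < \<epsilon> n \<and> \<epsilon> n < 1 / (real n + 1)
    \<and> (\<integral>\<^sup>+z\<in>strip (real n + 1) (1 / (real n + 1)) (real n + 2). ennreal \<bar>mollify (\<epsilon> n) u z - u z\<bar> \<partial>lborel) \<le> ennreal ((1 / 2) ^ n)
    \<and> (\<integral>\<^sup>+z\<in>strip (real n + 1) 0 (real n + 2). ennreal \<bar>mollify (\<epsilon> n) gN z - gN z\<bar> \<partial>lborel) \<le> ennreal ((1 / 2) ^ n)" ..
  have \<epsilon>: "\<And>n. 0 < \<epsilon> n" "\<And>n. \<epsilon> n < 1 / (real n + 1)"
    "\<And>n. (\<integral>\<^sup>+z\<in>strip (real n + 1) (1 / (real n + 1)) (real n + 2). ennreal \<bar>mollify (\<epsilon> n) u z - u z\<bar> \<partial>lborel) \<le> ennreal ((1 / 2) ^ n)"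
    "\<And>n. (\<integral>\<^sup>+z\<in>strip (real n + 1) 0 (real n + 2). ennreal \<bar>mollify (\<epsilon> n) gN z - gN z\<bar> \<partial>lborel) \<le> ennreal ((1 / 2) ^ n)"
    by (rule conjunct1[OF spec[OF ex]], rule conjunct1[OF conjunct2[OF spec[OF ex]]],
      rule conjunct1[OF conjunct2[OF conjunct2[OF spec[OF ex]]]], rule conjunct2[OF conjunct2[OF conjunct2[OF spec[OF ex]]]])
  have "\<epsilon> \<longlonglongrightarrow> 0"
  proof (rule tendsto_sandwich[of "\<lambda>_. 0" _ _ "\<lambda>n. 1 / (real n + 1)"])
    show "(\<lambda>n. 1 / (real n + 1)) \<longlonglongrightarrow> 0"
      using LIMSEQ_Suc[OF lim_1_over_n[where ?'a = real]] by (simp only: of_nat_Suc add.commute[of 1])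
    show "\<forall>\<^sub>F n in sequentially. 0 \<le> \<epsilon> n" by (intro always_eventually allI less_imp_le \<epsilon>(1))
    show "\<forall>\<^sub>F n in sequentially. \<epsilon> n \<le> 1 / (real n + 1)" by (intro always_eventually allI less_imp_le \<epsilon>(2))
  qed (rule tendsto_const)
  from that[OF \<epsilon>(1) this \<epsilon>(3,4)] show ?thesis .
qed

text \<open>Along a vertical line the mollification of \<open>u\<close> is a primitive of the mollification of the vertical derivative.\<close>

lemma mollify_rise:
  assumes "0 < \<epsilon>" "0 \<le> t"
  shows "mollify \<epsilon> u (x, t) = mollify \<epsilon> u (x, 0) + rise (mollify \<epsilon> gN) x t"
proof -
  have "mollified \<epsilon> (x, t) - mollified \<epsilon> (x, 0)
    = (LINT \<theta>|lborel. indicator {0..t} \<theta> * (LINT \<zeta>|lborel. (g \<zeta> \<bullet> (0, 1)) * mollifier \<epsilon> (\<zeta> - (x, \<theta>))))"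
  proof (rule mollified_curve[OF assms, where \<Gamma> = "\<lambda>\<theta>. (x, \<theta>)" and \<Gamma>' = "\<lambda>_. (0, 1)"])
    show "((\<lambda>\<theta>. (x, \<theta>)) has_vector_derivative (0, 1)) (at \<theta> within {0..t})" for \<theta>
      by (rule has_vector_derivative_Pair[OF has_vector_derivative_const has_vector_derivative_id])
  qed auto
  then show ?thesis by (simp add: mollified_eq_mollify rise_def mollify_def gN_def)
qed

definition line_error :: "('a \<times> real \<Rightarrow> real) \<Rightarrow> real \<Rightarrow> real \<Rightarrow> real \<Rightarrow> 'a \<Rightarrow> ennreal" where
  "line_error f e a b x = (\<integral>\<^sup>+\<tau>. ennreal \<bar>mollify e f (x, \<tau>) - f (x, \<tau>)\<bar> * indicator {a..b} \<tau> \<partial>lborel)"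

lemma nn_integral_strip_lines:
  fixes f :: "'a \<times> real \<Rightarrow> ennreal"
  assumes [measurable]: "f \<in> borel_measurable borel"
  shows "(\<integral>\<^sup>+z\<in>strip R a b. f z \<partial>lborel) = (\<integral>\<^sup>+x. (\<integral>\<^sup>+\<tau>. f (x, \<tau>) * indicator {a..b} \<tau> \<partial>lborel) * indicator (cball 0 R) x \<partial>lborel)"
proof -
  have "(\<integral>\<^sup>+z\<in>strip R a b. f z \<partial>lborel) = (\<integral>\<^sup>+\<tau>. \<integral>\<^sup>+x. f (x, \<tau>) * indicator (strip R a b) (x, \<tau>) \<partial>lborel \<partial>lborel)"
    by (rule nn_integral_lborel_Pair) measurable
  also have "\<dots> = (\<integral>\<^sup>+x. \<integral>\<^sup>+\<tau>. f (x, \<tau>) * indicator (strip R a b) (x, \<tau>) \<partial>lborel \<partial>lborel)"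
    by (rule lborel_pair.Fubini') measurable
  also have "\<dots> = (\<integral>\<^sup>+x. \<integral>\<^sup>+\<tau>. f (x, \<tau>) * indicator {a..b} \<tau> * indicator (cball 0 R) x \<partial>lborel \<partial>lborel)"
    by (intro nn_integral_cong) (simp add: strip_def indicator_def)
  also have "\<dots> = (\<integral>\<^sup>+x. (\<integral>\<^sup>+\<tau>. f (x, \<tau>) * indicator {a..b} \<tau> \<partial>lborel) * indicator (cball 0 R) x \<partial>lborel)"
    by (intro nn_integral_cong nn_integral_multc) measurable
  finally show ?thesis .
qed

lemma AE_finite_lines:
  fixes f :: "'a \<times> real \<Rightarrow> ennreal"
  assumes [measurable]: "f \<in> borel_measurable borel" and "\<And>R. (\<integral>\<^sup>+z\<in>strip R a b. f z \<partial>lborel) < \<infinity>"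
  shows "AE x in lborel. (\<integral>\<^sup>+\<tau>. f (x, \<tau>) * indicator {a..b} \<tau> \<partial>lborel) < \<infinity>"
proof -
  have "AE x in lborel. \<forall>R::nat. (\<integral>\<^sup>+\<tau>. f (x, \<tau>) * indicator {a..b} \<tau> \<partial>lborel) * indicator (cball 0 (real R)) x \<noteq> \<infinity>"
    unfolding AE_all_countable
  proof (rule allI, rule nn_integral_noteq_infinite)
    show "(\<lambda>x. (\<integral>\<^sup>+\<tau>. f (x, \<tau>) * indicator {a..b} \<tau> \<partial>lborel) * indicator (cball 0 (real R)) x) \<in> borel_measurable lborel" for R
      by measurable
    show "(\<integral>\<^sup>+x. (\<integral>\<^sup>+\<tau>. f (x, \<tau>) * indicator {a..b} \<tau> \<partial>lborel) * indicator (cball 0 (real R)) x \<partial>lborel) \<noteq> \<infinity>" for R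
      using assms(2)[of "real R"] unfolding nn_integral_strip_lines[OF assms(1)] by (simp add: less_top)
  qed
  then show ?thesis
  proof eventually_elim
    case (elim x)
    obtain R :: nat where "norm x \<le> real R" using real_arch_simple by blast
    then have "x \<in> cball 0 (real R)" by simp
    then have "(\<integral>\<^sup>+\<tau>. f (x, \<tau>) * indicator {a..b} \<tau> \<partial>lborel) \<noteq> \<infinity>" using elim[rule_format, of R] by simp
    then show ?case by (simp add: less_top)
  qed
qed

lemma integrable_line:
  fixes f :: "'a \<times> real \<Rightarrow> real"
  assumes [measurable]: "f \<in> borel_measurable borel" and "(\<integral>\<^sup>+\<tau>. ennreal \<bar>f (x, \<tau>)\<bar> * indicator {a..b} \<tau> \<partial>lborel) < \<infinity>"
  shows "integrable lborel (\<lambda>\<tau>. indicator {a..b} \<tau> * f (x, \<tau>))"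
proof (rule integrableI_bounded)
  show "(\<lambda>\<tau>. indicator {a..b} \<tau> * f (x, \<tau>)) \<in> borel_measurable lborel" by measurable
  have "(\<integral>\<^sup>+\<tau>. ennreal (norm (indicator {a..b} \<tau> * f (x, \<tau>))) \<partial>lborel) = (\<integral>\<^sup>+\<tau>. ennreal \<bar>f (x, \<tau>)\<bar> * indicator {a..b} \<tau> \<partial>lborel)"
    by (intro nn_integral_cong) (simp add: abs_mult indicator_def)
  then show "(\<integral>\<^sup>+\<tau>. ennreal (norm (indicator {a..b} \<tau> * f (x, \<tau>))) \<partial>lborel) < \<infinity>" using assms(2) by simp
qed

lemma indicator_bound_mono:
  "t \<le> T \<Longrightarrow> (\<integral>\<^sup>+\<tau>. (h \<tau> :: ennreal) * indicator {0..t} \<tau> \<partial>lborel) \<le> (\<integral>\<^sup>+\<tau>. h \<tau> * indicator {0..T} \<tau> \<partial>lborel)" for t T :: real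
  by (intro nn_integral_mono mult_left_mono) (auto simp: indicator_def)

lemma rise_bound: "ennreal \<bar>rise f x t\<bar> \<le> (\<integral>\<^sup>+\<tau>. ennreal \<bar>f (x, \<tau>)\<bar> * indicator {0..t} \<tau> \<partial>lborel)"
proof -
  have "ennreal \<bar>rise f x t\<bar> \<le> (\<integral>\<^sup>+\<tau>. ennreal (norm (indicator {0..t} \<tau> * f (x, \<tau>))) \<partial>lborel)"
    unfolding rise_def real_norm_def[symmetric] by (rule integral_norm_le_nn_integral)
  also have "\<dots> = (\<integral>\<^sup>+\<tau>. ennreal \<bar>f (x, \<tau>)\<bar> * indicator {0..t} \<tau> \<partial>lborel)"
    by (intro nn_integral_cong) (simp add: abs_mult indicator_def)
  finally show ?thesis .
qed

text \<open>On almost every vertical line the mollifications converge, at every height and at the boundary.\<close>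

lemma line_convergence:
  fixes \<epsilon> :: "nat \<Rightarrow> real"
  assumes \<epsilon>: "\<And>n. 0 < \<epsilon> n"
    and fin_u: "(\<integral>\<^sup>+\<tau>. ennreal \<bar>u (x, \<tau>)\<bar> * indicator {1..2} \<tau> \<partial>lborel) < \<infinity>"
    and fin_g: "\<And>T. (\<integral>\<^sup>+\<tau>. ennreal \<bar>gN (x, \<tau>)\<bar> * indicator {0..T} \<tau> \<partial>lborel) < \<infinity>"
    and lim_u: "(\<lambda>n. line_error u (\<epsilon> n) 1 2 x) \<longlonglongrightarrow> 0"
    and lim_g: "\<And>T. (\<lambda>n. line_error gN (\<epsilon> n) 0 T x) \<longlonglongrightarrow> 0"
  shows "(\<lambda>n. mollify (\<epsilon> n) u (x, 0)) \<longlonglongrightarrow> boundary_value x"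
    and "0 \<le> t \<Longrightarrow> (\<lambda>n. mollify (\<epsilon> n) u (x, t)) \<longlonglongrightarrow> boundary_value x + rise gN x t"
proof -
  define v where "v n = mollify (\<epsilon> n) u (x, 0)" for n
  have rise_diff: "ennreal \<bar>rise (mollify (\<epsilon> n) gN) x t - rise gN x t\<bar> \<le> line_error gN (\<epsilon> n) 0 t x"
    if fin: "line_error gN (\<epsilon> n) 0 t x < \<infinity>" for n t
  proof -
    let ?d = "\<lambda>z. mollify (\<epsilon> n) gN z - gN z"
    have id: "integrable lborel (\<lambda>\<tau>. indicator {0..t} \<tau> * ?d (x, \<tau>))"
      by (rule integrable_line) (use fin in \<open>simp_all add: line_error_def\<close>)
    have ig: "integrable lborel (\<lambda>\<tau>. indicator {0..t} \<tau> * gN (x, \<tau>))" by (rule integrable_line[OF _ fin_g]) simp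
    have im: "integrable lborel (\<lambda>\<tau>. indicator {0..t} \<tau> * mollify (\<epsilon> n) gN (x, \<tau>))"
      using Bochner_Integration.integrable_add[OF id ig] by (simp add: distrib_left[symmetric])
    have "rise (mollify (\<epsilon> n) gN) x t - rise gN x t = rise ?d x t"
      unfolding rise_def by (subst Bochner_Integration.integral_diff[OF im ig, symmetric]) (simp add: right_diff_distrib)
    then show ?thesis using rise_bound[of ?d x t] by (simp add: line_error_def)
  qed
  have ev: "\<forall>\<^sub>F n in sequentially. line_error gN (\<epsilon> n) 0 T x < \<infinity>" for T
    using lim_g by (rule order_tendstoD) simp
  have conv_rise: "(\<lambda>n. rise (mollify (\<epsilon> n) gN) x t) \<longlonglongrightarrow> rise gN x t" for t
  proof -
    have "(\<lambda>n. ennreal \<bar>rise (mollify (\<epsilon> n) gN) x t - rise gN x t\<bar>) \<longlonglongrightarrow> 0"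
    proof (rule tendsto_sandwich[OF _ _ tendsto_const lim_g[of t]])
      show "\<forall>\<^sub>F n in sequentially. ennreal \<bar>rise (mollify (\<epsilon> n) gN) x t - rise gN x t\<bar> \<le> line_error gN (\<epsilon> n) 0 t x"
        using ev[of t] by eventually_elim (rule rise_diff)
    qed simp
    then show ?thesis by (rule tendsto_of_ennreal_abs)
  qed
  have base: "v \<longlonglongrightarrow> boundary_value x"
  proof -
    define F where "F \<tau> = u (x, \<tau>) - rise gN x \<tau>" for \<tau>
    have [measurable]: "F \<in> borel_measurable borel" unfolding F_def[abs_def] by measurable
    have iF: "integrable lborel (\<lambda>\<tau>. indicator {1..2} \<tau> * F \<tau>)"
    proof -
      have iu: "integrable lborel (\<lambda>\<tau>. indicator {1..2} \<tau> * u (x, \<tau>))" by (rule integrable_line[OF _ fin_u]) simp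
      have "integrable lborel (\<lambda>\<tau>. indicator {1..2} \<tau> * rise gN x \<tau>)"
      proof (rule integrableI_bounded)
        show "(\<lambda>\<tau>. indicator {1..2} \<tau> * rise gN x \<tau>) \<in> borel_measurable lborel" by measurable
        let ?C = "\<integral>\<^sup>+\<tau>. ennreal \<bar>gN (x, \<tau>)\<bar> * indicator {0..2} \<tau> \<partial>lborel"
        have "(\<integral>\<^sup>+\<tau>. ennreal (norm (indicator {1..2} \<tau> * rise gN x \<tau>)) \<partial>lborel) \<le> (\<integral>\<^sup>+\<tau>. ?C * indicator {1..2} \<tau> \<partial>(lborel :: real measure))"
        proof (rule nn_integral_mono)
          fix \<tau> :: real
          show "ennreal (norm (indicator {1..2} \<tau> * rise gN x \<tau>)) \<le> ?C * indicator {1..2} \<tau>"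
          proof (cases "\<tau> \<in> {1..2}")
            case True
            then have "ennreal \<bar>rise gN x \<tau>\<bar> \<le> ?C" by (intro order_trans[OF rise_bound indicator_bound_mono]) simp
            then show ?thesis using True by simp
          qed simp
        qed
        also have "\<dots> = ?C * emeasure lborel {1..2::real}" by (rule nn_integral_cmult_indicator) simp
        also have "\<dots> < \<infinity>" using fin_g[of 2] by (simp add: ennreal_mult_less_top)
        finally show "(\<integral>\<^sup>+\<tau>. ennreal (norm (indicator {1..2} \<tau> * rise gN x \<tau>)) \<partial>lborel) < \<infinity>" .
      qed
      from Bochner_Integration.integrable_diff[OF iu this] show ?thesis by (simp add: F_def right_diff_distrib)
    qed
    have bound: "ennreal \<bar>v n - boundary_value x\<bar> \<le> line_error u (\<epsilon> n) 1 2 x + line_error gN (\<epsilon> n) 0 2 x"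
      if fin: "line_error gN (\<epsilon> n) 0 2 x < \<infinity>" for n
    proof -
      have ic: "integrable lborel (\<lambda>\<tau>. indicator {1..2::real} \<tau> * v n)"
        by (intro integrable_mult_left integrable_real_indicator) simp_all
      have "v n - boundary_value x = (LINT \<tau>|lborel. indicator {1..2::real} \<tau> * v n) - (LINT \<tau>|lborel. indicator {1..2} \<tau> * F \<tau>)"
        by (simp add: boundary_value_def F_def)
      also have "\<dots> = (LINT \<tau>|lborel. indicator {1..2} \<tau> * v n - indicator {1..2} \<tau> * F \<tau>)"
        by (rule Bochner_Integration.integral_diff[OF ic iF, symmetric])
      finally have "ennreal \<bar>v n - boundary_value x\<bar> \<le> (\<integral>\<^sup>+\<tau>. ennreal (norm (indicator {1..2} \<tau> * v n - indicator {1..2} \<tau> * F \<tau>)) \<partial>lborel)"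
        using integral_norm_le_nn_integral[of lborel "\<lambda>\<tau>. indicator {1..2} \<tau> * v n - indicator {1..2} \<tau> * F \<tau>"] by simp
      also have "\<dots> \<le> (\<integral>\<^sup>+\<tau>. ennreal \<bar>mollify (\<epsilon> n) u (x, \<tau>) - u (x, \<tau>)\<bar> * indicator {1..2} \<tau> + line_error gN (\<epsilon> n) 0 2 x * indicator {1..2} \<tau> \<partial>lborel)"
      proof (rule nn_integral_mono)
        fix \<tau> :: real
        show "ennreal (norm (indicator {1..2} \<tau> * v n - indicator {1..2} \<tau> * F \<tau>))
          \<le> ennreal \<bar>mollify (\<epsilon> n) u (x, \<tau>) - u (x, \<tau>)\<bar> * indicator {1..2} \<tau> + line_error gN (\<epsilon> n) 0 2 x * indicator {1..2} \<tau>"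
        proof (cases "\<tau> \<in> {1..2}")
          case True
          have "line_error gN (\<epsilon> n) 0 \<tau> x \<le> line_error gN (\<epsilon> n) 0 2 x"
            unfolding line_error_def using True by (intro indicator_bound_mono) simp
          then have r: "ennreal \<bar>rise (mollify (\<epsilon> n) gN) x \<tau> - rise gN x \<tau>\<bar> \<le> line_error gN (\<epsilon> n) 0 2 x"
            using rise_diff[of n \<tau>] le_less_trans[OF _ fin] by (meson order_trans)
          have "v n - F \<tau> = (mollify (\<epsilon> n) u (x, \<tau>) - u (x, \<tau>)) - (rise (mollify (\<epsilon> n) gN) x \<tau> - rise gN x \<tau>)"
            using mollify_rise[OF \<epsilon>, of \<tau> n x] True by (simp add: v_def F_def)
          then have "\<bar>v n - F \<tau>\<bar> \<le> \<bar>mollify (\<epsilon> n) u (x, \<tau>) - u (x, \<tau>)\<bar> + \<bar>rise (mollify (\<epsilon> n) gN) x \<tau> - rise gN x \<tau>\<bar>"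
            by linarith
          then have "ennreal \<bar>v n - F \<tau>\<bar> \<le> ennreal \<bar>mollify (\<epsilon> n) u (x, \<tau>) - u (x, \<tau>)\<bar> + ennreal \<bar>rise (mollify (\<epsilon> n) gN) x \<tau> - rise gN x \<tau>\<bar>"
            by (simp add: ennreal_plus[symmetric] ennreal_leI del: ennreal_plus)
          also have "\<dots> \<le> ennreal \<bar>mollify (\<epsilon> n) u (x, \<tau>) - u (x, \<tau>)\<bar> + line_error gN (\<epsilon> n) 0 2 x" by (rule add_left_mono[OF r])
          finally show ?thesis using True by simp
        qed simp
      qed
      also have "\<dots> = line_error u (\<epsilon> n) 1 2 x + (\<integral>\<^sup>+\<tau>. line_error gN (\<epsilon> n) 0 2 x * indicator {1..2} \<tau> \<partial>(lborel :: real measure))"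
        unfolding line_error_def by (rule nn_integral_add) measurable
      also have "(\<integral>\<^sup>+\<tau>. line_error gN (\<epsilon> n) 0 2 x * indicator {1..2} \<tau> \<partial>(lborel :: real measure)) = line_error gN (\<epsilon> n) 0 2 x * emeasure lborel {1..2::real}"
        by (rule nn_integral_cmult_indicator) simp
      also have "\<dots> = line_error gN (\<epsilon> n) 0 2 x" by simp
      finally show ?thesis .
    qed
    have "(\<lambda>n. ennreal \<bar>v n - boundary_value x\<bar>) \<longlonglongrightarrow> 0"
    proof (rule tendsto_sandwich[of "\<lambda>_. 0" _ _ "\<lambda>n. line_error u (\<epsilon> n) 1 2 x + line_error gN (\<epsilon> n) 0 2 x"])
      show "(\<lambda>n. line_error u (\<epsilon> n) 1 2 x + line_error gN (\<epsilon> n) 0 2 x) \<longlonglongrightarrow> 0"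
        using tendsto_add[OF lim_u lim_g[of 2]] by simp
      show "\<forall>\<^sub>F n in sequentially. ennreal \<bar>v n - boundary_value x\<bar> \<le> line_error u (\<epsilon> n) 1 2 x + line_error gN (\<epsilon> n) 0 2 x"
        using ev[of 2] by eventually_elim (rule bound)
    qed simp_all
    then show ?thesis by (rule tendsto_of_ennreal_abs)
  qed
  then show "(\<lambda>n. mollify (\<epsilon> n) u (x, 0)) \<longlonglongrightarrow> boundary_value x" by (simp only: v_def[abs_def])
  show "(\<lambda>n. mollify (\<epsilon> n) u (x, t)) \<longlonglongrightarrow> boundary_value x + rise gN x t" if "0 \<le> t"
    using tendsto_add[OF base conv_rise[of t]] mollify_rise[OF \<epsilon> that] by (simp add: v_def)
qed

end

section \<open>The trace\<close>

context trace_setting begin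

lemma line_error_mono: "a' \<le> a \<Longrightarrow> b \<le> b' \<Longrightarrow> line_error f e a b x \<le> line_error f e a' b' x"
  unfolding line_error_def by (intro nn_integral_mono mult_left_mono) (auto simp: indicator_def)

lemma line_error_measurable[measurable]:
  assumes [measurable]: "f \<in> borel_measurable borel"
  shows "line_error f e a b \<in> borel_measurable borel"
  unfolding line_error_def[abs_def] by measurable

text \<open>Every point and every vertical segment lies in all but finitely many of the strips on which the errors are summable.\<close>

lemma mollification_convergence:
  obtains \<epsilon> :: "nat \<Rightarrow> real" where "\<forall>n. 0 < \<epsilon> n" "\<epsilon> \<longlonglongrightarrow> 0"
    "AE x in lborel. (\<lambda>n. mollify (\<epsilon> n) u (x, 0)) \<longlonglongrightarrow> boundary_value x
      \<and> (\<forall>t\<ge>0. (\<lambda>n. mollify (\<epsilon> n) u (x, t)) \<longlonglongrightarrow> boundary_value x + rise gN x t)"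
    "AE z in lborel. z \<in> upper_half \<longrightarrow> (\<lambda>n. mollify (\<epsilon> n) u z) \<longlonglongrightarrow> u z"
proof (rule mollification_parameters)
  fix \<epsilon> :: "nat \<Rightarrow> real"
  assume \<epsilon>: "\<And>n. 0 < \<epsilon> n" "\<epsilon> \<longlonglongrightarrow> 0"
    and err_u: "\<And>n. (\<integral>\<^sup>+z\<in>strip (real n + 1) (1 / (real n + 1)) (real n + 2). ennreal \<bar>mollify (\<epsilon> n) u z - u z\<bar> \<partial>lborel) \<le> ennreal ((1 / 2) ^ n)"
    and err_g: "\<And>n. (\<integral>\<^sup>+z\<in>strip (real n + 1) 0 (real n + 2). ennreal \<bar>mollify (\<epsilon> n) gN z - gN z\<bar> \<partial>lborel) \<le> ennreal ((1 / 2) ^ n)"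
  have "AE z in lborel. (\<lambda>n. ennreal \<bar>mollify (\<epsilon> n) u z - u z\<bar> * indicator (strip (real n + 1) (1 / (real n + 1)) (real n + 2)) z) \<longlonglongrightarrow> 0"
    by (rule AE_tendsto_0_of_summable_L1[OF _ err_u]) measurable
  then have interior: "AE z in lborel. z \<in> upper_half \<longrightarrow> (\<lambda>n. mollify (\<epsilon> n) u z) \<longlonglongrightarrow> u z"
  proof eventually_elim
    case (elim z)
    show ?case
    proof
      assume "z \<in> upper_half"
      obtain x t where z: "z = (x, t)" by (cases z)
      have t: "0 < t" using \<open>z \<in> upper_half\<close> by (simp add: z upper_half_def)
      obtain m :: nat where m: "max (norm x) (max t (1 / t)) \<le> real m" using real_arch_simple by blast
      have "\<forall>\<^sub>F n in sequentially. ennreal \<bar>mollify (\<epsilon> n) u z - u z\<bar> * indicator (strip (real n + 1) (1 / (real n + 1)) (real n + 2)) z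
        = ennreal \<bar>mollify (\<epsilon> n) u z - u z\<bar>"
        unfolding eventually_sequentially
      proof (intro exI allI impI)
        fix n assume "m \<le> n"
        then have n: "norm x \<le> real n" "t \<le> real n" "1 / t \<le> real n" using m by auto
        have "1 / (real n + 1) \<le> t"
        proof -
          have "1 \<le> real n * t" using n(3) t by (simp add: pos_divide_le_eq)
          then have "1 \<le> t * (real n + 1)" using t by (simp add: algebra_simps)
          then show ?thesis by (simp add: pos_divide_le_eq)
        qed
        then have "z \<in> strip (real n + 1) (1 / (real n + 1)) (real n + 2)" using n by (simp add: z in_strip)
        then show "ennreal \<bar>mollify (\<epsilon> n) u z - u z\<bar> * indicator (strip (real n + 1) (1 / (real n + 1)) (real n + 2)) z
          = ennreal \<bar>mollify (\<epsilon> n) u z - u z\<bar>" by simp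
      qed
      then show "(\<lambda>n. mollify (\<epsilon> n) u z) \<longlonglongrightarrow> u z"
        by (rule tendsto_of_ennreal_abs[OF Lim_transform_eventually[OF elim]])
    qed
  qed
  have A: "AE x in lborel. (\<lambda>n. line_error u (\<epsilon> n) (1 / (real n + 1)) (real n + 2) x * indicator (cball 0 (real n + 1)) x) \<longlonglongrightarrow> 0"
  proof (rule AE_tendsto_0_of_summable_L1)
    show "(\<lambda>x. line_error u (\<epsilon> n) (1 / (real n + 1)) (real n + 2) x * indicator (cball 0 (real n + 1)) x) \<in> borel_measurable lborel" for n
      by measurable
    show "(\<integral>\<^sup>+x. line_error u (\<epsilon> n) (1 / (real n + 1)) (real n + 2) x * indicator (cball 0 (real n + 1)) x \<partial>lborel) \<le> ennreal ((1 / 2) ^ n)" for n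
      unfolding line_error_def
      by (rule order_trans[OF eq_refl err_u], rule nn_integral_strip_lines[symmetric, where f = "\<lambda>z. ennreal \<bar>mollify (\<epsilon> n) u z - u z\<bar>"]) measurable
  qed
  have B: "AE x in lborel. (\<lambda>n. line_error gN (\<epsilon> n) 0 (real n + 2) x * indicator (cball 0 (real n + 1)) x) \<longlonglongrightarrow> 0"
  proof (rule AE_tendsto_0_of_summable_L1)
    show "(\<lambda>x. line_error gN (\<epsilon> n) 0 (real n + 2) x * indicator (cball 0 (real n + 1)) x) \<in> borel_measurable lborel" for n
      by measurable
    show "(\<integral>\<^sup>+x. line_error gN (\<epsilon> n) 0 (real n + 2) x * indicator (cball 0 (real n + 1)) x \<partial>lborel) \<le> ennreal ((1 / 2) ^ n)" for n
      unfolding line_error_def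
      by (rule order_trans[OF eq_refl err_g], rule nn_integral_strip_lines[symmetric, where f = "\<lambda>z. ennreal \<bar>mollify (\<epsilon> n) gN z - gN z\<bar>"]) measurable
  qed
  have F: "AE x in lborel. (\<integral>\<^sup>+\<tau>. ennreal \<bar>u (x, \<tau>)\<bar> * indicator {1..2} \<tau> \<partial>lborel) < \<infinity>"
    by (rule AE_finite_lines[where f = "\<lambda>z. ennreal \<bar>u z\<bar>"], measurable) (rule u_L1(2), simp)
  have G: "AE x in lborel. \<forall>T::nat. (\<integral>\<^sup>+\<tau>. ennreal \<bar>gN (x, \<tau>)\<bar> * indicator {0..real T} \<tau> \<partial>lborel) < \<infinity>"
    unfolding AE_all_countable
    by (rule allI, rule AE_finite_lines[where f = "\<lambda>z. ennreal \<bar>gN z\<bar>"], measurable) (rule gN_L1, simp)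
  have lines: "AE x in lborel. (\<lambda>n. mollify (\<epsilon> n) u (x, 0)) \<longlonglongrightarrow> boundary_value x
      \<and> (\<forall>t\<ge>0. (\<lambda>n. mollify (\<epsilon> n) u (x, t)) \<longlonglongrightarrow> boundary_value x + rise gN x t)"
    using A B F G
  proof eventually_elim
    case (elim x)
    obtain m :: nat where m: "norm x \<le> real m" using real_arch_simple by blast
    have fin_g: "(\<integral>\<^sup>+\<tau>. ennreal \<bar>gN (x, \<tau>)\<bar> * indicator {0..T} \<tau> \<partial>lborel) < \<infinity>" for T
    proof -
      obtain k :: nat where k: "T \<le> real k" using real_arch_simple by blast
      show ?thesis by (rule le_less_trans[OF indicator_bound_mono[OF k] elim(4)[rule_format]])
    qed
    have lim_u: "(\<lambda>n. line_error u (\<epsilon> n) 1 2 x) \<longlonglongrightarrow> 0"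
    proof (rule tendsto_sandwich[OF _ _ tendsto_const elim(1)])
      show "\<forall>\<^sub>F n in sequentially. line_error u (\<epsilon> n) 1 2 x \<le> line_error u (\<epsilon> n) (1 / (real n + 1)) (real n + 2) x * indicator (cball 0 (real n + 1)) x"
        unfolding eventually_sequentially
      proof (intro exI allI impI)
        fix n assume "m \<le> n"
        then have "real m \<le> real n" by simp
        then have "x \<in> cball 0 (real n + 1)" using m by simp
        moreover have "line_error u (\<epsilon> n) 1 2 x \<le> line_error u (\<epsilon> n) (1 / (real n + 1)) (real n + 2) x"
          by (rule line_error_mono) simp_all
        ultimately show "line_error u (\<epsilon> n) 1 2 x \<le> line_error u (\<epsilon> n) (1 / (real n + 1)) (real n + 2) x * indicator (cball 0 (real n + 1)) x"
          by simp
      qed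
    qed simp
    have lim_g: "(\<lambda>n. line_error gN (\<epsilon> n) 0 T x) \<longlonglongrightarrow> 0" for T
    proof (rule tendsto_sandwich[OF _ _ tendsto_const elim(2)])
      obtain k :: nat where k: "T \<le> real k" using real_arch_simple by blast
      show "\<forall>\<^sub>F n in sequentially. line_error gN (\<epsilon> n) 0 T x \<le> line_error gN (\<epsilon> n) 0 (real n + 2) x * indicator (cball 0 (real n + 1)) x"
        unfolding eventually_sequentially
      proof (intro exI allI impI)
        fix n assume "max m k \<le> n"
        then have "real m \<le> real n" "real k \<le> real n" by simp_all
        then have "x \<in> cball 0 (real n + 1)" "T \<le> real n + 2" using m k by simp_all
        moreover have "line_error gN (\<epsilon> n) 0 T x \<le> line_error gN (\<epsilon> n) 0 (real n + 2) x"
          by (rule line_error_mono) (use \<open>T \<le> real n + 2\<close> in simp_all)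
        ultimately show "line_error gN (\<epsilon> n) 0 T x \<le> line_error gN (\<epsilon> n) 0 (real n + 2) x * indicator (cball 0 (real n + 1)) x"
          by simp
      qed
    qed simp
    note conv = line_convergence[OF \<epsilon>(1) elim(3) fin_g lim_u lim_g]
    show ?case by (intro conjI allI impI conv)
  qed
  have "\<forall>n. 0 < \<epsilon> n" using \<epsilon>(1) by simp
  then show ?thesis by (rule that[OF _ \<epsilon>(2) lines interior])
qed

definition extension :: "'a \<times> real \<Rightarrow> real" where
  "extension z = boundary_value (fst z) + rise gN (fst z) (snd z)"

text \<open>Hence \<open>u\<close> has a representative that is absolutely continuous on almost every vertical line.\<close>

lemma extension_eq: "AE z in lborel. z \<in> upper_half \<longrightarrow> extension z = u z"
proof -
  obtain \<epsilon> :: "nat \<Rightarrow> real" where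
    lines: "AE x in lborel. (\<lambda>n. mollify (\<epsilon> n) u (x, 0)) \<longlonglongrightarrow> boundary_value x
      \<and> (\<forall>t\<ge>0. (\<lambda>n. mollify (\<epsilon> n) u (x, t)) \<longlonglongrightarrow> boundary_value x + rise gN x t)"
    and interior: "AE z in lborel. z \<in> upper_half \<longrightarrow> (\<lambda>n. mollify (\<epsilon> n) u z) \<longlonglongrightarrow> u z"
    by (rule mollification_convergence, rule that)
  show ?thesis using AE_lborel_fst[OF lines] interior
  proof eventually_elim
    case (elim z)
    show ?case
    proof
      assume z: "z \<in> upper_half"
      then have "0 \<le> snd z" by (simp add: upper_half_def)
      have "(\<lambda>n. mollify (\<epsilon> n) u (fst z, snd z)) \<longlonglongrightarrow> boundary_value (fst z) + rise gN (fst z) (snd z)"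
        by (rule mp[OF spec[OF conjunct2[OF elim(1)]] \<open>0 \<le> snd z\<close>])
      then have "(\<lambda>n. mollify (\<epsilon> n) u z) \<longlonglongrightarrow> extension z" by (simp only: extension_def prod.collapse)
      then show "extension z = u z" by (rule LIMSEQ_unique[OF _ mp[OF elim(2) z]])
    qed
  qed
qed

lemma boundary_value_bound:
  "ennreal \<bar>boundary_value x\<bar> \<le> (\<integral>\<^sup>+\<tau>. ennreal \<bar>u (x, \<tau>)\<bar> * indicator {1..2} \<tau> \<partial>lborel)
    + (\<integral>\<^sup>+\<tau>. ennreal \<bar>gN (x, \<tau>)\<bar> * indicator {0..2} \<tau> \<partial>lborel)" (is "_ \<le> _ + ?C")
proof -
  have "ennreal \<bar>boundary_value x\<bar> \<le> (\<integral>\<^sup>+\<tau>. ennreal (norm (indicator {1..2} \<tau> * (u (x, \<tau>) - rise gN x \<tau>))) \<partial>lborel)"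
    unfolding boundary_value_def real_norm_def[symmetric] by (rule integral_norm_le_nn_integral)
  also have "\<dots> \<le> (\<integral>\<^sup>+\<tau>. ennreal \<bar>u (x, \<tau>)\<bar> * indicator {1..2} \<tau> + ?C * indicator {1..2} \<tau> \<partial>lborel)"
  proof (rule nn_integral_mono)
    fix \<tau> :: real
    show "ennreal (norm (indicator {1..2} \<tau> * (u (x, \<tau>) - rise gN x \<tau>))) \<le> ennreal \<bar>u (x, \<tau>)\<bar> * indicator {1..2} \<tau> + ?C * indicator {1..2} \<tau>"
    proof (cases "\<tau> \<in> {1..2}")
      case True
      then have r: "ennreal \<bar>rise gN x \<tau>\<bar> \<le> ?C" by (intro order_trans[OF rise_bound indicator_bound_mono]) simp
      have "ennreal \<bar>u (x, \<tau>) - rise gN x \<tau>\<bar> \<le> ennreal (\<bar>u (x, \<tau>)\<bar> + \<bar>rise gN x \<tau>\<bar>)"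
        by (rule ennreal_leI[OF abs_triangle_ineq4])
      also have "\<dots> = ennreal \<bar>u (x, \<tau>)\<bar> + ennreal \<bar>rise gN x \<tau>\<bar>" by (rule ennreal_plus) simp_all
      also have "\<dots> \<le> ennreal \<bar>u (x, \<tau>)\<bar> + ?C" by (rule add_left_mono[OF r])
      finally show ?thesis using True by simp
    qed simp
  qed
  also have "\<dots> = (\<integral>\<^sup>+\<tau>. ennreal \<bar>u (x, \<tau>)\<bar> * indicator {1..2} \<tau> \<partial>lborel) + (\<integral>\<^sup>+\<tau>. ?C * indicator {1..2} \<tau> \<partial>(lborel :: real measure))"
    by (rule nn_integral_add) measurable
  also have "(\<integral>\<^sup>+\<tau>. ?C * indicator {1..2} \<tau> \<partial>(lborel :: real measure)) = ?C * emeasure lborel {1..2::real}"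
    by (rule nn_integral_cmult_indicator) simp
  finally show ?thesis by simp
qed

lemma locally_integrable_of_ball_bound:
  fixes f h :: "'a \<Rightarrow> _"
  assumes [measurable]: "f \<in> borel_measurable borel"
    and le: "\<And>x. ennreal \<bar>f x\<bar> \<le> h x" and fin: "\<And>R. (\<integral>\<^sup>+x. h x * indicator (cball 0 R) x \<partial>lborel) < \<infinity>"
  shows "f locally_integrable_on UNIV"
  unfolding locally_integrable_on_def set_integrable_def
proof (intro allI impI)
  fix K :: "'a set"
  assume K: "compact K \<and> K \<subseteq> UNIV"
  then have [measurable]: "K \<in> sets borel" by (intro borel_closed compact_imp_closed) simp
  obtain R where "\<forall>x\<in>K. norm x \<le> R"
    using K compact_imp_bounded[of K] unfolding bounded_iff by blast
  then have R: "K \<subseteq> cball 0 R" by auto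
  have "integrable lborel (\<lambda>x. indicator K x *\<^sub>R f x)"
  proof (rule integrableI_bounded)
    show "(\<lambda>x. indicator K x *\<^sub>R f x) \<in> borel_measurable lborel" by measurable
    have "(\<integral>\<^sup>+x. ennreal (norm (indicator K x *\<^sub>R f x)) \<partial>lborel) \<le> (\<integral>\<^sup>+x. h x * indicator (cball 0 R) x \<partial>lborel)"
    proof (rule nn_integral_mono)
      fix x
      show "ennreal (norm (indicator K x *\<^sub>R f x)) \<le> h x * indicator (cball 0 R) x"
      proof (cases "x \<in> K")
        case True
        then have "x \<in> cball 0 R" using R by blast
        then show ?thesis using le[of x] True by simp
      qed simp
    qed
    then show "(\<integral>\<^sup>+x. ennreal (norm (indicator K x *\<^sub>R f x)) \<partial>lborel) < \<infinity>" using fin[of R] by (rule le_less_trans)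
  qed
  then show "integrable lebesgue (\<lambda>x. indicator K x *\<^sub>R f x)"
    by (subst integrable_completion) measurable
qed

lemma nn_integral_ball_lines:
  fixes f :: "'a \<times> real \<Rightarrow> real"
  assumes [measurable]: "f \<in> borel_measurable borel"
  shows "(\<integral>\<^sup>+x. (\<integral>\<^sup>+\<tau>. ennreal \<bar>f (x, \<tau>)\<bar> * indicator {a..b} \<tau> \<partial>lborel) * indicator (cball 0 R) x \<partial>lborel)
    = (\<integral>\<^sup>+z\<in>strip R a b. ennreal \<bar>f z\<bar> \<partial>lborel)"
  by (rule nn_integral_strip_lines[symmetric, where f = "\<lambda>z. ennreal \<bar>f z\<bar>"]) measurable

lemma extension_bound_L1:
  assumes "0 \<le> t"
  shows "(\<integral>\<^sup>+x. ((\<integral>\<^sup>+\<tau>. ennreal \<bar>u (x, \<tau>)\<bar> * indicator {1..2} \<tau> \<partial>lborel)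
    + (\<integral>\<^sup>+\<tau>. ennreal \<bar>gN (x, \<tau>)\<bar> * indicator {0..2} \<tau> \<partial>lborel)
    + (\<integral>\<^sup>+\<tau>. ennreal \<bar>gN (x, \<tau>)\<bar> * indicator {0..t} \<tau> \<partial>lborel)) * indicator (cball 0 R) x \<partial>lborel) < \<infinity>"
proof -
  define line where "line f a b x = (\<integral>\<^sup>+\<tau>. ennreal \<bar>f (x, \<tau>)\<bar> * indicator {a..b} \<tau> \<partial>lborel)"
    for f :: "'a \<times> real \<Rightarrow> real" and a b :: real and x
  have line[measurable]: "line f a b \<in> borel_measurable lborel" if [measurable]: "f \<in> borel_measurable borel" for f a b
    unfolding line_def[abs_def] by measurable
  let ?I = "indicator (cball 0 R) :: 'a \<Rightarrow> ennreal"
  note [measurable] = line[OF u_borel, of 1 2] line[OF gN_measurable, of 0 2] line[OF gN_measurable, of 0 t]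
  have "(\<integral>\<^sup>+x. (line u 1 2 x + line gN 0 2 x + line gN 0 t x) * ?I x \<partial>lborel)
    = (\<integral>\<^sup>+x. (line u 1 2 x * ?I x + line gN 0 2 x * ?I x) + line gN 0 t x * ?I x \<partial>lborel)"
    by (simp only: distrib_right)
  also have "\<dots> = (\<integral>\<^sup>+x. line u 1 2 x * ?I x + line gN 0 2 x * ?I x \<partial>lborel) + (\<integral>\<^sup>+x. line gN 0 t x * ?I x \<partial>lborel)"
    by (rule nn_integral_add) measurable
  also have "(\<integral>\<^sup>+x. line u 1 2 x * ?I x + line gN 0 2 x * ?I x \<partial>lborel)
    = (\<integral>\<^sup>+x. line u 1 2 x * ?I x \<partial>lborel) + (\<integral>\<^sup>+x. line gN 0 2 x * ?I x \<partial>lborel)"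
    by (rule nn_integral_add) measurable
  also have "\<dots> + (\<integral>\<^sup>+x. line gN 0 t x * ?I x \<partial>lborel) < \<infinity>"
    unfolding line_def nn_integral_ball_lines[OF u_borel] nn_integral_ball_lines[OF gN_measurable]
    using u_L1(2)[of 1 R 2] gN_L1[of 2 R] gN_L1[OF assms, of R] by simp
  finally show ?thesis by (simp only: line_def)
qed

lemma boundary_value_locally_integrable: "boundary_value locally_integrable_on UNIV"
proof (rule locally_integrable_of_ball_bound[OF _ _ extension_bound_L1[of 0]])
  fix x
  show "ennreal \<bar>boundary_value x\<bar> \<le> (\<integral>\<^sup>+\<tau>. ennreal \<bar>u (x, \<tau>)\<bar> * indicator {1..2} \<tau> \<partial>lborel)
    + (\<integral>\<^sup>+\<tau>. ennreal \<bar>gN (x, \<tau>)\<bar> * indicator {0..2} \<tau> \<partial>lborel)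
    + (\<integral>\<^sup>+\<tau>. ennreal \<bar>gN (x, \<tau>)\<bar> * indicator {0..0} \<tau> \<partial>lborel)"
    by (rule add_increasing2[OF zero_le boundary_value_bound])
qed simp_all

lemma extension_slice_locally_integrable:
  assumes "0 \<le> t"
  shows "(\<lambda>x. extension (x, t)) locally_integrable_on UNIV"
proof (rule locally_integrable_of_ball_bound[OF _ _ extension_bound_L1[OF assms]])
  show "(\<lambda>x. extension (x, t)) \<in> borel_measurable borel" unfolding extension_def by measurable
  fix x
  have "ennreal \<bar>extension (x, t)\<bar> \<le> ennreal (\<bar>boundary_value x\<bar> + \<bar>rise gN x t\<bar>)"
    unfolding extension_def fst_conv snd_conv by (rule ennreal_leI[OF abs_triangle_ineq])
  also have "\<dots> = ennreal \<bar>boundary_value x\<bar> + ennreal \<bar>rise gN x t\<bar>" by (rule ennreal_plus) simp_all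
  also have "\<dots> \<le> (\<integral>\<^sup>+\<tau>. ennreal \<bar>u (x, \<tau>)\<bar> * indicator {1..2} \<tau> \<partial>lborel)
    + (\<integral>\<^sup>+\<tau>. ennreal \<bar>gN (x, \<tau>)\<bar> * indicator {0..2} \<tau> \<partial>lborel)
    + (\<integral>\<^sup>+\<tau>. ennreal \<bar>gN (x, \<tau>)\<bar> * indicator {0..t} \<tau> \<partial>lborel)"
    by (rule add_mono[OF boundary_value_bound rise_bound])
  finally show "ennreal \<bar>extension (x, t)\<bar> \<le> (\<integral>\<^sup>+\<tau>. ennreal \<bar>u (x, \<tau>)\<bar> * indicator {1..2} \<tau> \<partial>lborel)
    + (\<integral>\<^sup>+\<tau>. ennreal \<bar>gN (x, \<tau>)\<bar> * indicator {0..2} \<tau> \<partial>lborel)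
    + (\<integral>\<^sup>+\<tau>. ennreal \<bar>gN (x, \<tau>)\<bar> * indicator {0..t} \<tau> \<partial>lborel)" .
qed

text \<open>Thin strips carry little of the gradient, by dominated convergence; this makes the slices converge.\<close>

lemma thin_strip_limit:
  "((\<lambda>t. \<integral>\<^sup>+z\<in>strip R 0 t. ennreal \<bar>gN z\<bar> \<partial>lborel) \<longlongrightarrow> 0) (at_right 0)"
proof (rule tendsto_at_right_sequentially[of 0 1])
  fix S :: "nat \<Rightarrow> real"
  assume S: "\<And>n. 0 < S n" "\<And>n. S n < 1" "S \<longlonglongrightarrow> 0"
  have "closed {z :: 'a \<times> real. snd z = 0}" by (intro closed_Collect_eq continuous_intros)
  moreover have "negligible {z :: 'a \<times> real. z \<bullet> (0, 1) = 0}"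
    by (rule negligible_standard_hyperplane) (simp add: Basis_prod_def)
  then have "{z :: 'a \<times> real. snd z = 0} \<in> null_sets lebesgue" by (simp add: negligible_iff_null_sets inner_prod_def)
  ultimately have null: "{z :: 'a \<times> real. snd z = 0} \<in> null_sets lborel"
    by (subst (asm) null_sets_completion_iff) auto
  have "(\<lambda>n. \<integral>\<^sup>+z\<in>strip R 0 (S n). ennreal \<bar>gN z\<bar> \<partial>lborel) \<longlonglongrightarrow> (\<integral>\<^sup>+z. 0 \<partial>(lborel :: ('a \<times> real) measure))"
  proof (rule nn_integral_dominated_convergence[where w = "\<lambda>z. ennreal \<bar>gN z\<bar> * indicator (strip R 0 1) z"])
    show "AE z in lborel. ennreal \<bar>gN z\<bar> * indicator (strip R 0 (S n)) z \<le> ennreal \<bar>gN z\<bar> * indicator (strip R 0 1) z" for n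
      using strip_mono[of R R 0 0 "S n" 1] S(2)[of n]
      by (intro AE_I2 mult_left_mono) (auto simp: indicator_def)
    show "(\<integral>\<^sup>+z\<in>strip R 0 1. ennreal \<bar>gN z\<bar> \<partial>lborel) < \<infinity>" by (rule gN_L1) simp
    show "AE z in lborel. (\<lambda>n. ennreal \<bar>gN z\<bar> * indicator (strip R 0 (S n)) z) \<longlonglongrightarrow> 0"
      using AE_not_in[OF null]
    proof eventually_elim
      case (elim z)
      have "\<forall>\<^sub>F n in sequentially. ennreal \<bar>gN z\<bar> * indicator (strip R 0 (S n)) z = 0"
      proof (cases "0 < snd z")
        case True
        have "\<forall>\<^sub>F n in sequentially. S n < snd z" by (rule order_tendstoD(2)[OF S(3) True])
        then show ?thesis by eventually_elim (simp add: strip_def mem_Times_iff indicator_def)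
      next
        case False
        then have "z \<notin> strip R 0 (S n)" for n using elim by (auto simp: strip_def)
        then show ?thesis by simp
      qed
      then show ?case by (rule tendsto_eventually)
    qed
  qed measurable
  then show "(\<lambda>n. \<integral>\<^sup>+z\<in>strip R 0 (S n). ennreal \<bar>gN z\<bar> \<partial>lborel) \<longlonglongrightarrow> 0" by simp
qed simp

lemma has_trace_boundary_value: "has_trace u boundary_value"
  unfolding has_trace_def
proof (intro conjI exI[of _ extension] allI impI)
  show "boundary_value locally_integrable_on UNIV" by (rule boundary_value_locally_integrable)
  show "AE z in lebesgue. z \<in> upper_half \<longrightarrow> extension z = u z" by (rule AE_completion[OF extension_eq])
  show "(\<lambda>x. extension (x, t)) locally_integrable_on UNIV" if "0 < t" for t
    using that by (intro extension_slice_locally_integrable) simp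
  fix K :: "'a set"
  assume K: "compact K"
  then have [measurable]: "K \<in> sets borel" by (intro borel_closed compact_imp_closed)
  obtain R where "\<forall>x\<in>K. norm x \<le> R"
    using K compact_imp_bounded[of K] unfolding bounded_iff by blast
  then have R: "K \<subseteq> cball 0 R" by auto
  have bound: "ennreal \<bar>(LINT x:K|lebesgue. \<bar>extension (x, t) - boundary_value x\<bar>) - 0\<bar> \<le> (\<integral>\<^sup>+z\<in>strip R 0 t. ennreal \<bar>gN z\<bar> \<partial>lborel)" for t
  proof -
    have "ennreal \<bar>(LINT x:K|lebesgue. \<bar>extension (x, t) - boundary_value x\<bar>) - 0\<bar>
      \<le> (\<integral>\<^sup>+x. ennreal (norm (indicator K x *\<^sub>R \<bar>extension (x, t) - boundary_value x\<bar>)) \<partial>lebesgue)"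
      unfolding set_lebesgue_integral_def real_norm_def[symmetric] diff_0_right by (rule integral_norm_le_nn_integral)
    also have "\<dots> = (\<integral>\<^sup>+x. ennreal (norm (indicator K x *\<^sub>R \<bar>extension (x, t) - boundary_value x\<bar>)) \<partial>lborel)"
      by (rule nn_integral_completion)
    also have "\<dots> \<le> (\<integral>\<^sup>+x. (\<integral>\<^sup>+\<tau>. ennreal \<bar>gN (x, \<tau>)\<bar> * indicator {0..t} \<tau> \<partial>lborel) * indicator (cball 0 R) x \<partial>lborel)"
    proof (rule nn_integral_mono)
      fix x
      show "ennreal (norm (indicator K x *\<^sub>R \<bar>extension (x, t) - boundary_value x\<bar>))
        \<le> (\<integral>\<^sup>+\<tau>. ennreal \<bar>gN (x, \<tau>)\<bar> * indicator {0..t} \<tau> \<partial>lborel) * indicator (cball 0 R) x"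
      proof (cases "x \<in> K")
        case True
        then have "x \<in> cball 0 R" using R by blast
        then show ?thesis using rise_bound[of gN x t] True by (simp add: extension_def)
      qed simp
    qed
    also have "\<dots> = (\<integral>\<^sup>+z\<in>strip R 0 t. ennreal \<bar>gN z\<bar> \<partial>lborel)" by (rule nn_integral_ball_lines) simp
    finally show ?thesis .
  qed
  show "((\<lambda>t. LINT x:K|lebesgue. \<bar>extension (x, t) - boundary_value x\<bar>) \<longlongrightarrow> 0) (at_right 0)"
  proof (rule tendsto_of_ennreal_abs[OF tendsto_sandwich[OF _ _ tendsto_const thin_strip_limit]])
    show "\<forall>\<^sub>F t in at_right 0. ennreal \<bar>(LINT x:K|lebesgue. \<bar>extension (x, t) - boundary_value x\<bar>) - 0\<bar> \<le> (\<integral>\<^sup>+z\<in>strip R 0 t. ennreal \<bar>gN z\<bar> \<partial>lborel)"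
      by (intro always_eventually allI bound)
  qed simp
qed

end

section \<open>The trace inequality\<close>

context trace_setting begin

text \<open>Fatou's lemma, in both variables, transfers the estimate from the mollifications to the limit.\<close>

theorem boundary_value_estimate:
  assumes s: "0 < s" "s < 1" and p: "1 < p" and \<beta>: "\<beta> = (1 - s) * p - 1"
    and fin: "(\<integral>\<^sup>+z\<in>upper_half. ennreal (norm (g z) powr p * snd z powr \<beta>) \<partial>lborel) < \<infinity>"
  shows "(\<integral>\<^sup>+x. (\<integral>\<^sup>+y\<in>upper_half. ennreal (\<bar>boundary_value x - u y\<bar> powr p / norm ((x, 0) - y) powr (real DIM('a) + 1 + s * p)) \<partial>lborel) \<partial>lborel)
    \<le> ennreal (section_integral DIM('a) (s * p) * ((real DIM('a) + 1) / s) powr p)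
      * (\<integral>\<^sup>+z\<in>upper_half. ennreal (norm (g z) powr p * snd z powr \<beta>) \<partial>lborel)"
proof -
  obtain \<epsilon> :: "nat \<Rightarrow> real" where pos: "\<forall>n. 0 < \<epsilon> n" and null: "\<epsilon> \<longlonglongrightarrow> 0"
    and lines: "AE x in lborel. (\<lambda>n. mollify (\<epsilon> n) u (x, 0)) \<longlonglongrightarrow> boundary_value x
      \<and> (\<forall>t\<ge>0. (\<lambda>n. mollify (\<epsilon> n) u (x, t)) \<longlonglongrightarrow> boundary_value x + rise gN x t)"
    and interior: "AE z in lborel. z \<in> upper_half \<longrightarrow> (\<lambda>n. mollify (\<epsilon> n) u z) \<longlonglongrightarrow> u z"
    by (rule mollification_convergence, rule that)
  have \<epsilon>: "\<And>n. 0 < \<epsilon> n" "\<epsilon> \<longlonglongrightarrow> 0" using pos null by simp_all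
  let ?r = "real DIM('a) + 1 + s * p"
  define K where "K n x y = ennreal (kernel_quotient (mollify (\<epsilon> n) u) p (s * p) x y) * indicator upper_half y" for n x y
  define L where "L x y = ennreal (\<bar>boundary_value x - u y\<bar> powr p / norm ((x, 0) - y) powr ?r) * indicator upper_half y" for x y
  let ?E = "\<lambda>n. \<integral>\<^sup>+z\<in>upper_half. mollified_power p (\<epsilon> n) z * ennreal (snd z powr \<beta>) \<partial>lborel"
  let ?C = "ennreal (section_integral DIM('a) (s * p) * ((real DIM('a) + 1) / s) powr p)"
  have K_pair[measurable]: "(\<lambda>(x, y). K n x y) \<in> borel_measurable (lborel \<Otimes>\<^sub>M lborel)" for n
    unfolding K_def kernel_quotient_def by measurable
  have K_meas: "K n x \<in> borel_measurable lborel" for n x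
    unfolding K_def[abs_def] kernel_quotient_def by measurable
  have inner: "AE x in lborel. (\<integral>\<^sup>+y. L x y \<partial>lborel) \<le> liminf (\<lambda>n. \<integral>\<^sup>+y. K n x y \<partial>lborel)"
    using lines
  proof eventually_elim
    case (elim x)
    note lim_x = conjunct1[OF elim]
    have "(\<integral>\<^sup>+y. L x y \<partial>lborel) \<le> (\<integral>\<^sup>+y. liminf (\<lambda>n. K n x y) \<partial>lborel)"
    proof (rule nn_integral_mono_AE)
      show "AE y in lborel. L x y \<le> liminf (\<lambda>n. K n x y)"
        using interior
      proof eventually_elim
        case (elim y)
        show ?case
        proof (cases "y \<in> upper_half")
          case True
          note lim_y = mp[OF elim True]
          have "(\<lambda>n. \<bar>mollify (\<epsilon> n) u (x, 0) - mollify (\<epsilon> n) u y\<bar> powr p) \<longlonglongrightarrow> \<bar>boundary_value x - u y\<bar> powr p"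
            by (rule tendsto_powr'[OF tendsto_rabs[OF tendsto_diff[OF lim_x lim_y]] tendsto_const]) (use p in simp)
          then have "(\<lambda>n. \<bar>mollify (\<epsilon> n) u (x, 0) - mollify (\<epsilon> n) u y\<bar> powr p / norm ((x, 0) - y) powr ?r)
            \<longlonglongrightarrow> \<bar>boundary_value x - u y\<bar> powr p / norm ((x, 0) - y) powr ?r"
            unfolding divide_inverse by (rule tendsto_mult_right)
          then have "(\<lambda>n. K n x y) \<longlonglongrightarrow> L x y"
            unfolding K_def L_def kernel_quotient_def using True by (simp add: tendsto_ennrealI)
          then have "liminf (\<lambda>n. K n x y) = L x y" by (rule lim_imp_Liminf[OF trivial_limit_sequentially])
          then show ?thesis by simp
        qed (simp add: L_def)
      qed
    qed
    also have "\<dots> \<le> liminf (\<lambda>n. \<integral>\<^sup>+y. K n x y \<partial>lborel)" by (rule nn_integral_liminf[OF K_meas])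
    finally show ?case .
  qed
  have energy: "?E \<longlonglongrightarrow> (\<integral>\<^sup>+z\<in>upper_half. ennreal (norm (g z) powr p * snd z powr \<beta>) \<partial>lborel)"
  proof (rule mollified_power_limit[OF \<epsilon> _ fin])
    show "- 1 < \<beta>" using s p by (simp add: \<beta>)
  qed
  have "(\<integral>\<^sup>+x. \<integral>\<^sup>+y. L x y \<partial>lborel \<partial>lborel) \<le> (\<integral>\<^sup>+x. liminf (\<lambda>n. \<integral>\<^sup>+y. K n x y \<partial>lborel) \<partial>lborel)"
    by (rule nn_integral_mono_AE[OF inner])
  also have "\<dots> \<le> liminf (\<lambda>n. \<integral>\<^sup>+x. \<integral>\<^sup>+y. K n x y \<partial>lborel \<partial>lborel)"
    by (rule nn_integral_liminf) (rule lborel.borel_measurable_nn_integral[OF K_pair])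
  also have "\<dots> \<le> liminf (\<lambda>n. ?C * ?E n)"
  proof (rule Liminf_mono, rule always_eventually, rule allI)
    fix n
    have p1: "1 \<le> p" using p by simp
    have "(\<integral>\<^sup>+x. \<integral>\<^sup>+y. K n x y \<partial>lborel \<partial>lborel)
      \<le> (\<integral>\<^sup>+(\<xi>::'a). ennreal (arc_bound s \<xi> powr p * (1 + (norm \<xi>)\<^sup>2) powr (- ((real DIM('a) + 1 + s * p) / 2))) \<partial>lborel) * ?E n"
      unfolding K_def mollified_eq_mollify[symmetric] by (rule mollified_estimate[OF s p1 \<epsilon>(1) \<beta>])
    also have "\<dots> \<le> ?C * ?E n" by (rule mult_right_mono[OF arc_bound_integral[OF s p1]]) simp
    finally show "(\<integral>\<^sup>+x. \<integral>\<^sup>+y. K n x y \<partial>lborel \<partial>lborel) \<le> ?C * ?E n" .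
  qed
  also have "liminf (\<lambda>n. ?C * ?E n) = ?C * (\<integral>\<^sup>+z\<in>upper_half. ennreal (norm (g z) powr p * snd z powr \<beta>) \<partial>lborel)"
    by (rule lim_imp_Liminf[OF trivial_limit_sequentially ennreal_tendsto_cmult[OF _ energy]]) simp
  finally show ?thesis unfolding L_def .
qed

end

lemma has_trace_cong_AE:
  assumes "has_trace u0 v" "AE z in lborel. z \<in> upper_half \<longrightarrow> u0 z = u z"
  shows "has_trace u v"
proof -
  obtain w where w: "AE z in lebesgue. z \<in> upper_half \<longrightarrow> w z = u0 z"
    and rest: "v locally_integrable_on UNIV" "\<forall>t>0. (\<lambda>x. w (x, t)) locally_integrable_on UNIV"
      "\<forall>K. compact K \<longrightarrow> ((\<lambda>t. LINT x:K|lebesgue. \<bar>w (x, t) - v x\<bar>) \<longlongrightarrow> 0) (at_right 0)"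
    using assms(1) unfolding has_trace_def by (elim conjE exE)
  have "AE z in lebesgue. z \<in> upper_half \<longrightarrow> w z = u z"
    using w AE_completion[OF assms(2)] by eventually_elim simp
  then show ?thesis unfolding has_trace_def by (intro conjI exI[of _ w] rest)
qed

theorem theorem2p1:
  fixes N :: nat and s p :: real
    and u :: "(real ^ 'n) \<times> real \<Rightarrow> real"
    and Du :: "(real ^ 'n) \<times> real \<Rightarrow> (real ^ 'n) \<times> real"
  assumes "N \<ge> 2" and "CARD('n) = N - 1"
    and "0 < s" and "s < 1" and "1 < p"
    and "has_weak_derivative_on u Du upper_half"
    and "(\<integral>\<^sup>+z\<in>upper_half. ennreal (norm (Du z) powr p / snd z powr (1 - (1 - s) * p)) \<partial>lebesgue) < \<infinity>"
  shows "\<exists>v :: real ^ 'n \<Rightarrow> real. has_trace u v \<and>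
    (\<integral>\<^sup>+x. (\<integral>\<^sup>+y\<in>upper_half.
        ennreal (\<bar>v x - u y\<bar> powr p / norm ((x, 0) - y) powr (real N + s * p)) \<partial>lebesgue) \<partial>lebesgue)
    \<le> ennreal (pi powr ((real N - 1) / 2) * Gamma ((s * p + 1) / 2) / Gamma ((real N + s * p) / 2)
               * (real N / s) powr p)
      * (\<integral>\<^sup>+z\<in>upper_half. ennreal (norm (Du z) powr p / snd z powr (1 - (1 - s) * p)) \<partial>lebesgue)"
proof -
  obtain u0 g0 where wg: "weak_gradient u0 g0"
    and u0: "AE z in lborel. z \<in> upper_half \<longrightarrow> u0 z = u z" and g0: "AE z in lborel. z \<in> upper_half \<longrightarrow> g0 z = Du z"
    by (rule weak_gradient_representative[OF assms(6)], rule that)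
  interpret wg: weak_gradient u0 g0 by (rule wg)
  define \<beta> where "\<beta> = (1 - s) * p - 1"
  have N: "real DIM(real ^ 'n) + 1 = real N" "real DIM(real ^ 'n) = real N - 1"
    using assms(1,2) by (simp_all add: of_nat_diff)
  have energy: "(\<integral>\<^sup>+z\<in>upper_half. ennreal (norm (Du z) powr p / snd z powr (1 - (1 - s) * p)) \<partial>lebesgue)
    = (\<integral>\<^sup>+z\<in>upper_half. ennreal (norm (g0 z) powr p * snd z powr \<beta>) \<partial>lborel)"
    unfolding nn_integral_completion
  proof (rule nn_integral_cong_AE)
    show "AE z in lborel. ennreal (norm (Du z) powr p / snd z powr (1 - (1 - s) * p)) * indicator upper_half z
      = ennreal (norm (g0 z) powr p * snd z powr \<beta>) * indicator upper_half z"
      using g0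
    proof eventually_elim
      case (elim z)
      have "snd z powr \<beta> = inverse (snd z powr (1 - (1 - s) * p))"
        unfolding powr_minus[symmetric] by (simp add: \<beta>_def)
      then show ?case using elim by (cases "z \<in> upper_half") (simp_all add: divide_inverse)
    qed
  qed
  have fin: "(\<integral>\<^sup>+z\<in>upper_half. ennreal (norm (g0 z) powr p * snd z powr \<beta>) \<partial>lborel) < \<infinity>"
    using assms(7) unfolding energy .
  have "trace_setting u0 g0"
  proof (intro trace_setting.intro trace_setting_axioms.intro wg)
    fix R T :: real
    assume T: "0 \<le> T"
    have "0 < s * p" using assms by simp
    then have \<beta>: "\<beta> < p - 1" by (simp add: \<beta>_def algebra_simps)
    show "(\<integral>\<^sup>+z\<in>strip R 0 T. ennreal (norm (g0 z)) \<partial>lborel) < \<infinity>"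
      by (rule weighted_energy_L1[OF _ norm_ge_zero assms(5) \<beta> T fin]) measurable
  qed
  then interpret trace_setting u0 g0 .
  show ?thesis
  proof (intro exI[of _ boundary_value] conjI)
    show "has_trace u boundary_value" by (rule has_trace_cong_AE[OF has_trace_boundary_value u0])
    have "(\<integral>\<^sup>+x. (\<integral>\<^sup>+y\<in>upper_half.
        ennreal (\<bar>boundary_value x - u y\<bar> powr p / norm ((x, 0) - y) powr (real N + s * p)) \<partial>lebesgue) \<partial>lebesgue)
      = (\<integral>\<^sup>+x. (\<integral>\<^sup>+y\<in>upper_half. ennreal (\<bar>boundary_value x - u0 y\<bar> powr p
          / norm ((x, 0) - y) powr (real DIM(real ^ 'n) + 1 + s * p)) \<partial>lborel) \<partial>lborel)"
      unfolding nn_integral_completion N(1)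
    proof (rule nn_integral_cong, rule nn_integral_cong_AE)
      fix x
      show "AE y in lborel. ennreal (\<bar>boundary_value x - u y\<bar> powr p / norm ((x, 0) - y) powr (real N + s * p)) * indicator upper_half y
        = ennreal (\<bar>boundary_value x - u0 y\<bar> powr p / norm ((x, 0) - y) powr (real N + s * p)) * indicator upper_half y"
        using u0
      proof eventually_elim
        case (elim y)
        then show ?case by (cases "y \<in> upper_half") simp_all
      qed
    qed
    also have "\<dots> \<le> ennreal (section_integral DIM(real ^ 'n) (s * p) * ((real DIM(real ^ 'n) + 1) / s) powr p)
      * (\<integral>\<^sup>+z\<in>upper_half. ennreal (norm (g0 z) powr p * snd z powr \<beta>) \<partial>lborel)"
      by (rule boundary_value_estimate[OF assms(3,4,5) \<beta>_def fin])
    also have "section_integral DIM(real ^ 'n) (s * p) * ((real DIM(real ^ 'n) + 1) / s) powr p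
      = pi powr ((real N - 1) / 2) * Gamma ((s * p + 1) / 2) / Gamma ((real N + s * p) / 2) * (real N / s) powr p"
      unfolding section_integral_def N(1) unfolding N(2) ..
    finally show "(\<integral>\<^sup>+x. (\<integral>\<^sup>+y\<in>upper_half.
        ennreal (\<bar>boundary_value x - u y\<bar> powr p / norm ((x, 0) - y) powr (real N + s * p)) \<partial>lebesgue) \<partial>lebesgue)
      \<le> ennreal (pi powr ((real N - 1) / 2) * Gamma ((s * p + 1) / 2) / Gamma ((real N + s * p) / 2) * (real N / s) powr p)
        * (\<integral>\<^sup>+z\<in>upper_half. ennreal (norm (Du z) powr p / snd z powr (1 - (1 - s) * p)) \<partial>lebesgue)"
      unfolding energy .
  qed
qed

end
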